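(* Let $M$ be a connected manifold of dimension $n\geq 2$ equipped with a Riemannian metric $g$, and suppose $M$ is the interior of a compact smooth manifold $W$ with non-empty boundary. Then $M$ admits an admissible collar-gluing $M=\overline{M_R}\cup_{\mathcal H}\overline{M_L}$ with $\overline{M_R}$ compact and with a diffeomorphism $\overline{M_L}\cong\mathcal H\times[0,\infty)$ of smooth manifolds with boundary.
   Context: All manifolds, maps and tensor fields are smooth; manifolds are Hausdorff and second countable. Collar-gluing: a decomposition $M=\overline{M_R}\cup_{\mathcal H}\overline{M_L}$ of a connected manifold $M$, where $\mathcal H\subset M$ is a non-empty embedded hypersurface, closed as a subset of $M$ (possibly noncompact, possibly disconnected), and $M\setminus\mathcal H=M_R\sqcup M_L$ for disjoint non-empty open sets $M_R,M_L$ (not required to be connected) whose closures in $M$ are $\overline{M_R}=M_R\cup\mathcal H$ and $\overline{M_L}=M_L\cup\mathcal H$. Transverse type-changing metric: a symmetric $(0,2)$-tensor field $\widetilde g$ on a manifold without boundary of dimension at least $2$ whose degeneracy locus $\{q:\det[\widetilde g_{\mu\nu}](q)=0\}$ is non-empty, and such that $d(\det[\widetilde g_{\mu\nu}])_q\neq0$ in every local coordinate system around every point $q$ of the degeneracy locus. The radical at $q$ is $\operatorname{Rad}_q(\widetilde g)=\{w\in T_qM:\widetilde g_q(w,v)=0\ \forall v\in T_qM\}$; it is transverse to $\mathcal H$ if $\operatorname{Rad}_q(\widetilde g)\oplus T_q\mathcal H=T_qM$ for all $q\in\mathcal H$. Admissible: a collar-gluing of a Riemannian manifold $(M,g)$ is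 admissible if there are $f\in C^\infty(M)$ and a vector field $V\in\Gamma(TM)$ such that $\widetilde g=g-fV^\flat\otimes V^\flat$, with $V^\flat=g(V,\cdot)$, is Riemannian on $M_R$, Lorentzian of index one on $M_L$, degenerate of corank one precisely along $\mathcal H$, and a transverse type-changing metric with radical transverse to $\mathcal H$ along $\mathcal H$. *)

theory Defs
  imports "HOL-Analysis.Analysis" "HOL-Library.Function_Algebras"
begin

section \<open>Smooth maps between subsets of Euclidean spaces\<close>

primrec Ck_on :: "nat \<Rightarrow> 'a::real_normed_vector set \<Rightarrow> ('a \<Rightarrow> 'b::real_normed_vector) \<Rightarrow> bool" where
  "Ck_on 0 S f \<longleftrightarrow> continuous_on S f"
| "Ck_on (Suc k) S f \<longleftrightarrow>
     (\<forall>x\<in>S. f differentiable (at x)) \<and> (\<forall>v. Ck_on k S (\<lambda>x. frechet_derivative f (at x) v))"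

text \<open>On a set that need not be open (such as a relatively open subset of a closed half-space),
  smoothness means that near every point the map has a smooth extension to an open set of the
  ambient space.\<close>

definition smooth_on :: "'a::real_normed_vector set \<Rightarrow> ('a \<Rightarrow> 'b::real_normed_vector) \<Rightarrow> bool" where
  "smooth_on S f \<longleftrightarrow>
     (\<forall>x\<in>S. \<exists>O' F. open O' \<and> x \<in> O' \<and> (\<forall>k. Ck_on k O' F) \<and> (\<forall>y\<in>O' \<inter> S. F y = f y))"


section \<open>Smooth manifolds, with and without boundary\<close>

text \<open>A manifold is given by a topological space, a model set \<open>X\<close> in Euclidean space, and a smooth
  atlas of charts onto relatively open subsets of \<open>X\<close>. The model sets in use are the
  whole space (manifolds without boundary of dimension \<open>n = CARD('n)\<close>), a closed half-space (manifolds
  with boundary of dimension \<open>n\<close>) and the hyperplane bounding it, a copy of Euclidean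
  \<open>(n - 1)\<close>-space (manifolds of dimension \<open>n - 1\<close>). Only the values of a chart map on its
  domain are relevant.\<close>

type_synonym ('a, 'n) chart = "'a set \<times> ('a \<Rightarrow> real^'n)"

record ('a, 'n::finite) manifold =
  mtop :: "'a topology"
  model :: "(real^'n) set"
  atlas :: "('a, 'n) chart set"

definition bdry_coord :: "'n::finite" where
  "bdry_coord = (SOME k. True)"

definition half_space :: "(real^'n::finite) set" where
  "half_space = {x. 0 \<le> x $ bdry_coord}"

definition hyperplane :: "(real^'n::finite) set" where
  "hyperplane = {x. x $ bdry_coord = 0}"

definition is_chart :: "('a, 'n::finite) manifold \<Rightarrow> ('a, 'n) chart \<Rightarrow> bool" where
  "is_chart M = (\<lambda>(U, \<phi>). openin (mtop M) U \<and> openin (top_of_set (model M)) (\<phi> ` U) \<and>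
     homeomorphic_map (subtopology (mtop M) U) (top_of_set (\<phi> ` U)) \<phi>)"

definition compatible :: "('a, 'n::finite) chart \<Rightarrow> ('a, 'n) chart \<Rightarrow> bool" where
  "compatible = (\<lambda>(U, \<phi>) (V, \<psi>).
     smooth_on (\<phi> ` (U \<inter> V)) (\<psi> \<circ> inv_into U \<phi>) \<and> smooth_on (\<psi> ` (U \<inter> V)) (\<phi> \<circ> inv_into V \<psi>))"

definition smooth_manifold :: "('a, 'n::finite) manifold \<Rightarrow> bool" where
  "smooth_manifold M \<longleftrightarrow>
     Hausdorff_space (mtop M) \<and> second_countable (mtop M) \<and>
     (\<forall>c\<in>atlas M. is_chart M c) \<and> topspace (mtop M) = \<Union> (fst ` atlas M) \<and>
     (\<forall>c\<in>atlas M. \<forall>c'\<in>atlas M. compatible c c')"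

definition manifold_without_boundary :: "('a, 'n::finite) manifold \<Rightarrow> bool" where
  "manifold_without_boundary M \<longleftrightarrow> smooth_manifold M \<and> model M = UNIV"

definition manifold_with_boundary :: "('a, 'n::finite) manifold \<Rightarrow> bool" where
  "manifold_with_boundary W \<longleftrightarrow> smooth_manifold W \<and> model W = half_space"

text \<open>All local coordinate systems, i.e. the maximal atlas.\<close>

definition max_atlas :: "('a, 'n::finite) manifold \<Rightarrow> ('a, 'n) chart set" where
  "max_atlas M = {c. is_chart M c \<and> (\<forall>c'\<in>atlas M. compatible c c')}"

definition boundary_pts :: "('a, 'n::finite) manifold \<Rightarrow> 'a set" where
  "boundary_pts W = {p. \<exists>(U, \<phi>)\<in>max_atlas W. p \<in> U \<and> \<phi> p \<in> hyperplane}"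

definition interior_pts :: "('a, 'n::finite) manifold \<Rightarrow> 'a set" where
  "interior_pts W = topspace (mtop W) - boundary_pts W"

definition interior_manifold :: "('a, 'n::finite) manifold \<Rightarrow> ('a, 'n) manifold" where
  "interior_manifold W =
     \<lparr>mtop = subtopology (mtop W) (interior_pts W), model = UNIV,
      atlas = {(U \<inter> interior_pts W, \<phi>) | U \<phi>. (U, \<phi>) \<in> atlas W}\<rparr>"

definition smooth_map ::
    "('a, 'n::finite) manifold \<Rightarrow> ('b, 'm::finite) manifold \<Rightarrow> ('a \<Rightarrow> 'b) \<Rightarrow> bool" where
  "smooth_map M N F \<longleftrightarrow> continuous_map (mtop M) (mtop N) F \<and>
     (\<forall>(U, \<phi>)\<in>atlas M. \<forall>(V, \<psi>)\<in>atlas N.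
        smooth_on (\<phi> ` {p \<in> U. F p \<in> V}) (\<psi> \<circ> F \<circ> inv_into U \<phi>))"

definition diffeomorphic :: "('a, 'n::finite) manifold \<Rightarrow> ('b, 'm::finite) manifold \<Rightarrow> bool" where
  "diffeomorphic M N \<longleftrightarrow> smooth_manifold M \<and> smooth_manifold N \<and>
     (\<exists>F G. smooth_map M N F \<and> smooth_map N M G \<and>
       (\<forall>p\<in>topspace (mtop M). G (F p) = p) \<and> (\<forall>q\<in>topspace (mtop N). F (G q) = q))"

text \<open>A subset \<open>S\<close> of a manifold without boundary \<open>M\<close> with the charts induced by those charts of
  \<open>M\<close> in which \<open>S\<close> corresponds to \<open>X\<close>. With \<open>X = hyperplane\<close> these are the slice
  charts of a hypersurface; with \<open>X = half_space\<close> they are the charts of a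
  codimension-zero submanifold with boundary.\<close>

definition submanifold :: "('a, 'n::finite) manifold \<Rightarrow> 'a set \<Rightarrow> (real^'n) set \<Rightarrow> ('a, 'n) manifold" where
  "submanifold M S X =
     \<lparr>mtop = subtopology (mtop M) S, model = X,
      atlas = {(U \<inter> S, \<phi>) | U \<phi>. (U, \<phi>) \<in> max_atlas M \<and> \<phi> ` (U \<inter> S) = \<phi> ` U \<inter> X}\<rparr>"

definition embedded_hypersurface :: "('a, 'n::finite) manifold \<Rightarrow> 'a set \<Rightarrow> bool" where
  "embedded_hypersurface M H \<longleftrightarrow> H \<subseteq> topspace (mtop M) \<and>
     (\<forall>q\<in>H. \<exists>(U, \<phi>)\<in>max_atlas M. q \<in> U \<and> \<phi> ` (U \<inter> H) = \<phi> ` U \<inter> hyperplane)"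

text \<open>The product \<open>N \<times> [0, \<infinity>)\<close> for a manifold \<open>N\<close> modelled on the hyperplane; the
  factor \<open>[0, \<infinity>)\<close> provides the coordinate transverse to the hyperplane.\<close>

definition half_cylinder :: "('a, 'n::finite) manifold \<Rightarrow> ('a \<times> real, 'n) manifold" where
  "half_cylinder N =
     \<lparr>mtop = prod_topology (mtop N) (top_of_set {0..}), model = half_space,
      atlas = {(U \<times> {0..}, \<lambda>(q, t). \<phi> q + t *\<^sub>R axis bdry_coord 1) | U \<phi>. (U, \<phi>) \<in> atlas N}\<rparr>"


section \<open>Tangent vectors and tensor fields\<close>

definition smooth_fun :: "('a, 'n::finite) manifold \<Rightarrow> ('a \<Rightarrow> real) \<Rightarrow> bool" where
  "smooth_fun M h \<longleftrightarrow> (\<forall>(U, \<phi>)\<in>atlas M. smooth_on (\<phi> ` U) (h \<circ> inv_into U \<phi>))"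

text \<open>Tangent vectors at \<open>p\<close> are derivations at \<open>p\<close> of the algebra of smooth functions; to
  represent each of them by exactly one function they are set to zero on non-smooth functions.\<close>

type_synonym 'a tvec = "('a \<Rightarrow> real) \<Rightarrow> real"

definition tscale :: "real \<Rightarrow> 'a tvec \<Rightarrow> 'a tvec" where
  "tscale c v = (\<lambda>h. c * v h)"

interpretation tangent: vector_space tscale
  by standard (auto simp: tscale_def fun_eq_iff algebra_simps)

definition tangent_space :: "('a, 'n::finite) manifold \<Rightarrow> 'a \<Rightarrow> 'a tvec set" where
  "tangent_space M p = {v.
     (\<forall>h. \<not> smooth_fun M h \<longrightarrow> v h = 0) \<and>
     (\<forall>h k. smooth_fun M h \<and> smooth_fun M k \<longrightarrow> v (h + k) = v h + v k) \<and>
     (\<forall>c h. smooth_fun M h \<longrightarrow> v (\<lambda>x. c * h x) = c * v h) \<and>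
     (\<forall>h k. smooth_fun M h \<and> smooth_fun M k \<longrightarrow> v (h * k) = h p * v k + k p * v h)}"

definition pushforward ::
    "('b, 'm::finite) manifold \<Rightarrow> ('a \<Rightarrow> 'b) \<Rightarrow> 'a tvec \<Rightarrow> 'b tvec" where
  "pushforward N F v = (\<lambda>h. if smooth_fun N h then v (h \<circ> F) else 0)"

text \<open>The tangent space of a hypersurface, as a subspace of the ambient tangent space: its image
  under the differential of the inclusion.\<close>

definition hypersurface_tangent_space ::
    "('a, 'n::finite) manifold \<Rightarrow> 'a set \<Rightarrow> 'a \<Rightarrow> 'a tvec set" where
  "hypersurface_tangent_space M H q =
     pushforward M (\<lambda>x. x) ` tangent_space (submanifold M H hyperplane) q"

definition coord_vec :: "('a, 'n::finite) manifold \<Rightarrow> ('a, 'n) chart \<Rightarrow> 'a \<Rightarrow> 'n \<Rightarrow> 'a tvec" where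
  "coord_vec M = (\<lambda>(U, \<phi>) p i h.
     if smooth_fun M h then frechet_derivative (h \<circ> inv_into U \<phi>) (at (\<phi> p)) (axis i 1) else 0)"

definition vector_field :: "('a, 'n::finite) manifold \<Rightarrow> ('a \<Rightarrow> 'a tvec) \<Rightarrow> bool" where
  "vector_field M V \<longleftrightarrow> (\<forall>p\<in>topspace (mtop M). V p \<in> tangent_space M p) \<and>
     (\<forall>h. smooth_fun M h \<longrightarrow> smooth_fun M (\<lambda>p. V p h))"

type_synonym 'a tensor02 = "'a \<Rightarrow> 'a tvec \<Rightarrow> 'a tvec \<Rightarrow> real"

text \<open>The matrix of components of a \<open>(0,2)\<close>-tensor field in a chart.\<close>

definition components ::
    "('a, 'n::finite) manifold \<Rightarrow> 'a tensor02 \<Rightarrow> ('a, 'n) chart \<Rightarrow> 'a \<Rightarrow> real^'n^'n" where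
  "components M g c p = (\<chi> i j. g p (coord_vec M c p i) (coord_vec M c p j))"

definition symmetric_tensor_field :: "('a, 'n::finite) manifold \<Rightarrow> 'a tensor02 \<Rightarrow> bool" where
  "symmetric_tensor_field M g \<longleftrightarrow>
     (\<forall>p\<in>topspace (mtop M). \<forall>u\<in>tangent_space M p. \<forall>v\<in>tangent_space M p.
        g p u v = g p v u \<and>
        (\<forall>w\<in>tangent_space M p. \<forall>a b.
           g p (tscale a u + tscale b v) w = a * g p u w + b * g p v w)) \<and>
     (\<forall>(U, \<phi>)\<in>atlas M. smooth_on (\<phi> ` U) (components M g (U, \<phi>) \<circ> inv_into U \<phi>))"

definition radical :: "('a, 'n::finite) manifold \<Rightarrow> 'a tensor02 \<Rightarrow> 'a \<Rightarrow> 'a tvec set" where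
  "radical M g q = {w \<in> tangent_space M q. \<forall>v\<in>tangent_space M q. g q w v = 0}"

definition index :: "('a, 'n::finite) manifold \<Rightarrow> 'a tensor02 \<Rightarrow> 'a \<Rightarrow> nat" where
  "index M g q = Max {tangent.dim S | S. tangent.subspace S \<and> S \<subseteq> tangent_space M q \<and>
     (\<forall>v\<in>S. v \<noteq> 0 \<longrightarrow> g q v v < 0)}"

definition riemannian_on :: "('a, 'n::finite) manifold \<Rightarrow> 'a set \<Rightarrow> 'a tensor02 \<Rightarrow> bool" where
  "riemannian_on M A g \<longleftrightarrow> (\<forall>p\<in>A. \<forall>v\<in>tangent_space M p. v \<noteq> 0 \<longrightarrow> 0 < g p v v)"

definition lorentzian_on :: "('a, 'n::finite) manifold \<Rightarrow> 'a set \<Rightarrow> 'a tensor02 \<Rightarrow> bool" where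
  "lorentzian_on M A g \<longleftrightarrow> (\<forall>p\<in>A. radical M g p = {0} \<and> index M g p = 1)"

definition riemannian_metric :: "('a, 'n::finite) manifold \<Rightarrow> 'a tensor02 \<Rightarrow> bool" where
  "riemannian_metric M g \<longleftrightarrow>
     symmetric_tensor_field M g \<and> riemannian_on M (topspace (mtop M)) g"

text \<open>Under a change of coordinates the determinant of the component matrix is multiplied by the
  square of a Jacobian determinant, so its vanishing does not depend on the chart.\<close>

definition degeneracy_locus :: "('a, 'n::finite) manifold \<Rightarrow> 'a tensor02 \<Rightarrow> 'a set" where
  "degeneracy_locus M g = {q. \<exists>(U, \<phi>)\<in>max_atlas M. q \<in> U \<and> det (components M g (U, \<phi>) q) = 0}"

definition transverse_type_changing :: "('a, 'n::finite) manifold \<Rightarrow> 'a tensor02 \<Rightarrow> bool" where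
  "transverse_type_changing M g \<longleftrightarrow>
     manifold_without_boundary M \<and> CARD('n) \<ge> 2 \<and>
     symmetric_tensor_field M g \<and> degeneracy_locus M g \<noteq> {} \<and>
     (\<forall>q\<in>degeneracy_locus M g. \<forall>(U, \<phi>)\<in>max_atlas M. q \<in> U \<longrightarrow>
        frechet_derivative (\<lambda>x. det (components M g (U, \<phi>) (inv_into U \<phi> x))) (at (\<phi> q))
          \<noteq> (\<lambda>_. 0))"

definition radical_transverse :: "('a, 'n::finite) manifold \<Rightarrow> 'a tensor02 \<Rightarrow> 'a set \<Rightarrow> bool" where
  "radical_transverse M g H \<longleftrightarrow> (\<forall>q\<in>H.
     radical M g q \<inter> hypersurface_tangent_space M H q = {0} \<and>
     {u + v | u v. u \<in> radical M g q \<and> v \<in> hypersurface_tangent_space M H q} = tangent_space M q)"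


section \<open>Admissible collar-gluings\<close>

definition collar_gluing :: "('a, 'n::finite) manifold \<Rightarrow> 'a set \<Rightarrow> 'a set \<Rightarrow> 'a set \<Rightarrow> bool" where
  "collar_gluing M H M\<^sub>R M\<^sub>L \<longleftrightarrow>
     manifold_without_boundary M \<and> connected_space (mtop M) \<and>
     H \<noteq> {} \<and> embedded_hypersurface M H \<and> closedin (mtop M) H \<and>
     openin (mtop M) M\<^sub>R \<and> openin (mtop M) M\<^sub>L \<and> M\<^sub>R \<noteq> {} \<and> M\<^sub>L \<noteq> {} \<and> M\<^sub>R \<inter> M\<^sub>L = {} \<and>
     topspace (mtop M) - H = M\<^sub>R \<union> M\<^sub>L \<and>
     (mtop M) closure_of M\<^sub>R = M\<^sub>R \<union> H \<and> (mtop M) closure_of M\<^sub>L = M\<^sub>L \<union> H"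

definition admissible_collar_gluing ::
    "('a, 'n::finite) manifold \<Rightarrow> 'a tensor02 \<Rightarrow> 'a set \<Rightarrow> 'a set \<Rightarrow> 'a set \<Rightarrow> bool" where
  "admissible_collar_gluing M g H M\<^sub>R M\<^sub>L \<longleftrightarrow> collar_gluing M H M\<^sub>R M\<^sub>L \<and>
     (\<exists>f V. smooth_fun M f \<and> vector_field M V \<and>
       (let g' = (\<lambda>p v w. g p v w - f p * (g p (V p) v * g p (V p) w)) in
          riemannian_on M M\<^sub>R g' \<and> lorentzian_on M M\<^sub>L g' \<and>
          {p \<in> topspace (mtop M). radical M g' p \<noteq> {0}} = H \<and>
          (\<forall>q\<in>H. tangent.dim (radical M g' q) = 1) \<and>
          transverse_type_changing M g' \<and> radical_transverse M g' H))"

end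

theory Submission
  imports Defs
begin

text \<open>The end of \<open>M\<close> is described by a collar of \<open>\<partial>W\<close>, which is obtained without flows: a boundary
  defining function \<open>\<rho>\<close> and a retraction \<open>r\<close> of a neighbourhood of \<open>\<partial>W\<close> onto \<open>\<partial>W\<close> are patched together from
  finitely many charts, and \<open>(r, \<rho>)\<close> is a local diffeomorphism along \<open>\<partial>W\<close> that is injective there, hence by
  compactness a diffeomorphism of a neighbourhood onto \<open>\<partial>W \<times> [0, \<epsilon>)\<close>. Moving along the second factor gives maps
  \<open>\<Theta> p t\<close>; after transport to \<open>M\<close> the level set \<open>H = {\<rho> = c}\<close> bounds the compact part \<open>{\<rho> \<ge> c}\<close>, and
  \<open>p \<mapsto> (\<Theta> p c, c / \<rho> p - 1)\<close> is the diffeomorphism of \<open>{\<rho> \<le> c}\<close> with \<open>H \<times> [0, \<infinity>)\<close>. For \<open>V = grad \<rho>\<close> the tensor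
  \<open>g - f V\<^sup>\<flat> \<otimes> V\<^sup>\<flat>\<close> is Riemannian, degenerate or Lorentzian according to the sign of \<open>1 - f |V|\<^sup>2\<close>, and since
  \<open>V \<noteq> 0\<close> on \<open>{\<rho> \<le> c}\<close> one can choose \<open>f\<close> such that \<open>f |V|\<^sup>2 - 1\<close> has the sign of \<open>c - \<rho>\<close> and vanishes to
  first order along \<open>H\<close>.\<close>

subsection \<open>Calculus of \<open>C\<^sup>k\<close> maps\<close>

text \<open>Taking \<open>V\<close> to be a gradient makes the covector
  \<open>V\<^sup>\<flat>\<close> equal to d\<rho>, so whatever the given metric is, the perturbed
  tensor is governed by \<rho> and the squared length of its gradient alone. Its radical along
  \<open>H\<close> is spanned by the gradient, while the tangent space of \<open>H\<close> is the
  kernel of d\<rho>; transversality is then just the positivity of that squared length.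

  Two obstacles shape the details. The coefficient must be smooth on all of \<open>M\<close>,
  although the gradient may vanish deep inside the compact part. There only a strict inequality is
  wanted, so a term that is zero up to level c and vanishes to infinite order at c can be added to
  the denominator without disturbing the first-order behaviour at \<open>H\<close>. Secondly, near
  the boundary of \<open>W\<close> a smooth map is known only through some extension across the half
  space. Derivatives at boundary points must be recovered from values on one side, and a local
  inverse must be shown to respect the half space.

  The parameter c / \<rho> - 1 is 0 on \<open>H\<close> and tends to infinity at the end, where
  \<rho> tends to 0.\<close>

lemma Ck_on_Suc_imp: "Ck_on (Suc k) S f \<Longrightarrow> Ck_on k S f"
proof (induction k arbitrary: f)
  case 0
  then show ?case
    by (auto intro!: continuous_at_imp_continuous_on differentiable_imp_continuous_within)
next
  case (Suc k)
  then show ?case by (metis Ck_on.simps(2))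
qed

lemma Ck_on_subset: "Ck_on k S f \<Longrightarrow> T \<subseteq> S \<Longrightarrow> Ck_on k T f"
  by (induction k arbitrary: f) (auto intro: continuous_on_subset)

text \<open>Openness of \<open>S\<close> makes the values on \<open>S\<close> determine the
  derivatives, which are taken in the ambient space.\<close>

lemma Ck_on_cong:
  assumes "open S" "\<And>x. x \<in> S \<Longrightarrow> f x = g x"
  shows "Ck_on k S f \<Longrightarrow> Ck_on k S g"
  using assms(2)
proof (induction k arbitrary: f g)
  case 0
  then show ?case by (auto cong: continuous_on_cong)
next
  case (Suc k)
  have d: "(g has_derivative frechet_derivative f (at x)) (at x)" if "x \<in> S" for x
    using has_derivative_transform_within_open[OF _ \<open>open S\<close> that, of f "frechet_derivative f (at x)" UNIV g]
      Suc.prems that frechet_derivative_works by auto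
  have "frechet_derivative f (at x) = frechet_derivative g (at x)" if "x \<in> S" for x
    using frechet_derivative_at[OF d[OF that]] .
  then have "Ck_on k S (\<lambda>x. frechet_derivative g (at x) v)" for v
    using Suc.IH[of "\<lambda>x. frechet_derivative f (at x) v" "\<lambda>x. frechet_derivative g (at x) v"] Suc.prems by auto
  then show ?case using d by (auto simp: differentiable_def)
qed

text \<open>The recursion refers to the chosen \<open>frechet_derivative\<close>; this rule lets any
  explicitly computed derivative stand in for it.\<close>

lemma Ck_on_SucI:
  assumes "open S" "\<And>x. x \<in> S \<Longrightarrow> (f has_derivative f' x) (at x)" "\<And>v. Ck_on k S (\<lambda>x. f' x v)"
  shows "Ck_on (Suc k) S f"
proof -
  have "Ck_on k S (\<lambda>x. frechet_derivative f (at x) v)" for v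
    by (rule Ck_on_cong[OF assms(1) _ assms(3)]) (simp add: frechet_derivative_at[OF assms(2)])
  then show ?thesis using assms(2) by (auto simp: differentiable_def)
qed

lemma Ck_on_SucD:
  assumes "Ck_on (Suc k) S f"
  shows "x \<in> S \<Longrightarrow> (f has_derivative frechet_derivative f (at x)) (at x)"
    "Ck_on k S (\<lambda>x. frechet_derivative f (at x) v)"
  using assms frechet_derivative_works by auto

lemma Ck_on_const: "Ck_on k S (\<lambda>x. c)"
  by (induction k arbitrary: c) auto

lemma Ck_on_compose_linear:
  assumes "bounded_linear L" "open S"
  shows "Ck_on k S f \<Longrightarrow> Ck_on k S (\<lambda>x. L (f x))"
proof (induction k arbitrary: f)
  case 0
  then show ?case using assms(1) by (auto intro: bounded_linear.continuous_on)
next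
  case (Suc k)
  show ?case
    by (rule Ck_on_SucI[OF assms(2) bounded_linear.has_derivative[OF assms(1) Ck_on_SucD(1)[OF Suc.prems]]])
      (auto intro!: Suc.IH Ck_on_SucD(2)[OF Suc.prems])
qed

lemma Ck_on_ident: "open S \<Longrightarrow> Ck_on k S (\<lambda>x. x)"
  by (cases k) (auto simp: Ck_on_const)

lemma Ck_on_bounded_linear: "bounded_linear L \<Longrightarrow> open S \<Longrightarrow> Ck_on k S L"
  using Ck_on_compose_linear[of L S k "\<lambda>x. x"] Ck_on_ident by auto

lemma Ck_on_add: "open S \<Longrightarrow> Ck_on k S f \<Longrightarrow> Ck_on k S g \<Longrightarrow> Ck_on k S (\<lambda>x. f x + g x)"
proof (induction k arbitrary: f g)
  case 0
  then show ?case by (auto intro: continuous_intros)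
next
  case (Suc k)
  show ?case
    by (rule Ck_on_SucI[OF Suc.prems(1) has_derivative_add[OF Ck_on_SucD(1)[OF Suc.prems(2)]
        Ck_on_SucD(1)[OF Suc.prems(3)]]])
      (auto intro!: Suc.IH Suc.prems(1) Ck_on_SucD(2)[OF Suc.prems(2)] Ck_on_SucD(2)[OF Suc.prems(3)])
qed

lemma Ck_on_sum: "open S \<Longrightarrow> (\<And>i. i \<in> I \<Longrightarrow> Ck_on k S (f i)) \<Longrightarrow> Ck_on k S (\<lambda>x. \<Sum>i\<in>I. f i x)"
  by (induction I rule: infinite_finite_induct) (auto intro: Ck_on_const Ck_on_add)

lemma Ck_on_bilinear:
  assumes "bounded_bilinear p" "open S"
  shows "Ck_on k S f \<Longrightarrow> Ck_on k S g \<Longrightarrow> Ck_on k S (\<lambda>x. p (f x) (g x))"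
proof (induction k arbitrary: f g)
  case 0
  then show ?case using assms(1) by (auto intro: bounded_bilinear.continuous_on)
next
  case (Suc k)
  show ?case
    by (rule Ck_on_SucI[OF assms(2) bounded_bilinear.FDERIV[OF assms(1) Ck_on_SucD(1)[OF Suc.prems(1)]
        Ck_on_SucD(1)[OF Suc.prems(2)]]])
      (auto intro!: Ck_on_add assms(2) Suc.IH Ck_on_SucD(2)[OF Suc.prems(1)] Ck_on_SucD(2)[OF Suc.prems(2)]
        Ck_on_Suc_imp[OF Suc.prems(1)] Ck_on_Suc_imp[OF Suc.prems(2)])
qed

text \<open>In the chain rule the direction \<open>?f x v\<close> varies with x, whereas induction
  controls derivatives in fixed directions only. Expanding that direction in the basis of the
  finite-dimensional middle space leaves a finite sum of products to which the induction hypothesis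
  applies.\<close>

lemma Ck_on_compose:
  fixes f :: "'a::real_normed_vector \<Rightarrow> 'b::euclidean_space" and g :: "'b \<Rightarrow> 'c::real_normed_vector"
  assumes "open S" "open T" "f ` S \<subseteq> T"
  shows "Ck_on k S f \<Longrightarrow> Ck_on k T g \<Longrightarrow> Ck_on k S (\<lambda>x. g (f x))"
proof (induction k arbitrary: g)
  case 0
  then show ?case using assms(3) by (auto intro: continuous_on_compose2)
next
  case (Suc k)
  let ?f = "\<lambda>x. frechet_derivative f (at x)" and ?g = "\<lambda>x. frechet_derivative g (at x)"
  have eq: "(\<Sum>b\<in>Basis. (?f x v \<bullet> b) *\<^sub>R ?g (f x) b) = ?g (f x) (?f x v)" if "x \<in> S" for x v
  proof -
    have "linear (?g (f x))"
      using Ck_on_SucD(1)[OF Suc.prems(2), of "f x"] that assms(3) has_derivative_linear by blast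
    then have "(\<Sum>b\<in>Basis. (?f x v \<bullet> b) *\<^sub>R ?g (f x) b) = ?g (f x) (\<Sum>b\<in>Basis. (?f x v \<bullet> b) *\<^sub>R b)"
      by (simp add: linear_sum linear_scale)
    then show ?thesis by (simp add: euclidean_representation)
  qed
  have 1: "((\<lambda>x. g (f x)) has_derivative (\<lambda>v. ?g (f x) (?f x v))) (at x)" if "x \<in> S" for x
    by (rule has_derivative_compose[OF Ck_on_SucD(1)[OF Suc.prems(1)] Ck_on_SucD(1)[OF Suc.prems(2)]])
      (use that assms(3) in auto)
  have "Ck_on k S (\<lambda>x. \<Sum>b\<in>Basis. (?f x v \<bullet> b) *\<^sub>R ?g (f x) b)" for v
    by (intro Ck_on_sum assms(1) Ck_on_bilinear[OF bounded_bilinear_scaleR]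
        Ck_on_bilinear[OF bounded_bilinear_inner] Ck_on_const Ck_on_SucD(2)[OF Suc.prems(1)]
        Suc.IH Ck_on_Suc_imp[OF Suc.prems(1)] Ck_on_SucD(2)[OF Suc.prems(2)])
  then have "Ck_on k S (\<lambda>x. ?g (f x) (?f x v))" for v
    by (rule Ck_on_cong[OF assms(1), rotated]) (simp add: eq)
  then show ?case using Ck_on_SucI[OF assms(1) 1] by blast
qed

text \<open>The derivative of the inverse is a product of two inverses with the direction, so each
  order follows from the one below.\<close>

lemma Ck_on_inverse: "Ck_on k {x::real. x \<noteq> 0} inverse"
proof (induction k)
  case 0
  then show ?case by (auto intro: continuous_intros)
next
  case (Suc k)
  have op: "open {x::real. x \<noteq> 0}" by (simp add: open_Collect_neq)
  show ?case
    by (rule Ck_on_SucI[OF op has_derivative_inverse'])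
      (auto intro!: Ck_on_bilinear[OF bounded_bilinear_mult op] Ck_on_const Suc
        Ck_on_compose_linear[OF bounded_linear_minus[OF bounded_linear_ident] op])
qed

definition Cinf :: "'a::real_normed_vector set \<Rightarrow> ('a \<Rightarrow> 'b::real_normed_vector) \<Rightarrow> bool" where
  "Cinf S f \<longleftrightarrow> (\<forall>k. Ck_on k S f)"

lemma Cinf_subset: "Cinf S f \<Longrightarrow> T \<subseteq> S \<Longrightarrow> Cinf T f"
  by (auto simp: Cinf_def intro: Ck_on_subset)

lemma Cinf_cong: "open S \<Longrightarrow> (\<And>x. x \<in> S \<Longrightarrow> f x = g x) \<Longrightarrow> Cinf S f \<Longrightarrow> Cinf S g"
  unfolding Cinf_def using Ck_on_cong by metis

lemma Cinf_const: "Cinf S (\<lambda>x. c)"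
  by (simp add: Cinf_def Ck_on_const)

lemma Cinf_ident: "open S \<Longrightarrow> Cinf S (\<lambda>x. x)"
  by (simp add: Cinf_def Ck_on_ident)

lemma Cinf_bounded_linear: "bounded_linear L \<Longrightarrow> open S \<Longrightarrow> Cinf S L"
  by (simp add: Cinf_def Ck_on_bounded_linear)

lemma Cinf_compose_linear: "bounded_linear L \<Longrightarrow> open S \<Longrightarrow> Cinf S f \<Longrightarrow> Cinf S (\<lambda>x. L (f x))"
  by (simp add: Cinf_def Ck_on_compose_linear)

lemma Cinf_add: "open S \<Longrightarrow> Cinf S f \<Longrightarrow> Cinf S g \<Longrightarrow> Cinf S (\<lambda>x. f x + g x)"
  by (simp add: Cinf_def Ck_on_add)

lemma Cinf_minus: "open S \<Longrightarrow> Cinf S f \<Longrightarrow> Cinf S (\<lambda>x. - f x)"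
  by (rule Cinf_compose_linear[OF bounded_linear_minus[OF bounded_linear_ident]])

lemma Cinf_diff: "open S \<Longrightarrow> Cinf S f \<Longrightarrow> Cinf S g \<Longrightarrow> Cinf S (\<lambda>x. f x - g x)"
  using Cinf_add[OF _ _ Cinf_minus, of S f g] by simp

lemma Cinf_sum: "open S \<Longrightarrow> (\<And>i. i \<in> I \<Longrightarrow> Cinf S (f i)) \<Longrightarrow> Cinf S (\<lambda>x. \<Sum>i\<in>I. f i x)"
  by (simp add: Cinf_def Ck_on_sum)

lemma Cinf_bilinear:
  "bounded_bilinear p \<Longrightarrow> open S \<Longrightarrow> Cinf S f \<Longrightarrow> Cinf S g \<Longrightarrow> Cinf S (\<lambda>x. p (f x) (g x))"
  by (simp add: Cinf_def Ck_on_bilinear)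

lemmas Cinf_mult = Cinf_bilinear[OF bounded_bilinear_mult]
lemmas Cinf_scaleR = Cinf_bilinear[OF bounded_bilinear_scaleR]
lemmas Cinf_inner = Cinf_bilinear[OF bounded_bilinear_inner]

lemma Cinf_prod:
  fixes f :: "'i \<Rightarrow> 'a::real_normed_vector \<Rightarrow> real"
  shows "open S \<Longrightarrow> (\<And>i. i \<in> I \<Longrightarrow> Cinf S (f i)) \<Longrightarrow> Cinf S (\<lambda>x. \<Prod>i\<in>I. f i x)"
  by (induction I rule: infinite_finite_induct) (auto intro: Cinf_const Cinf_mult)

lemma Cinf_compose:
  fixes f :: "'a::real_normed_vector \<Rightarrow> 'b::euclidean_space" and g :: "'b \<Rightarrow> 'c::real_normed_vector"
  shows "open S \<Longrightarrow> open T \<Longrightarrow> f ` S \<subseteq> T \<Longrightarrow> Cinf S f \<Longrightarrow> Cinf T g \<Longrightarrow> Cinf S (\<lambda>x. g (f x))"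
  unfolding Cinf_def using Ck_on_compose by metis

lemma Cinf_divide:
  fixes f g :: "'a::real_normed_vector \<Rightarrow> real"
  assumes "open S" "Cinf S f" "Cinf S g" "\<And>x. x \<in> S \<Longrightarrow> g x \<noteq> 0"
  shows "Cinf S (\<lambda>x. f x / g x)"
proof -
  have "Cinf S (\<lambda>x. inverse (g x))"
    by (rule Cinf_compose[OF assms(1) _ _ assms(3), of "{x. x \<noteq> 0}"])
      (use assms(4) in \<open>auto simp: open_Collect_neq Cinf_def Ck_on_inverse\<close>)
  then show ?thesis unfolding divide_inverse using assms by (intro Cinf_mult)
qed

lemma Cinf_imp_continuous_on: "Cinf S f \<Longrightarrow> continuous_on S f"
  unfolding Cinf_def by (metis Ck_on.simps(1))

lemma Cinf_has_derivative:
  "Cinf S f \<Longrightarrow> x \<in> S \<Longrightarrow> (f has_derivative frechet_derivative f (at x)) (at x)"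
  unfolding Cinf_def using Ck_on_SucD(1)[of 0 S f x] by blast

lemma Cinf_derivative: "Cinf S f \<Longrightarrow> Cinf S (\<lambda>x. frechet_derivative f (at x) v)"
  unfolding Cinf_def using Ck_on_SucD(2) by blast

lemma Cinf_vec_nth: "open S \<Longrightarrow> Cinf S f \<Longrightarrow> Cinf S (\<lambda>x. f x $ i)"
  by (rule Cinf_compose_linear[OF bounded_linear_vec_nth])

lemma Cinf_vec_lambda:
  fixes f :: "'n::finite \<Rightarrow> 'a::real_normed_vector \<Rightarrow> real"
  assumes "open S" "\<And>i. Cinf S (f i)"
  shows "Cinf S (\<lambda>x. \<chi> i. f i x)"
proof -
  have "Cinf S (\<lambda>x. \<Sum>i\<in>UNIV. f i x *\<^sub>R axis i (1::real))"
    by (intro Cinf_sum Cinf_scaleR Cinf_const assms)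
  moreover have "(\<lambda>x. \<Sum>i\<in>UNIV. f i x *\<^sub>R axis i (1::real)) = (\<lambda>x. \<chi> i. f i x)"
    by (auto simp: vec_eq_iff axis_def if_distrib cong: if_cong)
  ultimately show ?thesis by simp
qed

lemma Cinf_det:
  fixes A :: "'a::real_normed_vector \<Rightarrow> real^'n^'n"
  assumes "open S" "\<And>i j. Cinf S (\<lambda>x. A x $ i $ j)"
  shows "Cinf S (\<lambda>x. det (A x))"
  unfolding det_def by (intro Cinf_sum Cinf_mult Cinf_prod Cinf_const assms)

lemma Cinf_locally:
  assumes "\<And>x. x \<in> S \<Longrightarrow> \<exists>T. open T \<and> x \<in> T \<and> Cinf T f"
  shows "Cinf S f"
proof -
  have "Ck_on k S f" if "\<And>x. x \<in> S \<Longrightarrow> \<exists>T. open T \<and> x \<in> T \<and> Ck_on k T f" for k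
    using that
  proof (induction k arbitrary: f)
    case 0
    then show ?case
      by (metis Ck_on.simps(1) continuous_at_imp_continuous_on continuous_on_eq_continuous_at)
  next
    case (Suc k)
    then show ?case by (metis Ck_on.simps(2))
  qed
  then show ?thesis using assms unfolding Cinf_def by blast
qed

text \<open>By Cramer's rule the solution consists of quotients of determinants and inherits
  smoothness from the coefficients.\<close>

lemma Cinf_solve:
  fixes A :: "'a::real_normed_vector \<Rightarrow> real^'n^'n" and b :: "'a \<Rightarrow> real^'n"
  assumes "open S" "\<And>i j. Cinf S (\<lambda>x. A x $ i $ j)" "\<And>i. Cinf S (\<lambda>x. b x $ i)"
    and "\<And>x. x \<in> S \<Longrightarrow> det (A x) \<noteq> 0" "\<And>x. x \<in> S \<Longrightarrow> A x *v y x = b x"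
  shows "Cinf S y"
proof -
  let ?z = "\<lambda>x. (\<chi> k. det (\<chi> i j. if j = k then b x $ i else A x $ i $ j) / det (A x))"
  have "Cinf S (\<lambda>x. if j = k then b x $ i else A x $ i $ j)" for i j k
    by (cases "j = k") (simp_all add: assms)
  then have "Cinf S ?z"
    by (intro Cinf_vec_lambda Cinf_divide Cinf_det assms) simp_all
  then show ?thesis
    by (rule Cinf_cong[OF assms(1), rotated]) (use cramer[OF assms(4)] assms(5) in auto)
qed

text \<open>The regularity of the local inverse is bootstrapped: by Cramer's rule its derivative is a
  rational expression in the derivative of the map, evaluated at the local inverse.\<close>

lemma smooth_inverse_function:
  fixes f :: "real^'n::finite \<Rightarrow> real^'n"
  assumes "open S" "Cinf S f" "x0 \<in> S" "\<And>v. frechet_derivative f (at x0) v = 0 \<Longrightarrow> v = 0"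
  obtains U V g where "open U" "U \<subseteq> S" "x0 \<in> U" "open V" "f x0 \<in> V" "homeomorphism U V f g" "Cinf V g"
    "\<And>x. x \<in> U \<Longrightarrow> bij (frechet_derivative f (at x))"
proof -
  \<comment> \<open>The inverse function theorem wants a derivative that is continuous in operator
    norm; in finite dimension it is enough to check continuity in each basis direction.\<close>
  define f' where "f' x = Blinfun (frechet_derivative f (at x))" for x
  note d = Cinf_has_derivative[OF assms(2)]
  have f': "blinfun_apply (f' x) = frechet_derivative f (at x)" if "x \<in> S" for x
    unfolding f'_def by (rule bounded_linear_Blinfun_apply[OF has_derivative_bounded_linear[OF d[OF that]]])
  have contf: "continuous_on S f'"
  proof (rule continuous_on_blinfun_componentwise)
    fix i :: "real^'n"
    assume "i \<in> Basis"
    have "continuous_on S (\<lambda>x. frechet_derivative f (at x) i)"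
      by (intro Cinf_imp_continuous_on Cinf_derivative assms)
    then show "continuous_on S (\<lambda>x. blinfun_apply (f' x) i)"
      by (simp cong: continuous_on_cong add: f')
  qed
  have lin: "linear (frechet_derivative f (at x0))"
    using d[OF assms(3)] has_derivative_linear by blast
  then have inj: "inj (frechet_derivative f (at x0))"
    using assms(4) linear_injective_0 by blast
  obtain L where L: "linear L" "L \<circ> frechet_derivative f (at x0) = id"
    using linear_injective_left_inverse[OF lin inj] by blast
  have "Blinfun L o\<^sub>L f' x0 = id_blinfun"
    using L f'[OF assms(3)] by (auto intro!: blinfun_eqI simp: bounded_linear_Blinfun_apply
        linear_conv_bounded_linear fun_eq_iff)
  from inverse_function_theorem[OF assms(1) _ contf assms(3) this] d f'
  obtain U V g g' where U: "open U" "U \<subseteq> S" "x0 \<in> U" "open V" "f x0 \<in> V" "homeomorphism U V f g"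
    and g: "\<And>y. y \<in> V \<Longrightarrow> (g has_derivative (g' y)) (at y)"
      "\<And>y. y \<in> V \<Longrightarrow> g' y = inv (blinfun_apply (f'(g y)))" "\<And>y. y \<in> V \<Longrightarrow> bij (blinfun_apply (f'(g y)))"
    by metis
  have gU: "g y \<in> U" "g y \<in> S" "f (g y) = y" if "y \<in> V" for y
    using U that unfolding homeomorphism_def by auto
  let ?D = "\<lambda>x. frechet_derivative f (at x)"
  have bij: "bij (?D (g y))" if "y \<in> V" for y
    using g(3)[OF that] f'[OF gU(2)[OF that]] by simp
  have bijU: "bij (?D x)" if "x \<in> U" for x
    using bij[of "f x"] U(6) that unfolding homeomorphism_def by auto
  have linD: "linear (?D (g y))" if "y \<in> V" for y
    using d[OF gU(2)[OF that]] has_derivative_linear by blast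
  have Dg: "?D (g y) (g' y v) = v" if "y \<in> V" for y v
    using g(2)[OF that] bij[OF that] f'[OF gU(2)[OF that]] by (simp add: bij_is_surj surj_f_inv_f)
  have "Ck_on k V g" for k
  proof (induction k)
    case 0
    show ?case using U(6) unfolding homeomorphism_def by simp
  next
    case (Suc k)
    have "Ck_on k V (\<lambda>y. g' y v)" for v
    proof -
      define A where "A y = matrix (?D (g y))" for y
      have dA: "det (A y) \<noteq> 0" if "y \<in> V" for y
        using bij[OF that] linD[OF that] unfolding A_def
        by (simp add: det_nz_iff_inj bij_is_inj)
      have "A y *v g' y v = v" if "y \<in> V" for y
        using Dg[OF that] linD[OF that] unfolding A_def by (simp add: matrix_works)
      then have g'eq: "g' y v = (\<chi> k. det (\<chi> i j. if j = k then v $ i else A y $ i $ j) * inverse (det (A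
          y)))" if "y \<in> V" for y
        using cramer[OF dA[OF that], of "g' y v" v] that by (simp add: divide_inverse)
      have CA: "Ck_on k V (\<lambda>y. A y $ i $ j)" for i j
      proof -
        have "Ck_on k S (\<lambda>x. ?D x (axis j 1) $ i)"
          using Cinf_vec_nth[OF assms(1) Cinf_derivative[OF assms(2)]] unfolding Cinf_def by blast
        then show ?thesis unfolding A_def matrix_def
          using Ck_on_compose[OF U(4) assms(1) _ Suc, of "\<lambda>x. ?D x (axis j 1) $ i"] gU(2) by auto
      qed
      \<comment> \<open>At this stage \<open>g\<close> is only known to be of class
        \<open>Ck_on k\<close>, so the rules for products and determinants are redone at fixed order
        instead of being quoted for \<open>Cinf\<close>.\<close>
      have Cprod: "Ck_on k V (\<lambda>x. \<Prod>i\<in>I. h i x)" if "\<And>i. i \<in> I \<Longrightarrow> Ck_on k V (h i)" for I and h :: "'n \<Rightarrow>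
          real^'n \<Rightarrow> real"
        using that by (induction I rule: infinite_finite_induct)
          (auto intro: Ck_on_const Ck_on_bilinear[OF bounded_bilinear_mult U(4)])
      have Cdet: "Ck_on k V (\<lambda>x. det (B x))" if "\<And>i j. Ck_on k V (\<lambda>x. B x $ i $ j)" for B :: "real^'n \<Rightarrow>
          real^'n^'n"
        unfolding det_def by (intro Ck_on_sum U(4) Ck_on_bilinear[OF bounded_bilinear_mult] Cprod
            Ck_on_const that)
      have Cinv: "Ck_on k V (\<lambda>y. inverse (det (A y)))"
        by (rule Ck_on_compose[OF U(4) _ _ Cdet[OF CA] Ck_on_inverse]) (use dA in \<open>auto simp: open_Collect_neq\<close>)
      have "Ck_on k V (\<lambda>y. if j = l then v $ i else A y $ i $ j)" for i j l
        by (cases "j = l") (simp_all add: CA Ck_on_const)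
      then have "Ck_on k V (\<lambda>y. \<Sum>l\<in>UNIV. (det (\<chi> i j. if j = l then v $ i else A y $ i $ j) * inverse (det
          (A y))) *\<^sub>R axis l (1::real))"
        by (intro Ck_on_sum U(4) Ck_on_bilinear[OF bounded_bilinear_scaleR] Ck_on_bilinear[OF
            bounded_bilinear_mult] Cdet Cinv Ck_on_const) simp_all
      then show ?thesis
        by (rule Ck_on_cong[OF U(4), rotated])
          (auto simp: g'eq vec_eq_iff axis_def if_distrib cong: if_cong)
    qed
    then show ?case by (intro Ck_on_SucI[OF U(4) g(1)])
  qed
  then show ?thesis using that U bijU unfolding Cinf_def by blast
qed

subsection \<open>Flat functions and bump functions\<close>

text \<open>\<open>flat 0\<close> is the classical function exp (-1/x), extended by zero. The powers
  in the denominator make the family closed under differentiation up to linear combinations, so that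
  smoothness becomes an induction over all m at once.\<close>

definition flat :: "nat \<Rightarrow> real \<Rightarrow> real" where
  "flat m x = (if x \<le> 0 then 0 else exp (- (1 / x)) / x ^ m)"

lemma flat_DERIV: "(flat m has_real_derivative (flat (m + 2) x - real m * flat (m + 1) x)) (at x)"
proof -
  consider "x < 0" | "x = 0" | "x > 0" by linarith
  then show ?thesis
  proof cases
    case 1
    have "((\<lambda>x. 0) has_real_derivative 0) (at x)" by simp
    then have "(flat m has_real_derivative 0) (at x)"
      by (rule has_field_derivative_transform_within_open[of _ _ _ "{..<0}"]) (use 1 in \<open>auto simp: flat_def\<close>)
    then show ?thesis using 1 by (simp add: flat_def)
  next
    case 3
    let ?E = "exp (- (1 / x))"
    have d: "((\<lambda>x. exp (- (1 / x)) / x ^ m) has_real_derivative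
        (?E * (1 / x\<^sup>2) * x ^ m - ?E * (real m * x ^ (m - 1))) / (x ^ m * x ^ m)) (at x)"
      by (rule derivative_eq_intros refl | use 3 in \<open>simp add: power2_eq_square\<close>)+
    have "(?E * (1 / x\<^sup>2) * x ^ m - ?E * (real m * x ^ (m - 1))) / (x ^ m * x ^ m) = flat (m + 2) x - real
        m * flat (m + 1) x"
    proof (cases m)
      case 0
      then show ?thesis using 3 by (simp add: flat_def power2_eq_square)
    next
      case (Suc j)
      define y where "y = x ^ j"
      have y: "y \<noteq> 0" using 3 by (simp add: y_def)
      have "(?E * (1 / (x * x)) * (x * y) - ?E * (real m * y)) / (x * y * (x * y)) = ?E / (x * x * x * y)
          - real m * (?E / (x * x * y))"
        using 3 y by (simp add: divide_simps) (simp add: algebra_simps)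
      then show ?thesis using 3 by (simp add: Suc flat_def y_def power2_eq_square mult.assoc)
    qed
    with d have "((\<lambda>x. exp (- (1 / x)) / x ^ m) has_real_derivative (flat (m + 2) x - real m * flat (m +
        1) x)) (at x)"
      by simp
    then show ?thesis
      by (rule has_field_derivative_transform_within_open[of _ _ _ "{0<..}"]) (use 3 in \<open>auto simp: flat_def\<close>)
  next
    case 2
    \<comment> \<open>The difference quotient of \<open>flat m\<close> at 0 is
      \<open>flat (m + 1)\<close>, so this is the limit that decides differentiability at 0. From
      the right, y = 1 / h turns it into a power of y divided by exp y.\<close>
    have "((\<lambda>h. flat (m + 1) h) \<longlongrightarrow> 0) (at_right 0)"
    proof -
      have "((\<lambda>y::real. y ^ (m + 1) / exp y) \<longlongrightarrow> 0) at_top"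
        by (rule tendsto_power_div_exp_0)
      then have "((\<lambda>h::real. inverse h ^ (m + 1) / exp (inverse h)) \<longlongrightarrow> 0) (at_right 0)"
        using filterlim_compose filterlim_inverse_at_top_right by fastforce
      moreover have "eventually (\<lambda>h::real. inverse h ^ (m + 1) / exp (inverse h) = flat (m + 1) h) (at_right 0)"
        by (rule eventually_at_rightI[of 0 1]) (auto simp: flat_def exp_minus field_simps)
      ultimately show ?thesis by (simp add: tendsto_cong)
    qed
    moreover have "((\<lambda>h. flat (m + 1) h) \<longlongrightarrow> 0) (at_left 0)"
    proof -
      have "eventually (\<lambda>h::real. 0 = flat (m + 1) h) (at_left 0)"
        by (rule eventually_at_leftI[of "-1"]) (auto simp: flat_def)
      then show ?thesis using tendsto_const[of 0 "at_left (0::real)"] by (simp add: tendsto_cong)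
    qed
    ultimately have "((\<lambda>h. flat (m + 1) h) \<longlongrightarrow> 0) (at 0)"
      by (simp add: filterlim_split_at)
    moreover have "(\<lambda>h. (flat m (0 + h) - flat m 0) / h) = flat (m + 1)"
      by (auto simp: flat_def fun_eq_iff)
    moreover have "flat m 0 = 0" "flat (m + 2) 0 = 0" "flat (m + 1) 0 = 0"
      by (simp_all add: flat_def)
    ultimately show ?thesis using 2 by (simp add: DERIV_def)
  qed
qed

lemma Cinf_flat: "Cinf UNIV (flat m)"
proof -
  have "Ck_on k UNIV (flat m)" for k
  proof (induction k arbitrary: m)
    case 0
    show ?case by (auto intro!: continuous_at_imp_continuous_on DERIV_isCont flat_DERIV)
  next
    case (Suc k)
    have "Ck_on k UNIV (\<lambda>x. (flat (m + 2) x + (- real m) * flat (m + 1) x) * v)" for v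
      by (intro Ck_on_bilinear[OF bounded_bilinear_mult] Ck_on_add Suc Ck_on_const open_UNIV)
    then show ?case
      by (intro Ck_on_SucI[OF open_UNIV flat_DERIV[unfolded has_field_derivative_def]]) simp
  qed
  then show ?thesis by (simp add: Cinf_def)
qed

lemma flat_nonneg: "0 \<le> flat m x" and flat_pos: "0 < x \<Longrightarrow> 0 < flat m x" and flat_zero: "x \<le> 0 \<Longrightarrow> flat m x = 0"
  by (auto simp: flat_def)

definition step :: "real \<Rightarrow> real" where
  "step t = flat 0 (2 - t) / (flat 0 (2 - t) + flat 0 (t - 1))"

lemma step_denominator_pos: "0 < flat 0 (2 - t) + flat 0 (t - 1)"
  using flat_nonneg[of 0 "2 - t"] flat_nonneg[of 0 "t - 1"] flat_pos[of "2 - t" 0] flat_pos[of "t - 1" 0]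
  by (cases "t < 2") force+

lemma step: "0 \<le> step t" "step t \<le> 1" "t \<le> 1 \<Longrightarrow> step t = 1" "2 \<le> t \<Longrightarrow> step t = 0"
  using step_denominator_pos[of t] flat_nonneg[of 0 "2 - t"] flat_nonneg[of 0 "t - 1"]
  by (auto simp: step_def flat_zero field_simps)

lemma Cinf_UNIV_compose:
  fixes f :: "'a::real_normed_vector \<Rightarrow> 'b::euclidean_space"
  shows "Cinf UNIV g \<Longrightarrow> open S \<Longrightarrow> Cinf S f \<Longrightarrow> Cinf S (\<lambda>x. g (f x))"
  using Cinf_compose[of S UNIV f g] by auto

lemma Cinf_step: "Cinf UNIV step"
  unfolding step_def
  by (intro Cinf_divide Cinf_add Cinf_UNIV_compose[OF Cinf_flat] Cinf_diff Cinf_ident Cinf_const open_UNIV)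
    (use step_denominator_pos in \<open>auto simp: less_le\<close>)

lemma bump_exists:
  fixes p :: "'a::euclidean_space"
  assumes "0 < r"
  obtains \<beta> :: "'a \<Rightarrow> real" and s where "Cinf UNIV \<beta>" "0 < s" "s < r" "\<forall>x. 0 \<le> \<beta> x" "\<forall>x. \<beta> x \<le> 1"
    "\<forall>x. dist p x < s \<longrightarrow> \<beta> x = 1" "\<forall>x. r \<le> dist p x \<longrightarrow> \<beta> x = 0"
proof -
  \<comment> \<open>The squared distance is smooth at p as well. The factor makes the argument of
    \<open>step\<close> equal to 2 at distance r, where \<open>step\<close> has reached 0, and equal
    to 1 / 2 at distance r / 2, inside the plateau.\<close>
  let ?\<beta> = "\<lambda>x. step (2 / r\<^sup>2 * ((x - p) \<bullet> (x - p)))"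
  have sq: "(x - p) \<bullet> (x - p) = (dist p x)\<^sup>2" for x
    by (simp add: dist_norm power2_norm_eq_inner norm_minus_commute[of p])
  show ?thesis
  proof (rule that[of ?\<beta> "r / 2"])
    show "Cinf UNIV ?\<beta>"
      by (intro Cinf_UNIV_compose[OF Cinf_step] Cinf_mult Cinf_inner Cinf_diff Cinf_ident Cinf_const open_UNIV)
    show "\<forall>x. dist p x < r / 2 \<longrightarrow> ?\<beta> x = 1"
    proof (intro allI impI)
      fix x assume that: "dist p x < r / 2"
      have "(dist p x)\<^sup>2 \<le> (r / 2)\<^sup>2" using that by (intro power_mono) auto
      then have "4 * (dist p x)\<^sup>2 \<le> r\<^sup>2" by (simp add: power_divide)
      moreover have "0 \<le> (dist p x)\<^sup>2" by simp
      ultimately have "2 * (dist p x)\<^sup>2 \<le> r\<^sup>2" by linarith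
      then show "?\<beta> x = 1" using assms by (intro step(3)) (simp add: sq)
    qed
    show "\<forall>x. r \<le> dist p x \<longrightarrow> ?\<beta> x = 0"
    proof (intro allI impI)
      fix x assume that: "r \<le> dist p x"
      have "r\<^sup>2 \<le> (dist p x)\<^sup>2" using that assms by (intro power_mono) auto
      then show "?\<beta> x = 0" using assms by (intro step(4)) (simp add: sq field_simps power2_eq_square)
    qed
  qed (use assms in \<open>auto simp: step\<close>)
qed

subsection \<open>Hadamard's lemma\<close>

text \<open>The factor t ^ m is there for the induction: differentiating F (p + t (x - p)) in x
  produces one more factor t, so the derivative is an integral of the same shape with m + 1 and a
  directional derivative of \<open>F\<close>.\<close>

lemma Cinf_parametric_integral:
  fixes F :: "'a::euclidean_space \<Rightarrow> real"
  assumes "Cinf (ball p r) F"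
  shows "Cinf (ball p r) (\<lambda>x. integral (cbox 0 1) (\<lambda>t. t ^ m * F (p + t *\<^sub>R (x - p))))"
proof -
  have mem: "p + t *\<^sub>R (x - p) \<in> ball p r" if "x \<in> ball p r" "t \<in> cbox 0 (1::real)" for x t
  proof -
    have "dist p (p + t *\<^sub>R (x - p)) = t * dist p x"
      using that by (simp add: dist_norm norm_minus_commute)
    also have "\<dots> \<le> 1 * dist p x" using that by (intro mult_right_mono) auto
    finally show ?thesis using that by simp
  qed
  have cont: "continuous_on (ball p r \<times> cbox 0 1) (\<lambda>(x, t). t ^ m * F (p + t *\<^sub>R (x - p)))"
    if "Cinf (ball p r) F" for m :: nat and F :: "'a \<Rightarrow> real"
  proof -
    have "continuous_on (ball p r \<times> cbox 0 1) (\<lambda>z. snd z ^ m * F (p + snd z *\<^sub>R (fst z - p)))"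
      by (intro continuous_intros continuous_on_compose2[OF Cinf_imp_continuous_on[OF that]]) (use mem in force)
    then show ?thesis by (simp add: case_prod_unfold)
  qed
  have "Ck_on k (ball p r) (\<lambda>x. integral (cbox 0 1) (\<lambda>t. t ^ m * F (p + t *\<^sub>R (x - p))))"
    if "Cinf (ball p r) F" for k m F
    using that
  proof (induction k arbitrary: m F)
    case 0
    then show ?case using integral_continuous_on_param[OF cont[OF 0]] by simp
  next
    case (Suc k)
    let ?D = "\<lambda>x. frechet_derivative F (at x)"
    define fx where "fx x t = (t ^ Suc m) *\<^sub>R Blinfun (?D (p + t *\<^sub>R (x - p)))" for x t
    note d = Cinf_has_derivative[OF Suc.prems]
    have fx: "blinfun_apply (fx x t) v = t ^ Suc m * ?D (p + t *\<^sub>R (x - p)) v"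
      if "x \<in> ball p r" "t \<in> cbox 0 (1::real)" for x t v
      using bounded_linear_Blinfun_apply[OF has_derivative_bounded_linear[OF d[OF mem[OF that]]]]
      by (simp add: fx_def blinfun.scaleR_left)
    have cfx: "continuous_on (ball p r \<times> cbox 0 1) (\<lambda>(x, t). fx x t)"
    proof (rule continuous_on_blinfun_componentwise)
      fix i :: 'a
      show "continuous_on (ball p r \<times> cbox 0 1) (\<lambda>z. blinfun_apply (case z of (x, t) \<Rightarrow> fx x t) i)"
        using cont[OF Cinf_derivative[OF Suc.prems, of i], of "Suc m"]
        by (rule continuous_on_eq) (auto simp: fx)
    qed
    have int: "(\<lambda>t. t ^ m * F (p + t *\<^sub>R (x - p))) integrable_on cbox 0 1" if "x \<in> ball p r" for x
      by (intro integrable_continuous continuous_intros continuous_on_compose2[OF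
          Cinf_imp_continuous_on[OF Suc.prems]])
        (use mem[OF that] in auto)
    have d1: "((\<lambda>x. t ^ m * F (p + t *\<^sub>R (x - p))) has_derivative blinfun_apply (fx x t)) (at x within
        ball p r)"
      if "x \<in> ball p r" "t \<in> cbox 0 (1::real)" for x t
    proof -
      have lin: "linear (?D (p + t *\<^sub>R (x - p)))"
        using d[OF mem[OF that]] has_derivative_linear by blast
      have "((\<lambda>x. F (p + t *\<^sub>R (x - p))) has_derivative (\<lambda>v. ?D (p + t *\<^sub>R (x - p)) (t *\<^sub>R v))) (at x)"
        by (rule has_derivative_compose[where f = "\<lambda>x. p + t *\<^sub>R (x - p)", OF _ d[OF mem[OF that]]]) (auto
            intro!: derivative_eq_intros)
      then have "((\<lambda>x. t ^ m * F (p + t *\<^sub>R (x - p))) has_derivative (\<lambda>v. t ^ m * ?D (p + t *\<^sub>R (x - p))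
          (t *\<^sub>R v))) (at x)"
        by (rule has_derivative_mult_right)
      moreover have "(\<lambda>v. t ^ m * ?D (p + t *\<^sub>R (x - p)) (t *\<^sub>R v)) = blinfun_apply (fx x t)"
        using lin by (auto simp: fun_eq_iff fx[OF that] linear_scale)
      ultimately show ?thesis by (simp add: has_derivative_at_withinI)
    qed
    have fxint: "fx x integrable_on cbox 0 1" if "x \<in> ball p r" for x
    proof (rule integrable_continuous)
      have "continuous_on (cbox 0 1) ((\<lambda>(x, t). fx x t) \<circ> (\<lambda>t. (x, t)))"
        by (intro continuous_on_compose continuous_intros continuous_on_subset[OF cfx]) (use that in auto)
      then show "continuous_on (cbox 0 1) (fx x)" by (simp add: o_def)
    qed
    have "((\<lambda>x. integral (cbox 0 1) (\<lambda>t. t ^ m * F (p + t *\<^sub>R (x - p)))) has_derivative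
        blinfun_apply (integral (cbox 0 1) (fx x))) (at x)" if "x \<in> ball p r" for x
      using leibniz_rule[OF d1 int cfx that convex_ball] at_within_open[OF that open_ball] by simp
    moreover have "Ck_on k (ball p r) (\<lambda>x. blinfun_apply (integral (cbox 0 1) (fx x)) v)" for v
      using Suc.IH[OF Cinf_derivative[OF Suc.prems, of v], of "Suc m"]
      by (rule Ck_on_cong[OF open_ball, rotated])
        (auto simp: blinfun_apply_integral[OF fxint] fx intro!: integral_cong simp del: power_Suc box_real)
    ultimately show ?case by (intro Ck_on_SucI[OF open_ball])
  qed
  then show ?thesis using assms by (simp add: Cinf_def)
qed

text \<open>The difference f x - f p is the integral of the derivative of f along the segment from p
  to x. Expanding x - p in coordinates and taking the coordinate differences out of the integral
  leaves smooth coefficients. This factorisation later identifies derivations with directional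
  derivatives.\<close>

lemma Hadamard:
  fixes f :: "real^'n::finite \<Rightarrow> real"
  assumes "Cinf (ball p r) f"
  obtains G where "\<And>i. Cinf (ball p r) (G i)"
    "\<And>x. x \<in> ball p r \<Longrightarrow> f x = f p + (\<Sum>i\<in>UNIV. (x $ i - p $ i) * G i x)"
    "\<And>i. 0 < r \<Longrightarrow> G i p = frechet_derivative f (at p) (axis i 1)"
proof
  let ?D = "\<lambda>x. frechet_derivative f (at x)"
  \<comment> \<open>The factor t ^ 0 only brings the integrand into the shape of
    \<open>Cinf_parametric_integral\<close>.\<close>
  define G where "G i x = integral (cbox 0 1) (\<lambda>t. t ^ 0 * ?D (p + t *\<^sub>R (x - p)) (axis i 1))" for i x
  show "Cinf (ball p r) (G i)" for i
    unfolding G_def by (rule Cinf_parametric_integral[OF Cinf_derivative[OF assms]])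
  show "0 < r \<Longrightarrow> G i p = ?D p (axis i 1)" for i
    by (simp add: G_def)
  show "f x = f p + (\<Sum>i\<in>UNIV. (x $ i - p $ i) * G i x)" if x: "x \<in> ball p r" for x
  proof -
    have mem: "p + t *\<^sub>R (x - p) \<in> ball p r" if "t \<in> {0..1}" for t
    proof -
      have "dist p (p + t *\<^sub>R (x - p)) = t * dist p x"
        using that by (simp add: dist_norm norm_minus_commute)
      also have "\<dots> \<le> 1 * dist p x" using that by (intro mult_right_mono) auto
      finally show ?thesis using x by simp
    qed
    have "((\<lambda>t. f (p + t *\<^sub>R (x - p))) has_vector_derivative ?D (p + t *\<^sub>R (x - p)) (x - p)) (at t within
        {0..1})"
      if "t \<in> {0..1}" for t
    proof -
      have "linear (?D (p + t *\<^sub>R (x - p)))"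
        using Cinf_has_derivative[OF assms mem[OF that]] has_derivative_linear by blast
      moreover have "((\<lambda>t. f (p + t *\<^sub>R (x - p))) has_derivative (\<lambda>s. ?D (p + t *\<^sub>R (x - p)) (s *\<^sub>R (x -
          p)))) (at t)"
        by (rule has_derivative_compose[where f = "\<lambda>t. p + t *\<^sub>R (x - p)", OF _ Cinf_has_derivative[OF
            assms mem[OF that]]])
          (auto intro!: derivative_eq_intros)
      ultimately show ?thesis
        by (auto simp: has_vector_derivative_def linear_scale intro: has_derivative_at_withinI)
    qed
    then have "((\<lambda>t. ?D (p + t *\<^sub>R (x - p)) (x - p)) has_integral f x - f p) {0..1}"
      using fundamental_theorem_of_calculus[of 0 1 "\<lambda>t. f (p + t *\<^sub>R (x - p))"] by simp
    moreover have "?D y (x - p) = (\<Sum>i\<in>UNIV. (x $ i - p $ i) * ?D y (axis i 1))" if "y \<in> ball p r" for y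
    proof -
      have lin: "linear (?D y)"
        using Cinf_has_derivative[OF assms that] has_derivative_linear by blast
      have "?D y (x - p) = ?D y (\<Sum>i\<in>UNIV. (x - p) $ i *\<^sub>R axis i 1)"
        using basis_expansion[of "x - p"] by (simp add: scalar_mult_eq_scaleR)
      then show ?thesis using lin by (simp add: linear_sum linear_scale)
    qed
    ultimately have "((\<lambda>t. \<Sum>i\<in>UNIV. (x $ i - p $ i) * ?D (p + t *\<^sub>R (x - p)) (axis i 1)) has_integral f x
        - f p) {0..1}"
      using mem by (auto elim!: has_integral_eq[rotated])
    then have "f x - f p = integral {0..1} (\<lambda>t. \<Sum>i\<in>UNIV. (x $ i - p $ i) * ?D (p + t *\<^sub>R (x - p)) (axis i 1))"
      by (simp add: integral_unique)
    also have "\<dots> = (\<Sum>i\<in>UNIV. integral {0..1} (\<lambda>t. (x $ i - p $ i) * ?D (p + t *\<^sub>R (x - p)) (axis i 1)))"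
    proof (rule integral_sum)
      fix i
      have "continuous_on {0..1} (\<lambda>t. ?D (p + t *\<^sub>R (x - p)) (axis i 1))"
        by (intro continuous_on_compose2[OF Cinf_imp_continuous_on[OF Cinf_derivative[OF assms]]]
            continuous_intros)
          (use mem in auto)
      then show "(\<lambda>t. (x $ i - p $ i) * ?D (p + t *\<^sub>R (x - p)) (axis i 1)) integrable_on {0..1}"
        by (intro integrable_continuous_real continuous_intros)
    qed simp
    also have "\<dots> = (\<Sum>i\<in>UNIV. (x $ i - p $ i) * G i x)"
      by (simp add: G_def)
    finally show ?thesis by simp
  qed
qed

subsection \<open>Rank one perturbations of matrices\<close>

text \<open>Induction over the set of perturbed rows: the determinant is linear in the row added
  last, so it splits into the previous determinant and a multiple of one in which that row is
  y.\<close>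

lemma det_rank_one_rows:
  fixes x y :: "real^'n::finite"
  shows "det (\<chi> i. axis i 1 + (if i \<in> S then x $ i *s y else 0)) = 1 + (\<Sum>i\<in>S. x $ i * y $ i)"
proof -
  let ?B = "\<lambda>S i. axis i 1 + (if i \<in> S then x $ i *s y else 0) :: real^'n"
  have eq0: "(\<chi> i. axis i 1) = (mat 1 :: real^'n^'n)"
    by (simp add: vec_eq_iff mat_def axis_def)
  \<comment> \<open>Once row k equals y, the multiples of y in the other rows are cleared by row
    operations, and only the coordinate \<open>y $ k\<close> survives.\<close>
  have y: "det (\<chi> i. if i = k then y else ?B S i) = y $ k" if "finite S" "k \<notin> S" for S k
    using that
  proof (induction S rule: finite_induct)
    case empty
    have e: "(\<Sum>i\<in>UNIV. y $ i *s row i (mat 1)) = y"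
      by (simp add: row_def mat_def vec_eq_iff if_distrib cong: if_cong)
    then have d: "det (\<chi> i. if i = k then y else row i (mat 1)) = y $ k"
      using cramer_lemma_transpose[of k y "mat 1"] by (simp only: e det_I mult_1_right)
    have r: "row i (mat 1) = axis i 1" for i :: 'n
      by (simp add: vec_eq_iff row_def mat_def axis_def)
    show ?case using d by (simp add: r cong: if_cong)
  next
    case (insert j S)
    let ?A = "\<chi> i. if i = k then y else ?B S i"
    have jk: "j \<noteq> k" using insert by auto
    have "(\<chi> i. if i = k then y else ?B (insert j S) i) = (\<chi> i. if i = j then row j ?A + x $ j *s row k ?A
        else row i ?A)"
      using insert jk by (auto simp: vec_eq_iff row_def)
    then show ?case using det_row_operation[OF jk, of ?A] insert by simp
  qed
  have "finite S" by simp
  then show ?thesis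
  proof (induction S rule: finite_induct)
    case empty
    then show ?case by (simp add: eq0)
  next
    case (insert k S)
    have "(\<chi> i. ?B (insert k S) i) = (\<chi> i. if i = k then axis k 1 + x $ k *s y else ?B S i)"
      by (auto simp: vec_eq_iff)
    then have "det (\<chi> i. ?B (insert k S) i) = det (\<chi> i. if i = k then axis k 1 else ?B S i) + det (\<chi> i. if
        i = k then x $ k *s y else ?B S i)"
      using det_row_add[of k "\<lambda>i. axis k 1" "\<lambda>i. x $ k *s y" "?B S"] by simp
    also have "(\<chi> i. if i = k then axis k 1 else ?B S i) = (\<chi> i. ?B S i)"
      using insert by (auto simp: vec_eq_iff)
    also have "det (\<chi> i. if i = k then x $ k *s y else ?B S i) = x $ k * y $ k"
      using det_row_mul[of k "x $ k" "\<lambda>i. y" "?B S"] y[of S k] insert by simp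
    finally show ?case using insert by simp
  qed
qed

text \<open>The matrix determinant lemma. Because y = A x, the matrix A can be factored out of the
  perturbed matrix; the other factor is the identity minus c times the outer product of x and
  z.\<close>

lemma det_rank_one_update:
  fixes A :: "real^'n::finite^'n" and x y :: "real^'n"
  assumes "A *v x = y"
  shows "det (\<chi> i j. A $ i $ j - c * (y $ i * z $ j)) = det A * (1 - c * (x \<bullet> z))"
proof -
  let ?C = "\<chi> i. (axis i 1 :: real^'n) + (if i \<in> UNIV then (- c *\<^sub>R x) $ i *s z else 0)"
  have "(\<chi> i j. A $ i $ j - c * (y $ i * z $ j)) = A ** ?C"
  proof -
    have "(A ** ?C) $ i $ j = A $ i $ j - c * (y $ i * z $ j)" for i j
    proof -
      have "(A ** ?C) $ i $ j = (\<Sum>k\<in>UNIV. A $ i $ k * (if k = j then 1 else 0)) + (\<Sum>k\<in>UNIV. - c * z $ j *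
          (A $ i $ k * x $ k))"
        unfolding sum.distrib[symmetric] matrix_matrix_mult_def by (auto simp: axis_def algebra_simps
            intro!: sum.cong)
      also have "\<dots> = A $ i $ j - c * z $ j * (A *v x) $ i"
        by (simp add: matrix_vector_mult_def sum_distrib_left sum_negf if_distrib cong: if_cong)
      finally show ?thesis by (simp add: assms)
    qed
    then show ?thesis by (simp add: vec_eq_iff)
  qed
  then have "det (\<chi> i j. A $ i $ j - c * (y $ i * z $ j)) = det A * (1 + (\<Sum>i\<in>UNIV. (- c *\<^sub>R x) $ i * z $ i))"
    by (simp only: det_mul det_rank_one_rows)
  then show ?thesis by (simp add: inner_vec_def sum_distrib_left sum_negf mult_ac)
qed

subsection \<open>Charts\<close>

lemma is_chartD:
  assumes "is_chart M (U, \<phi>)"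
  shows "openin (mtop M) U" "inj_on \<phi> U" "homeomorphic_map (subtopology (mtop M) U) (top_of_set (\<phi> ` U)) \<phi>"
    "\<exists>T. open T \<and> \<phi> ` U = T \<inter> model M" "U \<subseteq> topspace (mtop M)"
proof -
  show 1: "openin (mtop M) U" and 2: "homeomorphic_map (subtopology (mtop M) U) (top_of_set (\<phi> ` U)) \<phi>"
    using assms by (auto simp: is_chart_def)
  then show sub: "U \<subseteq> topspace (mtop M)" using openin_subset by blast
  then show "inj_on \<phi> U" using homeomorphic_imp_injective_map[OF 2] by (simp add: Int_absorb1)
  show "\<exists>T. open T \<and> \<phi> ` U = T \<inter> model M" using assms by (auto simp: is_chart_def openin_open)
qed

lemma chart_open:
  assumes "is_chart M (U, \<phi>)" "open T"
  shows "openin (mtop M) {y\<in>U. \<phi> y \<in> T}"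
proof -
  have "continuous_map (subtopology (mtop M) U) euclidean \<phi>"
    using homeomorphic_imp_continuous_map[OF is_chartD(3)[OF assms(1)]]
    by (simp add: continuous_map_in_subtopology)
  then have "openin (subtopology (mtop M) U) {y \<in> topspace (subtopology (mtop M) U). \<phi> y \<in> T}"
    using assms(2) by (simp add: continuous_map)
  moreover have "{y \<in> topspace (subtopology (mtop M) U). \<phi> y \<in> T} = {y\<in>U. \<phi> y \<in> T}"
    using is_chartD(5)[OF assms(1)] by auto
  ultimately show ?thesis
    using is_chartD(1)[OF assms(1)] openin_trans_full by metis
qed

lemma chart_nbhd:
  assumes "is_chart M (U, \<phi>)" "openin (mtop M) A" "p \<in> U" "p \<in> A"
  obtains T where "open T" "\<phi> p \<in> T" "\<forall>y\<in>U. \<phi> y \<in> T \<longrightarrow> y \<in> A"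
proof -
  have "openin (subtopology (mtop M) U) (U \<inter> A)"
    using assms(2) by (auto simp: openin_subtopology)
  then have "openin (top_of_set (\<phi> ` U)) (\<phi> ` (U \<inter> A))"
    using homeomorphic_imp_open_map[OF is_chartD(3)[OF assms(1)]] open_map_def by blast
  then obtain T where T: "open T" "\<phi> ` (U \<inter> A) = \<phi> ` U \<inter> T" by (auto simp: openin_open)
  show ?thesis
  proof (rule that[OF T(1)])
    show "\<phi> p \<in> T" using T(2) assms by auto
    show "\<forall>y\<in>U. \<phi> y \<in> T \<longrightarrow> y \<in> A"
    proof (intro ballI impI)
      fix y assume "y \<in> U" "\<phi> y \<in> T"
      then have "\<phi> y \<in> \<phi> ` (U \<inter> A)" using T(2) by auto
      then show "y \<in> A" using is_chartD(2)[OF assms(1)] \<open>y \<in> U\<close> by (auto dest: inj_onD)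
    qed
  qed
qed

lemma smooth_onD:
  assumes "smooth_on S f" "x \<in> S"
  obtains T F where "open T" "x \<in> T" "Cinf T F" "\<forall>y\<in>T. y \<in> S \<longrightarrow> F y = f y"
  using bspec[OF assms(1)[unfolded smooth_on_def Cinf_def[symmetric]] assms(2)] by (elim exE conjE) simp

lemma smooth_onI:
  assumes "\<And>x. x \<in> S \<Longrightarrow> \<exists>T F. open T \<and> x \<in> T \<and> Cinf T F \<and> (\<forall>y\<in>T \<inter> S. F y = f y)"
  shows "smooth_on S f"
  unfolding smooth_on_def Cinf_def[symmetric] by (intro ballI assms)

text \<open>Restating compatibility at points of the manifold removes \<open>inv_into\<close> from
  the later arguments about transition maps.\<close>

lemma compatible_iff:
  assumes "inj_on \<phi> U" "inj_on \<psi> V"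
  shows "compatible (U, \<phi>) (V, \<psi>) \<longleftrightarrow> (\<forall>p\<in>U \<inter> V.
      (\<exists>T F. open T \<and> \<phi> p \<in> T \<and> Cinf T F \<and> (\<forall>y\<in>U \<inter> V. \<phi> y \<in> T \<longrightarrow> F (\<phi> y) = \<psi> y)) \<and>
      (\<exists>T F. open T \<and> \<psi> p \<in> T \<and> Cinf T F \<and> (\<forall>y\<in>U \<inter> V. \<psi> y \<in> T \<longrightarrow> F (\<psi> y) = \<phi> y)))"
proof -
  have *: "smooth_on (\<phi> ` (U \<inter> V)) (\<psi> \<circ> inv_into U \<phi>) \<longleftrightarrow> (\<forall>p\<in>U \<inter> V.
      (\<exists>T F. open T \<and> \<phi> p \<in> T \<and> Cinf T F \<and> (\<forall>y\<in>U \<inter> V. \<phi> y \<in> T \<longrightarrow> F (\<phi> y) = \<psi> y)))"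
    if "inj_on \<phi> U" for \<phi> \<psi> :: "'a \<Rightarrow> real^'n" and U V
  proof -
    have inv: "\<And>y. y \<in> U \<Longrightarrow> inv_into U \<phi> (\<phi> y) = y" using that by simp
    then have "(\<forall>z\<in>T \<inter> \<phi> ` (U \<inter> V). F z = (\<psi> \<circ> inv_into U \<phi>) z) \<longleftrightarrow> (\<forall>y\<in>U \<inter> V. \<phi> y \<in> T \<longrightarrow> F (\<phi> y) = \<psi> y)"
      for T F by auto
    then show ?thesis unfolding smooth_on_def Cinf_def[symmetric] by (simp add: ball_simps(9))
  qed
  show ?thesis unfolding compatible_def using *[OF assms(1), of V \<psi>] *[OF assms(2), of U \<phi>]
    by (auto simp: Int_commute)
qed

lemma max_atlas_chart: "c \<in> max_atlas M \<Longrightarrow> is_chart M c"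
  by (simp add: max_atlas_def)

lemma atlas_subset_max_atlas: "smooth_manifold M \<Longrightarrow> c \<in> atlas M \<Longrightarrow> c \<in> max_atlas M"
  by (auto simp: smooth_manifold_def max_atlas_def)

lemma atlas_cover:
  assumes "smooth_manifold M" "p \<in> topspace (mtop M)"
  obtains U \<phi> where "(U, \<phi>) \<in> atlas M" "p \<in> U"
proof -
  have "p \<in> \<Union> (fst ` atlas M)" using assms by (simp add: smooth_manifold_def)
  then show ?thesis using that by auto
qed

lemma compatible_transition:
  assumes "is_chart M (U, \<phi>)" "is_chart M (V, \<psi>)" "compatible (U, \<phi>) (V, \<psi>)" "p \<in> U" "p \<in> V"
  obtains T F where "open T" "\<phi> p \<in> T" "Cinf T F" "\<forall>y\<in>U. \<phi> y \<in> T \<longrightarrow> y \<in> V \<and> F (\<phi> y) = \<psi> y"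
proof -
  obtain T F where T: "open T" "\<phi> p \<in> T" "Cinf T F" "\<forall>y\<in>U \<inter> V. \<phi> y \<in> T \<longrightarrow> F (\<phi> y) = \<psi> y"
    using assms compatible_iff[OF is_chartD(2)[OF assms(1)] is_chartD(2)[OF assms(2)]] by blast
  obtain T' where T': "open T'" "\<phi> p \<in> T'" "\<forall>y\<in>U. \<phi> y \<in> T' \<longrightarrow> y \<in> V"
    by (rule chart_nbhd[OF assms(1) is_chartD(1)[OF assms(2)] assms(4,5)])
  show ?thesis
    by (rule that[of "T \<inter> T'" F]) (use T T' in \<open>auto intro: Cinf_subset\<close>)
qed

lemma compatible_sym: "compatible c c' \<longleftrightarrow> compatible c' c"
  by (cases c; cases c') (auto simp: compatible_def Int_commute)

lemma Cinf_compose_Int: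
  fixes f :: "'a::real_normed_vector \<Rightarrow> 'b::euclidean_space" and g :: "'b \<Rightarrow> 'c::real_normed_vector"
  assumes "open S" "open T" "Cinf S f" "Cinf T g"
  shows "open (S \<inter> f -` T)" "Cinf (S \<inter> f -` T) (\<lambda>x. g (f x))"
proof -
  show *: "open (S \<inter> f -` T)"
    using continuous_open_preimage[OF Cinf_imp_continuous_on[OF assms(3)] assms(1,2)] by blast
  show "Cinf (S \<inter> f -` T) (\<lambda>x. g (f x))"
    by (rule Cinf_compose[OF * assms(2) _ Cinf_subset[OF assms(3)] assms(4)]) auto
qed

text \<open>Charts of the maximal atlas are by definition compatible with atlas charts only; the
  transition between two of them is smooth near p because it factors through an atlas chart around
  p.\<close>

lemma max_atlas_transition:
  assumes "smooth_manifold M" "(U, \<phi>) \<in> max_atlas M" "(V, \<psi>) \<in> max_atlas M" "p \<in> U" "p \<in> V"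
  obtains T F where "open T" "\<phi> p \<in> T" "Cinf T F" "\<forall>y\<in>U. \<phi> y \<in> T \<longrightarrow> y \<in> V \<and> F (\<phi> y) = \<psi> y"
proof -
  have c: "is_chart M (U, \<phi>)" "is_chart M (V, \<psi>)" using assms max_atlas_chart by auto
  then have "p \<in> topspace (mtop M)" using is_chartD(5) assms(4) by blast
  then obtain X \<xi> where X: "(X, \<xi>) \<in> atlas M" "p \<in> X" using atlas_cover[OF assms(1)] by blast
  then have cX: "is_chart M (X, \<xi>)" using assms(1) by (auto simp: smooth_manifold_def)
  have "compatible (U, \<phi>) (X, \<xi>)" "compatible (X, \<xi>) (V, \<psi>)"
    using assms(2,3) X(1) by (auto simp: max_atlas_def compatible_sym)
  obtain T1 F1 where
    1: "open T1" "\<phi> p \<in> T1" "Cinf T1 F1" "\<forall>y\<in>U. \<phi> y \<in> T1 \<longrightarrow> y \<in> X \<and> F1 (\<phi> y) = \<xi> y"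
    using compatible_transition[OF c(1) cX \<open>compatible (U, \<phi>) (X, \<xi>)\<close> assms(4) X(2)] .
  obtain T2 F2 where
    2: "open T2" "\<xi> p \<in> T2" "Cinf T2 F2" "\<forall>y\<in>X. \<xi> y \<in> T2 \<longrightarrow> y \<in> V \<and> F2 (\<xi> y) = \<psi> y"
    by (rule compatible_transition[OF cX c(2) \<open>compatible (X, \<xi>) (V, \<psi>)\<close> X(2) assms(5)])
  show ?thesis
  proof (rule that[OF Cinf_compose_Int(1)[OF 1(1) 2(1) 1(3) 2(3)] _ Cinf_compose_Int(2)[OF 1(1) 2(1) 1(3)
      2(3)]])
    show "\<phi> p \<in> T1 \<inter> F1 -` T2" using 1 2 assms(4) by auto
    show "\<forall>y\<in>U. \<phi> y \<in> T1 \<inter> F1 -` T2 \<longrightarrow> y \<in> V \<and> F2 (F1 (\<phi> y)) = \<psi> y"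
      using 1(4) 2(4) by auto
  qed
qed

subsection \<open>Smooth functions near a point\<close>

text \<open>The set \<open>S\<close> is where the local extension has to agree with
  \<open>h\<close>. Taking all of the space gives ordinary smoothness at p, taking a subset gives
  smoothness on a submanifold, with no change of manifold.\<close>

definition smooth_near ::
    "('a, 'n::finite) manifold \<Rightarrow> 'a set \<Rightarrow> ('a \<Rightarrow> 'b::real_normed_vector) \<Rightarrow> 'a \<Rightarrow> bool" where
  "smooth_near M S h p \<longleftrightarrow> (\<forall>(U, \<phi>)\<in>max_atlas M. p \<in> U \<longrightarrow>
     (\<exists>T F. open T \<and> \<phi> p \<in> T \<and> Cinf T F \<and> (\<forall>y\<in>U \<inter> S. \<phi> y \<in> T \<longrightarrow> F (\<phi> y) = h y)))"

lemma smooth_nearD: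
  assumes "smooth_near M S h p" "(U, \<phi>) \<in> max_atlas M" "p \<in> U"
  obtains T F where "open T" "\<phi> p \<in> T" "Cinf T F" "\<forall>y\<in>U. y \<in> S \<longrightarrow> \<phi> y \<in> T \<longrightarrow> F (\<phi> y) = h y"
proof -
  have "\<exists>T F. open T \<and> \<phi> p \<in> T \<and> Cinf T F \<and> (\<forall>y\<in>U \<inter> S. \<phi> y \<in> T \<longrightarrow> F (\<phi> y) = h y)"
    using bspec[OF assms(1)[unfolded smooth_near_def] assms(2)] assms(3) by simp
  then show ?thesis using that by (elim exE conjE) simp
qed

text \<open>One chart around p suffices: the extension is carried to any other chart by composing it
  with a transition map.\<close>

lemma smooth_nearI:
  assumes "smooth_manifold M" "(U, \<phi>) \<in> max_atlas M" "p \<in> U" "open T" "\<phi> p \<in> T" "Cinf T F"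
    "\<And>y. y \<in> U \<Longrightarrow> y \<in> S \<Longrightarrow> \<phi> y \<in> T \<Longrightarrow> F (\<phi> y) = h y"
  shows "smooth_near M S h p"
  unfolding smooth_near_def
proof safe
  fix V \<psi> assume V: "(V, \<psi>) \<in> max_atlas M" "p \<in> V"
  obtain T' G where T': "open T'" "\<psi> p \<in> T'" "Cinf T' G" "\<forall>y\<in>V. \<psi> y \<in> T' \<longrightarrow> y \<in> U \<and> G (\<psi> y) = \<phi> y"
    by (rule max_atlas_transition[OF assms(1) V(1) assms(2) V(2) assms(3)])
  show "\<exists>T F. open T \<and> \<psi> p \<in> T \<and> Cinf T F \<and> (\<forall>y\<in>V \<inter> S. \<psi> y \<in> T \<longrightarrow> F (\<psi> y) = h y)"
  proof (intro exI conjI ballI impI)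
    show "open (T' \<inter> G -` T)" "Cinf (T' \<inter> G -` T) (\<lambda>x. F (G x))"
      using Cinf_compose_Int[OF T'(1) assms(4) T'(3) assms(6)] by auto
    show "\<psi> p \<in> T' \<inter> G -` T" using T' V assms by auto
    show "F (G (\<psi> y)) = h y" if "y \<in> V \<inter> S" "\<psi> y \<in> T' \<inter> G -` T" for y
      using T'(4)[rule_format, of y] assms(7)[of y] that by auto
  qed
qed

lemma max_atlas_cover:
  assumes "smooth_manifold M" "p \<in> topspace (mtop M)"
  obtains U \<phi> where "(U, \<phi>) \<in> max_atlas M" "p \<in> U"
  using atlas_cover[OF assms] atlas_subset_max_atlas[OF assms(1)] by metis

lemma smooth_near_cong:
  assumes "smooth_near M S h p" "openin (mtop M) A" "p \<in> A" "\<And>y. y \<in> A \<Longrightarrow> y \<in> S' \<Longrightarrow> y \<in> S \<and> h y = k y"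
  shows "smooth_near M S' k p"
  unfolding smooth_near_def
proof safe
  fix U \<phi> assume U: "(U, \<phi>) \<in> max_atlas M" "p \<in> U"
  obtain T F where T: "open T" "\<phi> p \<in> T" "Cinf T F" "\<forall>y\<in>U. y \<in> S \<longrightarrow> \<phi> y \<in> T \<longrightarrow> F (\<phi> y) = h y"
    by (rule smooth_nearD[OF assms(1) U])
  obtain T' where T': "open T'" "\<phi> p \<in> T'" "\<forall>y\<in>U. \<phi> y \<in> T' \<longrightarrow> y \<in> A"
    by (rule chart_nbhd[OF max_atlas_chart[OF U(1)] assms(2) U(2) assms(3)])
  show "\<exists>T F. open T \<and> \<phi> p \<in> T \<and> Cinf T F \<and> (\<forall>y\<in>U \<inter> S'. \<phi> y \<in> T \<longrightarrow> F (\<phi> y) = k y)"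
    by (rule exI[of _ "T \<inter> T'"], rule exI[of _ F]) (use T T' assms(4) in \<open>auto intro: Cinf_subset\<close>)
qed

lemma smooth_near_mono:
  assumes "smooth_near M T h p" "S \<subseteq> T"
  shows "smooth_near M S h p"
  unfolding smooth_near_def
proof safe
  fix U \<phi> assume U: "(U, \<phi>) \<in> max_atlas M" "p \<in> U"
  obtain T' F where "open T'" "\<phi> p \<in> T'" "Cinf T' F" "\<forall>y\<in>U. y \<in> T \<longrightarrow> \<phi> y \<in> T' \<longrightarrow> F (\<phi> y) = h y"
    by (rule smooth_nearD[OF assms(1) U])
  then show "\<exists>T F. open T \<and> \<phi> p \<in> T \<and> Cinf T F \<and> (\<forall>y\<in>U \<inter> S. \<phi> y \<in> T \<longrightarrow> F (\<phi> y) = h y)"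
    using assms(2) by (intro exI[of _ T'] exI[of _ F]) auto
qed

lemma smooth_near_compose:
  fixes h :: "'a \<Rightarrow> 'b::euclidean_space"
  assumes "smooth_near M S h p" "p \<in> S" "open T" "h p \<in> T" "Cinf T G"
  shows "smooth_near M S (\<lambda>y. G (h y)) p"
  unfolding smooth_near_def
proof safe
  fix U \<phi> assume U: "(U, \<phi>) \<in> max_atlas M" "p \<in> U"
  obtain O' F where O': "open O'" "\<phi> p \<in> O'" "Cinf O' F" "\<forall>y\<in>U. y \<in> S \<longrightarrow> \<phi> y \<in> O' \<longrightarrow> F (\<phi> y) = h y"
    by (rule smooth_nearD[OF assms(1) U])
  show "\<exists>T F. open T \<and> \<phi> p \<in> T \<and> Cinf T F \<and> (\<forall>y\<in>U \<inter> S. \<phi> y \<in> T \<longrightarrow> F (\<phi> y) = G (h y))"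
  proof (intro exI conjI)
    show "open (O' \<inter> F -` T)" "Cinf (O' \<inter> F -` T) (\<lambda>x. G (F x))"
      using Cinf_compose_Int[OF O'(1) assms(3) O'(3) assms(5)] by auto
  qed (use O' assms U in auto)
qed

lemma smooth_near_const: "smooth_near (M :: ('a, 'b::finite) manifold) S (\<lambda>y. c) p"
  unfolding smooth_near_def
proof safe
  fix U and \<phi> :: "'a \<Rightarrow> real^'b"
  show "\<exists>T F. open T \<and> \<phi> p \<in> T \<and> Cinf T F \<and> (\<forall>y\<in>U \<inter> S. \<phi> y \<in> T \<longrightarrow> F (\<phi> y) = c)"
    by (intro exI[of _ UNIV] exI[of _ "\<lambda>_. c"]) (simp add: Cinf_const)
qed

lemma smooth_near_binary:
  fixes h :: "'a \<Rightarrow> 'b::real_normed_vector" and k :: "'a \<Rightarrow> 'c::real_normed_vector"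
  assumes "smooth_near M S h p" "smooth_near M S k p"
    and "\<And>T F G. open T \<Longrightarrow> Cinf T F \<Longrightarrow> Cinf T G \<Longrightarrow> Cinf T (\<lambda>x :: real^'n::finite. B (F x) (G x))"
  shows "smooth_near (M :: ('a, 'n) manifold) S (\<lambda>y. B (h y) (k y) :: 'd::real_normed_vector) p"
  unfolding smooth_near_def
proof safe
  fix U \<phi> assume U: "(U, \<phi>) \<in> max_atlas M" "p \<in> U"
  obtain T1 F1 where
    1: "open T1" "\<phi> p \<in> T1" "Cinf T1 F1" "\<forall>y\<in>U. y \<in> S \<longrightarrow> \<phi> y \<in> T1 \<longrightarrow> F1 (\<phi> y) = h y"
    by (rule smooth_nearD[OF assms(1) U])
  obtain T2 F2 where
    2: "open T2" "\<phi> p \<in> T2" "Cinf T2 F2" "\<forall>y\<in>U. y \<in> S \<longrightarrow> \<phi> y \<in> T2 \<longrightarrow> F2 (\<phi> y) = k y"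
    by (rule smooth_nearD[OF assms(2) U])
  have "Cinf (T1 \<inter> T2) (\<lambda>x. B (F1 x) (F2 x))"
    by (rule assms(3)) (use 1 2 in \<open>auto intro: Cinf_subset\<close>)
  then show "\<exists>T F. open T \<and> \<phi> p \<in> T \<and> Cinf T F \<and> (\<forall>y\<in>U \<inter> S. \<phi> y \<in> T \<longrightarrow> F (\<phi> y) = B (h y) (k y))"
    using 1 2 by (intro exI[of _ "T1 \<inter> T2"] exI[of _ "\<lambda>x. B (F1 x) (F2 x)"]) auto
qed

lemma smooth_near_add: "smooth_near M S h p \<Longrightarrow> smooth_near M S k p \<Longrightarrow> smooth_near M S (\<lambda>y. h y + k y) p"
  by (rule smooth_near_binary[where B = "(+)"]) (auto intro: Cinf_add)

lemma smooth_near_diff: "smooth_near M S h p \<Longrightarrow> smooth_near M S k p \<Longrightarrow> smooth_near M S (\<lambda>y. h y - k y) p"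
  by (rule smooth_near_binary[where B = "(-)"]) (auto intro: Cinf_diff)

lemma smooth_near_mult:
  fixes h k :: "'a \<Rightarrow> real"
  shows "smooth_near M S h p \<Longrightarrow> smooth_near M S k p \<Longrightarrow> smooth_near M S (\<lambda>y. h y * k y) p"
  by (rule smooth_near_binary[where B = "(*)"]) (auto intro: Cinf_mult)

lemma smooth_near_scaleR:
  "smooth_near M S h p \<Longrightarrow> smooth_near M S k p \<Longrightarrow> smooth_near M S (\<lambda>y. h y *\<^sub>R k y) p"
  by (rule smooth_near_binary[where B = "(*\<^sub>R)"]) (auto intro: Cinf_scaleR)

lemma smooth_near_sum:
  "(\<And>i. i \<in> I \<Longrightarrow> smooth_near M S (h i) p) \<Longrightarrow> smooth_near M S (\<lambda>y. \<Sum>i\<in>I. h i y) p"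
  by (induction I rule: infinite_finite_induct) (auto intro: smooth_near_const smooth_near_add)

lemma smooth_near_prod:
  fixes h :: "'i \<Rightarrow> 'a \<Rightarrow> real"
  shows "(\<And>i. i \<in> I \<Longrightarrow> smooth_near M S (h i) p) \<Longrightarrow> smooth_near M S (\<lambda>y. \<Prod>i\<in>I. h i y) p"
  by (induction I rule: infinite_finite_induct) (auto intro: smooth_near_const smooth_near_mult)

lemma smooth_near_compose_UNIV:
  fixes h :: "'a \<Rightarrow> 'b::euclidean_space"
  shows "smooth_near M S h p \<Longrightarrow> p \<in> S \<Longrightarrow> Cinf UNIV G \<Longrightarrow> smooth_near M S (\<lambda>y. G (h y)) p"
  by (rule smooth_near_compose[of _ _ _ _ UNIV]) auto

lemma smooth_near_linear:
  fixes h :: "'a \<Rightarrow> 'b::euclidean_space"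
  shows "smooth_near M S h p \<Longrightarrow> p \<in> S \<Longrightarrow> bounded_linear L \<Longrightarrow> smooth_near M S (\<lambda>y. L (h y)) p"
  by (rule smooth_near_compose_UNIV) (auto intro: Cinf_bounded_linear)

lemma smooth_near_divide:
  fixes h k :: "'a \<Rightarrow> real"
  assumes "smooth_near M S h p" "smooth_near M S k p" "p \<in> S" "k p \<noteq> 0"
  shows "smooth_near M S (\<lambda>y. h y / k y) p"
proof -
  have "smooth_near M S (\<lambda>y. inverse (k y)) p"
    by (rule smooth_near_compose[OF assms(2,3), of "{x. x \<noteq> 0}"])
      (use assms in \<open>auto simp: open_Collect_neq Cinf_def Ck_on_inverse\<close>)
  then show ?thesis unfolding divide_inverse using assms(1) by (intro smooth_near_mult)
qed

text \<open>The extension that witnesses smoothness at p also serves as a witness at all nearby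
  points.\<close>

lemma smooth_near_eventually:
  assumes "smooth_manifold M" "smooth_near M S h p" "p \<in> topspace (mtop M)"
  obtains A where "openin (mtop M) A" "p \<in> A" "\<forall>q\<in>A. smooth_near M S h q"
proof -
  obtain U \<phi> where U: "(U, \<phi>) \<in> max_atlas M" "p \<in> U" using max_atlas_cover[OF assms(1,3)] by blast
  obtain T F where T: "open T" "\<phi> p \<in> T" "Cinf T F" "\<forall>y\<in>U. y \<in> S \<longrightarrow> \<phi> y \<in> T \<longrightarrow> F (\<phi> y) = h y"
    by (rule smooth_nearD[OF assms(2) U])
  show ?thesis
    by (rule that[of "{y\<in>U. \<phi> y \<in> T}"])
      (use U T chart_open[OF max_atlas_chart[OF U(1)] T(1)] in \<open>auto intro: smooth_nearI[OF assms(1) U(1)]\<close>)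
qed

lemma smooth_near_continuous:
  assumes "smooth_manifold M" "smooth_near M S h p" "p \<in> topspace (mtop M)" "p \<in> S" "open B" "h p \<in> B"
  obtains A where "openin (mtop M) A" "p \<in> A" "\<forall>y\<in>A. y \<in> S \<longrightarrow> h y \<in> B"
proof -
  obtain U \<phi> where U: "(U, \<phi>) \<in> max_atlas M" "p \<in> U" using max_atlas_cover[OF assms(1,3)] by blast
  obtain T F where T: "open T" "\<phi> p \<in> T" "Cinf T F" "\<forall>y\<in>U. y \<in> S \<longrightarrow> \<phi> y \<in> T \<longrightarrow> F (\<phi> y) = h y"
    by (rule smooth_nearD[OF assms(2) U])
  have "open (T \<inter> F -` B)"
    using continuous_open_preimage[OF Cinf_imp_continuous_on[OF T(3)] T(1) assms(5)] by blast
  from chart_open[OF max_atlas_chart[OF U(1)] this] show ?thesis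
    by (rule that) (use U T assms in auto)
qed

lemma smooth_near_chart:
  assumes "smooth_manifold M" "(U, \<phi>) \<in> max_atlas M" "p \<in> U"
  shows "smooth_near M S \<phi> p"
  by (rule smooth_nearI[OF assms(1,2,3) open_UNIV _ Cinf_ident]) auto

lemma smooth_fun_iff:
  assumes "smooth_manifold M"
  shows "smooth_fun M h \<longleftrightarrow> (\<forall>p\<in>topspace (mtop M). smooth_near M (topspace (mtop M)) h p)"
proof
  assume h: "smooth_fun M h"
  show "\<forall>p\<in>topspace (mtop M). smooth_near M (topspace (mtop M)) h p"
  proof
    fix p assume "p \<in> topspace (mtop M)"
    then obtain U \<phi> where U: "(U, \<phi>) \<in> atlas M" "p \<in> U" using atlas_cover[OF assms] by blast
    have m: "(U, \<phi>) \<in> max_atlas M" using atlas_subset_max_atlas[OF assms U(1)] .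
    have "smooth_on (\<phi> ` U) (h \<circ> inv_into U \<phi>)" using h U(1) by (auto simp: smooth_fun_def)
    then obtain T F where "open T" "\<phi> p \<in> T" "Cinf T F" "\<forall>y\<in>T. y \<in> \<phi> ` U \<longrightarrow> F y = (h \<circ> inv_into U \<phi>) y"
      using smooth_onD[of _ _ "\<phi> p"] U(2) by (metis imageI)
    then show "smooth_near M (topspace (mtop M)) h p"
      using is_chartD(2)[OF max_atlas_chart[OF m]] by (intro smooth_nearI[OF assms m U(2), of T F]) auto
  qed
next
  assume h: "\<forall>p\<in>topspace (mtop M). smooth_near M (topspace (mtop M)) h p"
  show "smooth_fun M h"
    unfolding smooth_fun_def
  proof (clarify, rule smooth_onI)
    fix U \<phi> x assume U: "(U, \<phi>) \<in> atlas M" and "x \<in> \<phi> ` U"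
    then obtain p where p: "p \<in> U" "x = \<phi> p" by auto
    have m: "(U, \<phi>) \<in> max_atlas M" using atlas_subset_max_atlas[OF assms U(1)] .
    have sub: "U \<subseteq> topspace (mtop M)" using is_chartD(5)[OF max_atlas_chart[OF m]] .
    have "smooth_near M (topspace (mtop M)) h p" using h sub p(1) by blast
    from smooth_nearD[OF this m p(1)] obtain T F where "open T" "\<phi> p \<in> T" "Cinf T F"
      "\<forall>y\<in>U. y \<in> topspace (mtop M) \<longrightarrow> \<phi> y \<in> T \<longrightarrow> F (\<phi> y) = h y" .
    then show "\<exists>T F. open T \<and> x \<in> T \<and> Cinf T F \<and> (\<forall>y\<in>T \<inter> \<phi> ` U. F y = (h \<circ> inv_into U \<phi>) y)"
      using sub is_chartD(2)[OF max_atlas_chart[OF m]] p by (intro exI[of _ T] exI[of _ F]) auto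
  qed
qed

text \<open>The membership of \<open>F p\<close> in the target space keeps the condition on charts
  from being vacuous. Together with smoothness of the coordinate expressions, each chart must
  receive all points of \<open>S\<close> near p, which is continuity relative to
  \<open>S\<close>.\<close>

definition map_near :: "('a, 'n::finite) manifold \<Rightarrow> 'a set \<Rightarrow> ('b, 'm::finite) manifold \<Rightarrow> ('a \<Rightarrow> 'b) \<Rightarrow> 'a \<Rightarrow>
    bool" where
  "map_near M S N F p \<longleftrightarrow> F p \<in> topspace (mtop N) \<and> (\<forall>(V, \<psi>)\<in>max_atlas N. F p \<in> V \<longrightarrow>
     (\<exists>A. openin (mtop M) A \<and> p \<in> A \<and> (\<forall>y\<in>A \<inter> S. F y \<in> V)) \<and> smooth_near M S (\<lambda>y. \<psi> (F y)) p)"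

lemma map_nearI:
  assumes "smooth_manifold N" "p \<in> S" "(V, \<psi>) \<in> max_atlas N" "F p \<in> V"
    "openin (mtop M) A" "p \<in> A" "\<And>y. y \<in> A \<Longrightarrow> y \<in> S \<Longrightarrow> F y \<in> V"
    "smooth_manifold M" "smooth_near M S (\<lambda>y. \<psi> (F y)) p"
  shows "map_near M S N F p"
  unfolding map_near_def
proof (safe)
  show "F p \<in> topspace (mtop N)" using is_chartD(5)[OF max_atlas_chart[OF assms(3)]] assms(4) by blast
  fix V' \<psi>' assume V': "(V', \<psi>') \<in> max_atlas N" "F p \<in> V'"
  obtain T G where T: "open T" "\<psi> (F p) \<in> T" "Cinf T G" "\<forall>y\<in>V. \<psi> y \<in> T \<longrightarrow> y \<in> V' \<and> G (\<psi> y) = \<psi>' y"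
    by (rule max_atlas_transition[OF assms(1,3) V'(1) assms(4) V'(2)])
  have pM: "p \<in> topspace (mtop M)" using assms(5,6) openin_subset by blast
  obtain A' where A': "openin (mtop M) A'" "p \<in> A'" "\<forall>y\<in>A'. y \<in> S \<longrightarrow> \<psi> (F y) \<in> T"
    by (rule smooth_near_continuous[OF assms(8,9) pM assms(2) T(1,2)])
  show "\<exists>A. openin (mtop M) A \<and> p \<in> A \<and> (\<forall>y\<in>A \<inter> S. F y \<in> V')"
    by (rule exI[of _ "A \<inter> A'"]) (use A' T(4) assms in auto)
  show "smooth_near M S (\<lambda>y. \<psi>' (F y)) p"
    by (rule smooth_near_cong[OF smooth_near_compose[OF assms(9,2) T(1,2,3)], of "A \<inter> A'"])
      (use A' T(4) assms in auto)
qed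

lemma map_near_compose:
  assumes "smooth_manifold M" "smooth_manifold N" "map_near M S N F p" "p \<in> S"
    "smooth_near N T k (F p)" "F p \<in> T" "openin (mtop M) A" "p \<in> A" "\<And>y. y \<in> A \<Longrightarrow> y \<in> S \<Longrightarrow> F y \<in> T"
  shows "smooth_near M S (\<lambda>y. k (F y)) p"
proof -
  have "F p \<in> topspace (mtop N)" using assms(3) by (simp add: map_near_def)
  then obtain V \<psi> where V: "(V, \<psi>) \<in> max_atlas N" "F p \<in> V" using max_atlas_cover[OF assms(2)] by blast
  obtain O' K where K: "open O'" "\<psi> (F p) \<in> O'" "Cinf O' K" "\<forall>y\<in>V. y \<in> T \<longrightarrow> \<psi> y \<in> O' \<longrightarrow> K (\<psi> y) = k y"
    by (rule smooth_nearD[OF assms(5) V])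
  obtain A' where A': "openin (mtop M) A'" "p \<in> A'" "\<forall>y\<in>A' \<inter> S. F y \<in> V" and s: "smooth_near M S (\<lambda>y. \<psi> (F
      y)) p"
    using assms(3) V unfolding map_near_def by blast
  have pM: "p \<in> topspace (mtop M)" using assms(7,8) openin_subset by blast
  obtain A'' where A'': "openin (mtop M) A''" "p \<in> A''" "\<forall>y\<in>A''. y \<in> S \<longrightarrow> \<psi> (F y) \<in> O'"
    by (rule smooth_near_continuous[OF assms(1) s pM assms(4) K(1,2)])
  show ?thesis
    by (rule smooth_near_cong[OF smooth_near_compose[OF s assms(4) K(1,2,3)], of "A \<inter> A' \<inter> A''"])
      (use A' A'' K(4) assms in auto)
qed

lemma map_near_continuous:
  assumes "smooth_manifold M" "smooth_manifold N" "map_near M S N F p" "p \<in> topspace (mtop M)" "p \<in> S"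
      "openin (mtop N) B" "F p \<in> B"
  obtains A where "openin (mtop M) A" "p \<in> A" "\<forall>y\<in>A. y \<in> S \<longrightarrow> F y \<in> B"
proof -
  have "F p \<in> topspace (mtop N)" using assms(3) by (simp add: map_near_def)
  then obtain V \<psi> where V: "(V, \<psi>) \<in> max_atlas N" "F p \<in> V" using max_atlas_cover[OF assms(2)] by blast
  obtain A' where A': "openin (mtop M) A'" "p \<in> A'" "\<forall>y\<in>A' \<inter> S. F y \<in> V" and s: "smooth_near M S (\<lambda>y. \<psi> (F
      y)) p"
    using assms(3) V unfolding map_near_def by blast
  obtain T where T: "open T" "\<psi> (F p) \<in> T" "\<forall>y\<in>V. \<psi> y \<in> T \<longrightarrow> y \<in> B"
    by (rule chart_nbhd[OF max_atlas_chart[OF V(1)] assms(6) V(2) assms(7)])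
  obtain A'' where A'': "openin (mtop M) A''" "p \<in> A''" "\<forall>y\<in>A''. y \<in> S \<longrightarrow> \<psi> (F y) \<in> T"
    by (rule smooth_near_continuous[OF assms(1) s assms(4,5) T(1,2)])
  show ?thesis by (rule that[of "A' \<inter> A''"]) (use A' A'' T in auto)
qed

subsection \<open>Bump functions on manifolds\<close>

text \<open>The support is the chart preimage of a closed ball. Its image is the intersection of
  that ball with the closed model set, hence compact; compact sets are closed in a Hausdorff space,
  so extension by zero is smooth. The argument is the same at interior and at boundary
  points.\<close>

lemma manifold_bump:
  fixes M :: "('a, 'n::finite) manifold"
  assumes "smooth_manifold M" "closed (model M)" "openin (mtop M) A" "p \<in> A"
  obtains lam K A' where "smooth_fun M lam" "\<forall>y. 0 \<le> lam y" "\<forall>y. lam y \<le> 1"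
    "openin (mtop M) A'" "p \<in> A'" "\<forall>y\<in>A'. lam y = 1" "A' \<subseteq> K"
    "closedin (mtop M) K" "K \<subseteq> A" "\<forall>y. y \<notin> K \<longrightarrow> lam y = 0"
proof -
  have "p \<in> topspace (mtop M)" using assms openin_subset by blast
  then obtain U \<phi> where U: "(U, \<phi>) \<in> max_atlas M" "p \<in> U" using max_atlas_cover[OF assms(1)] by blast
  note c = max_atlas_chart[OF U(1)]
  obtain T1 where T1: "open T1" "\<phi> p \<in> T1" "\<forall>y\<in>U. \<phi> y \<in> T1 \<longrightarrow> y \<in> A"
    by (rule chart_nbhd[OF c assms(3) U(2) assms(4)])
  obtain T2 where T2: "open T2" "\<phi> ` U = T2 \<inter> model M" using is_chartD(4)[OF c] by blast
  have "\<phi> p \<in> T1 \<inter> T2" using T1 T2 U(2) by auto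
  then obtain r where r: "0 < r" "cball (\<phi> p) r \<subseteq> T1 \<inter> T2"
    using open_contains_cball_eq[OF open_Int[OF T1(1) T2(1)]] by blast
  obtain \<beta> :: "real^'n \<Rightarrow> real" and s where b: "Cinf UNIV \<beta>" "0 < s" "s < r" "\<forall>x. 0 \<le> \<beta> x" "\<forall>x. \<beta> x \<le> 1"
    "\<forall>x. dist (\<phi> p) x < s \<longrightarrow> \<beta> x = 1" "\<forall>x. r \<le> dist (\<phi> p) x \<longrightarrow> \<beta> x = 0"
    by (rule bump_exists[OF r(1), of "\<phi> p"])
  define K where "K = {y\<in>U. \<phi> y \<in> cball (\<phi> p) r}"
  define lam where "lam y = (if y \<in> U then \<beta> (\<phi> y) else 0)" for y
  have "\<phi> ` K = cball (\<phi> p) r \<inter> model M"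
    using T2(2) r(2) unfolding K_def by (auto simp: image_iff) (metis Int_iff T2(2) imageE mem_cball subsetD)
  then have "compact (\<phi> ` K)" using assms(2) by (simp add: compact_Int_closed)
  moreover have "\<phi> ` K \<subseteq> \<phi> ` U" "K \<subseteq> U" by (auto simp: K_def)
  ultimately have "compactin (subtopology (mtop M) U) K"
    using homeomorphic_map_compactness_eq[OF is_chartD(3)[OF c], of K] is_chartD(5)[OF c]
    by (auto simp: compactin_subtopology)
  then have "compactin (mtop M) K" by (simp add: compactin_subtopology)
  then have clK: "closedin (mtop M) K"
    using assms(1) by (simp add: smooth_manifold_def compactin_imp_closedin)
  have 0: "lam y = 0" if "y \<notin> K" for y
    using that b(7) by (auto simp: lam_def K_def)
  have "smooth_near M (topspace (mtop M)) lam q" if q: "q \<in> topspace (mtop M)" for q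
  proof (cases "q \<in> U")
    case True
    show ?thesis
      by (rule smooth_nearI[OF assms(1) U(1) True open_UNIV _ b(1)]) (auto simp: lam_def)
  next
    case False
    have "openin (mtop M) (topspace (mtop M) - K)" using clK by blast
    then show ?thesis
      by (rule smooth_near_cong[OF smooth_near_const[of M "topspace (mtop M)" 0]]) (use 0 q False in \<open>auto
          simp: K_def\<close>)
  qed
  then have "smooth_fun M lam" using smooth_fun_iff[OF assms(1)] by blast
  then show ?thesis
    by (rule that[of _ "{y\<in>U. \<phi> y \<in> ball (\<phi> p) s}" K])
      (use b U r T1 0 clK chart_open[OF c open_ball] in \<open>auto simp: K_def lam_def\<close>)
qed

text \<open>This turns functions that are smooth only near the support of the bump function, such as
  chart coordinates, into global smooth functions.\<close>

lemma smooth_fun_bump_mult: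
  assumes "smooth_manifold M" "smooth_fun M lam" "closedin (mtop M) K" "\<forall>y. y \<notin> K \<longrightarrow> lam y = 0"
    "\<And>q. q \<in> K \<Longrightarrow> smooth_near M (topspace (mtop M)) h q"
  shows "smooth_fun M (\<lambda>y. lam y * h y)"
  unfolding smooth_fun_iff[OF assms(1)]
proof
  fix q assume q: "q \<in> topspace (mtop M)"
  show "smooth_near M (topspace (mtop M)) (\<lambda>y. lam y * h y) q"
  proof (cases "q \<in> K")
    case True
    then show ?thesis using assms q by (intro smooth_near_mult) (auto simp: smooth_fun_iff)
  next
    case False
    have "openin (mtop M) (topspace (mtop M) - K)" using assms(3) by blast
    then show ?thesis
      by (rule smooth_near_cong[OF smooth_near_const[of M "topspace (mtop M)" 0]]) (use assms(4) q False
          in auto)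
  qed
qed

subsection \<open>The boundary of a manifold\<close>

abbreviation bvec :: "real^'n::finite" where
  "bvec \<equiv> axis bdry_coord 1"

definition hproj :: "real^'n::finite \<Rightarrow> real^'n" where
  "hproj x = x - (x $ bdry_coord) *\<^sub>R bvec"

lemma bvec_nth [simp]: "bvec $ bdry_coord = 1"
  by (simp add: axis_def)

lemma hproj_nth [simp]: "hproj x $ bdry_coord = 0"
  by (simp add: hproj_def)

lemma hproj_in [simp]: "hproj x \<in> hyperplane"
  by (simp add: hyperplane_def)

lemma hproj_ident [simp]: "x \<in> hyperplane \<Longrightarrow> hproj x = x"
  by (simp add: hproj_def hyperplane_def)

lemma hproj_decomp: "hproj x + (x $ bdry_coord) *\<^sub>R bvec = x"
  by (simp add: hproj_def)

lemma bounded_linear_hproj: "bounded_linear hproj"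
  unfolding hproj_def
  by (intro bounded_linear_sub bounded_linear_ident bounded_linear_scaleR_left[THEN
      bounded_linear_compose] bounded_linear_vec_nth)

lemma hproj_add_bvec [simp]: "hproj (x + t *\<^sub>R bvec) = hproj x"
  by (simp add: hproj_def algebra_simps)

lemma hyperplane_subset_half_space: "hyperplane \<subseteq> half_space"
  by (auto simp: hyperplane_def half_space_def)

lemma closed_half_space: "closed half_space"
  unfolding half_space_def by (intro closed_Collect_le continuous_intros)

lemma closed_hyperplane: "closed hyperplane"
  unfolding hyperplane_def by (intro closed_Collect_eq continuous_intros)

lemma map_near_cong:
  assumes "map_near M S N F p" "openin (mtop M) A" "p \<in> A" "p \<in> S" "\<And>y. y \<in> A \<Longrightarrow> y \<in> S \<Longrightarrow> F y = G y"
  shows "map_near M S N G p"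
  unfolding map_near_def
proof (safe)
  have Gp: "G p = F p" using assms by simp
  show "G p \<in> topspace (mtop N)" using assms(1) Gp by (simp add: map_near_def)
  fix V \<psi> assume V: "(V, \<psi>) \<in> max_atlas N" "G p \<in> V"
  then obtain A' where A': "openin (mtop M) A'" "p \<in> A'" "\<forall>y\<in>A' \<inter> S. F y \<in> V" and s: "smooth_near M S (\<lambda>y.
      \<psi> (F y)) p"
    using assms(1) Gp unfolding map_near_def by auto
  show "\<exists>A. openin (mtop M) A \<and> p \<in> A \<and> (\<forall>y\<in>A \<inter> S. G y \<in> V)"
    by (rule exI[of _ "A \<inter> A'"]) (use A' assms(2,3) assms(5)[symmetric] in auto)
  show "smooth_near M S (\<lambda>y. \<psi> (G y)) p"
    by (rule smooth_near_cong[OF s assms(2,3)]) (use assms(5) in auto)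
qed

lemma map_near_eventually:
  assumes "smooth_manifold M" "smooth_manifold N" "map_near M (topspace (mtop M)) N F p" "p \<in> topspace (mtop M)"
  obtains A where "openin (mtop M) A" "p \<in> A" "\<forall>y\<in>A. map_near M (topspace (mtop M)) N F y"
proof -
  have "F p \<in> topspace (mtop N)" using assms(3) by (simp add: map_near_def)
  then obtain V \<psi> where V: "(V, \<psi>) \<in> max_atlas N" "F p \<in> V" using max_atlas_cover[OF assms(2)] by blast
  obtain A' where A': "openin (mtop M) A'" "p \<in> A'" "\<forall>y\<in>A' \<inter> topspace (mtop M). F y \<in> V"
    and s: "smooth_near M (topspace (mtop M)) (\<lambda>y. \<psi> (F y)) p"
    using assms(3) V unfolding map_near_def by blast
  obtain A'' where A'': "openin (mtop M) A''" "p \<in> A''"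
    "\<forall>q\<in>A''. smooth_near M (topspace (mtop M)) (\<lambda>y. \<psi> (F y)) q"
    by (rule smooth_near_eventually[OF assms(1) s assms(4)])
  have sub: "A' \<subseteq> topspace (mtop M)" using A'(1) openin_subset by blast
  show ?thesis
    by (rule that[of "A' \<inter> A''"])
      (use A' A'' sub in \<open>auto intro!: map_nearI[OF assms(2) _ V(1) _ A'(1) _ _ assms(1)]\<close>)
qed

section \<open>Manifolds with boundary: invariance of the boundary, patching of local
  retractions\<close>

locale bounded_manifold =
  fixes W :: "('w, 'n::finite) manifold"
  assumes bounded: "manifold_with_boundary W"
begin

abbreviation "X \<equiv> topspace (mtop W)"
abbreviation "B \<equiv> boundary_pts W"

lemma smooth: "smooth_manifold W" and model: "model W = half_space"
  using bounded by (auto simp: manifold_with_boundary_def)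

lemma hausdorff: "Hausdorff_space (mtop W)"
  using smooth by (simp add: smooth_manifold_def)

lemma boundary_subset: "B \<subseteq> X"
  using is_chartD(5)[OF max_atlas_chart] by (fastforce simp: boundary_pts_def)

lemma chart_half_space: "(U, \<phi>) \<in> max_atlas W \<Longrightarrow> p \<in> U \<Longrightarrow> \<phi> p \<in> half_space"
  using is_chartD(4)[OF max_atlas_chart] model by fastforce

lemma chart_image:
  assumes "(U, \<phi>) \<in> max_atlas W"
  obtains T where "open T" "\<phi> ` U = T \<inter> half_space"
  using is_chartD(4)[OF max_atlas_chart[OF assms]] model by auto

text \<open>Membership in the boundary is defined by the existence of one suitable chart. If another
  chart placed the point in the open half space, invariance of domain applied to the transition map
  would produce a full neighbourhood of a hyperplane point inside the half space.\<close>

lemma boundary_iff: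
  assumes U: "(U, \<phi>) \<in> max_atlas W" "p \<in> U"
  shows "p \<in> B \<longleftrightarrow> \<phi> p \<in> hyperplane"
proof
  assume "\<phi> p \<in> hyperplane"
  then show "p \<in> B" using U by (auto simp: boundary_pts_def)
next
  assume "p \<in> B"
  then obtain V \<psi> where V: "(V, \<psi>) \<in> max_atlas W" "p \<in> V" "\<psi> p \<in> hyperplane"
    by (auto simp: boundary_pts_def)
  show "\<phi> p \<in> hyperplane"
  proof (rule ccontr)
    assume "\<phi> p \<notin> hyperplane"
    then have pos: "0 < \<phi> p $ bdry_coord"
      using chart_half_space[OF U] by (simp add: half_space_def hyperplane_def)
    obtain T F where T: "open T" "\<phi> p \<in> T" "Cinf T F" "\<forall>y\<in>U. \<phi> y \<in> T \<longrightarrow> y \<in> V \<and> F (\<phi> y) = \<psi> y"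
      by (rule max_atlas_transition[OF smooth U(1) V(1) U(2) V(2)])
    obtain T0 where T0: "open T0" "\<phi> ` U = T0 \<inter> half_space" by (rule chart_image[OF U(1)])
    define S where "S = T \<inter> T0 \<inter> {x. 0 < x $ bdry_coord}"
    have "open {x :: real^'n. 0 < x $ bdry_coord}"
      by (intro open_Collect_less continuous_intros)
    then have oS: "open S" unfolding S_def using T T0 by auto
    have S: "\<exists>y\<in>U. x = \<phi> y \<and> y \<in> V \<and> F x = \<psi> y" if "x \<in> S" for x
    proof -
      have "x \<in> \<phi> ` U" using that T0(2) by (auto simp: S_def half_space_def)
      then show ?thesis using that T(4) by (auto simp: S_def)
    qed
    have "inj_on F S"
    proof (rule inj_onI)
      fix x x' assume "x \<in> S" "x' \<in> S" "F x = F x'"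
      then obtain y y' where "x = \<phi> y" "x' = \<phi> y'" "y \<in> V" "y' \<in> V" "\<psi> y = \<psi> y'"
        using S by metis
      then show "x = x'" using is_chartD(2)[OF max_atlas_chart[OF V(1)]] by (auto dest: inj_onD)
    qed
    moreover have "continuous_on S F"
      by (rule Cinf_imp_continuous_on[OF Cinf_subset[OF T(3)]]) (auto simp: S_def)
    ultimately have "open (F ` S)"
      using invariance_of_domain oS by blast
    moreover have "\<phi> p \<in> S" using T T0 U pos by (auto simp: S_def)
    moreover have "F (\<phi> p) = \<psi> p" using T(2,4) U(2) by simp
    ultimately have "\<psi> p \<in> F ` S" by (metis imageI)
    with \<open>open (F ` S)\<close> obtain d where d: "0 < d" "ball (\<psi> p) d \<subseteq> F ` S" using open_contains_ball by blast
    \<comment> \<open>A point pushed slightly below the hyperplane; it still lies in the open image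
      and hence would come from a point of \<open>V\<close>.\<close>
    let ?z = "\<psi> p + (- (d / 2)) *\<^sub>R bvec"
    have "?z \<in> ball (\<psi> p) d" using d(1) by (simp add: dist_norm)
    then have "?z \<in> F ` S" using d(2) by blast
    then obtain x where "x \<in> S" "?z = F x" by blast
    then obtain y where "y \<in> V" "?z = \<psi> y" using S by metis
    then have "?z \<in> half_space" using chart_half_space[OF V(1)] by metis
    then show False using V(3) d(1) by (simp add: half_space_def hyperplane_def)
  qed
qed

lemma closedin_boundary: "closedin (mtop W) B"
proof -
  have "openin (mtop W) (X - B)"
  proof (subst openin_subopen, safe)
    fix p assume p: "p \<in> X" "p \<notin> B"
    obtain U \<phi> where U: "(U, \<phi>) \<in> max_atlas W" "p \<in> U" by (rule max_atlas_cover[OF smooth p(1)])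
    let ?A = "{y\<in>U. \<phi> y \<in> - hyperplane}"
    have "openin (mtop W) ?A"
      by (rule chart_open[OF max_atlas_chart[OF U(1)]]) (simp add: closed_hyperplane open_Compl)
    moreover have "p \<in> ?A" "?A \<subseteq> X - B"
      using U p boundary_iff[OF U(1)] is_chartD(5)[OF max_atlas_chart[OF U(1)]] by auto
    ultimately show "\<exists>T. openin (mtop W) T \<and> p \<in> T \<and> T \<subseteq> X - B" by blast
  qed
  then show ?thesis using boundary_subset by (simp add: closedin_def)
qed

lemma smooth_near_fun: "smooth_fun W h \<Longrightarrow> p \<in> X \<Longrightarrow> smooth_near W X h p"
  using smooth_fun_iff[OF smooth] by blast

definition bdry_bump where
  "bdry_bump b U \<phi> lam K A \<longleftrightarrow> (U, \<phi>) \<in> max_atlas W \<and> smooth_fun W lam \<and> (\<forall>y. 0 \<le> lam y \<and> lam y \<le> 1) \<and>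
     openin (mtop W) A \<and> b \<in> A \<and> (\<forall>y\<in>A. lam y = 1) \<and> A \<subseteq> K \<and> closedin (mtop W) K \<and> K \<subseteq> U \<and>
     (\<forall>y. y \<notin> K \<longrightarrow> lam y = 0)"

lemma bdry_bump_exists:
  assumes "b \<in> X"
  shows "\<exists>U \<phi> lam K A. bdry_bump b U \<phi> lam K A"
proof -
  obtain U \<phi> where U: "(U, \<phi>) \<in> max_atlas W" "b \<in> U" by (rule max_atlas_cover[OF smooth assms])
  have "closed (model W)" by (simp add: model closed_half_space)
  obtain lam K A where "smooth_fun W lam" "\<forall>y. 0 \<le> lam y" "\<forall>y. lam y \<le> 1"
    "openin (mtop W) A" "b \<in> A" "\<forall>y\<in>A. lam y = 1" "A \<subseteq> K"
    "closedin (mtop W) K" "K \<subseteq> U" "\<forall>y. y \<notin> K \<longrightarrow> lam y = 0"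
    by (rule manifold_bump[OF smooth \<open>closed (model W)\<close> is_chartD(1)[OF max_atlas_chart[OF U(1)]] U(2)])
  then have "bdry_bump b U \<phi> lam K A" using U by (simp add: bdry_bump_def)
  then show ?thesis by blast
qed

text \<open>Being a retraction is formulated at single boundary points, so that maps defined on the
  whole type can be patched without keeping track of a common domain.\<close>

definition retr_near where
  "retr_near r b \<longleftrightarrow> map_near W X W r b \<and>
     (\<exists>A. openin (mtop W) A \<and> b \<in> A \<and> (\<forall>y\<in>A. r y \<in> B \<and> (y \<in> B \<longrightarrow> r y = y)))"

lemma retr_nearI:
  assumes "b \<in> B" "(U, \<phi>) \<in> max_atlas W" "b \<in> U" "smooth_near W X m b" "openin (mtop W) A" "b \<in> A"
    and A: "\<forall>y\<in>A. r y \<in> U \<and> \<phi> (r y) = m y \<and> m y \<in> hyperplane \<and> (y \<in> B \<longrightarrow> r y = y)"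
  shows "retr_near r b"
  unfolding retr_near_def
proof (intro conjI exI)
  have "smooth_near W X (\<lambda>y. \<phi> (r y)) b"
    by (rule smooth_near_cong[OF assms(4,5,6)]) (use A in auto)
  moreover have "r b = b" using A assms by auto
  ultimately show "map_near W X W r b"
    using A assms boundary_subset by (intro map_nearI[OF smooth _ assms(2) _ assms(5,6) _ smooth]) auto
  show "\<forall>y\<in>A. r y \<in> B \<and> (y \<in> B \<longrightarrow> r y = y)"
    using A boundary_iff[OF assms(2)] by auto
qed (use assms in auto)

text \<open>In the chart, the old map and the projection \<open>hproj\<close> are averaged with
  weight \<open>lam\<close>. The hyperplane is convex, so the average stays in it, and at boundary
  points both maps fix the point, so near them the average stays in the chart image. Where the
  weight is 1 nothing is required of the old map, and off \<open>K\<close> it is kept.\<close>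

lemma retraction_extend:
  assumes bump: "bdry_bump b0 U \<phi> lam K A" and r: "\<forall>b\<in>B \<inter> C. retr_near r b"
  shows "\<exists>r. \<forall>b\<in>B \<inter> (A \<union> C). retr_near r b"
proof -
  have U: "(U, \<phi>) \<in> max_atlas W" and lam: "smooth_fun W lam" "\<And>y. y \<notin> K \<Longrightarrow> lam y = 0" "\<And>y. y \<in> A \<Longrightarrow> lam y = 1"
    and A: "openin (mtop W) A" "A \<subseteq> K" and K: "closedin (mtop W) K" "K \<subseteq> U"
    using bump by (auto simp: bdry_bump_def)
  obtain T where T: "open T" "\<phi> ` U = T \<inter> half_space" by (rule chart_image[OF U])
  have inj: "inj_on \<phi> U" using is_chartD(2)[OF max_atlas_chart[OF U]] .
  have oU: "openin (mtop W) U" using is_chartD(1)[OF max_atlas_chart[OF U]] .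
  define m where "m y = (1 - lam y) *\<^sub>R \<phi> (r y) + lam y *\<^sub>R hproj (\<phi> y)" for y
  define r' where "r' y = (if y \<in> K then inv_into U \<phi> (m y) else r y)" for y
  have inT: "inv_into U \<phi> x \<in> U \<and> \<phi> (inv_into U \<phi> x) = x" if "x \<in> T" "x \<in> hyperplane" for x
  proof -
    have "x \<in> \<phi> ` U" using that T(2) hyperplane_subset_half_space by auto
    then show ?thesis by (simp add: inv_into_into f_inv_into_f)
  qed
  have hp: "smooth_near W X (\<lambda>y. hproj (\<phi> y)) b" if "b \<in> U" for b
    using smooth_near_linear[OF smooth_near_chart[OF smooth U that] _ bounded_linear_hproj, of X]
      that is_chartD(5)[OF max_atlas_chart[OF U]] by auto
  have "retr_near r' b" if b: "b \<in> B" "b \<in> A \<or> b \<in> C" for b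
  proof -
    have bX: "b \<in> X" using b(1) boundary_subset by auto
    consider "b \<in> A" | "b \<notin> A" "b \<in> C" "b \<in> K" | "b \<notin> K" "b \<in> C" using b A(2) by blast
    then show ?thesis
    proof cases
      case 1
      then have bU: "b \<in> U" using A K by auto
      have fb: "\<phi> b \<in> hyperplane" using boundary_iff[OF U bU] b by simp
      have "hproj (\<phi> b) \<in> T" using fb T(2) bU by auto
      then obtain A' where A': "openin (mtop W) A'" "b \<in> A'" "\<forall>y\<in>A'. y \<in> X \<longrightarrow> hproj (\<phi> y) \<in> T"
        using smooth_near_continuous[OF smooth hp[OF bU] bX bX T(1)] by blast
      show ?thesis
      proof (rule retr_nearI[OF b(1) U bU hp[OF bU], of "A \<inter> A'"])
        show "\<forall>y\<in>A \<inter> A'. r' y \<in> U \<and> \<phi> (r' y) = hproj (\<phi> y) \<and> hproj (\<phi> y) \<in> hyperplane \<and> (y \<in> B \<longrightarrow> r' y = y)"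
        proof
          fix y assume y: "y \<in> A \<inter> A'"
          then have yU: "y \<in> U" "y \<in> X" using A K openin_subset[OF A(1)] by auto
          have eq: "r' y = inv_into U \<phi> (hproj (\<phi> y))"
            using y A lam(3)[of y] by (auto simp: r'_def m_def)
          have "hproj (\<phi> y) \<in> T" using A'(3) y yU by auto
          then have "r' y \<in> U \<and> \<phi> (r' y) = hproj (\<phi> y)" using inT eq by simp
          moreover have "r' y = y" if "y \<in> B"
            using boundary_iff[OF U yU(1)] that inj yU by (simp add: eq)
          ultimately show "r' y \<in> U \<and> \<phi> (r' y) = hproj (\<phi> y) \<and> hproj (\<phi> y) \<in> hyperplane \<and> (y \<in> B \<longrightarrow> r' y = y)"
            by simp
        qed
      qed (use A A' 1 in auto)
    next
      case 2
      then have bU: "b \<in> U" using K by auto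
      have fb: "\<phi> b \<in> hyperplane" using boundary_iff[OF U bU] b by simp
      have rb: "retr_near r b" using r b 2 by auto
      then obtain A1 where A1: "openin (mtop W) A1" "b \<in> A1" "\<forall>y\<in>A1. r y \<in> B \<and> (y \<in> B \<longrightarrow> r y = y)"
        by (auto simp: retr_near_def)
      have rbb: "r b = b" using A1 b by auto
      then obtain A2 where A2: "openin (mtop W) A2" "b \<in> A2" "\<forall>y\<in>A2 \<inter> X. r y \<in> U"
        and s: "smooth_near W X (\<lambda>y. \<phi> (r y)) b"
        using rb U bU unfolding retr_near_def map_near_def by auto
      have sm: "smooth_near W X m b"
        unfolding m_def
        by (intro smooth_near_add smooth_near_scaleR smooth_near_diff smooth_near_const s hp bU
            smooth_near_fun lam bX)
      have "m b = \<phi> b" by (simp add: m_def rbb fb flip: scaleR_left_distrib)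
      then have "m b \<in> T" using T bU by auto
      then obtain A3 where A3: "openin (mtop W) A3" "b \<in> A3" "\<forall>y\<in>A3. y \<in> X \<longrightarrow> m y \<in> T"
        using smooth_near_continuous[OF smooth sm bX bX T(1)] by blast
      show ?thesis
      proof (rule retr_nearI[OF b(1) U bU sm, of "A1 \<inter> A2 \<inter> A3 \<inter> U"])
        show "\<forall>y\<in>A1 \<inter> A2 \<inter> A3 \<inter> U. r' y \<in> U \<and> \<phi> (r' y) = m y \<and> m y \<in> hyperplane \<and> (y \<in> B \<longrightarrow> r' y = y)"
        proof
          fix y assume y: "y \<in> A1 \<inter> A2 \<inter> A3 \<inter> U"
          then have yX: "y \<in> X" using openin_subset[OF A1(1)] by auto
          have ry: "r y \<in> U" "r y \<in> B" "y \<in> B \<Longrightarrow> r y = y" using y yX A1(3) A2(3) by auto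
          have fr: "\<phi> (r y) \<in> hyperplane" using boundary_iff[OF U ry(1)] ry(2) by simp
          have mh: "m y \<in> hyperplane" using fr by (simp add: m_def hyperplane_def)
          have mT: "m y \<in> T" using A3(3) y yX by auto
          \<comment> \<open>Off \<open>K\<close> the weight is 0 and m y is the coordinate vector of
            r y, so both branches of the definition of \<open>r'\<close> obey one formula and no
            seam appears along the edge of \<open>K\<close>.\<close>
          have eq: "r' y = inv_into U \<phi> (m y)"
          proof (cases "y \<in> K")
            case False
            then have "m y = \<phi> (r y)" using lam by (simp add: m_def)
            then show ?thesis using False inj ry(1) by (simp add: r'_def)
          qed (simp add: r'_def)
          have "r' y = y" if "y \<in> B"
          proof -
            have "\<phi> y \<in> hyperplane" using boundary_iff[OF U, of y] that y by auto
            then have "m y = \<phi> y" using ry(3)[OF that] by (simp add: m_def flip: scaleR_left_distrib)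
            then show ?thesis using eq inj y by auto
          qed
          then show "r' y \<in> U \<and> \<phi> (r' y) = m y \<and> m y \<in> hyperplane \<and> (y \<in> B \<longrightarrow> r' y = y)"
            using inT[OF mT mh] eq mh by simp
        qed
      qed (use A1 A2 A3 bU oU in auto)
    next
      case 3
      have oK: "openin (mtop W) (X - K)" using K by blast
      have rb: "retr_near r b" using r b 3 by auto
      then obtain A1 where A1: "openin (mtop W) A1" "b \<in> A1" "\<forall>y\<in>A1. r y \<in> B \<and> (y \<in> B \<longrightarrow> r y = y)"
        by (auto simp: retr_near_def)
      have "map_near W X W r' b"
        by (rule map_near_cong[of _ _ _ r, OF _ oK]) (use rb 3 bX in \<open>auto simp: retr_near_def r'_def\<close>)
      moreover have "\<forall>y\<in>A1 \<inter> (X - K). r' y \<in> B \<and> (y \<in> B \<longrightarrow> r' y = y)"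
        using A1 by (auto simp: r'_def)
      ultimately show ?thesis
        unfolding retr_near_def using A1 oK 3 bX by (intro conjI exI[of _ "A1 \<inter> (X - K)"]) auto
    qed
  qed
  then show ?thesis by blast
qed

end

section \<open>Compact manifolds with boundary: global retraction and boundary defining
  function\<close>

locale compact_bounded_manifold = bounded_manifold W for W :: "('w, 'n::finite) manifold" +
  assumes compact: "compact_space (mtop W)"
begin

lemma compactin_boundary: "compactin (mtop W) B"
  using closedin_compact_space[OF compact closedin_boundary] .

lemma boundary_finite_cover:
  obtains I U \<phi> lam K A where "finite I" "\<forall>i\<in>I. bdry_bump i (U i) (\<phi> i) (lam i) (K i) (A i)" "B \<subseteq> (\<Union>i\<in>I. A i)"
proof -
  have "\<forall>b\<in>B. \<exists>d. bdry_bump b (fst d) (fst (snd d)) (fst (snd (snd d))) (fst (snd (snd (snd d)))) (snd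
      (snd (snd (snd d))))"
    using bdry_bump_exists boundary_subset by fastforce
  then obtain d where d: "\<forall>b\<in>B. bdry_bump b (fst (d b)) (fst (snd (d b))) (fst (snd (snd (d b)))) (fst
      (snd (snd (snd (d b))))) (snd (snd (snd (snd (d b)))))"
    by (rule bchoice[THEN exE])
  define A where "A b = snd (snd (snd (snd (d b))))" for b
  have "\<forall>b\<in>B. openin (mtop W) (A b) \<and> b \<in> A b" using d unfolding A_def bdry_bump_def by blast
  then obtain F where F: "finite F" "F \<subseteq> A ` B" "B \<subseteq> \<Union>F"
    using compactinD[OF compactin_boundary, of "A ` B"] by blast
  then obtain I where I: "finite I" "I \<subseteq> B" "F = A ` I" by (meson finite_subset_image)
  show ?thesis
    by (rule that[of I "\<lambda>b. fst (d b)" "\<lambda>b. fst (snd (d b))" "\<lambda>b. fst (snd (snd (d b)))" "\<lambda>b. fst (snd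
        (snd (snd (d b))))" A])
      (use I F d in \<open>auto simp: A_def\<close>)
qed

lemma boundary_retraction:
  obtains r where "\<forall>b\<in>B. retr_near r b"
proof -
  obtain I U \<phi> lam K A where I: "finite I" "\<forall>i\<in>I. bdry_bump i (U i) (\<phi> i) (lam i) (K i) (A i)" "B \<subseteq> (\<Union>i\<in>I. A i)"
    by (rule boundary_finite_cover)
  have "\<exists>r. \<forall>b\<in>B \<inter> (\<Union>i\<in>I. A i). retr_near r b"
    using I(1,2)
  proof (induction I rule: finite_induct)
    case (insert i I)
    then obtain r where "\<forall>b\<in>B \<inter> (\<Union>i\<in>I. A i). retr_near r b" by auto
    with retraction_extend[of i "U i" "\<phi> i" "lam i" "K i" "A i"] insert.prems show ?case by simp
  qed simp
  then show ?thesis using that I(3) by (metis inf.absorb1)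
qed

text \<open>The sum of the weighted boundary coordinates vanishes on \<open>B\<close>, but also
  wherever all weights vanish; the product of the factors 1 - lam is positive wherever no weight
  equals 1, and zero on \<open>B\<close> because the sets \<open>A i\<close> cover it. Both terms
  are nonnegative, so they cannot cancel. The lower bound by a chart coordinate will give a nonzero
  normal derivative.\<close>

lemma boundary_function:
  obtains \<rho> where "smooth_fun W \<rho>" "\<forall>p\<in>X. 0 \<le> \<rho> p" "\<forall>p\<in>X. \<rho> p = 0 \<longleftrightarrow> p \<in> B"
    "\<forall>b\<in>B. \<exists>U \<phi> A. (U, \<phi>) \<in> max_atlas W \<and> b \<in> U \<and> openin (mtop W) A \<and> b \<in> A \<and> (\<forall>y\<in>A \<inter> U. \<phi> y $ bdry_coord
        \<le> \<rho> y)"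
proof -
  obtain I U \<phi> lam K A where I: "finite I" "\<forall>i\<in>I. bdry_bump i (U i) (\<phi> i) (lam i) (K i) (A i)" "B \<subseteq> (\<Union>i\<in>I. A i)"
    by (rule boundary_finite_cover)
  have U: "(U i, \<phi> i) \<in> max_atlas W" and lam: "smooth_fun W (lam i)" "\<And>y. 0 \<le> lam i y" "\<And>y. lam i y \<le> 1"
      "\<And>y. y \<in> A i \<Longrightarrow> lam i y = 1" "\<And>y. y \<notin> K i \<Longrightarrow> lam i y = 0"
    and A: "openin (mtop W) (A i)" "A i \<subseteq> K i" and K: "closedin (mtop W) (K i)" "K i \<subseteq> U i"
    if "i \<in> I" for i
    using bspec[OF I(2) that] by (auto simp: bdry_bump_def)
  define \<sigma> where "\<sigma> i y = lam i y * \<phi> i y $ bdry_coord" for i y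
  define \<rho> where "\<rho> y = (\<Prod>i\<in>I. 1 - lam i y) + (\<Sum>i\<in>I. \<sigma> i y)" for y
  have \<sigma>0: "0 \<le> \<sigma> i y" if "i \<in> I" for i y
  proof (cases "y \<in> K i")
    case True
    then have "\<phi> i y \<in> half_space" using chart_half_space[OF U[OF that]] K(2)[OF that] by auto
    then show ?thesis using lam(2)[OF that] by (simp add: \<sigma>_def half_space_def)
  qed (simp add: \<sigma>_def lam(5)[OF that])
  have pr0: "0 \<le> (\<Prod>i\<in>I. 1 - lam i y)" for y
    by (intro prod_nonneg) (use lam(3) in auto)
  have s: "smooth_fun W (\<sigma> i)" if "i \<in> I" for i
    unfolding \<sigma>_def
  proof (rule smooth_fun_bump_mult[OF smooth lam(1)[OF that] K(1)[OF that]])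
    show "smooth_near W X (\<lambda>y. \<phi> i y $ bdry_coord) q" if "q \<in> K i" for q
      using that K[OF \<open>i \<in> I\<close>] closedin_subset[OF K(1)[OF \<open>i \<in> I\<close>]]
      by (intro smooth_near_linear[OF _ _ bounded_linear_vec_nth] smooth_near_chart[OF smooth U[OF \<open>i \<in>
          I\<close>]]) auto
  qed (use lam(5)[OF that] in simp)
  have 1: "smooth_fun W \<rho>"
    unfolding smooth_fun_iff[OF smooth] \<rho>_def
    by (intro ballI smooth_near_add smooth_near_prod smooth_near_sum smooth_near_diff smooth_near_const
        smooth_near_fun s lam(1))
  have 2: "0 \<le> \<rho> p" for p using pr0[of p] sum_nonneg[of I "\<lambda>i. \<sigma> i p"] \<sigma>0 by (simp add: \<rho>_def)
  have 3: "\<rho> p = 0 \<longleftrightarrow> p \<in> B" if p: "p \<in> X" for p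
  proof
    assume pB: "p \<in> B"
    then obtain i where i: "i \<in> I" "p \<in> A i" using I(3) by auto
    then have "(\<Prod>i\<in>I. 1 - lam i p) = 0" using I(1) lam(4) by auto
    moreover have "\<sigma> j p = 0" if "j \<in> I" for j
    proof (cases "p \<in> K j")
      case True
      then have "\<phi> j p \<in> hyperplane" using boundary_iff[OF U[OF that]] K(2)[OF that] pB by auto
      then show ?thesis by (simp add: \<sigma>_def hyperplane_def)
    qed (simp add: \<sigma>_def lam(5)[OF that])
    ultimately show "\<rho> p = 0" by (simp add: \<rho>_def)
  next
    assume 0: "\<rho> p = 0"
    show "p \<in> B"
    proof (rule ccontr)
      assume "p \<notin> B"
      have s0: "(\<Sum>i\<in>I. \<sigma> i p) = 0" and p0: "(\<Prod>i\<in>I. 1 - lam i p) = 0"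
        using 0 pr0[of p] sum_nonneg[of I "\<lambda>i. \<sigma> i p"] \<sigma>0 unfolding \<rho>_def by (auto simp: add_nonneg_eq_0_iff)
      obtain i where i: "i \<in> I" "lam i p = 1" using p0 I(1) by auto
      then have "p \<in> K i" using lam(5) by force
      then have "\<phi> i p $ bdry_coord > 0"
        using boundary_iff[OF U[OF i(1)]] chart_half_space[OF U[OF i(1)]] K(2)[OF i(1)] \<open>p \<notin> B\<close>
        by (force simp: half_space_def hyperplane_def)
      moreover have "\<sigma> i p = 0" using s0 I(1) i(1) \<sigma>0 by (simp add: sum_nonneg_eq_0_iff)
      ultimately show False using i by (simp add: \<sigma>_def)
    qed
  qed
  have 4: "\<exists>U \<phi> A. (U, \<phi>) \<in> max_atlas W \<and> b \<in> U \<and> openin (mtop W) A \<and> b \<in> A \<and> (\<forall>y\<in>A \<inter> U. \<phi> y $ bdry_coord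
      \<le> \<rho> y)"
    if b: "b \<in> B" for b
  proof -
    obtain i where i: "i \<in> I" "b \<in> A i" using I(3) b by auto
    have "\<phi> i y $ bdry_coord \<le> \<rho> y" if "y \<in> A i" for y
    proof -
      have "\<sigma> i y \<le> (\<Sum>i\<in>I. \<sigma> i y)" by (rule member_le_sum[OF i(1) _ I(1)]) (use \<sigma>0 in auto)
      then show ?thesis using pr0[of y] lam(4)[OF i(1) that] by (simp add: \<rho>_def \<sigma>_def)
    qed
    then show ?thesis using U[OF i(1)] A[OF i(1)] K[OF i(1)] i(2) by blast
  qed
  show ?thesis using that[of \<rho>] 1 2 3 4 by blast
qed

end

subsection \<open>Collars\<close>

text \<open>A derivative in a direction tangent to the hyperplane is determined by the values on the
  hyperplane, however \<open>F\<close> extends beyond it.\<close>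

lemma directional_derivative_const:
  fixes F :: "real^'n::finite \<Rightarrow> 'b::real_normed_vector"
  assumes "open S" "Cinf S F" "x \<in> S" "bounded_linear L" "\<forall>z\<in>S. z \<in> hyperplane \<longrightarrow> F z = L z"
    "x \<in> hyperplane" "v \<in> hyperplane"
  shows "frechet_derivative F (at x) v = L v"
proof -
  have der: "((\<lambda>t. F (x + t *\<^sub>R v)) has_vector_derivative frechet_derivative F (at x) v) (at 0)"
  proof -
    have d: "(F has_derivative frechet_derivative F (at x)) (at (x + 0 *\<^sub>R v))"
      using Cinf_has_derivative[OF assms(2,3)] by simp
    have "((\<lambda>t. F (x + t *\<^sub>R v)) has_derivative (\<lambda>t. frechet_derivative F (at x) (t *\<^sub>R v))) (at 0)"
      by (rule has_derivative_compose[where f = "\<lambda>t. x + t *\<^sub>R v", OF _ d]) (auto intro!: derivative_eq_intros)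
    then show ?thesis
      using linear_scale[OF has_derivative_linear[OF d]] by (simp add: has_vector_derivative_def)
  qed
  define T where "T = {t::real. x + t *\<^sub>R v \<in> S}"
  have "open T"
    unfolding T_def using continuous_open_preimage[OF _ open_UNIV assms(1), of "\<lambda>t::real. x + t *\<^sub>R v"]
    by (simp add: vimage_def continuous_intros)
  moreover have eq: "L (x + t *\<^sub>R v) = F (x + t *\<^sub>R v)" if "t \<in> T" for t
    using assms that by (simp add: T_def hyperplane_def)
  moreover have "0 \<in> T" using assms by (simp add: T_def)
  moreover have "((\<lambda>t. L (x + t *\<^sub>R v)) has_vector_derivative L v) (at 0)"
  proof -
    have "((\<lambda>t. x + t *\<^sub>R v) has_vector_derivative v) (at 0)"
      by (auto intro!: derivative_eq_intros simp: has_vector_derivative_def)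
    then show ?thesis by (rule bounded_linear.has_vector_derivative[OF assms(4)])
  qed
  ultimately have "((\<lambda>t. F (x + t *\<^sub>R v)) has_vector_derivative L v) (at 0)"
    using has_vector_derivative_transform_within_open[of "\<lambda>t. L (x + t *\<^sub>R v)" "L v" 0 T "\<lambda>t. F (x + t *\<^sub>R
        v)"] by blast
  then show ?thesis using vector_derivative_unique_at[OF der] by simp
qed

text \<open>Only difference quotients with positive h see the half space, and those are at least 1;
  as the two-sided derivative exists, it is their limit.\<close>

lemma normal_derivative_ge_1:
  fixes F :: "real^'n::finite \<Rightarrow> real"
  assumes "open S" "Cinf S F" "x \<in> S" "x \<in> hyperplane" "F x = 0" "\<forall>z\<in>S. z \<in> half_space \<longrightarrow> z $ bdry_coord \<le> F z"
  shows "1 \<le> frechet_derivative F (at x) bvec"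
proof -
  have d: "(F has_derivative frechet_derivative F (at x)) (at (x + 0 *\<^sub>R bvec))"
    using Cinf_has_derivative[OF assms(2,3)] by simp
  have "((\<lambda>t. F (x + t *\<^sub>R bvec)) has_derivative (\<lambda>t. frechet_derivative F (at x) (t *\<^sub>R bvec))) (at 0)"
    by (rule has_derivative_compose[where f = "\<lambda>t. x + t *\<^sub>R bvec", OF _ d]) (auto intro!: derivative_eq_intros)
  then have "((\<lambda>t. F (x + t *\<^sub>R bvec)) has_real_derivative frechet_derivative F (at x) bvec) (at 0)"
    using linear_scale[OF has_derivative_linear[OF d]] by (simp add: has_field_derivative_def mult_commute_abs)
  then have "((\<lambda>h. F (x + h *\<^sub>R bvec) / h) \<longlongrightarrow> frechet_derivative F (at x) bvec) (at 0)"
    using assms(5) by (simp add: DERIV_def)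
  then have lim: "((\<lambda>h. F (x + h *\<^sub>R bvec) / h) \<longlongrightarrow> frechet_derivative F (at x) bvec) (at_right 0)"
    by (simp add: filterlim_at_split)
  obtain e where e: "0 < e" "ball x e \<subseteq> S" using assms(1,3) open_contains_ball by blast
  have "eventually (\<lambda>h. 1 \<le> F (x + h *\<^sub>R bvec) / h) (at_right 0)"
  proof (rule eventually_at_rightI[of 0 e])
    fix h assume h: "h \<in> {0<..<e}"
    then have "x + h *\<^sub>R bvec \<in> S" using e(2) by (intro subsetD[OF e(2)]) (simp add: dist_norm)
    moreover have "x + h *\<^sub>R bvec \<in> half_space" "(x + h *\<^sub>R bvec) $ bdry_coord = h"
      using h assms(4) by (auto simp: half_space_def hyperplane_def)
    ultimately have "h \<le> F (x + h *\<^sub>R bvec)" using assms(6) by fastforce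
    then show "1 \<le> F (x + h *\<^sub>R bvec) / h" using h by (simp add: field_simps)
  qed (use e in simp)
  then show ?thesis by (rule tendsto_lowerbound[OF lim]) simp
qed

section \<open>Local collars from the inverse function theorem\<close>

context bounded_manifold
begin

text \<open>At a boundary point, the coordinate expression of the retraction has the identity as
  derivative along the hyperplane, while that of \<rho> vanishes along it and is at least 1 on
  \<open>bvec\<close>. The combined derivative is therefore injective. What remains is to see that
  the resulting inverse \<open>Q\<close> maps \<open>V\<close> cut with the half space back into the
  half space.\<close>

lemma collar_local:
  assumes b: "b \<in> B" and \<rho>: "smooth_fun W \<rho>" "\<forall>p\<in>X. \<rho> p = 0 \<longleftrightarrow> p \<in> B"
    and U: "(U, \<phi>) \<in> max_atlas W" "b \<in> U" "openin (mtop W) A0" "b \<in> A0" "\<forall>y\<in>A0 \<inter> U. \<phi> y $ bdry_coord \<le> \<rho> y"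
    and r: "retr_near r b"
  obtains O' V Q where "open O'" "\<phi> b \<in> O'" "open V" "Cinf V Q" "\<phi> b \<in> V"
    "\<forall>y\<in>U. \<phi> y \<in> O' \<longrightarrow> r y \<in> U \<and> r y \<in> B \<and> map_near W X W r y \<and>
       \<phi> (r y) + \<rho> y *\<^sub>R bvec \<in> V \<and> Q (\<phi> (r y) + \<rho> y *\<^sub>R bvec) = \<phi> y"
    "\<forall>z\<in>V. z \<in> half_space \<longrightarrow> (\<exists>y\<in>U. \<phi> y = Q z \<and> \<phi> y \<in> O' \<and> \<phi> (r y) + \<rho> y *\<^sub>R bvec = z)"
proof -
  have bX: "b \<in> X" using b boundary_subset by auto
  have UX: "U \<subseteq> X" using is_chartD(5)[OF max_atlas_chart[OF U(1)]] .
  note c = max_atlas_chart[OF U(1)]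
  obtain T0 where T0: "open T0" "\<phi> ` U = T0 \<inter> half_space" by (rule chart_image[OF U(1)])
  obtain A1 where A1: "openin (mtop W) A1" "b \<in> A1" "\<forall>y\<in>A1. r y \<in> B \<and> (y \<in> B \<longrightarrow> r y = y)"
    and rm: "map_near W X W r b" using r by (auto simp: retr_near_def)
  have rb: "r b = b" using A1 b by auto
  obtain A2 where A2: "openin (mtop W) A2" "b \<in> A2" "\<forall>y\<in>A2 \<inter> X. r y \<in> U" and sr: "smooth_near W X (\<lambda>y. \<phi>
      (r y)) b"
    using rm U(1,2) rb unfolding map_near_def by auto
  obtain A3 where A3: "openin (mtop W) A3" "b \<in> A3" "\<forall>y\<in>A3. map_near W X W r y"
    by (rule map_near_eventually[OF smooth smooth rm bX])
  have "openin (mtop W) (A0 \<inter> A1 \<inter> A2 \<inter> A3)" using U(3) A1 A2 A3 by auto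
  then obtain T3 where T3: "open T3" "\<phi> b \<in> T3" "\<forall>y\<in>U. \<phi> y \<in> T3 \<longrightarrow> y \<in> A0 \<inter> A1 \<inter> A2 \<inter> A3"
    using chart_nbhd[OF c _ U(2)] U(4) A1(2) A2(2) A3(2) by (metis IntI)
  obtain T1 f where T1: "open T1" "\<phi> b \<in> T1" "Cinf T1 f" "\<forall>y\<in>U. y \<in> X \<longrightarrow> \<phi> y \<in> T1 \<longrightarrow> f (\<phi> y) = \<rho> y"
    by (rule smooth_nearD[OF smooth_near_fun[OF \<rho>(1) bX] U(1,2)])
  obtain T2 R where T2: "open T2" "\<phi> b \<in> T2" "Cinf T2 R" "\<forall>y\<in>U. y \<in> X \<longrightarrow> \<phi> y \<in> T2 \<longrightarrow> R (\<phi> y) = \<phi> (r y)"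
    by (rule smooth_nearD[OF sr U(1,2)])
  define x0 where "x0 = \<phi> b"
  have x0h: "x0 \<in> hyperplane" using boundary_iff[OF U(1,2)] b by (simp add: x0_def)
  define S where "S = T0 \<inter> T1 \<inter> T2 \<inter> T3"
  have oS: "open S" and x0S: "x0 \<in> S" using T0 T1 T2 T3 U(2) by (auto simp: S_def x0_def)
  have Cf: "Cinf S f" and CR: "Cinf S R" using T1(3) T2(3) by (auto simp: S_def intro: Cinf_subset)
  \<comment> \<open>\<open>f\<close> and \<open>R\<close> are extensions to an open set of the
    coordinate expressions of \<rho> and \<open>r\<close>; their meaning for points of
    \<open>W\<close> is available on the half space only and is collected here.\<close>
  have fact: "\<exists>y\<in>U. x = \<phi> y \<and> f x = \<rho> y \<and> R x = \<phi> (r y) \<and> r y \<in> U \<and> r y \<in> B \<and> map_near W X W r y \<and>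
      x $ bdry_coord \<le> f x \<and> R x \<in> hyperplane \<and> (x \<in> hyperplane \<longrightarrow> f x = 0 \<and> R x = x)"
    if x: "x \<in> S" "x \<in> half_space" for x
  proof -
    obtain y where y: "y \<in> U" "x = \<phi> y" using x T0(2) by (auto simp: S_def)
    then have yA: "y \<in> A0 \<inter> A1 \<inter> A2 \<inter> A3" and yX: "y \<in> X" using T3(3) x UX by (auto simp: S_def)
    have ry: "r y \<in> U" "r y \<in> B" using yA yX A1(3) A2(3) by auto
    have fx: "f x = \<rho> y" "R x = \<phi> (r y)" using T1(4) T2(4) y yX x by (auto simp: S_def)
    have "f x = 0 \<and> R x = x" if "x \<in> hyperplane"
    proof -
      have "y \<in> B" using boundary_iff[OF U(1) y(1)] that y by simp
      then show ?thesis using fx \<rho>(2) yX A1(3) yA y by auto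
    qed
    then show ?thesis
      using y yA ry fx A3(3) U(5) boundary_iff[OF U(1) ry(1)] by (intro bexI[of _ y]) auto
  qed
  have half: "x \<in> half_space" if "x \<in> hyperplane" for x :: "real^'n"
    using that hyperplane_subset_half_space by auto
  have D1: "frechet_derivative f (at x0) v = 0" if "v \<in> hyperplane" for v
    using directional_derivative_const[OF oS Cf x0S bounded_linear_zero _ x0h that] fact half by blast
  have D2: "frechet_derivative R (at x0) v = v" if "v \<in> hyperplane" for v
    using directional_derivative_const[OF oS CR x0S bounded_linear_ident _ x0h that] fact half by blast
  have D3: "1 \<le> frechet_derivative f (at x0) bvec"
    by (rule normal_derivative_ge_1[OF oS Cf x0S x0h]) (use fact half x0S x0h in blast)+
  have linf: "linear (frechet_derivative f (at x))" if "x \<in> S" for x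
    using Cinf_has_derivative[OF Cf that] has_derivative_linear by blast
  have linR: "linear (frechet_derivative R (at x0))"
    using Cinf_has_derivative[OF CR x0S] has_derivative_linear by blast
  have "open {x\<in>S. 0 < frechet_derivative f (at x) bvec}"
    using continuous_open_preimage[OF Cinf_imp_continuous_on[OF Cinf_derivative[OF Cf]] oS, of "{0<..}" bvec]
    by (simp add: vimage_def Int_def)
  moreover have "x0 \<in> {x\<in>S. 0 < frechet_derivative f (at x) bvec}" using D3 x0S by simp
  \<comment> \<open>The normal derivative is positive on a whole ball and not merely at x0, so that
    \<open>f\<close> is increasing along normal segments inside the ball.\<close>
  ultimately obtain \<delta> where \<delta>: "0 < \<delta>" "ball x0 \<delta> \<subseteq> {x\<in>S. 0 < frechet_derivative f (at x) bvec}"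
    using open_contains_ball by blast
  then have \<delta>S: "ball x0 \<delta> \<subseteq> S" by auto
  \<comment> \<open>Outside the half space the extension \<open>R\<close> need not stay in the
    hyperplane; applying \<open>hproj\<close> makes the boundary coordinate of \<open>P x\<close>
    equal to \<open>f x\<close> everywhere.\<close>
  define P where "P x = hproj (R x) + f x *\<^sub>R bvec" for x
  have CP: "Cinf (ball x0 \<delta>) P"
    unfolding P_def
    by (intro Cinf_add Cinf_scaleR Cinf_const Cinf_compose_linear[OF bounded_linear_hproj] open_ball
        Cinf_subset[OF Cf \<delta>S] Cinf_subset[OF CR \<delta>S])
  have x0b: "x0 \<in> ball x0 \<delta>" using \<delta> by simp
  have DP: "frechet_derivative P (at x0) = (\<lambda>v. hproj (frechet_derivative R (at x0) v) +
      frechet_derivative f (at x0) v *\<^sub>R bvec)"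
  proof (rule frechet_derivative_at[symmetric])
    show "(P has_derivative (\<lambda>v. hproj (frechet_derivative R (at x0) v) + frechet_derivative f (at x0) v
        *\<^sub>R bvec)) (at x0)"
      unfolding P_def
      by (intro has_derivative_add bounded_linear.has_derivative[OF bounded_linear_hproj]
          bounded_linear.has_derivative[OF bounded_linear_scaleR_left] Cinf_has_derivative[OF Cf x0S]
              Cinf_has_derivative[OF CR x0S])
  qed
  have "v = 0" if "frechet_derivative P (at x0) v = 0" for v
  proof -
    have eq: "hproj (frechet_derivative R (at x0) v) + frechet_derivative f (at x0) v *\<^sub>R bvec = 0"
      using that by (simp add: DP)
    then have "(hproj (frechet_derivative R (at x0) v) + frechet_derivative f (at x0) v *\<^sub>R bvec) $
        bdry_coord = 0"
      by (simp del: vector_add_component)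
    then have f0: "frechet_derivative f (at x0) v = 0" by simp
    have "frechet_derivative f (at x0) v = frechet_derivative f (at x0) (hproj v + (v $ bdry_coord) *\<^sub>R bvec)"
      by (simp add: hproj_decomp)
    also have "\<dots> = v $ bdry_coord * frechet_derivative f (at x0) bvec"
      using linf[OF x0S] D1 by (simp add: linear_add linear_scale)
    finally have "v $ bdry_coord = 0" using f0 D3 by auto
    then have vh: "v \<in> hyperplane" by (simp add: hyperplane_def)
    then show ?thesis using eq f0 D2[OF vh] by simp
  qed
  then obtain O1 V Q where O1: "open O1" "O1 \<subseteq> ball x0 \<delta>" "x0 \<in> O1" "open V" "P x0 \<in> V" "homeomorphism O1
      V P Q" "Cinf V Q"
    using smooth_inverse_function[OF open_ball CP x0b] by metis
  have Px0: "P x0 = x0" using fact[OF x0S half[OF x0h]] x0h by (auto simp: P_def)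
  have Pnth: "P x $ bdry_coord = f x" for x by (simp add: P_def)
  \<comment> \<open>A point below the hyperplane is joined to its projection, where \<open>f\<close>
    vanishes, by a normal segment along which \<open>f\<close> increases strictly. So
    \<open>f\<close> is negative at the point, and P cannot map it into the half space.\<close>
  have sgn: "x \<in> half_space" if x: "x \<in> O1" "0 \<le> f x" for x
  proof (rule ccontr)
    assume "x \<notin> half_space"
    then have neg: "x $ bdry_coord < 0" by (simp add: half_space_def)
    define z where "z = hproj x"
    \<comment> \<open>As x0 lies in the hyperplane, moving the boundary coordinate towards 0 does
      not increase any component of the distance to x0, so the segment stays in the ball.\<close>
    have line: "z + s *\<^sub>R bvec \<in> ball x0 \<delta>" if "x $ bdry_coord \<le> s" "s \<le> 0" for s
    proof -
      have "norm (z + s *\<^sub>R bvec - x0) \<le> norm (x - x0)"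
      proof (rule norm_le_componentwise_cart)
        fix i
        have "x0 $ bdry_coord = 0" using x0h by (simp add: hyperplane_def)
        then show "norm ((z + s *\<^sub>R bvec - x0) $ i) \<le> norm ((x - x0) $ i)"
          using that by (cases "i = bdry_coord") (auto simp: z_def hproj_def axis_def)
      qed
      moreover have "norm (x - x0) < \<delta>" using x O1(2) by (auto simp: dist_norm norm_minus_commute)
      ultimately show ?thesis by (simp add: dist_norm norm_minus_commute)
    qed
    have der: "((\<lambda>s. f (z + s *\<^sub>R bvec)) has_real_derivative frechet_derivative f (at (z + s *\<^sub>R bvec))
        bvec) (at s)"
      if "x $ bdry_coord \<le> s" "s \<le> 0" for s
    proof -
      have inS: "z + s *\<^sub>R bvec \<in> S" using line[OF that] \<delta>S by auto
      have "((\<lambda>s. f (z + s *\<^sub>R bvec)) has_derivative (\<lambda>t. frechet_derivative f (at (z + s *\<^sub>R bvec)) (t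
          *\<^sub>R bvec))) (at s)"
        by (rule has_derivative_compose[where f = "\<lambda>s. z + s *\<^sub>R bvec", OF _ Cinf_has_derivative[OF Cf inS]])
          (auto intro!: derivative_eq_intros)
      then show ?thesis using linear_scale[OF linf[OF inS]] by (simp add: has_field_derivative_def
          mult_commute_abs)
    qed
    have "f (z + (x $ bdry_coord) *\<^sub>R bvec) < f (z + 0 *\<^sub>R bvec)"
    proof (rule DERIV_pos_imp_increasing[OF neg, of "\<lambda>s. f (z + s *\<^sub>R bvec)"])
      fix s assume s: "x $ bdry_coord \<le> s" "s \<le> 0"
      have "0 < frechet_derivative f (at (z + s *\<^sub>R bvec)) bvec" using line[OF s] \<delta>(2) by auto
      then show "\<exists>y. ((\<lambda>s. f (z + s *\<^sub>R bvec)) has_real_derivative y) (at s) \<and> 0 < y"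
        using der[OF s] by blast
    qed
    moreover have "z \<in> S" using line[of 0] neg \<delta>S by auto
    then have "f z = 0" using fact[of z] half[of z] by (auto simp: z_def)
    ultimately show False using x(2) by (simp add: z_def hproj_decomp)
  qed
  show ?thesis
  proof (rule that[OF O1(1) O1(3)[unfolded x0_def] O1(4,7)])
    show "\<phi> b \<in> V" using O1(5) Px0 by (simp add: x0_def)
    show "\<forall>y\<in>U. \<phi> y \<in> O1 \<longrightarrow> r y \<in> U \<and> r y \<in> B \<and> map_near W X W r y \<and>
       \<phi> (r y) + \<rho> y *\<^sub>R bvec \<in> V \<and> Q (\<phi> (r y) + \<rho> y *\<^sub>R bvec) = \<phi> y"
    proof (intro ballI impI)
      fix y assume y: "y \<in> U" "\<phi> y \<in> O1"
      then have "\<phi> y \<in> S" using O1(2) \<delta>S by auto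
      from fact[OF this chart_half_space[OF U(1) y(1)]] obtain y' where
        y': "y' \<in> U" "\<phi> y = \<phi> y'" "f (\<phi> y) = \<rho> y'" "R (\<phi> y) = \<phi> (r y')" "r y' \<in> U" "r y' \<in> B" "map_near W
            X W r y'" "R (\<phi> y) \<in> hyperplane"
        by blast
      have eq: "y' = y" using inj_onD[OF is_chartD(2)[OF c] y'(2) y(1) y'(1)] by simp
      have Py: "P (\<phi> y) = \<phi> (r y) + \<rho> y *\<^sub>R bvec"
        using y'(3,4,8) unfolding eq by (simp add: P_def)
      have "P (\<phi> y) \<in> V" "Q (P (\<phi> y)) = \<phi> y" using O1(6) y(2) by (auto simp: homeomorphism_def)
      then show "r y \<in> U \<and> r y \<in> B \<and> map_near W X W r y \<and>
       \<phi> (r y) + \<rho> y *\<^sub>R bvec \<in> V \<and> Q (\<phi> (r y) + \<rho> y *\<^sub>R bvec) = \<phi> y"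
        using y'(5,6,7) unfolding eq Py by simp
    qed
    show "\<forall>z\<in>V. z \<in> half_space \<longrightarrow> (\<exists>y\<in>U. \<phi> y = Q z \<and> \<phi> y \<in> O1 \<and> \<phi> (r y) + \<rho> y *\<^sub>R bvec = z)"
    proof (intro ballI impI)
      fix z assume z: "z \<in> V" "z \<in> half_space"
      have Qz: "Q z \<in> O1" "P (Q z) = z" using O1(6) z by (auto simp: homeomorphism_def)
      have "Q z \<in> half_space" using sgn[OF Qz(1)] Pnth[of "Q z"] Qz(2) z(2) by (simp add: half_space_def)
      moreover have "Q z \<in> S" using Qz(1) O1(2) \<delta>S by auto
      ultimately obtain y where y: "y \<in> U" "Q z = \<phi> y" "f (Q z) = \<rho> y" "R (Q z) = \<phi> (r y)" "R (Q z) \<in>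
          hyperplane"
        using fact by blast
      then have "\<phi> (r y) + \<rho> y *\<^sub>R bvec = z" using Qz(2) by (simp add: P_def)
      then show "\<exists>y\<in>U. \<phi> y = Q z \<and> \<phi> y \<in> O1 \<and> \<phi> (r y) + \<rho> y *\<^sub>R bvec = z"
        using y Qz(1) by (intro bexI[of _ y]) auto
    qed
  qed
qed

end

text \<open>A collar of the end \<open>{\<rho> < \<epsilon>}\<close>: the curves \<open>t \<mapsto> \<Theta> p t\<close> sweep out the end, \<open>\<rho>\<close> being the parameter along
  them. Joint smoothness in \<open>(p, t)\<close> is expressed without a product manifold by factoring
  \<open>\<Theta> p t\<close>, in coordinates, through a smooth map applied to \<open>R p + t bvec\<close>.\<close>

definition collar :: "('a, 'n::finite) manifold \<Rightarrow> ('a \<Rightarrow> real) \<Rightarrow> real \<Rightarrow> ('a \<Rightarrow> real \<Rightarrow> 'a) \<Rightarrow> bool" where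
  "collar M \<rho> \<epsilon> \<Theta> \<longleftrightarrow> smooth_fun M \<rho> \<and> 0 < \<epsilon> \<and>
     (\<forall>p\<in>topspace (mtop M). 0 < \<rho> p \<and> \<rho> p < \<epsilon> \<longrightarrow> \<Theta> p (\<rho> p) = p \<and>
       (\<forall>t. 0 < t \<and> t < \<epsilon> \<longrightarrow> \<Theta> p t \<in> topspace (mtop M) \<and> \<rho> (\<Theta> p t) = t \<and>
         (\<forall>s. 0 < s \<and> s < \<epsilon> \<longrightarrow> \<Theta> (\<Theta> p t) s = \<Theta> p s) \<and>
         (\<exists>V \<psi> T Q (R :: 'a \<Rightarrow> real^'n) A. (V, \<psi>) \<in> max_atlas M \<and> open T \<and> Cinf T Q \<and> smooth_near M
             (topspace (mtop M)) R p \<and>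
            openin (mtop M) A \<and> p \<in> A \<and> R p + t *\<^sub>R bvec \<in> T \<and>
            (\<forall>y\<in>A. \<forall>s. 0 < \<rho> y \<and> \<rho> y < \<epsilon> \<and> 0 < s \<and> s < \<epsilon> \<and> R y + s *\<^sub>R bvec \<in> T \<longrightarrow>
               \<Theta> y s \<in> V \<and> \<psi> (\<Theta> y s) = Q (R y + s *\<^sub>R bvec)))))"

lemma smooth_fun_continuous_map:
  assumes "smooth_manifold M" "smooth_fun M h"
  shows "continuous_map (mtop M) euclidean h"
  unfolding continuous_map_def
proof (intro conjI allI impI)
  fix V :: "real set" assume "openin euclidean V"
  then have V: "open V" by simp
  show "openin (mtop M) {x \<in> topspace (mtop M). h x \<in> V}"
  proof (subst openin_subopen, safe)
    fix x assume x: "x \<in> topspace (mtop M)" "h x \<in> V"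
    have near: "smooth_near M (topspace (mtop M)) h x" using assms x smooth_fun_iff by blast
    obtain A where A: "openin (mtop M) A" "x \<in> A" "\<forall>y\<in>A. y \<in> topspace (mtop M) \<longrightarrow> h y \<in> V"
      by (rule smooth_near_continuous[OF assms(1) near x(1) x(1) V x(2)])
    then show "\<exists>T. openin (mtop M) T \<and> x \<in> T \<and> T \<subseteq> {x \<in> topspace (mtop M). h x \<in> V}"
      using openin_subset by (intro exI[of _ A]) auto
  qed
qed simp

section \<open>From local collars to a collar of the whole boundary\<close>

context compact_bounded_manifold
begin

text \<open>On the compact complement of \<open>N\<close> the function \<rho> is positive and
  attains its minimum, which serves as the threshold.\<close>

lemma small_values:
  assumes "smooth_fun W \<rho>" "\<forall>p\<in>X. 0 \<le> \<rho> p" "\<forall>p\<in>X. \<rho> p = 0 \<longleftrightarrow> p \<in> B" "openin (mtop W) N" "B \<subseteq> N"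
  obtains \<epsilon> where "0 < \<epsilon>" "\<forall>p\<in>X. \<rho> p < \<epsilon> \<longrightarrow> p \<in> N"
proof (cases "X - N = {}")
  case True
  then show ?thesis using that[of 1] by auto
next
  case False
  have "compactin (mtop W) (X - N)"
    using compact assms(4) by (intro closedin_compact_space) auto
  then have "compact (\<rho> ` (X - N))"
    using image_compactin[OF _ smooth_fun_continuous_map[OF smooth assms(1)]] by simp
  then obtain m where m: "m \<in> \<rho> ` (X - N)" "\<forall>y\<in>\<rho> ` (X - N). m \<le> y"
    using compact_attains_inf[of "\<rho> ` (X - N)"] False by auto
  then have "0 < m" using assms(2,3,5) by (auto simp: less_le)
  then show ?thesis using m(2) by (intro that[of m]) force+
qed

lemma collar_exists:
  obtains \<rho> \<epsilon> \<Theta> where "collar W \<rho> \<epsilon> \<Theta>" "\<forall>p\<in>X. 0 \<le> \<rho> p" "\<forall>p\<in>X. \<rho> p = 0 \<longleftrightarrow> p \<in> B"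
    "\<forall>t. B \<noteq> {} \<and> 0 < t \<and> t < \<epsilon> \<longrightarrow> (\<exists>p\<in>X. \<rho> p = t)"
proof -
  obtain \<rho> where \<rho>: "smooth_fun W \<rho>" "\<forall>p\<in>X. 0 \<le> \<rho> p" "\<forall>p\<in>X. \<rho> p = 0 \<longleftrightarrow> p \<in> B" and
    \<rho>1: "\<forall>b\<in>B. \<exists>U \<phi> A. (U, \<phi>) \<in> max_atlas W \<and> b \<in> U \<and> openin (mtop W) A \<and> b \<in> A \<and> (\<forall>y\<in>A \<inter> U. \<phi> y $
        bdry_coord \<le> \<rho> y)"
    by (rule boundary_function)
  obtain r where r: "\<forall>b\<in>B. retr_near r b" by (rule boundary_retraction)
  have rid: "r b = b" if "b \<in> B" for b using r that by (auto simp: retr_near_def)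
  \<comment> \<open>This packages a local collar: on the points of \<open>U\<close> with coordinates
    in O', the pair (r, \<rho>), written as \<phi> (r y) + \<rho> y bvec, is a bijection onto the
    part of \<open>V\<close> in the half space, with inverse \<open>Q\<close>.\<close>
  define Loc where "Loc b U \<phi> O' V Q \<longleftrightarrow> (U, \<phi>) \<in> max_atlas W \<and> b \<in> U \<and> open O' \<and> \<phi> b \<in> O' \<and> open V \<and> Cinf V
      Q \<and> \<phi> b \<in> V \<and>
    (\<forall>y\<in>U. \<phi> y \<in> O' \<longrightarrow> r y \<in> U \<and> r y \<in> B \<and> map_near W X W r y \<and>
       \<phi> (r y) + \<rho> y *\<^sub>R bvec \<in> V \<and> Q (\<phi> (r y) + \<rho> y *\<^sub>R bvec) = \<phi> y) \<and>
    (\<forall>z\<in>V. z \<in> half_space \<longrightarrow> (\<exists>y\<in>U. \<phi> y = Q z \<and> \<phi> y \<in> O' \<and> \<phi> (r y) + \<rho> y *\<^sub>R bvec = z))"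
    for b U \<phi> O' V and Q :: "real^'n \<Rightarrow> real^'n"
  have Loc_ex: "\<exists>U \<phi> O' V Q. Loc b U \<phi> O' V Q" if b: "b \<in> B" for b
  proof -
    obtain U \<phi> A where U: "(U, \<phi>) \<in> max_atlas W" "b \<in> U" "openin (mtop W) A" "b \<in> A" "\<forall>y\<in>A \<inter> U. \<phi> y $
        bdry_coord \<le> \<rho> y"
      using \<rho>1 b by blast
    obtain O' V Q where "open O'" "\<phi> b \<in> O'" "open V" "Cinf V Q" "\<phi> b \<in> V"
      "\<forall>y\<in>U. \<phi> y \<in> O' \<longrightarrow> r y \<in> U \<and> r y \<in> B \<and> map_near W X W r y \<and>
         \<phi> (r y) + \<rho> y *\<^sub>R bvec \<in> V \<and> Q (\<phi> (r y) + \<rho> y *\<^sub>R bvec) = \<phi> y"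
      "\<forall>z\<in>V. z \<in> half_space \<longrightarrow> (\<exists>y\<in>U. \<phi> y = Q z \<and> \<phi> y \<in> O' \<and> \<phi> (r y) + \<rho> y *\<^sub>R bvec = z)"
      by (rule collar_local[OF b \<rho>(1,3) U bspec[OF r b]])
    then have "Loc b U \<phi> O' V Q" unfolding Loc_def using U by simp
    then show ?thesis by blast
  qed
  have LocD: "(U, \<phi>) \<in> max_atlas W" "b \<in> U" "open O'" "\<phi> b \<in> O'" "open V" "Cinf V Q" "\<phi> b \<in> V"
    "openin (mtop W) {y\<in>U. \<phi> y \<in> O'}" if "Loc b U \<phi> O' V Q" for b U \<phi> O' V Q
    using that chart_open[OF max_atlas_chart] unfolding Loc_def by auto
  have Loc1: "r y \<in> U \<and> r y \<in> B \<and> map_near W X W r y \<and> \<phi> (r y) \<in> hyperplane \<and>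
       \<phi> (r y) + \<rho> y *\<^sub>R bvec \<in> V \<and> Q (\<phi> (r y) + \<rho> y *\<^sub>R bvec) = \<phi> y"
    if L: "Loc b U \<phi> O' V Q" and y: "y \<in> U" "\<phi> y \<in> O'" for b U \<phi> O' V Q y
  proof -
    have "r y \<in> U \<and> r y \<in> B \<and> map_near W X W r y \<and> \<phi> (r y) + \<rho> y *\<^sub>R bvec \<in> V \<and> Q (\<phi> (r y) + \<rho> y *\<^sub>R bvec)
        = \<phi> y"
      using L y unfolding Loc_def by simp
    then show ?thesis using boundary_iff[OF LocD(1)[OF L], of "r y"] by blast
  qed
  have Loc2: "\<exists>y\<in>U. \<phi> y \<in> O' \<and> \<phi> y = Q (\<phi> q + t *\<^sub>R bvec) \<and> r y = q \<and> \<rho> y = t"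
    if L: "Loc b U \<phi> O' V Q" and q: "q \<in> B" "q \<in> U" "\<phi> q + t *\<^sub>R bvec \<in> V" "0 \<le> t" for b U \<phi> O' V Q q t
  proof -
    have qh: "\<phi> q \<in> hyperplane" using boundary_iff[OF LocD(1)[OF L] q(2)] q(1) by simp
    then have "\<phi> q + t *\<^sub>R bvec \<in> half_space" using q(4) by (simp add: half_space_def hyperplane_def)
    then obtain y where y: "y \<in> U" "\<phi> y = Q (\<phi> q + t *\<^sub>R bvec)" "\<phi> y \<in> O'" and
      eq: "\<phi> (r y) + \<rho> y *\<^sub>R bvec = \<phi> q + t *\<^sub>R bvec"
      using L q(3) unfolding Loc_def by blast
    have ry: "r y \<in> U" "\<phi> (r y) \<in> hyperplane" using Loc1[OF L y(1,3)] by auto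
    have "\<phi> (r y) = \<phi> q"
      using arg_cong[OF eq, of hproj] ry(2) qh by simp
    then have "r y = q" "\<rho> y = t"
      using inj_onD[OF is_chartD(2)[OF max_atlas_chart[OF LocD(1)[OF L]]] _ ry(1) q(2)] eq
      by (auto simp: axis_eq_0_iff)
    then show ?thesis using y by blast
  qed
  define G where "G = {y. \<exists>b\<in>B. \<exists>U \<phi> O' V Q. Loc b U \<phi> O' V Q \<and> y \<in> U \<and> \<phi> y \<in> O'}"
  have oG: "openin (mtop W) G"
  proof (subst openin_subopen, safe)
    fix y assume "y \<in> G"
    then obtain b U \<phi> O' V Q where L: "b \<in> B" "Loc b U \<phi> O' V Q" "y \<in> U" "\<phi> y \<in> O'"
      unfolding G_def by blast
    then show "\<exists>T. openin (mtop W) T \<and> y \<in> T \<and> T \<subseteq> G"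
      using LocD(8)[OF L(2)] unfolding G_def by (intro exI[of _ "{y\<in>U. \<phi> y \<in> O'}"]) blast
  qed
  have BG: "B \<subseteq> G"
  proof
    fix b assume b: "b \<in> B"
    then obtain U \<phi> O' V Q where L: "Loc b U \<phi> O' V Q" using Loc_ex by blast
    then show "b \<in> G" unfolding G_def using b LocD(2,4)[OF L] by blast
  qed
  \<comment> \<open>The union of all open boxes on which the pair (r, \<rho>) separates points. It
    contains B \<times> B: near the diagonal by local injectivity, elsewhere because
    \<open>r\<close> is the identity on \<open>B\<close> and distinct points have disjoint
    neighbourhoods. The tube lemma for the compact set \<open>B\<close> then yields a box N1
    \<times> N2 around B \<times> B, which is global injectivity near the boundary.\<close>
  define Wset where "Wset = \<Union> {A \<times> A' | A A'. openin (mtop W) A \<and> openin (mtop W) A' \<and>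
     (\<forall>y\<in>A. \<forall>y'\<in>A'. r y = r y' \<and> \<rho> y = \<rho> y' \<longrightarrow> y = y')}"
  have "openin (prod_topology (mtop W) (mtop W)) Wset"
    unfolding Wset_def by (rule openin_Union) (auto simp: openin_prod_Times_iff)
  moreover have "B \<times> B \<subseteq> Wset"
  proof safe
    fix b b' assume b: "b \<in> B" "b' \<in> B"
    have "\<exists>A A'. openin (mtop W) A \<and> openin (mtop W) A' \<and> b \<in> A \<and> b' \<in> A' \<and>
       (\<forall>y\<in>A. \<forall>y'\<in>A'. r y = r y' \<and> \<rho> y = \<rho> y' \<longrightarrow> y = y')"
    proof (cases "b = b'")
      case True
      obtain U \<phi> O' V Q where L: "Loc b U \<phi> O' V Q" using Loc_ex b by blast
      have "y = y'" if "y \<in> U" "\<phi> y \<in> O'" "y' \<in> U" "\<phi> y' \<in> O'" "r y = r y'" "\<rho> y = \<rho> y'" for y y'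
      proof -
        have "\<phi> y = \<phi> y'" using Loc1[OF L that(1,2)] Loc1[OF L that(3,4)] that(5,6) by simp
        then show ?thesis
          using inj_onD[OF is_chartD(2)[OF max_atlas_chart[OF LocD(1)[OF L]]] _ that(1,3)] by simp
      qed
      then show ?thesis
        using LocD(2,4,8)[OF L] True
        by (intro exI[of _ "{y\<in>U. \<phi> y \<in> O'}"]) simp
    next
      case False
      have bX: "b \<in> X" "b' \<in> X" using b boundary_subset by auto
      then obtain E E' where E: "openin (mtop W) E" "openin (mtop W) E'" "b \<in> E" "b' \<in> E'" "disjnt E E'"
        using hausdorff False unfolding Hausdorff_space_def by metis
      have m: "map_near W X W r b" "map_near W X W r b'" using r b by (auto simp: retr_near_def)
      have rb: "r b \<in> E" "r b' \<in> E'" using rid b E by auto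
      obtain A where A: "openin (mtop W) A" "b \<in> A" "\<forall>y\<in>A. y \<in> X \<longrightarrow> r y \<in> E"
        by (rule map_near_continuous[OF smooth smooth m(1) bX(1) bX(1) E(1) rb(1)])
      obtain A' where A': "openin (mtop W) A'" "b' \<in> A'" "\<forall>y\<in>A'. y \<in> X \<longrightarrow> r y \<in> E'"
        by (rule map_near_continuous[OF smooth smooth m(2) bX(2) bX(2) E(2) rb(2)])
      have "r y \<noteq> r y'" if "y \<in> A" "y' \<in> A'" for y y'
      proof -
        have "r y \<in> E" "r y' \<in> E'"
          using A(3) A'(3) that openin_subset[OF A(1)] openin_subset[OF A'(1)] by blast+
        then show ?thesis using E(5) unfolding disjnt_iff by metis
      qed
      then show ?thesis using A A' by blast
    qed
    then show "(b, b') \<in> Wset" unfolding Wset_def by blast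
  qed
  ultimately obtain N1 N2 where N: "openin (mtop W) N1" "openin (mtop W) N2" "B \<subseteq> N1" "B \<subseteq> N2" "N1 \<times> N2 \<subseteq> Wset"
    using Wallace_theorem_prod_topology[OF compactin_boundary compactin_boundary] by metis
  have inj: "y = y'" if "y \<in> N1" "y' \<in> N2" "r y = r y'" "\<rho> y = \<rho> y'" for y y'
  proof -
    have "(y, y') \<in> Wset" using N(5) that by blast
    then show ?thesis using that(3,4) unfolding Wset_def by blast
  qed
  obtain \<epsilon>1 where e1: "0 < \<epsilon>1" "\<forall>p\<in>X. \<rho> p < \<epsilon>1 \<longrightarrow> p \<in> N1 \<inter> N2 \<inter> G"
    using small_values[OF \<rho>, of "N1 \<inter> N2 \<inter> G"] N oG BG by auto
  have "\<forall>b\<in>B. \<exists>d. openin (mtop W) (fst d) \<and> b \<in> fst d \<and> 0 < snd d \<and>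
      (\<forall>q\<in>fst d \<inter> B. \<forall>t. 0 \<le> t \<and> t < snd d \<longrightarrow> (\<exists>y\<in>X. r y = q \<and> \<rho> y = t))"
  proof
    fix b assume b: "b \<in> B"
    obtain U \<phi> O' V Q where L: "Loc b U \<phi> O' V Q" using Loc_ex b by blast
    obtain \<eta> where \<eta>: "0 < \<eta>" "ball (\<phi> b) \<eta> \<subseteq> V" using LocD(5,7)[OF L] open_contains_ball by blast
    \<comment> \<open>Half of the radius is spent on the base point and half on the height, so that
      their sum stays in \<open>V\<close>.\<close>
    let ?A = "{y\<in>U. \<phi> y \<in> ball (\<phi> b) (\<eta> / 2)}"
    have "\<exists>y\<in>X. r y = q \<and> \<rho> y = t" if q: "q \<in> ?A" "q \<in> B" and t: "0 \<le> t" "t < \<eta> / 2" for q t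
    proof -
      have "dist (\<phi> q) (\<phi> q + t *\<^sub>R bvec) = t" using t by (simp add: dist_norm)
      then have "dist (\<phi> b) (\<phi> q + t *\<^sub>R bvec) \<le> dist (\<phi> b) (\<phi> q) + t"
        using dist_triangle[of "\<phi> b" "\<phi> q + t *\<^sub>R bvec" "\<phi> q"] by simp
      then have "\<phi> q + t *\<^sub>R bvec \<in> V" using \<eta>(2) q t by (auto simp: subset_iff)
      then show ?thesis
        using Loc2[OF L q(2) _ _ t(1)] q(1) is_chartD(5)[OF max_atlas_chart[OF LocD(1)[OF L]]] by blast
    qed
    then have ex: "\<forall>q\<in>?A \<inter> B. \<forall>t. 0 \<le> t \<and> t < \<eta> / 2 \<longrightarrow> (\<exists>y\<in>X. r y = q \<and> \<rho> y = t)" by blast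
    have "openin (mtop W) ?A" by (rule chart_open[OF max_atlas_chart[OF LocD(1)[OF L]] open_ball])
    moreover have "b \<in> ?A" "0 < \<eta> / 2" using LocD(2)[OF L] \<eta>(1) by auto
    ultimately show "\<exists>d. openin (mtop W) (fst d) \<and> b \<in> fst d \<and> 0 < snd d \<and>
      (\<forall>q\<in>fst d \<inter> B. \<forall>t. 0 \<le> t \<and> t < snd d \<longrightarrow> (\<exists>y\<in>X. r y = q \<and> \<rho> y = t))"
      using ex by (intro exI[of _ "(?A, \<eta> / 2)"]) (simp only: fst_conv snd_conv)
  qed
  then obtain d where d: "\<forall>b\<in>B. openin (mtop W) (fst (d b)) \<and> b \<in> fst (d b) \<and> 0 < snd (d b) \<and>
      (\<forall>q\<in>fst (d b) \<inter> B. \<forall>t. 0 \<le> t \<and> t < snd (d b) \<longrightarrow> (\<exists>y\<in>X. r y = q \<and> \<rho> y = t))"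
    by (rule bchoice[THEN exE])
  have "\<exists>F. finite F \<and> F \<subseteq> (\<lambda>b. fst (d b)) ` B \<and> B \<subseteq> \<Union>F"
    by (rule compactinD[OF compactin_boundary]) (use d in auto)
  then obtain I where I: "finite I" "I \<subseteq> B" "B \<subseteq> (\<Union>b\<in>I. fst (d b))"
    by (metis (no_types, lifting) finite_subset_image)
  \<comment> \<open>The bound \<epsilon>1 secures injectivity; the heights \<open>snd (d b)\<close>
    secure that every fibre over \<open>B\<close> is hit, and there are only finitely many of
    them.\<close>
  define \<epsilon> where "\<epsilon> = Min (insert \<epsilon>1 ((\<lambda>b. snd (d b)) ` I))"
  have \<epsilon>: "0 < \<epsilon>" "\<epsilon> \<le> \<epsilon>1" "\<And>b. b \<in> I \<Longrightarrow> \<epsilon> \<le> snd (d b)"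
    using I d e1(1) by (auto simp: \<epsilon>_def)
  have surj: "\<exists>y\<in>X. r y = q \<and> \<rho> y = t" if "q \<in> B" "0 \<le> t" "t < \<epsilon>" for q t
  proof -
    obtain b where b: "b \<in> I" "q \<in> fst (d b)" using subsetD[OF I(3) \<open>q \<in> B\<close>] by blast
    have "t < snd (d b)" using \<epsilon>(3)[OF b(1)] that(3) by simp
    moreover have "b \<in> B" using b(1) I(2) by blast
    ultimately show ?thesis using d b(2) that(1,2) by blast
  qed
  have near: "p \<in> N1" "p \<in> N2" "p \<in> G" if "p \<in> X" "\<rho> p < \<epsilon>" for p
    using e1(2) that \<epsilon>(2) by auto
  have rp: "r p \<in> B" "map_near W X W r p" if "p \<in> X" "\<rho> p < \<epsilon>" for p
    using near(3)[OF that] Loc1 unfolding G_def by blast+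
  \<comment> \<open>The point at height t in the fibre of \<open>r\<close> through p. It exists by
    \<open>surj\<close> and is unique by \<open>inj\<close>, so identities for \<Theta> reduce to
    comparing values of \<open>r\<close> and \<rho>.\<close>
  define \<Theta> where "\<Theta> p t = (SOME y. y \<in> X \<and> r y = r p \<and> \<rho> y = t)" for p t
  have \<Theta>: "\<Theta> p t \<in> X" "r (\<Theta> p t) = r p" "\<rho> (\<Theta> p t) = t" if "p \<in> X" "\<rho> p < \<epsilon>" "0 < t" "t < \<epsilon>" for p t
  proof -
    have "\<exists>y. y \<in> X \<and> r y = r p \<and> \<rho> y = t" using surj[OF rp(1)[OF that(1,2)], of t] that by auto
    from someI_ex[OF this] show "\<Theta> p t \<in> X" "r (\<Theta> p t) = r p" "\<rho> (\<Theta> p t) = t"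
      unfolding \<Theta>_def by auto
  qed
  have uniq: "y = \<Theta> p t" if "p \<in> X" "\<rho> p < \<epsilon>" "0 < t" "t < \<epsilon>" "y \<in> X" "r y = r p" "\<rho> y = t" for p t y
  proof (rule inj)
    show "y \<in> N1" using near that by auto
    show "\<Theta> p t \<in> N2" using near(2) \<Theta>[OF that(1-4)] that by auto
  qed (use \<Theta>[OF that(1-4)] that in auto)
  have "collar W \<rho> \<epsilon> \<Theta>"
    unfolding collar_def
  proof (intro conjI ballI impI allI \<rho>(1) \<epsilon>(1))
    fix p assume p: "p \<in> X" "0 < \<rho> p \<and> \<rho> p < \<epsilon>"
    show "\<Theta> p (\<rho> p) = p" by (rule uniq[symmetric]) (use p in auto)
    fix t assume t: "0 < t \<and> t < \<epsilon>"
    have y0: "\<Theta> p t \<in> X" "r (\<Theta> p t) = r p" "\<rho> (\<Theta> p t) = t" using \<Theta>[of p t] p t by auto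
    then show "\<Theta> p t \<in> X" "\<rho> (\<Theta> p t) = t" by auto
    show "\<Theta> (\<Theta> p t) s = \<Theta> p s" if "0 < s \<and> s < \<epsilon>" for s
      by (rule uniq[symmetric]) (use \<Theta>[of p s] y0 p t that in auto)
    \<comment> \<open>The local collar is taken around the target point \<Theta> p t and not around
      p. It still applies to r p, because p and the target share this base point.\<close>
    obtain b U \<phi> O' V Q where L: "Loc b U \<phi> O' V Q" "\<Theta> p t \<in> U" "\<phi> (\<Theta> p t) \<in> O'"
      using near(3)[OF y0(1)] y0(3) t unfolding G_def by auto
    note L1 = Loc1[OF L]
    have rpU: "r p \<in> U" using L1 y0 by simp
    obtain A where A: "openin (mtop W) A" "p \<in> A" "\<forall>y\<in>A \<inter> X. r y \<in> U" and s: "smooth_near W X (\<lambda>y. \<phi> (r y)) p"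
      using rp(2)[of p] p LocD(1)[OF L(1)] rpU unfolding map_near_def by auto
    show "\<exists>V \<psi> T Q (R :: 'w \<Rightarrow> real^'n) A. (V, \<psi>) \<in> max_atlas W \<and> open T \<and> Cinf T Q \<and> smooth_near W X R p \<and>
            openin (mtop W) A \<and> p \<in> A \<and> R p + t *\<^sub>R bvec \<in> T \<and>
            (\<forall>y\<in>A. \<forall>s. 0 < \<rho> y \<and> \<rho> y < \<epsilon> \<and> 0 < s \<and> s < \<epsilon> \<and> R y + s *\<^sub>R bvec \<in> T \<longrightarrow>
               \<Theta> y s \<in> V \<and> \<psi> (\<Theta> y s) = Q (R y + s *\<^sub>R bvec))"
    proof (intro exI conjI ballI allI impI)
      show "(U, \<phi>) \<in> max_atlas W" "open V" "Cinf V Q" using LocD[OF L(1)] by auto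
      show "smooth_near W X (\<lambda>y. \<phi> (r y)) p" "openin (mtop W) A" "p \<in> A" by fact+
      show "\<phi> (r p) + t *\<^sub>R bvec \<in> V" using L1 y0 by simp
      fix y s assume y: "y \<in> A" and s: "0 < \<rho> y \<and> \<rho> y < \<epsilon> \<and> 0 < s \<and> s < \<epsilon> \<and> \<phi> (r y) + s *\<^sub>R bvec \<in> V"
      have yX: "y \<in> X" using y openin_subset[OF A(1)] by auto
      have "r y \<in> U" "r y \<in> B" using A(3) y yX rp(1)[OF yX] s by auto
      then obtain y' where y': "y' \<in> U" "\<phi> y' = Q (\<phi> (r y) + s *\<^sub>R bvec)" "r y' = r y" "\<rho> y' = s"
        using Loc2[OF L(1), of "r y" s] s by auto
      have "y' = \<Theta> y s"
        by (rule uniq) (use y' yX s is_chartD(5)[OF max_atlas_chart[OF LocD(1)[OF L(1)]]] in auto)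
      then show "\<Theta> y s \<in> U" "\<phi> (\<Theta> y s) = Q (\<phi> (r y) + s *\<^sub>R bvec)" using y' by auto
    qed
  qed
  moreover have "\<exists>p\<in>X. \<rho> p = t" if "B \<noteq> {}" "0 < t" "t < \<epsilon>" for t
  proof -
    obtain b where "b \<in> B" using \<open>B \<noteq> {}\<close> by blast
    then show ?thesis using surj[of b t] that by auto
  qed
  ultimately show ?thesis using that \<rho>(2,3) by blast
qed

end

section \<open>Transport of the collar from the interior of \<open>W\<close> to
  \<open>M\<close>\<close>

lemma smooth_map_near:
  assumes "smooth_manifold M" "smooth_manifold N" "smooth_map M N F" "p \<in> topspace (mtop M)"
  shows "map_near M (topspace (mtop M)) N F p"
proof -
  have cont: "continuous_map (mtop M) (mtop N) F" using assms(3) by (simp add: smooth_map_def)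
  then have "F p \<in> topspace (mtop N)" using assms(4) by (auto simp: continuous_map_def)
  then obtain V \<psi> where V: "(V, \<psi>) \<in> atlas N" "F p \<in> V" using atlas_cover[OF assms(2)] by blast
  obtain U \<phi> where U: "(U, \<phi>) \<in> atlas M" "p \<in> U" using atlas_cover[OF assms(1,4)] by blast
  have mU: "(U, \<phi>) \<in> max_atlas M" and mV: "(V, \<psi>) \<in> max_atlas N"
    using atlas_subset_max_atlas assms U V by blast+
  define A where "A = {x \<in> topspace (mtop M). F x \<in> V}"
  have oA: "openin (mtop M) A"
    unfolding A_def by (rule openin_continuous_map_preimage[OF cont is_chartD(1)[OF max_atlas_chart[OF mV]]])
  have "smooth_on (\<phi> ` {p \<in> U. F p \<in> V}) (\<psi> \<circ> F \<circ> inv_into U \<phi>)"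
    using assms(3) U V by (auto simp: smooth_map_def)
  then obtain T G where T: "open T" "\<phi> p \<in> T" "Cinf T G"
    "\<forall>y\<in>T. y \<in> \<phi> ` {p \<in> U. F p \<in> V} \<longrightarrow> G y = (\<psi> \<circ> F \<circ> inv_into U \<phi>) y"
    by (rule smooth_onD) (use U V in auto)
  have G: "G (\<phi> y) = \<psi> (F y)" if "y \<in> U" "y \<in> A" "\<phi> y \<in> T" for y
    using T(4) that is_chartD(2)[OF max_atlas_chart[OF mU]] by (auto simp: A_def)
  have "smooth_near M A (\<lambda>y. \<psi> (F y)) p"
    by (rule smooth_nearI[OF assms(1) mU U(2) T(1,2,3)]) (use G in auto)
  then have "smooth_near M (topspace (mtop M)) (\<lambda>y. \<psi> (F y)) p"
    by (rule smooth_near_cong[OF _ oA]) (use assms(4) V in \<open>auto simp: A_def\<close>)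
  then show ?thesis
    by (intro map_nearI[where F = F, OF assms(2,4) mV V(2) oA _ _ assms(1)]) (use assms(4) V in \<open>auto
        simp: A_def\<close>)
qed

context compact_bounded_manifold
begin

lemma interior_open: "openin (mtop W) (interior_pts W)"
  using closedin_boundary by (auto simp: interior_pts_def)

lemma interior_topspace: "topspace (mtop (interior_manifold W)) = interior_pts W"
  by (auto simp: interior_manifold_def interior_pts_def)

lemma interior_chart: "(U, \<phi>) \<in> atlas W \<Longrightarrow> (U \<inter> interior_pts W, \<phi>) \<in> atlas (interior_manifold W)"
  by (auto simp: interior_manifold_def)

text \<open>The charts of the interior are charts of \<open>W\<close> on smaller domains, and the
  interior is open, so a coordinate expression on the interior also serves in
  \<open>W\<close>.\<close>

lemma map_near_from_interior:
  assumes IW: "smooth_manifold (interior_manifold W)" and N: "smooth_manifold N"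
    and F: "smooth_map (interior_manifold W) N F" and p: "p \<in> interior_pts W"
  shows "map_near W X N F p"
proof -
  have 1: "map_near (interior_manifold W) (interior_pts W) N F p"
    using smooth_map_near[OF IW N F] p by (simp add: interior_topspace)
  have pX: "p \<in> X" using p by (simp add: interior_pts_def)
  have "F p \<in> topspace (mtop N)" using 1 by (simp add: map_near_def)
  then obtain V \<psi> where V: "(V, \<psi>) \<in> max_atlas N" "F p \<in> V" using max_atlas_cover[OF N] by blast
  obtain A where A: "openin (mtop (interior_manifold W)) A" "p \<in> A" "\<forall>y\<in>A \<inter> interior_pts W. F y \<in> V"
    and s: "smooth_near (interior_manifold W) (interior_pts W) (\<lambda>y. \<psi> (F y)) p"
    using 1 V unfolding map_near_def by auto
  have oA: "openin (mtop W) A"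
    using A(1) interior_open by (simp add: interior_manifold_def openin_open_subtopology)
  have AI: "A \<subseteq> interior_pts W" using openin_subset[OF A(1)] interior_topspace by simp
  obtain U \<phi> where U: "(U, \<phi>) \<in> atlas W" "p \<in> U" using atlas_cover[OF smooth pX] by blast
  have mU: "(U, \<phi>) \<in> max_atlas W" using atlas_subset_max_atlas[OF smooth U(1)] .
  have mI: "(U \<inter> interior_pts W, \<phi>) \<in> max_atlas (interior_manifold W)"
    using atlas_subset_max_atlas[OF IW interior_chart[OF U(1)]] .
  have pI: "p \<in> U \<inter> interior_pts W" using U p by simp
  obtain T G where T: "open T" "\<phi> p \<in> T" "Cinf T G"
    "\<forall>y\<in>U \<inter> interior_pts W. y \<in> interior_pts W \<longrightarrow> \<phi> y \<in> T \<longrightarrow> G (\<phi> y) = \<psi> (F y)"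
    by (rule smooth_nearD[OF s mI pI])
  have "smooth_near W (interior_pts W) (\<lambda>y. \<psi> (F y)) p"
    by (rule smooth_nearI[OF smooth mU U(2) T(1,2,3)]) (use T(4) in auto)
  then have "smooth_near W X (\<lambda>y. \<psi> (F y)) p"
    by (rule smooth_near_cong[OF _ interior_open]) (use p in auto)
  then show ?thesis
    by (intro map_nearI[where F = F, OF N pX V oA A(2) _ smooth]) (use A AI in auto)
qed

lemma map_near_to_interior:
  assumes IW: "smooth_manifold (interior_manifold W)" and M: "smooth_manifold M"
    and F: "smooth_map M (interior_manifold W) F" and p: "p \<in> topspace (mtop M)"
  shows "map_near M (topspace (mtop M)) W F p"
proof -
  have 1: "map_near M (topspace (mtop M)) (interior_manifold W) F p"
    by (rule smooth_map_near[OF M IW F p])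
  then have FpI: "F p \<in> interior_pts W" by (simp add: map_near_def interior_topspace)
  then have "F p \<in> X" by (simp add: interior_pts_def)
  then obtain U \<phi> where U: "(U, \<phi>) \<in> atlas W" "F p \<in> U" using atlas_cover[OF smooth] by blast
  have mU: "(U, \<phi>) \<in> max_atlas W" using atlas_subset_max_atlas[OF smooth U(1)] .
  have mI: "(U \<inter> interior_pts W, \<phi>) \<in> max_atlas (interior_manifold W)"
    using atlas_subset_max_atlas[OF IW interior_chart[OF U(1)]] .
  then obtain A where A: "openin (mtop M) A" "p \<in> A" "\<forall>y\<in>A \<inter> topspace (mtop M). F y \<in> U \<inter> interior_pts W"
    and s: "smooth_near M (topspace (mtop M)) (\<lambda>y. \<phi> (F y)) p"
    using 1 U(2) FpI unfolding map_near_def by blast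
  show ?thesis
    by (rule map_nearI[where F = F, OF smooth p mU U(2) A(1,2) _ M s]) (use A(3) in auto)
qed

text \<open>Since \<rho> is positive on the curves of the collar, they stay in the interior, where D
  and E are mutually inverse. The factorisation that expresses joint smoothness is transported by
  precomposing \<open>R\<close> with D and postcomposing \<open>Q\<close> with a coordinate
  expression of E near the target point.\<close>

lemma transport_collar:
  fixes M :: "('a, 'n) manifold"
  assumes IW: "smooth_manifold (interior_manifold W)" and M: "smooth_manifold M"
    and D: "smooth_map M (interior_manifold W) D" and E: "smooth_map (interior_manifold W) M E"
    and ED: "\<forall>p\<in>topspace (mtop M). E (D p) = p" and DE: "\<forall>q\<in>topspace (mtop (interior_manifold W)). D (E q) = q"
    and collar: "collar W \<rho> \<epsilon> \<Theta>" and \<rho>0: "\<forall>p\<in>X. \<rho> p = 0 \<longleftrightarrow> p \<in> B"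
  shows "collar M (\<lambda>p. \<rho> (D p)) \<epsilon> (\<lambda>p t. E (\<Theta> (D p) t))"
proof -
  let ?Y = "topspace (mtop M)"
  have mD: "map_near M ?Y W D p" if "p \<in> ?Y" for p by (rule map_near_to_interior[OF IW M D that])
  have DI: "D p \<in> interior_pts W" "D p \<in> X" if "p \<in> ?Y" for p
    using D that by (auto simp: smooth_map_def continuous_map_def interior_manifold_def interior_pts_def)
  have EY: "E y \<in> ?Y" "D (E y) = y" if "y \<in> interior_pts W" for y
    using E DE that interior_topspace by (auto simp: smooth_map_def continuous_map_def)
  have smD: "smooth_near M ?Y (\<lambda>y. k (D y)) p" if "p \<in> ?Y" "smooth_near W X k (D p)" for p and k :: "'w \<Rightarrow>
      'c::euclidean_space"
    by (rule map_near_compose[OF M smooth mD[OF that(1)] that(1,2) DI(2)[OF that(1)] openin_topspace that(1)])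
      (use DI in auto)
  have c: "smooth_fun W \<rho>" "0 < \<epsilon>" using collar by (auto simp: collar_def)
  have int: "y \<in> interior_pts W" if "y \<in> X" "0 < \<rho> y" for y
    using that \<rho>0 by (auto simp: interior_pts_def)
  have "smooth_fun M (\<lambda>p. \<rho> (D p))"
    unfolding smooth_fun_iff[OF M] using smD smooth_near_fun[OF c(1)] DI by blast
  moreover have "E (\<Theta> (D p) (\<rho> (D p))) = p \<and> (\<forall>t. 0 < t \<and> t < \<epsilon> \<longrightarrow> E (\<Theta> (D p) t) \<in> ?Y \<and> \<rho> (D (E (\<Theta> (D p)
      t))) = t \<and>
         (\<forall>s. 0 < s \<and> s < \<epsilon> \<longrightarrow> E (\<Theta> (D (E (\<Theta> (D p) t))) s) = E (\<Theta> (D p) s)) \<and>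
         (\<exists>V \<psi> T Q (R :: 'a \<Rightarrow> real^'n) A. (V, \<psi>) \<in> max_atlas M \<and> open T \<and> Cinf T Q \<and> smooth_near M ?Y R p \<and>
            openin (mtop M) A \<and> p \<in> A \<and> R p + t *\<^sub>R bvec \<in> T \<and>
            (\<forall>y\<in>A. \<forall>s. 0 < \<rho> (D y) \<and> \<rho> (D y) < \<epsilon> \<and> 0 < s \<and> s < \<epsilon> \<and> R y + s *\<^sub>R bvec \<in> T \<longrightarrow>
               E (\<Theta> (D y) s) \<in> V \<and> \<psi> (E (\<Theta> (D y) s)) = Q (R y + s *\<^sub>R bvec))))"
    if p: "p \<in> ?Y" "0 < \<rho> (D p)" "\<rho> (D p) < \<epsilon>" for p
  proof (intro conjI allI impI)
    have all: "\<Theta> q (\<rho> q) = q \<and>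
       (\<forall>t. 0 < t \<and> t < \<epsilon> \<longrightarrow> \<Theta> q t \<in> X \<and> \<rho> (\<Theta> q t) = t \<and>
         (\<forall>s. 0 < s \<and> s < \<epsilon> \<longrightarrow> \<Theta> (\<Theta> q t) s = \<Theta> q s) \<and>
         (\<exists>V \<psi> T Q (R :: 'w \<Rightarrow> real^'n) A. (V, \<psi>) \<in> max_atlas W \<and> open T \<and> Cinf T Q \<and> smooth_near W X R q \<and>
            openin (mtop W) A \<and> q \<in> A \<and> R q + t *\<^sub>R bvec \<in> T \<and>
            (\<forall>y\<in>A. \<forall>s. 0 < \<rho> y \<and> \<rho> y < \<epsilon> \<and> 0 < s \<and> s < \<epsilon> \<and> R y + s *\<^sub>R bvec \<in> T \<longrightarrow>
               \<Theta> y s \<in> V \<and> \<psi> (\<Theta> y s) = Q (R y + s *\<^sub>R bvec))))" if "q \<in> X" "0 < \<rho> q" "\<rho> q < \<epsilon>" for q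
      using collar that by (simp add: collar_def)
    note this_p = all[OF DI(2)[OF p(1)] p(2,3)]
    show "E (\<Theta> (D p) (\<rho> (D p))) = p" using this_p ED p by simp
    fix t assume t: "0 < t \<and> t < \<epsilon>"
    define y0 where "y0 = \<Theta> (D p) t"
    have y0: "y0 \<in> X" "\<rho> y0 = t" "y0 \<in> interior_pts W" using this_p t int[of y0] by (auto simp: y0_def)
    show "E (\<Theta> (D p) t) \<in> ?Y" "\<rho> (D (E (\<Theta> (D p) t))) = t" using EY y0 by (auto simp: y0_def)
    show "E (\<Theta> (D (E (\<Theta> (D p) t))) s) = E (\<Theta> (D p) s)" if "0 < s \<and> s < \<epsilon>" for s
      using EY(2)[OF y0(3)] this_p t that by (auto simp: y0_def)
    obtain V \<psi> T Q and R :: "'w \<Rightarrow> real^'n" and A where V: "(V, \<psi>) \<in> max_atlas W" and Q: "open T" "Cinf T Q"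
      and R: "smooth_near W X R (D p)" and A: "openin (mtop W) A" "D p \<in> A" and RT: "R (D p) + t *\<^sub>R bvec \<in> T"
      and \<Theta>Q: "\<forall>y\<in>A. \<forall>s. 0 < \<rho> y \<and> \<rho> y < \<epsilon> \<and> 0 < s \<and> s < \<epsilon> \<and> R y + s *\<^sub>R bvec \<in> T \<longrightarrow>
               \<Theta> y s \<in> V \<and> \<psi> (\<Theta> y s) = Q (R y + s *\<^sub>R bvec)"
      using this_p t by blast
    have y0V: "y0 \<in> V" "\<psi> y0 = Q (R (D p) + t *\<^sub>R bvec)" using \<Theta>Q A RT p t by (auto simp: y0_def)
    have mE: "map_near W X M E y0" by (rule map_near_from_interior[OF IW M E y0(3)])
    obtain V' \<psi>' where V': "(V', \<psi>') \<in> max_atlas M" "E y0 \<in> V'" using max_atlas_cover[OF M EY(1)[OF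
        y0(3)]] by blast
    obtain A1 where A1: "openin (mtop W) A1" "y0 \<in> A1" "\<forall>y\<in>A1 \<inter> X. E y \<in> V'"
      and sE: "smooth_near W X (\<lambda>y. \<psi>' (E y)) y0"
      using mE V' unfolding map_near_def by auto
    obtain T1 F where T1: "open T1" "\<psi> y0 \<in> T1" "Cinf T1 F" "\<forall>y\<in>V. y \<in> X \<longrightarrow> \<psi> y \<in> T1 \<longrightarrow> F (\<psi> y) = \<psi>' (E y)"
      by (rule smooth_nearD[OF sE V y0V(1)])
    obtain T2 where T2: "open T2" "\<psi> y0 \<in> T2" "\<forall>y\<in>V. \<psi> y \<in> T2 \<longrightarrow> y \<in> A1"
      by (rule chart_nbhd[OF max_atlas_chart[OF V] A1(1) y0V(1) A1(2)])
    let ?T = "T \<inter> Q -` (T1 \<inter> T2)"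
    have CT: "open ?T" "Cinf ?T (\<lambda>x. F (Q x))"
      using Cinf_compose_Int[OF Q(1) open_Int[OF T1(1) T2(1)] Q(2) Cinf_subset[OF T1(3)]] by auto
    show "\<exists>V \<psi> T Q (R :: 'a \<Rightarrow> real^'n) A. (V, \<psi>) \<in> max_atlas M \<and> open T \<and> Cinf T Q \<and> smooth_near M ?Y R p \<and>
            openin (mtop M) A \<and> p \<in> A \<and> R p + t *\<^sub>R bvec \<in> T \<and>
            (\<forall>y\<in>A. \<forall>s. 0 < \<rho> (D y) \<and> \<rho> (D y) < \<epsilon> \<and> 0 < s \<and> s < \<epsilon> \<and> R y + s *\<^sub>R bvec \<in> T \<longrightarrow>
               E (\<Theta> (D y) s) \<in> V \<and> \<psi> (E (\<Theta> (D y) s)) = Q (R y + s *\<^sub>R bvec))"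
    proof (intro exI conjI ballI allI impI)
      show "(V', \<psi>') \<in> max_atlas M" "open ?T" "Cinf ?T (\<lambda>x. F (Q x))" by fact+
      show "smooth_near M ?Y (\<lambda>y. R (D y)) p" by (rule smD[OF p(1) R])
      show "openin (mtop M) {y \<in> ?Y. D y \<in> A}"
      proof -
        have "continuous_map (mtop M) (mtop W) D"
          using D by (simp add: smooth_map_def interior_manifold_def continuous_map_in_subtopology)
        then show ?thesis using A(1) by (rule openin_continuous_map_preimage)
      qed
      show "p \<in> {y \<in> ?Y. D y \<in> A}" using p A by simp
      show "R (D p) + t *\<^sub>R bvec \<in> ?T" using RT y0V T1 T2 by auto
      fix y s assume y: "y \<in> {y \<in> ?Y. D y \<in> A}"
        and s: "0 < \<rho> (D y) \<and> \<rho> (D y) < \<epsilon> \<and> 0 < s \<and> s < \<epsilon> \<and> R (D y) + s *\<^sub>R bvec \<in> ?T"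
      have 1: "\<Theta> (D y) s \<in> V" "\<psi> (\<Theta> (D y) s) = Q (R (D y) + s *\<^sub>R bvec)" using \<Theta>Q y s by auto
      have "\<Theta> (D y) s \<in> X" using all[of "D y"] y s DI by auto
      then show "E (\<Theta> (D y) s) \<in> V'" "\<psi>' (E (\<Theta> (D y) s)) = F (Q (R (D y) + s *\<^sub>R bvec))"
        using 1 T1(4) T2(3) A1(3) s by auto
    qed
  qed
  ultimately show ?thesis unfolding collar_def using c(2) by blast
qed

text \<open>A set {c \<le> \<rho>} with c > 0 is closed in the compact \<open>W\<close> and misses
  the boundary, hence is a compact subset of the interior and is carried to a compact subset of
  \<open>M\<close>.\<close>

lemma end_collar:
  fixes M :: "('a, 'n) manifold"
  assumes diffeo: "diffeomorphic M (interior_manifold W)" and "B \<noteq> {}"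
  obtains \<rho> \<epsilon> \<Theta> where "collar M \<rho> \<epsilon> \<Theta>" "\<forall>p\<in>topspace (mtop M). 0 < \<rho> p"
    "\<forall>c>0. compactin (mtop M) {p\<in>topspace (mtop M). c \<le> \<rho> p}"
    "\<forall>t. 0 < t \<and> t < \<epsilon> \<longrightarrow> (\<exists>p\<in>topspace (mtop M). \<rho> p = t)"
proof -
  obtain \<rho> \<epsilon> \<Theta> where c: "collar W \<rho> \<epsilon> \<Theta>" and \<rho>: "\<forall>p\<in>X. 0 \<le> \<rho> p" "\<forall>p\<in>X. \<rho> p = 0 \<longleftrightarrow> p \<in> B"
    and ex: "\<forall>t. B \<noteq> {} \<and> 0 < t \<and> t < \<epsilon> \<longrightarrow> (\<exists>p\<in>X. \<rho> p = t)"
    by (rule collar_exists)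
  obtain D E where IW: "smooth_manifold (interior_manifold W)" and M: "smooth_manifold M"
    and D: "smooth_map M (interior_manifold W) D" and E: "smooth_map (interior_manifold W) M E"
    and ED: "\<forall>p\<in>topspace (mtop M). E (D p) = p" and DE: "\<forall>q\<in>topspace (mtop (interior_manifold W)). D (E q) = q"
    using diffeo unfolding diffeomorphic_def by blast
  let ?Y = "topspace (mtop M)"
  have DI: "D p \<in> interior_pts W" "D p \<in> X" if "p \<in> ?Y" for p
    using D that by (auto simp: smooth_map_def continuous_map_def interior_manifold_def interior_pts_def)
  have EY: "E y \<in> ?Y" "D (E y) = y" if "y \<in> interior_pts W" for y
    using E DE that interior_topspace by (auto simp: smooth_map_def continuous_map_def)
  have int: "y \<in> interior_pts W \<longleftrightarrow> 0 < \<rho> y" if "y \<in> X" for y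
    using that \<rho> by (auto simp: interior_pts_def less_le)
  show ?thesis
  proof (rule that[OF transport_collar[OF IW M D E ED DE c \<rho>(2)]])
    show "\<forall>p\<in>?Y. 0 < \<rho> (D p)" using DI int by blast
    show "\<forall>t. 0 < t \<and> t < \<epsilon> \<longrightarrow> (\<exists>p\<in>?Y. \<rho> (D p) = t)"
    proof (intro allI impI)
      fix t assume t: "0 < t \<and> t < \<epsilon>"
      then obtain y where y: "y \<in> X" "\<rho> y = t" using ex \<open>B \<noteq> {}\<close> by blast
      then have "y \<in> interior_pts W" using int t by simp
      then show "\<exists>p\<in>?Y. \<rho> (D p) = t" using EY y by (intro bexI[of _ "E y"]) auto
    qed
    show "\<forall>c>0. compactin (mtop M) {p\<in>?Y. c \<le> \<rho> (D p)}"
    proof (intro allI impI)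
      fix c :: real assume "0 < c"
      let ?C = "{y\<in>X. \<rho> y \<in> {c..}}"
      have "continuous_map (mtop W) euclidean \<rho>"
        using smooth_fun_continuous_map[OF smooth] c by (simp add: collar_def)
      then have "closedin (mtop W) ?C" by (rule closedin_continuous_map_preimage) simp
      then have "compactin (mtop W) ?C" using closedin_compact_space[OF compact] by blast
      moreover have CI: "?C \<subseteq> interior_pts W" using int \<open>0 < c\<close> by auto
      ultimately have "compactin (mtop (interior_manifold W)) ?C"
        by (simp add: interior_manifold_def compactin_subtopology)
      then have "compactin (mtop M) (E ` ?C)"
        by (rule image_compactin) (use E in \<open>simp add: smooth_map_def\<close>)
      moreover have "E ` ?C = {p\<in>?Y. c \<le> \<rho> (D p)}"
      proof (intro equalityI subsetI)
        fix p assume "p \<in> E ` ?C"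
        then obtain y where "p = E y" "y \<in> ?C" by blast
        then have "y \<in> interior_pts W" "c \<le> \<rho> y" "p = E y" using CI by auto
        then show "p \<in> {p\<in>?Y. c \<le> \<rho> (D p)}" using EY by auto
      next
        fix p assume p: "p \<in> {p\<in>?Y. c \<le> \<rho> (D p)}"
        then have "p = E (D p)" "D p \<in> ?C" using DI ED by auto
        then show "p \<in> E ` ?C" by blast
      qed
      ultimately show "compactin (mtop M) {p\<in>?Y. c \<le> \<rho> (D p)}" by simp
    qed
  qed
qed

end

subsection \<open>Tangent vectors as directional derivatives in a chart\<close>

definition dvec :: "('a, 'n::finite) manifold \<Rightarrow> ('a, 'n) chart \<Rightarrow> 'a \<Rightarrow> real^'n \<Rightarrow> 'a tvec" where
  "dvec M = (\<lambda>(U, \<phi>) p v h.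
     if smooth_fun M h then frechet_derivative (h \<circ> inv_into U \<phi>) (at (\<phi> p)) v else 0)"

lemma coord_vec_dvec: "coord_vec M c p i = dvec M c p (axis i 1)"
  by (cases c) (simp add: coord_vec_def dvec_def fun_eq_iff)

locale boundaryless =
  fixes M :: "('a, 'n::finite) manifold"
  assumes boundaryless: "manifold_without_boundary M"
begin

abbreviation "X \<equiv> topspace (mtop M)"

lemma smooth: "smooth_manifold M" and model: "model M = UNIV"
  using boundaryless by (auto simp: manifold_without_boundary_def)

lemma open_chart_image: "(U, \<phi>) \<in> max_atlas M \<Longrightarrow> open (\<phi> ` U)"
  using is_chartD(4)[OF max_atlas_chart] model by fastforce

lemma chart_subset: "(U, \<phi>) \<in> max_atlas M \<Longrightarrow> U \<subseteq> X"
  using is_chartD(5)[OF max_atlas_chart] .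

lemma chart_inj: "(U, \<phi>) \<in> max_atlas M \<Longrightarrow> inj_on \<phi> U"
  using is_chartD(2)[OF max_atlas_chart] .

lemma chart_inv: "(U, \<phi>) \<in> max_atlas M \<Longrightarrow> y \<in> U \<Longrightarrow> inv_into U \<phi> (\<phi> y) = y"
  using chart_inj by simp

lemma smooth_fun_near: "smooth_fun M h \<longleftrightarrow> (\<forall>p\<in>X. smooth_near M X h p)"
  by (rule smooth_fun_iff[OF smooth])

lemma local_rep:
  fixes h :: "'a \<Rightarrow> 'b::real_normed_vector"
  assumes U: "(U, \<phi>) \<in> max_atlas M" "p \<in> U" and h: "smooth_near M X h p"
  obtains T where "open T" "\<phi> p \<in> T" "T \<subseteq> \<phi> ` U" "Cinf T (h \<circ> inv_into U \<phi>)"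
proof -
  obtain T F where T: "open T" "\<phi> p \<in> T" "Cinf T F" "\<forall>y\<in>U. y \<in> X \<longrightarrow> \<phi> y \<in> T \<longrightarrow> F (\<phi> y) = h y"
    by (rule smooth_nearD[OF h U])
  have o: "open (T \<inter> \<phi> ` U)" using T(1) open_chart_image[OF U(1)] by blast
  have "Cinf (T \<inter> \<phi> ` U) (h \<circ> inv_into U \<phi>)"
    by (rule Cinf_cong[OF o _ Cinf_subset[OF T(3)]])
      (use T(4) chart_inv[OF U(1)] chart_subset[OF U(1)] in auto)
  then show ?thesis using that[OF o] T(2) U(2) by auto
qed

lemma global_rep:
  fixes h :: "'a \<Rightarrow> 'b::real_normed_vector"
  assumes U: "(U, \<phi>) \<in> max_atlas M" and h: "\<forall>p\<in>U. smooth_near M X h p"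
  shows "Cinf (\<phi> ` U) (h \<circ> inv_into U \<phi>)"
proof (rule Cinf_locally)
  fix x assume "x \<in> \<phi> ` U"
  then obtain p where p: "p \<in> U" "x = \<phi> p" by auto
  obtain T where "open T" "\<phi> p \<in> T" "T \<subseteq> \<phi> ` U" "Cinf T (h \<circ> inv_into U \<phi>)"
    by (rule local_rep[OF U p(1) bspec[OF h p(1)]])
  then show "\<exists>T. open T \<and> x \<in> T \<and> Cinf T (h \<circ> inv_into U \<phi>)" using p by auto
qed

lemma fun_rep:
  assumes U: "(U, \<phi>) \<in> max_atlas M" and h: "smooth_fun M h"
  shows "Cinf (\<phi> ` U) (h \<circ> inv_into U \<phi>)"
  by (rule global_rep[OF U]) (use h smooth_fun_near chart_subset[OF U] in auto)

lemma rep_derivative: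
  assumes "(U, \<phi>) \<in> max_atlas M" "smooth_fun M h" "p \<in> U"
  shows "((h \<circ> inv_into U \<phi>) has_derivative frechet_derivative (h \<circ> inv_into U \<phi>) (at (\<phi> p))) (at (\<phi> p))"
  by (rule Cinf_has_derivative[OF fun_rep[OF assms(1,2)]]) (use assms(3) in auto)

lemma smooth_fun_add: "smooth_fun M h \<Longrightarrow> smooth_fun M k \<Longrightarrow> smooth_fun M (h + k)"
  unfolding smooth_fun_near plus_fun_def by (intro ballI smooth_near_add) auto

lemma smooth_fun_mult: "smooth_fun M h \<Longrightarrow> smooth_fun M k \<Longrightarrow> smooth_fun M (h * k)"
  unfolding smooth_fun_near times_fun_def by (intro ballI smooth_near_mult) auto

lemma smooth_fun_cmult: "smooth_fun M h \<Longrightarrow> smooth_fun M (\<lambda>x. c * h x)"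
  unfolding smooth_fun_near by (intro ballI smooth_near_mult smooth_near_const) auto

lemma smooth_fun_sum: "(\<And>i. i \<in> I \<Longrightarrow> smooth_fun M (F i)) \<Longrightarrow> smooth_fun M (\<lambda>x. \<Sum>i\<in>I. F i x)"
  unfolding smooth_fun_near by (intro ballI smooth_near_sum) auto

lemma tangent_spaceD:
  assumes "t \<in> tangent_space M p"
  shows "\<not> smooth_fun M h \<Longrightarrow> t h = 0"
    "smooth_fun M h \<Longrightarrow> smooth_fun M k \<Longrightarrow> t (h + k) = t h + t k"
    "smooth_fun M h \<Longrightarrow> t (\<lambda>x. c * h x) = c * t h"
    "smooth_fun M h \<Longrightarrow> smooth_fun M k \<Longrightarrow> t (h * k) = h p * t k + k p * t h"
  using assms by (auto simp: tangent_space_def)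

lemma tangent_sum:
  assumes t: "t \<in> tangent_space M p"
  shows "(\<And>i. i \<in> I \<Longrightarrow> smooth_fun M (F i)) \<Longrightarrow> t (\<lambda>x. \<Sum>i\<in>I. F i x) = (\<Sum>i\<in>I. t (F i))"
proof (induction I rule: infinite_finite_induct)
  case (insert i I)
  have "t (F i + (\<lambda>x. \<Sum>i\<in>I. F i x)) = t (F i) + t (\<lambda>x. \<Sum>i\<in>I. F i x)"
    by (rule tangent_spaceD(2)[OF t]) (use insert in \<open>auto intro: smooth_fun_sum\<close>)
  then show ?case using insert by (simp add: plus_fun_def)
qed (use tangent_spaceD(3)[OF t, of "\<lambda>x. 0" 0] in \<open>auto simp: smooth_fun_near smooth_near_const\<close>)

lemma tangent_subspace: "tangent.subspace (tangent_space M p)"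
  unfolding tangent.subspace_def tangent_space_def
  by (auto simp: tscale_def algebra_simps)

lemma dvec_apply: "smooth_fun M h \<Longrightarrow> dvec M (U, \<phi>) p v h = frechet_derivative (h \<circ> inv_into U \<phi>) (at (\<phi> p)) v"
  by (simp add: dvec_def)

lemma dvec_tangent:
  assumes U: "(U, \<phi>) \<in> max_atlas M" "p \<in> U"
  shows "dvec M (U, \<phi>) p v \<in> tangent_space M p"
proof -
  let ?D = "\<lambda>h. frechet_derivative (h \<circ> inv_into U \<phi>) (at (\<phi> p))"
  note d = rep_derivative[OF U(1) _ U(2)]
  have add: "?D (h + k) = (\<lambda>v. ?D h v + ?D k v)" if "smooth_fun M h" "smooth_fun M k" for h k
    by (rule frechet_derivative_at[symmetric])
      (use has_derivative_add[OF d[OF that(1)] d[OF that(2)]] in \<open>simp add: o_def plus_fun_def\<close>)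
  have scale: "?D (\<lambda>x. c * h x) = (\<lambda>v. c * ?D h v)" if "smooth_fun M h" for c h
    by (rule frechet_derivative_at[symmetric])
      (use has_derivative_mult_right[OF d[OF that], of c] in \<open>simp add: o_def\<close>)
  have mult: "?D (h * k) = (\<lambda>v. h p * ?D k v + k p * ?D h v)" if "smooth_fun M h" "smooth_fun M k" for h k
    by (rule frechet_derivative_at[symmetric])
      (use has_derivative_mult[OF d[OF that(1)] d[OF that(2)]] chart_inv[OF U] in
        \<open>simp add: o_def times_fun_def mult.commute\<close>)
  show ?thesis
    unfolding tangent_space_def
    using add scale mult smooth_fun_add smooth_fun_mult smooth_fun_cmult
    by (auto simp: dvec_def)
qed

lemma dvec_linear:
  assumes U: "(U, \<phi>) \<in> max_atlas M" "p \<in> U"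
  shows "dvec M (U, \<phi>) p (a *\<^sub>R v + b *\<^sub>R w) = tscale a (dvec M (U, \<phi>) p v) + tscale b (dvec M (U, \<phi>) p w)"
proof
  fix h
  show "dvec M (U, \<phi>) p (a *\<^sub>R v + b *\<^sub>R w) h = (tscale a (dvec M (U, \<phi>) p v) + tscale b (dvec M (U, \<phi>) p w)) h"
  proof (cases "smooth_fun M h")
    case True
    have "linear (frechet_derivative (h \<circ> inv_into U \<phi>) (at (\<phi> p)))"
      using rep_derivative[OF U(1) True U(2)] has_derivative_linear by blast
    then show ?thesis using True by (simp add: dvec_def tscale_def linear_add linear_scale)
  qed (simp add: dvec_def tscale_def)
qed

lemma chart_bump:
  assumes U: "(U, \<phi>) \<in> max_atlas M" "p \<in> U"
  obtains lam K r A where "0 < r" "ball (\<phi> p) r \<subseteq> \<phi> ` U" "smooth_fun M lam" "closedin (mtop M) K"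
    "K \<subseteq> U" "\<forall>y\<in>K. \<phi> y \<in> ball (\<phi> p) r" "\<forall>y. y \<notin> K \<longrightarrow> lam y = 0" "openin (mtop M) A" "p \<in> A" "A \<subseteq> K" "\<forall>y\<in>A.
        lam y = 1"
proof -
  have "\<phi> p \<in> \<phi> ` U" using U by simp
  then obtain r where r: "0 < r" "ball (\<phi> p) r \<subseteq> \<phi> ` U"
    using open_chart_image[OF U(1)] open_contains_ball by blast
  let ?A = "{y\<in>U. \<phi> y \<in> ball (\<phi> p) r}"
  have A: "openin (mtop M) ?A" "p \<in> ?A"
    using chart_open[OF max_atlas_chart[OF U(1)] open_ball] U r by auto
  have cl: "closed (model M)" by (simp add: model)
  obtain lam K A' where l: "smooth_fun M lam" "\<forall>y. 0 \<le> lam y" "\<forall>y. lam y \<le> 1"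
    "openin (mtop M) A'" "p \<in> A'" "\<forall>y\<in>A'. lam y = 1" "A' \<subseteq> K"
    "closedin (mtop M) K" "K \<subseteq> ?A" "\<forall>y. y \<notin> K \<longrightarrow> lam y = 0"
    by (rule manifold_bump[OF smooth cl A])
  show ?thesis by (rule that[OF r l(1,8) _ _ l(10,4,5,7,6)]) (use l(9) in auto)
qed

text \<open>Hadamard's lemma writes a function as a constant plus products of coordinate differences
  with smooth factors; a derivation at p sees only the values of those factors at p. The local
  formula is cut off by bump functions because derivations act on globally defined
  functions.\<close>

lemma tangent_eq_dvec:
  assumes U: "(U, \<phi>) \<in> max_atlas M" "p \<in> U" and t: "t \<in> tangent_space M p"
  obtains v where "t = dvec M (U, \<phi>) p v"
proof -
  obtain lam K r A where r: "0 < r" "ball (\<phi> p) r \<subseteq> \<phi> ` U" and lam: "smooth_fun M lam" and K: "closedin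
      (mtop M) K"
    "K \<subseteq> U" "\<forall>y\<in>K. \<phi> y \<in> ball (\<phi> p) r" and l0: "\<forall>y. y \<notin> K \<longrightarrow> lam y = 0"
    and A: "openin (mtop M) A" "p \<in> A" "A \<subseteq> K" "\<forall>y\<in>A. lam y = 1"
    by (rule chart_bump[OF U])
  have KX: "K \<subseteq> X" using closedin_subset[OF K(1)] .
  have lp: "lam p = 1" using A by auto
  define Y where "Y i y = lam y * (\<phi> y $ i - \<phi> p $ i)" for i y
  have sY: "smooth_fun M (Y i)" for i
    unfolding Y_def
  proof (rule smooth_fun_bump_mult[OF smooth lam K(1) l0])
    fix q assume q: "q \<in> K"
    show "smooth_near M X (\<lambda>y. \<phi> y $ i - \<phi> p $ i) q"
      using q K(2) KX by (intro smooth_near_diff smooth_near_const smooth_near_linear[OF _ _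
          bounded_linear_vec_nth]
          smooth_near_chart[OF smooth U(1)]) auto
  qed
  define v where "v = (\<chi> i. t (Y i))"
  have "t h = dvec M (U, \<phi>) p v h" for h
  proof (cases "smooth_fun M h")
    case False
    then show ?thesis using tangent_spaceD(1)[OF t] by (simp add: dvec_def)
  next
    case True
    define f where "f = h \<circ> inv_into U \<phi>"
    have hf: "h y = f (\<phi> y)" if "y \<in> U" for y using chart_inv[OF U(1) that] by (simp add: f_def)
    have Cf: "Cinf (ball (\<phi> p) r) f" unfolding f_def by (rule Cinf_subset[OF fun_rep[OF U(1) True] r(2)])
    obtain G where G: "\<And>i. Cinf (ball (\<phi> p) r) (G i)"
      "\<And>x. x \<in> ball (\<phi> p) r \<Longrightarrow> f x = f (\<phi> p) + (\<Sum>i\<in>UNIV. (x $ i - \<phi> p $ i) * G i x)"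
      "\<And>i. 0 < r \<Longrightarrow> G i (\<phi> p) = frechet_derivative f (at (\<phi> p)) (axis i 1)"
      using Hadamard[OF Cf] by blast
    define Z where "Z i y = lam y * G i (\<phi> y)" for i y
    have sZ: "smooth_fun M (Z i)" for i
      unfolding Z_def
    proof (rule smooth_fun_bump_mult[OF smooth lam K(1) l0])
      fix q assume q: "q \<in> K"
      show "smooth_near M X (\<lambda>y. G i (\<phi> y)) q"
        by (rule smooth_nearI[OF smooth U(1) _ open_ball _ G(1)]) (use q K in auto)
    qed
    have sl: "smooth_fun M (lam * lam)" by (rule smooth_fun_mult[OF lam lam])
    \<comment> \<open>Two factors \<open>lam\<close> are used because each of \<open>Y i\<close> and
      \<open>Z i\<close> needs its own cutoff to be globally smooth. They do no harm: lam p = 1, so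
      the terms with t (lam * lam) on both sides cancel.\<close>
    have eq: "lam * lam * h = (\<lambda>y. h p * (lam * lam) y) + (\<lambda>y. \<Sum>i\<in>UNIV. (Y i * Z i) y)"
    proof
      fix y
      show "(lam * lam * h) y = ((\<lambda>y. h p * (lam * lam) y) + (\<lambda>y. \<Sum>i\<in>UNIV. (Y i * Z i) y)) y"
      proof (cases "y \<in> K")
        case True
        then have y: "y \<in> U" "\<phi> y \<in> ball (\<phi> p) r" using K by auto
        have "h y = h p + (\<Sum>i\<in>UNIV. (\<phi> y $ i - \<phi> p $ i) * G i (\<phi> y))"
          using G(2)[OF y(2)] hf[OF y(1)] hf[OF U(2)] by simp
        then have "lam y * lam y * h y = lam y * lam y * h p + (\<Sum>i\<in>UNIV. lam y * lam y * ((\<phi> y $ i - \<phi> p $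
            i) * G i (\<phi> y)))"
          by (simp only: distrib_left sum_distrib_left)
        then show ?thesis by (simp add: Y_def Z_def times_fun_def plus_fun_def mult_ac)
      next
        case False
        then show ?thesis using l0 by (simp add: Y_def Z_def times_fun_def plus_fun_def)
      qed
    qed
    have "t (lam * lam * h) = t h + h p * t (lam * lam)"
      using tangent_spaceD(4)[OF t sl True] lp by (simp add: times_fun_def)
    moreover have "t ((\<lambda>y. h p * (lam * lam) y) + (\<lambda>y. \<Sum>i\<in>UNIV. (Y i * Z i) y)) = h p * t (lam * lam) +
        (\<Sum>i\<in>UNIV. t (Y i * Z i))"
      using tangent_spaceD(2)[OF t smooth_fun_cmult[OF sl] smooth_fun_sum[of UNIV "\<lambda>i. Y i * Z i"]]
        tangent_spaceD(3)[OF t sl] tangent_sum[OF t, of UNIV "\<lambda>i. Y i * Z i"] smooth_fun_mult[OF sY sZ] by simp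
    ultimately have "t h = (\<Sum>i\<in>UNIV. t (Y i * Z i))" using eq by simp
    also have "\<dots> = (\<Sum>i\<in>UNIV. v $ i * frechet_derivative f (at (\<phi> p)) (axis i 1))"
    proof (rule sum.cong[OF refl])
      fix i
      have "t (Y i * Z i) = Y i p * t (Z i) + Z i p * t (Y i)" by (rule tangent_spaceD(4)[OF t sY sZ])
      then show "t (Y i * Z i) = v $ i * frechet_derivative f (at (\<phi> p)) (axis i 1)"
        using lp G(3)[OF r(1)] by (simp add: Y_def Z_def v_def)
    qed
    also have "\<dots> = frechet_derivative f (at (\<phi> p)) (\<Sum>i\<in>UNIV. v $ i *\<^sub>R axis i 1)"
    proof -
      have "linear (frechet_derivative f (at (\<phi> p)))"
        using rep_derivative[OF U(1) True U(2)] has_derivative_linear unfolding f_def by blast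
      then show ?thesis by (simp add: linear_sum linear_scale)
    qed
    also have "(\<Sum>i\<in>UNIV. v $ i *\<^sub>R axis i 1) = v"
      using basis_expansion[of v] by (simp add: scalar_mult_eq_scaleR)
    finally show ?thesis using True by (simp add: dvec_def f_def[symmetric])
  qed
  then show ?thesis using that by blast
qed

text \<open>The coordinate functions, cut off by a bump function that is 1 near p, return the
  components of v.\<close>

lemma dvec_eq_0D:
  assumes U: "(U, \<phi>) \<in> max_atlas M" "p \<in> U" and 0: "dvec M (U, \<phi>) p v = 0"
  shows "v = 0"
proof -
  obtain lam K r A where r: "0 < r" "ball (\<phi> p) r \<subseteq> \<phi> ` U" and lam: "smooth_fun M lam" and K: "closedin
      (mtop M) K"
    "K \<subseteq> U" "\<forall>y\<in>K. \<phi> y \<in> ball (\<phi> p) r" and l0: "\<forall>y. y \<notin> K \<longrightarrow> lam y = 0"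
    and A: "openin (mtop M) A" "p \<in> A" "A \<subseteq> K" "\<forall>y\<in>A. lam y = 1"
    by (rule chart_bump[OF U])
  have KX: "K \<subseteq> X" using closedin_subset[OF K(1)] .
  have "v $ i = 0" for i
  proof -
    define Y where "Y y = lam y * \<phi> y $ i" for y
    have sY: "smooth_fun M Y"
      unfolding Y_def
    proof (rule smooth_fun_bump_mult[OF smooth lam K(1) l0])
      fix q assume q: "q \<in> K"
      show "smooth_near M X (\<lambda>y. \<phi> y $ i) q"
        using q K(2) KX by (intro smooth_near_linear[OF _ _ bounded_linear_vec_nth] smooth_near_chart[OF
            smooth U(1)]) auto
    qed
    obtain T where T: "open T" "\<phi> p \<in> T" "\<forall>y\<in>U. \<phi> y \<in> T \<longrightarrow> y \<in> A"
      by (rule chart_nbhd[OF max_atlas_chart[OF U(1)] A(1) U(2) A(2)])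
    have "((\<lambda>x. x $ i) has_derivative (\<lambda>x. x $ i)) (at (\<phi> p))"
      by (rule bounded_linear_imp_has_derivative[OF bounded_linear_vec_nth])
    then have "((Y \<circ> inv_into U \<phi>) has_derivative (\<lambda>x. x $ i)) (at (\<phi> p))"
    proof (rule has_derivative_transform_within_open[where s = "T \<inter> \<phi> ` U"])
      show "open (T \<inter> \<phi> ` U)" using T(1) open_chart_image[OF U(1)] by blast
      show "\<phi> p \<in> T \<inter> \<phi> ` U" using T(2) U(2) by blast
      fix x assume x: "x \<in> T \<inter> \<phi> ` U"
      then obtain y where y: "y \<in> U" "x = \<phi> y" by blast
      then have "y \<in> A" using T(3) x by blast
      then show "x $ i = (Y \<circ> inv_into U \<phi>) x" using A(4) chart_inv[OF U(1) y(1)] y by (simp add: Y_def)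
    qed
    then have "dvec M (U, \<phi>) p v Y = v $ i"
      using sY frechet_derivative_at by (metis dvec_apply)
    then show ?thesis using 0 by simp
  qed
  then show ?thesis by (simp add: vec_eq_iff)
qed

lemma transition_rep:
  assumes U: "(U, \<phi>) \<in> max_atlas M" and V: "(V, \<psi>) \<in> max_atlas M"
  shows "Cinf (\<psi> ` (U \<inter> V)) (\<phi> \<circ> inv_into V \<psi>)" "open (\<psi> ` (U \<inter> V))"
proof -
  show "Cinf (\<psi> ` (U \<inter> V)) (\<phi> \<circ> inv_into V \<psi>)"
  proof (rule Cinf_locally)
    fix x assume "x \<in> \<psi> ` (U \<inter> V)"
    then obtain p where p: "p \<in> U" "p \<in> V" "x = \<psi> p" by auto
    obtain T where "open T" "\<psi> p \<in> T" "T \<subseteq> \<psi> ` V" "Cinf T (\<phi> \<circ> inv_into V \<psi>)"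
      by (rule local_rep[OF V p(2) smooth_near_chart[OF smooth U p(1)]])
    then show "\<exists>T. open T \<and> x \<in> T \<and> Cinf T (\<phi> \<circ> inv_into V \<psi>)" using p(3) by auto
  qed
  have "openin (subtopology (mtop M) V) (V \<inter> U)"
    using is_chartD(1)[OF max_atlas_chart[OF U]] by (auto simp: openin_subtopology)
  then have "openin (top_of_set (\<psi> ` V)) (\<psi> ` (V \<inter> U))"
    using homeomorphic_imp_open_map[OF is_chartD(3)[OF max_atlas_chart[OF V]]] open_map_def by blast
  then show "open (\<psi> ` (U \<inter> V))"
    using open_chart_image[OF V] by (simp add: openin_open_eq Int_commute)
qed

lemma dvec_change:
  assumes U: "(U, \<phi>) \<in> max_atlas M" and V: "(V, \<psi>) \<in> max_atlas M" and p: "p \<in> U" "p \<in> V"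
  shows "dvec M (V, \<psi>) p v = dvec M (U, \<phi>) p (frechet_derivative (\<phi> \<circ> inv_into V \<psi>) (at (\<psi> p)) v)"
proof
  fix h
  let ?J = "frechet_derivative (\<phi> \<circ> inv_into V \<psi>) (at (\<psi> p))"
  show "dvec M (V, \<psi>) p v h = dvec M (U, \<phi>) p (?J v) h"
  proof (cases "smooth_fun M h")
    case True
    note tr = transition_rep[OF U V]
    have pin: "\<psi> p \<in> \<psi> ` (U \<inter> V)" using p by blast
    have 1: "((h \<circ> inv_into U \<phi>) has_derivative frechet_derivative (h \<circ> inv_into U \<phi>) (at (\<phi> p))) (at ((\<phi>
        \<circ> inv_into V \<psi>) (\<psi> p)))"
      using rep_derivative[OF U True p(1)] chart_inv[OF V p(2)] by simp
    have "((\<lambda>x. (h \<circ> inv_into U \<phi>) ((\<phi> \<circ> inv_into V \<psi>) x)) has_derivative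
        (\<lambda>v. frechet_derivative (h \<circ> inv_into U \<phi>) (at (\<phi> p)) (?J v))) (at (\<psi> p))"
      by (rule has_derivative_compose[OF Cinf_has_derivative[OF tr(1) pin] 1])
    then have "((h \<circ> inv_into V \<psi>) has_derivative
        (\<lambda>v. frechet_derivative (h \<circ> inv_into U \<phi>) (at (\<phi> p)) (?J v))) (at (\<psi> p))"
      by (rule has_derivative_transform_within_open[OF _ tr(2) pin])
        (use chart_inv[OF V] chart_inv[OF U] in auto)
    then have "frechet_derivative (h \<circ> inv_into V \<psi>) (at (\<psi> p)) = (\<lambda>v. frechet_derivative (h \<circ> inv_into U
        \<phi>) (at (\<phi> p)) (?J v))"
      by (rule frechet_derivative_at[symmetric])
    then show ?thesis using True by (simp add: dvec_apply)
  qed (simp add: dvec_def)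
qed

lemma chart_compose:
  assumes U: "(U, \<phi>) \<in> max_atlas M" and S: "open S" "open P" "homeomorphism S P G G'" "Cinf S G" "Cinf P G'"
  shows "({y\<in>U. \<phi> y \<in> S}, \<lambda>y. G (\<phi> y)) \<in> max_atlas M"
proof -
  let ?U = "{y\<in>U. \<phi> y \<in> S}" and ?\<phi> = "\<lambda>y. G (\<phi> y)"
  note c = max_atlas_chart[OF U]
  have G: "\<And>x. x \<in> S \<Longrightarrow> G' (G x) = x" "\<And>x. x \<in> S \<Longrightarrow> G x \<in> P" using S(3) by (auto simp: homeomorphism_def)
  have oU: "openin (mtop M) ?U" by (rule chart_open[OF c S(1)])
  have im: "\<phi> ` ?U = \<phi> ` U \<inter> S" by auto
  have oim: "open (\<phi> ` U \<inter> S)" using open_chart_image[OF U] S(1) by blast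
  have him: "?\<phi> ` ?U = P \<inter> G' -` (\<phi> ` U \<inter> S)"
    using S(3) unfolding homeomorphism_def by (auto simp: image_iff)
  have oim': "open (?\<phi> ` ?U)"
    unfolding him using continuous_open_preimage[OF Cinf_imp_continuous_on[OF S(5)] S(2) oim] .
  have hom1: "homeomorphic_map (subtopology (mtop M) ?U) (top_of_set (\<phi> ` ?U)) \<phi>"
  proof -
    have "homeomorphic_map (subtopology (subtopology (mtop M) U) ?U) (subtopology (top_of_set (\<phi> ` U)) (\<phi>
        ` ?U)) \<phi>"
      by (rule homeomorphic_map_subtopologies[OF is_chartD(3)[OF c]])
        (use is_chartD(5)[OF c] in auto)
    moreover have "U \<inter> ?U = ?U" "\<phi> ` U \<inter> \<phi> ` ?U = \<phi> ` ?U" by auto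
    ultimately show ?thesis by (simp add: subtopology_subtopology)
  qed
  have hom2: "homeomorphic_map (top_of_set (\<phi> ` ?U)) (top_of_set (?\<phi> ` ?U)) G"
  proof -
    have "homeomorphic_maps (top_of_set (\<phi> ` ?U)) (top_of_set (?\<phi> ` ?U)) G G'"
      unfolding homeomorphic_maps_def
    proof (intro conjI ballI)
      show "continuous_map (top_of_set (\<phi> ` ?U)) (top_of_set (?\<phi> ` ?U)) G"
        using Cinf_imp_continuous_on[OF S(4)] by (auto intro: continuous_on_subset)
      show "continuous_map (top_of_set (?\<phi> ` ?U)) (top_of_set (\<phi> ` ?U)) G'"
        using Cinf_imp_continuous_on[OF S(5)] G by (auto intro: continuous_on_subset)
    qed (use G in auto)
    then show ?thesis using homeomorphic_maps_map by blast
  qed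
  have "homeomorphic_map (subtopology (mtop M) ?U) (top_of_set (?\<phi> ` ?U)) ?\<phi>"
    using homeomorphic_map_compose[OF hom1 hom2] by (simp add: o_def)
  then have chart: "is_chart M (?U, ?\<phi>)"
    using oU oim' model by (simp add: is_chart_def)
  moreover have "compatible (?U, ?\<phi>) (V, \<psi>)" if V: "(V, \<psi>) \<in> atlas M" for V \<psi>
  proof -
    have mV: "(V, \<psi>) \<in> max_atlas M" using atlas_subset_max_atlas[OF smooth V] .
    show ?thesis
      unfolding compatible_iff[OF is_chartD(2)[OF chart] chart_inj[OF mV]]
    proof (intro ballI conjI)
      fix p assume p: "p \<in> ?U \<inter> V"
      obtain T F where T: "open T" "\<phi> p \<in> T" "Cinf T F" "\<forall>y\<in>U. \<phi> y \<in> T \<longrightarrow> y \<in> V \<and> F (\<phi> y) = \<psi> y"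
        by (rule max_atlas_transition[OF smooth U mV, of p]) (use p in auto)
      show "\<exists>T F. open T \<and> G (\<phi> p) \<in> T \<and> Cinf T F \<and> (\<forall>y\<in>?U \<inter> V. G (\<phi> y) \<in> T \<longrightarrow> F (G (\<phi> y)) = \<psi> y)"
      proof (intro exI conjI)
        show "open (P \<inter> G' -` T)" "Cinf (P \<inter> G' -` T) (\<lambda>x. F (G' x))"
          using Cinf_compose_Int[OF S(2) T(1) S(5) T(3)] by auto
      qed (use p T G in auto)
      obtain T' F' where T': "open T'" "\<psi> p \<in> T'" "Cinf T' F'" "\<forall>y\<in>V. \<psi> y \<in> T' \<longrightarrow> y \<in> U \<and> F' (\<psi> y) = \<phi> y"
        by (rule max_atlas_transition[OF smooth mV U, of p]) (use p in auto)
      show "\<exists>T F. open T \<and> \<psi> p \<in> T \<and> Cinf T F \<and> (\<forall>y\<in>?U \<inter> V. \<psi> y \<in> T \<longrightarrow> F (\<psi> y) = G (\<phi> y))"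
      proof (intro exI conjI)
        show "open (T' \<inter> F' -` S)" "Cinf (T' \<inter> F' -` S) (\<lambda>x. G (F' x))"
          using Cinf_compose_Int[OF T'(1) S(1) T'(3) S(4)] by auto
      qed (use p T' in auto)
    qed
  qed
  ultimately show ?thesis by (auto simp: max_atlas_def)
qed

end

subsection \<open>Rank one perturbations of a Riemannian metric\<close>

lemma smooth_on_open_Cinf:
  assumes "open S" "smooth_on S f"
  shows "Cinf S f"
proof (rule Cinf_locally)
  fix x assume x: "x \<in> S"
  obtain T F where T: "open T" "x \<in> T" "Cinf T F" "\<forall>y\<in>T. y \<in> S \<longrightarrow> F y = f y"
    by (rule smooth_onD[OF assms(2) x])
  have "open (T \<inter> S)" using T(1) assms(1) by blast
  moreover have "Cinf (T \<inter> S) f"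
    by (rule Cinf_cong[OF \<open>open (T \<inter> S)\<close> _ Cinf_subset[OF T(3)]]) (use T(4) in auto)
  ultimately show "\<exists>T. open T \<and> x \<in> T \<and> Cinf T f" using T(2) x by blast
qed

section \<open>Symmetric tensor fields in charts\<close>

context boundaryless
begin

lemma tangent_closed:
  "u \<in> tangent_space M p \<Longrightarrow> v \<in> tangent_space M p \<Longrightarrow> tscale a u + tscale b v \<in> tangent_space M p"
  using tangent_subspace by (simp add: tangent.subspace_add tangent.subspace_scale)

lemma tscale_simps [simp]: "tscale 1 v = v" "tscale 0 v = 0" "tscale c 0 = 0"
  by (auto simp: tscale_def fun_eq_iff)

definition bilinear_at :: "'a tensor02 \<Rightarrow> 'a \<Rightarrow> bool" where
  "bilinear_at k p \<longleftrightarrow> (\<forall>u\<in>tangent_space M p. \<forall>v\<in>tangent_space M p. k p u v = k p v u \<and>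
     (\<forall>w\<in>tangent_space M p. \<forall>a b. k p (tscale a u + tscale b v) w = a * k p u w + b * k p v w))"

lemma bilinear_atD:
  assumes "bilinear_at k p" "u \<in> tangent_space M p" "v \<in> tangent_space M p"
  shows "k p u v = k p v u"
    "w \<in> tangent_space M p \<Longrightarrow> k p (tscale a u + tscale b v) w = a * k p u w + b * k p v w"
    "w \<in> tangent_space M p \<Longrightarrow> k p w (tscale a u + tscale b v) = a * k p w u + b * k p w v"
    "k p (tscale a u) v = a * k p u v"
    "k p v (tscale a u) = a * k p v u"
proof -
  have 1: "k p u v = k p v u" if "u \<in> tangent_space M p" "v \<in> tangent_space M p" for u v
    using assms(1) that by (auto simp: bilinear_at_def)
  have 2: "k p (tscale a u + tscale b v) w = a * k p u w + b * k p v w"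
    if "u \<in> tangent_space M p" "v \<in> tangent_space M p" "w \<in> tangent_space M p" for a b u v w
    using bspec[OF bspec[OF assms(1)[unfolded bilinear_at_def] that(1)] that(2)] that(3) by simp
  show "k p u v = k p v u" by (rule 1[OF assms(2,3)])
  show "k p (tscale a u + tscale b v) w = a * k p u w + b * k p v w" if "w \<in> tangent_space M p"
    by (rule 2[OF assms(2,3) that])
  show "k p w (tscale a u + tscale b v) = a * k p w u + b * k p w v" if "w \<in> tangent_space M p"
    using 1[OF that tangent_closed[OF assms(2,3)]] 1[OF that assms(2)] 1[OF that assms(3)] 2[OF assms(2,3)
        that] by simp
  show 3: "k p (tscale a u) v = a * k p u v" using 2[OF assms(2,2,3), of a 0] by simp
  show "k p v (tscale a u) = a * k p v u"
    using 1[OF assms(3) tangent_closed[OF assms(2,2), of a 0]] 1[OF assms(3,2)] 3 by simp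
qed

lemma symmetric_tensor_bilinear: "symmetric_tensor_field M k \<Longrightarrow> p \<in> X \<Longrightarrow> bilinear_at k p"
  by (simp add: symmetric_tensor_field_def bilinear_at_def)

lemma bilinear_dvec:
  assumes U: "(U, \<phi>) \<in> max_atlas M" "p \<in> U" and b: "bilinear_at k p"
  shows "k p (dvec M (U, \<phi>) p v) (dvec M (U, \<phi>) p w) = (\<Sum>i\<in>UNIV. \<Sum>j\<in>UNIV. v $ i * w $ j * components M k
      (U, \<phi>) p $ i $ j)"
proof -
  let ?d = "dvec M (U, \<phi>) p"
  note tan = dvec_tangent[OF U]
  have l1: "linear (\<lambda>v. k p (?d v) t)" if "t \<in> tangent_space M p" for t
  proof (rule linearI)
    show "k p (?d (v + w)) t = k p (?d v) t + k p (?d w) t" for v w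
      using bilinear_atD(2)[OF b tan tan that, of 1 v 1 w] dvec_linear[OF U, of 1 v 1 w] by simp
    show "k p (?d (c *\<^sub>R v)) t = c *\<^sub>R k p (?d v) t" for c v
      using bilinear_atD(2)[OF b tan tan that, of c v 0 v] dvec_linear[OF U, of c v 0 v] by simp
  qed
  have l2: "linear (\<lambda>w. k p t (?d w))" if "t \<in> tangent_space M p" for t
  proof -
    have "(\<lambda>w. k p t (?d w)) = (\<lambda>w. k p (?d w) t)" using bilinear_atD(1)[OF b that tan] by auto
    then show ?thesis using l1[OF that] by simp
  qed
  have ex: "(\<Sum>i\<in>UNIV. v $ i *\<^sub>R axis i 1) = v" for v :: "real^'n"
    using basis_expansion[of v] by (simp add: scalar_mult_eq_scaleR)
  have "k p (?d v) (?d w) = k p (?d (\<Sum>i\<in>UNIV. v $ i *\<^sub>R axis i 1)) (?d w)" by (simp add: ex)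
  also have "\<dots> = (\<Sum>i\<in>UNIV. v $ i * k p (?d (axis i 1)) (?d w))"
    by (simp add: linear_sum[OF l1[OF tan]] linear_scale[OF l1[OF tan]])
  also have "\<dots> = (\<Sum>i\<in>UNIV. v $ i * k p (?d (axis i 1)) (?d (\<Sum>j\<in>UNIV. w $ j *\<^sub>R axis j 1)))" by (simp add: ex)
  also have "\<dots> = (\<Sum>i\<in>UNIV. v $ i * (\<Sum>j\<in>UNIV. w $ j * k p (?d (axis i 1)) (?d (axis j 1))))"
    by (simp add: linear_sum[OF l2[OF tan]] linear_scale[OF l2[OF tan]])
  finally show ?thesis by (simp add: components_def coord_vec_dvec sum_distrib_left mult.assoc)
qed

text \<open>Smoothness of a tensor field is demanded in atlas charts only; the transformation law,
  with the Jacobian of the transition map, carries it to the maximal atlas.\<close>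

lemma components_smooth:
  assumes k: "symmetric_tensor_field M k" and V: "(V, \<psi>) \<in> max_atlas M"
  shows "Cinf (\<psi> ` V) (\<lambda>x. components M k (V, \<psi>) (inv_into V \<psi> x) $ i $ j)"
proof (rule Cinf_locally)
  fix x assume "x \<in> \<psi> ` V"
  then obtain p where p: "p \<in> V" "x = \<psi> p" by auto
  have "p \<in> X" using p(1) chart_subset[OF V] by auto
  then obtain U \<phi> where U: "(U, \<phi>) \<in> atlas M" "p \<in> U" using atlas_cover[OF smooth] by blast
  have mU: "(U, \<phi>) \<in> max_atlas M" using atlas_subset_max_atlas[OF smooth U(1)] .
  let ?S = "\<psi> ` (U \<inter> V)" and ?\<tau> = "\<phi> \<circ> inv_into V \<psi>"
  let ?C = "components M k (U, \<phi>) \<circ> inv_into U \<phi>"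
  note tr = transition_rep[OF mU V]
  have "smooth_on (\<phi> ` U) ?C" using k U(1) by (auto simp: symmetric_tensor_field_def)
  then have "Cinf (\<phi> ` U) ?C" by (rule smooth_on_open_Cinf[OF open_chart_image[OF mU]])
  then have "Cinf (\<phi> ` U) (\<lambda>z. ?C z $ a $ b)" for a b
    by (intro Cinf_vec_nth open_chart_image[OF mU])
  moreover have im: "?\<tau> ` ?S \<subseteq> \<phi> ` U" using chart_inv[OF V] by auto
  ultimately have CC: "Cinf ?S (\<lambda>z. ?C (?\<tau> z) $ a $ b)" for a b
    by (intro Cinf_compose[OF tr(2) open_chart_image[OF mU] im tr(1), of "\<lambda>z. ?C z $ a $ b"])
  let ?J = "\<lambda>z v. frechet_derivative ?\<tau> (at z) v"
  have C: "Cinf ?S (\<lambda>z. \<Sum>a\<in>UNIV. \<Sum>b\<in>UNIV. ?J z (axis i 1) $ a * ?J z (axis j 1) $ b * ?C (?\<tau> z) $ a $ b)"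
    by (intro Cinf_sum Cinf_mult Cinf_vec_nth Cinf_derivative tr CC)
  have eq: "(\<Sum>a\<in>UNIV. \<Sum>b\<in>UNIV. ?J z (axis i 1) $ a * ?J z (axis j 1) $ b * ?C (?\<tau> z) $ a $ b)
      = components M k (V, \<psi>) (inv_into V \<psi> z) $ i $ j" if "z \<in> ?S" for z
  proof -
    obtain y where y: "y \<in> U" "y \<in> V" "z = \<psi> y" using \<open>z \<in> ?S\<close> by auto
    have yX: "y \<in> X" using y chart_subset[OF V] by auto
    have iz: "inv_into V \<psi> z = y" "?C (?\<tau> z) = components M k (U, \<phi>) y"
      using y chart_inv[OF V] chart_inv[OF mU] by auto
    have "components M k (V, \<psi>) y $ i $ j = k y (dvec M (V, \<psi>) y (axis i 1)) (dvec M (V, \<psi>) y (axis j 1))"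
      by (simp add: components_def coord_vec_dvec)
    also have "\<dots> = k y (dvec M (U, \<phi>) y (?J z (axis i 1))) (dvec M (U, \<phi>) y (?J z (axis j 1)))"
      using dvec_change[OF mU V y(1,2)] y(3) by simp
    also have "\<dots> = (\<Sum>a\<in>UNIV. \<Sum>b\<in>UNIV. ?J z (axis i 1) $ a * ?J z (axis j 1) $ b * components M k (U, \<phi>) y
        $ a $ b)"
      by (rule bilinear_dvec[OF mU y(1) symmetric_tensor_bilinear[OF k yX]])
    finally show ?thesis using iz by simp
  qed
  have "Cinf ?S (\<lambda>z. components M k (V, \<psi>) (inv_into V \<psi> z) $ i $ j)"
    by (rule Cinf_cong[OF tr(2) eq C])
  then show "\<exists>T. open T \<and> x \<in> T \<and> Cinf T (\<lambda>x. components M k (V, \<psi>) (inv_into V \<psi> x) $ i $ j)"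
    using tr(2) p U by blast
qed

end

section \<open>Gradients and the signature of the perturbed tensor\<close>

locale riemannian = boundaryless M for M :: "('a, 'n::finite) manifold" +
  fixes g :: "'a tensor02"
  assumes riemannian: "riemannian_metric M g"
begin

lemma sym: "symmetric_tensor_field M g"
  using riemannian by (simp add: riemannian_metric_def)

lemma bil: "p \<in> X \<Longrightarrow> bilinear_at g p"
  using symmetric_tensor_bilinear[OF sym] .

lemma pos: "p \<in> X \<Longrightarrow> v \<in> tangent_space M p \<Longrightarrow> v \<noteq> 0 \<Longrightarrow> 0 < g p v v"
  using riemannian by (auto simp: riemannian_metric_def riemannian_on_def)

lemma zero_tangent: "0 \<in> tangent_space M p"
  using tangent_subspace tangent.subspace_0 by blast

lemma g_zero: "p \<in> X \<Longrightarrow> v \<in> tangent_space M p \<Longrightarrow> g p 0 v = 0"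
  using bilinear_atD(4)[OF bil zero_tangent, of p v 0] by simp

lemma nondegenerate:
  assumes p: "p \<in> X" and u: "u \<in> tangent_space M p" "v \<in> tangent_space M p" and eq: "\<And>w. w \<in> tangent_space
      M p \<Longrightarrow> g p u w = g p v w"
  shows "u = v"
proof (rule ccontr)
  assume ne: "u \<noteq> v"
  let ?d = "tscale 1 u + tscale (- 1) v"
  have dT: "?d \<in> tangent_space M p" by (rule tangent_closed[OF u])
  have "?d \<noteq> 0" using ne by (auto simp: tscale_def fun_eq_iff)
  then have "0 < g p ?d ?d" by (rule pos[OF p dT])
  moreover have "g p ?d ?d = 0"
    using bilinear_atD(2)[OF bil[OF p] u dT, of 1 "-1"] eq[OF dT] by simp
  ultimately show False by simp
qed

lemma components_bilinear:
  assumes U: "(U, \<phi>) \<in> max_atlas M" "p \<in> U"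
  shows "g p (dvec M (U, \<phi>) p v) (dvec M (U, \<phi>) p w) = w \<bullet> (components M g (U, \<phi>) p *v v)"
proof -
  have p: "p \<in> X" using U chart_subset by blast
  have c: "components M g (U, \<phi>) p $ i $ j = components M g (U, \<phi>) p $ j $ i" for i j
    using bilinear_atD(1)[OF bil[OF p] dvec_tangent[OF U] dvec_tangent[OF U]]
    by (simp add: components_def coord_vec_dvec)
  have "g p (dvec M (U, \<phi>) p v) (dvec M (U, \<phi>) p w) = (\<Sum>i\<in>UNIV. \<Sum>j\<in>UNIV. v $ i * w $ j * components M g
      (U, \<phi>) p $ i $ j)"
    by (rule bilinear_dvec[OF U bil[OF p]])
  also have "\<dots> = (\<Sum>j\<in>UNIV. \<Sum>i\<in>UNIV. w $ j * (components M g (U, \<phi>) p $ j $ i * v $ i))"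
    by (subst sum.swap) (simp add: c mult_ac)
  also have "\<dots> = w \<bullet> (components M g (U, \<phi>) p *v v)"
    by (simp add: inner_vec_def matrix_vector_mult_def sum_distrib_left)
  finally show ?thesis .
qed

lemma det_components:
  assumes U: "(U, \<phi>) \<in> max_atlas M" "p \<in> U"
  shows "det (components M g (U, \<phi>) p) \<noteq> 0"
proof -
  let ?G = "components M g (U, \<phi>) p"
  have p: "p \<in> X" using U chart_subset by blast
  have "v = 0" if "?G *v v = 0" for v
  proof (rule ccontr)
    assume "v \<noteq> 0"
    then have "dvec M (U, \<phi>) p v \<noteq> 0" using dvec_eq_0D[OF U] by blast
    then have "0 < g p (dvec M (U, \<phi>) p v) (dvec M (U, \<phi>) p v)" by (rule pos[OF p dvec_tangent[OF U]])
    then show False using that by (simp add: components_bilinear[OF U])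
  qed
  then have "inj ((*v) ?G)" using linear_injective_0[OF matrix_vector_mul_linear] by blast
  then show ?thesis
    using invertible_left_inverse matrix_left_invertible_injective invertible_det_nz by blast
qed

text \<open>The choice is legitimate because the dual vector exists and is unique by nondegeneracy.
  The expression \<open>grad \<rho> p \<rho>\<close>, which occurs throughout, is the derivative of
  \<rho> along its gradient, that is, the squared length of the gradient.\<close>

definition grad :: "('a \<Rightarrow> real) \<Rightarrow> 'a \<Rightarrow> 'a tvec" where
  "grad \<rho> p = (SOME v. v \<in> tangent_space M p \<and> (\<forall>w\<in>tangent_space M p. g p v w = w \<rho>))"

text \<open>The matrix of the metric is invertible, so the linear system that raises the index of
  d\<rho> can be solved.\<close>

lemma grad_exists:
  assumes U: "(U, \<phi>) \<in> max_atlas M" "p \<in> U" and \<rho>: "smooth_fun M \<rho>"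
  obtains x where "components M g (U, \<phi>) p *v x = (\<chi> i. dvec M (U, \<phi>) p (axis i 1) \<rho>)"
    "\<forall>w\<in>tangent_space M p. g p (dvec M (U, \<phi>) p x) w = w \<rho>"
proof -
  let ?b = "\<chi> i. dvec M (U, \<phi>) p (axis i 1) \<rho>"
  have "\<exists>x. components M g (U, \<phi>) p *v x = ?b" by (simp add: cramer[OF det_components[OF U]])
  then obtain x where x: "components M g (U, \<phi>) p *v x = ?b" by blast
  have "g p (dvec M (U, \<phi>) p x) w = w \<rho>" if w: "w \<in> tangent_space M p" for w
  proof -
    obtain y where y: "w = dvec M (U, \<phi>) p y" by (rule tangent_eq_dvec[OF U w])
    have lin: "linear (frechet_derivative (\<rho> \<circ> inv_into U \<phi>) (at (\<phi> p)))"
      using rep_derivative[OF U(1) \<rho> U(2)] has_derivative_linear by blast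
    have "y = (\<Sum>i\<in>UNIV. y $ i *\<^sub>R axis i 1)"
      using basis_expansion[of y] by (simp add: scalar_mult_eq_scaleR)
    then have "w \<rho> = frechet_derivative (\<rho> \<circ> inv_into U \<phi>) (at (\<phi> p)) (\<Sum>i\<in>UNIV. y $ i *\<^sub>R axis i 1)"
      using y \<rho> by (simp add: dvec_apply)
    also have "\<dots> = y \<bullet> ?b"
      using lin \<rho> by (simp add: linear_sum linear_scale inner_vec_def dvec_apply)
    finally show ?thesis using x by (simp add: y components_bilinear[OF U])
  qed
  then show ?thesis using that x by blast
qed

lemma grad:
  assumes p: "p \<in> X" and \<rho>: "smooth_fun M \<rho>"
  shows "grad \<rho> p \<in> tangent_space M p" "w \<in> tangent_space M p \<Longrightarrow> g p (grad \<rho> p) w = w \<rho>"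
proof -
  obtain U \<phi> where U: "(U, \<phi>) \<in> max_atlas M" "p \<in> U" by (rule max_atlas_cover[OF smooth p])
  obtain x where x: "\<forall>w\<in>tangent_space M p. g p (dvec M (U, \<phi>) p x) w = w \<rho>"
    by (rule grad_exists[OF U \<rho>])
  have "\<exists>v. v \<in> tangent_space M p \<and> (\<forall>w\<in>tangent_space M p. g p v w = w \<rho>)"
    using x dvec_tangent[OF U] by blast
  from someI_ex[OF this] show "grad \<rho> p \<in> tangent_space M p" "w \<in> tangent_space M p \<Longrightarrow> g p (grad \<rho> p) w = w \<rho>"
    unfolding grad_def by auto
qed

text \<open>Uniqueness of the dual vector identifies the chosen gradient with the solution of the
  linear system, whose smoothness is Cramer's rule.\<close>

lemma grad_coordinates:
  assumes U: "(U, \<phi>) \<in> max_atlas M" and \<rho>: "smooth_fun M \<rho>"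
  obtains x where "Cinf (\<phi> ` U) (\<lambda>z. x (inv_into U \<phi> z))" "\<forall>y\<in>U. grad \<rho> y = dvec M (U, \<phi>) y (x y)"
    "\<forall>y\<in>U. components M g (U, \<phi>) y *v x y = (\<chi> i. dvec M (U, \<phi>) y (axis i 1) \<rho>)"
proof -
  have "\<forall>y\<in>U. \<exists>x. components M g (U, \<phi>) y *v x = (\<chi> i. dvec M (U, \<phi>) y (axis i 1) \<rho>) \<and>
      grad \<rho> y = dvec M (U, \<phi>) y x"
  proof
    fix y assume y: "y \<in> U"
    then have yX: "y \<in> X" using chart_subset[OF U] by auto
    obtain x where x: "components M g (U, \<phi>) y *v x = (\<chi> i. dvec M (U, \<phi>) y (axis i 1) \<rho>)"
      "\<forall>w\<in>tangent_space M y. g y (dvec M (U, \<phi>) y x) w = w \<rho>"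
      by (rule grad_exists[OF U y \<rho>])
    have "grad \<rho> y = dvec M (U, \<phi>) y x"
      by (rule nondegenerate[OF yX grad(1)[OF yX \<rho>] dvec_tangent[OF U y]]) (use x(2) grad(2)[OF yX \<rho>] in auto)
    then show "\<exists>x. components M g (U, \<phi>) y *v x = (\<chi> i. dvec M (U, \<phi>) y (axis i 1) \<rho>) \<and>
      grad \<rho> y = dvec M (U, \<phi>) y x" using x by blast
  qed
  then obtain x where x: "\<forall>y\<in>U. components M g (U, \<phi>) y *v x y = (\<chi> i. dvec M (U, \<phi>) y (axis i 1) \<rho>) \<and>
      grad \<rho> y = dvec M (U, \<phi>) y (x y)" by (rule bchoice[THEN exE])
  have "Cinf (\<phi> ` U) (\<lambda>z. x (inv_into U \<phi> z))"
  proof (rule Cinf_solve[OF open_chart_image[OF U] components_smooth[OF sym U]])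
    let ?b = "\<lambda>z. \<chi> i. frechet_derivative (\<rho> \<circ> inv_into U \<phi>) (at z) (axis i 1)"
    show "Cinf (\<phi> ` U) (\<lambda>z. ?b z $ i)" for i
      using Cinf_derivative[OF fun_rep[OF U \<rho>]] by simp
    fix z assume "z \<in> \<phi> ` U"
    then obtain y where y: "y \<in> U" "z = \<phi> y" by auto
    then show "det (components M g (U, \<phi>) (inv_into U \<phi> z)) \<noteq> 0"
      "components M g (U, \<phi>) (inv_into U \<phi> z) *v x (inv_into U \<phi> z) = ?b z"
      using chart_inv[OF U] det_components[OF U] x \<rho> by (auto simp: dvec_apply)
  qed
  then show ?thesis using that x by blast
qed

lemma grad_vector_field:
  assumes \<rho>: "smooth_fun M \<rho>"
  shows "vector_field M (grad \<rho>)"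
  unfolding vector_field_def
proof (intro conjI ballI allI impI)
  show "p \<in> X \<Longrightarrow> grad \<rho> p \<in> tangent_space M p" for p by (rule grad(1)[OF _ \<rho>])
  fix h assume h: "smooth_fun M h"
  show "smooth_fun M (\<lambda>p. grad \<rho> p h)"
    unfolding smooth_fun_near
  proof
    fix p assume p: "p \<in> X"
    obtain U \<phi> where U: "(U, \<phi>) \<in> max_atlas M" "p \<in> U" by (rule max_atlas_cover[OF smooth p])
    obtain x where x: "Cinf (\<phi> ` U) (\<lambda>z. x (inv_into U \<phi> z))" "\<forall>y\<in>U. grad \<rho> y = dvec M (U, \<phi>) y (x y)"
      by (rule grad_coordinates[OF U(1) \<rho>])
    let ?D = "\<lambda>z. frechet_derivative (h \<circ> inv_into U \<phi>) (at z)"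
    have C: "Cinf (\<phi> ` U) (\<lambda>z. \<Sum>i\<in>UNIV. x (inv_into U \<phi> z) $ i * ?D z (axis i 1))"
      by (intro Cinf_sum Cinf_mult Cinf_vec_nth Cinf_derivative fun_rep[OF U(1) h] x(1)
          open_chart_image[OF U(1)])
    show "smooth_near M X (\<lambda>p. grad \<rho> p h) p"
    proof (rule smooth_nearI[OF smooth U open_chart_image[OF U(1)] _ C])
      show "\<phi> p \<in> \<phi> ` U" using U by blast
      fix y assume y: "y \<in> U"
      have lin: "linear (?D (\<phi> y))" using rep_derivative[OF U(1) h y] has_derivative_linear by blast
      have "?D (\<phi> y) (x y) = ?D (\<phi> y) (\<Sum>i\<in>UNIV. x y $ i *\<^sub>R axis i 1)"
        using basis_expansion[of "x y"] by (simp add: scalar_mult_eq_scaleR)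
      also have "\<dots> = (\<Sum>i\<in>UNIV. x y $ i * ?D (\<phi> y) (axis i 1))"
        by (simp add: linear_sum[OF lin] linear_scale[OF lin])
      finally have "?D (\<phi> y) (x y) = (\<Sum>i\<in>UNIV. x y $ i * ?D (\<phi> y) (axis i 1))" .
      then show "(\<Sum>i\<in>UNIV. x (inv_into U \<phi> (\<phi> y)) $ i * ?D (\<phi> y) (axis i 1)) = grad \<rho> y h"
        using chart_inv[OF U(1) y] x(2) y h by (simp add: dvec_apply)
    qed
  qed
qed

lemma grad_nonneg: "p \<in> X \<Longrightarrow> smooth_fun M \<rho> \<Longrightarrow> 0 \<le> grad \<rho> p \<rho>"
  using grad[of p \<rho>] pos[of p "grad \<rho> p"] g_zero[of p 0] zero_tangent by (cases "grad \<rho> p = 0") force+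

lemma grad_pos:
  assumes p: "p \<in> X" and \<rho>: "smooth_fun M \<rho>" and w: "w \<in> tangent_space M p" "w \<rho> \<noteq> 0"
  shows "0 < grad \<rho> p \<rho>"
proof -
  have "grad \<rho> p \<noteq> 0" using grad(2)[OF p \<rho> w(1)] w g_zero[OF p w(1)] by auto
  then show ?thesis using pos[OF p grad(1)[OF p \<rho>]] grad(2)[OF p \<rho> grad(1)[OF p \<rho>]] by simp
qed

text \<open>The pairing of v with the gradient is v \<rho>, so this is the Cauchy-Schwarz inequality
  for that pair. It comes from the nonnegative square length of v minus its projection onto the
  gradient; \<open>k\<close> is the projection coefficient.\<close>

lemma grad_Cauchy_Schwarz:
  assumes p: "p \<in> X" and \<rho>: "smooth_fun M \<rho>" and v: "v \<in> tangent_space M p"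
  shows "(v \<rho>)\<^sup>2 \<le> grad \<rho> p \<rho> * g p v v"
proof (cases "grad \<rho> p = 0")
  case True
  then show ?thesis using grad(2)[OF p \<rho> v] g_zero[OF p v] by simp
next
  case False
  note G = grad(1)[OF p \<rho>]
  let ?a = "grad \<rho> p \<rho>"
  have a: "0 < ?a" using pos[OF p G False] grad(2)[OF p \<rho> G] by simp
  define k where "k = v \<rho> / ?a"
  have ka: "k * ?a = v \<rho>" using a by (simp add: k_def)
  let ?d = "tscale 1 v + tscale (- k) (grad \<rho> p)"
  have dT: "?d \<in> tangent_space M p" by (rule tangent_closed[OF v G])
  have "0 \<le> g p ?d ?d"
    using pos[OF p dT] g_zero[OF p zero_tangent] by (cases "?d = 0") (auto simp: less_imp_le)
  also have "g p ?d ?d = 1 * g p v ?d + (- k) * g p (grad \<rho> p) ?d"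
    by (rule bilinear_atD(2)[OF bil[OF p] v G dT])
  also have "g p v ?d = 1 * g p v v + (- k) * g p v (grad \<rho> p)"
    by (rule bilinear_atD(3)[OF bil[OF p] v G v])
  also have "g p v (grad \<rho> p) = v \<rho>"
    using bilinear_atD(1)[OF bil[OF p] v G] grad(2)[OF p \<rho> v] by simp
  also have "g p (grad \<rho> p) ?d = 1 * g p (grad \<rho> p) v + (- k) * g p (grad \<rho> p) (grad \<rho> p)"
    by (rule bilinear_atD(3)[OF bil[OF p] v G G])
  also have "\<dots> = 1 * v \<rho> + (- k) * ?a" using grad(2)[OF p \<rho> v] grad(2)[OF p \<rho> G] by simp
  also have "1 * (1 * g p v v + - k * v \<rho>) + - k * (1 * v \<rho> + - k * ?a) = g p v v - (v \<rho>)\<^sup>2 / ?a"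
    using ka by (simp add: power2_eq_square) (simp add: k_def)
  finally show ?thesis using a by (simp add: field_simps)
qed

text \<open>The signature of \<open>g - f \<cdot> d\<rho> \<otimes> d\<rho>\<close> is decided by comparing \<open>f |grad \<rho>|\<^sup>2\<close> with 1.\<close>

definition pert :: "('a \<Rightarrow> real) \<Rightarrow> ('a \<Rightarrow> real) \<Rightarrow> 'a tensor02" where
  "pert f \<rho> p v w = g p v w - f p * (g p (grad \<rho> p) v * g p (grad \<rho> p) w)"

context
  fixes f \<rho> :: "'a \<Rightarrow> real" and p :: 'a
  assumes p: "p \<in> X" and \<rho>: "smooth_fun M \<rho>"
begin

lemma pert_eq: "v \<in> tangent_space M p \<Longrightarrow> w \<in> tangent_space M p \<Longrightarrow> pert f \<rho> p v w = g p v w - f p * (v \<rho> * w \<rho>)"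
  by (simp add: pert_def grad(2)[OF p \<rho>])

text \<open>If f p \<le> 0, nothing is subtracted from the metric. Otherwise Cauchy-Schwarz bounds
  the subtracted term by \<open>f p * grad \<rho> p \<rho>\<close> times g p v v, and that factor is
  below 1.\<close>

lemma pert_pos:
  assumes "f p * grad \<rho> p \<rho> < 1" "v \<in> tangent_space M p" "v \<noteq> 0"
  shows "0 < pert f \<rho> p v v"
proof -
  have gv: "0 < g p v v" by (rule pos[OF p assms(2,3)])
  have "f p * (v \<rho>)\<^sup>2 < g p v v"
  proof (cases "f p \<le> 0")
    case True
    then have "f p * (v \<rho>)\<^sup>2 \<le> 0" by (simp add: mult_nonpos_nonneg)
    then show ?thesis using gv by simp
  next
    case False
    then have "f p * (v \<rho>)\<^sup>2 \<le> f p * grad \<rho> p \<rho> * g p v v"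
      using grad_Cauchy_Schwarz[OF p \<rho> assms(2)] by (simp add: mult.assoc)
    also have "\<dots> < 1 * g p v v" using assms(1) gv by (rule mult_strict_right_mono)
    finally show ?thesis by simp
  qed
  then show ?thesis using assms(2) by (simp add: pert_eq power2_eq_square)
qed

text \<open>That w pairs to zero with everything says that g p w equals a multiple of g p (grad
  \<rho> p) as a functional, so nondegeneracy of the metric puts w on the line of the gradient;
  evaluating at \<rho> gives the scalar condition.\<close>

lemma radical_pert_eq:
  assumes w: "w \<in> radical M (pert f \<rho>) p"
  shows "w = tscale (f p * w \<rho>) (grad \<rho> p)" "w \<rho> * (1 - f p * grad \<rho> p \<rho>) = 0"
proof -
  have wT: "w \<in> tangent_space M p" and w0: "\<And>v. v \<in> tangent_space M p \<Longrightarrow> pert f \<rho> p w v = 0"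
    using w by (auto simp: radical_def)
  note G = grad(1)[OF p \<rho>]
  show eq: "w = tscale (f p * w \<rho>) (grad \<rho> p)"
  proof (rule nondegenerate[OF p wT])
    show "tscale (f p * w \<rho>) (grad \<rho> p) \<in> tangent_space M p" using tangent_closed[OF G G, of _ 0] by simp
    fix v assume v: "v \<in> tangent_space M p"
    show "g p w v = g p (tscale (f p * w \<rho>) (grad \<rho> p)) v"
      using w0[OF v] pert_eq[OF wT v] bilinear_atD(4)[OF bil[OF p] G v] grad(2)[OF p \<rho> v] by (simp add:
          mult.assoc)
  qed
  have "w \<rho> = f p * w \<rho> * grad \<rho> p \<rho>" using eq by (metis tscale_def)
  then show "w \<rho> * (1 - f p * grad \<rho> p \<rho>) = 0" by (simp add: algebra_simps)
qed

lemma radical_pert_trivial: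
  assumes "f p * grad \<rho> p \<rho> \<noteq> 1"
  shows "radical M (pert f \<rho>) p = {0}"
proof (intro equalityI subsetI)
  fix w assume "w \<in> radical M (pert f \<rho>) p"
  from radical_pert_eq[OF this] assms have "w = tscale (f p * w \<rho>) (grad \<rho> p)" "w \<rho> = 0" by auto
  then show "w \<in> {0}" by simp
next
  fix w :: "'a tvec" assume "w \<in> {0}"
  then show "w \<in> radical M (pert f \<rho>) p"
    using zero_tangent g_zero[OF p] by (auto simp: radical_def pert_eq zero_tangent)
qed

lemma radical_pert_span:
  assumes "f p * grad \<rho> p \<rho> = 1"
  shows "radical M (pert f \<rho>) p = range (\<lambda>c. tscale c (grad \<rho> p))"
proof (intro equalityI subsetI)
  fix w assume "w \<in> radical M (pert f \<rho>) p"
  from radical_pert_eq(1)[OF this] show "w \<in> range (\<lambda>c. tscale c (grad \<rho> p))" by blast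
next
  fix w :: "'a tvec" assume "w \<in> range (\<lambda>c. tscale c (grad \<rho> p))"
  then obtain c where w: "w = tscale c (grad \<rho> p)" by blast
  note G = grad(1)[OF p \<rho>]
  have wT: "w \<in> tangent_space M p" using tangent_closed[OF G G, of c 0] w by simp
  have "pert f \<rho> p w v = 0" if v: "v \<in> tangent_space M p" for v
  proof -
    have "pert f \<rho> p w v = c * v \<rho> - f p * (c * grad \<rho> p \<rho> * v \<rho>)"
      unfolding pert_eq[OF wT v] using bilinear_atD(4)[OF bil[OF p] G v] grad(2)[OF p \<rho> v] by (simp add: w
          tscale_def)
    also have "\<dots> = c * v \<rho> * (1 - f p * grad \<rho> p \<rho>)" by (simp add: algebra_simps)
    finally show ?thesis using assms by simp
  qed
  then show "w \<in> radical M (pert f \<rho>) p" using wT by (simp add: radical_def)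
qed

text \<open>On the kernel of d\<rho> the perturbed tensor equals the metric. Hence evaluation at
  \<rho> is injective on a negative definite subspace, which can have at most dimension 1. The line
  of the gradient attains this bound.\<close>

lemma index_pert:
  assumes "1 < f p * grad \<rho> p \<rho>"
  shows "index M (pert f \<rho>) p = 1"
proof -
  let ?P = "\<lambda>S. tangent.subspace S \<and> S \<subseteq> tangent_space M p \<and> (\<forall>v\<in>S. v \<noteq> 0 \<longrightarrow> pert f \<rho> p v v < 0)"
  note G = grad(1)[OF p \<rho>]
  have a: "grad \<rho> p \<rho> \<noteq> 0" using assms by auto
  have apos: "0 < grad \<rho> p \<rho>" using a grad_nonneg[OF p \<rho>] by simp
  have Gne: "grad \<rho> p \<noteq> 0" using a by auto
  have le: "tangent.dim S \<le> 1" if S: "?P S" for S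
  proof (cases "S \<subseteq> {0}")
    case True
    then show ?thesis using tangent.dim_le_card[of S "{0}"] tangent.span_superset[of "{0}"] by auto
  next
    case False
    then obtain s where s: "s \<in> S" "s \<noteq> 0" by auto
    have zero: "v = 0" if v: "v \<in> S" "v \<rho> = 0" for v
    proof (rule ccontr)
      assume "v \<noteq> 0"
      then have "pert f \<rho> p v v < 0" "0 < g p v v" using S v pos[OF p, of v] by auto
      then show False using pert_eq[of v v] S v by auto
    qed
    have "S \<subseteq> tangent.span {s}"
    proof
      fix v assume v: "v \<in> S"
      have s\<rho>: "s \<rho> \<noteq> 0" using zero s by auto
      let ?d = "v - tscale (v \<rho> / s \<rho>) s"
      have "?d \<in> S" using S v s by (intro tangent.subspace_diff tangent.subspace_scale) auto
      moreover have "?d \<rho> = 0" using s\<rho> by (simp add: tscale_def)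
      ultimately have "?d = 0" by (rule zero)
      then have "v = tscale (v \<rho> / s \<rho>) s" by simp
      then show "v \<in> tangent.span {s}" by (metis tangent.span_base tangent.span_scale singletonI)
    qed
    then show ?thesis using tangent.dim_le_card[of S "{s}"] by simp
  qed
  let ?L = "tangent.span {grad \<rho> p}"
  have "tangent.independent {grad \<rho> p}" using Gne by (simp add: tangent.dependent_single)
  then have dimL: "tangent.dim ?L = 1" using tangent.dim_eq_card_independent[of "{grad \<rho> p}"] by simp
  have L: "?P ?L"
  proof (intro conjI ballI impI)
    show "tangent.subspace ?L" by (rule tangent.subspace_span)
    show sub: "?L \<subseteq> tangent_space M p" using G tangent_subspace by (simp add: tangent.span_minimal)
    fix v assume v: "v \<in> ?L" "v \<noteq> 0"
    then obtain c where c: "v = tscale c (grad \<rho> p)" by (auto simp: tangent.span_singleton)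
    have vT: "v \<in> tangent_space M p" using sub v by blast
    have "c \<noteq> 0" using c v by auto
    have "pert f \<rho> p v v = g p v v - f p * (v \<rho> * v \<rho>)" by (rule pert_eq[OF vT vT])
    also have "g p v v = c * (c * grad \<rho> p \<rho>)"
      using bilinear_atD(4)[OF bil[OF p] G vT, of c] bilinear_atD(5)[OF bil[OF p] G G, of c] grad(2)[OF p
          \<rho> G] c by simp
    also have "c * (c * grad \<rho> p \<rho>) - f p * (v \<rho> * v \<rho>) = c\<^sup>2 * grad \<rho> p \<rho> * (1 - f p * grad \<rho> p \<rho>)"
      by (simp add: c tscale_def algebra_simps power2_eq_square)
    also have "\<dots> < 0" using \<open>c \<noteq> 0\<close> apos assms by (intro mult_pos_neg) auto
    finally show "pert f \<rho> p v v < 0" .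
  qed
  \<comment> \<open>The index is a \<open>Max\<close>, whose characterisation requires a finite set
    of dimensions.\<close>
  have "{tangent.dim S | S. ?P S} \<subseteq> {..1}" using le by auto
  then have fin: "finite {tangent.dim S | S. ?P S}" by (rule finite_subset) simp
  have "Max {tangent.dim S | S. ?P S} = 1"
    by (rule Max_eqI[OF fin]) (use le L dimL in \<open>auto intro!: exI[of _ ?L]\<close>)
  then show ?thesis by (simp add: index_def)
qed

end

lemma pert_symmetric:
  assumes \<rho>: "smooth_fun M \<rho>" and f: "smooth_fun M f"
  shows "symmetric_tensor_field M (pert f \<rho>)"
  unfolding symmetric_tensor_field_def
proof (intro conjI ballI)
  fix p u v assume p: "p \<in> X" and u: "u \<in> tangent_space M p" and v: "v \<in> tangent_space M p"
  show "pert f \<rho> p u v = pert f \<rho> p v u"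
    using u v bilinear_atD(1)[OF bil[OF p] u v] by (simp add: pert_eq[OF p \<rho>])
  show "\<forall>a b. pert f \<rho> p (tscale a u + tscale b v) w = a * pert f \<rho> p u w + b * pert f \<rho> p v w"
    if w: "w \<in> tangent_space M p" for w
    using u v w bilinear_atD(2)[OF bil[OF p] u v w] tangent_closed[OF u v]
    by (simp add: pert_eq[OF p \<rho>] tscale_def algebra_simps)
next
  fix c assume c: "c \<in> atlas M"
  obtain U \<phi> where cU: "c = (U, \<phi>)" by (cases c)
  have U: "(U, \<phi>) \<in> max_atlas M" using atlas_subset_max_atlas[OF smooth] c cU by blast
  have UX: "U \<subseteq> X" by (rule chart_subset[OF U])
  let ?d = "\<lambda>i z. frechet_derivative (\<rho> \<circ> inv_into U \<phi>) (at z) (axis i 1)"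
  have "Cinf (\<phi> ` U) (\<lambda>z. components M g (U, \<phi>) (inv_into U \<phi> z) $ i $ j - (f \<circ> inv_into U \<phi>) z * (?d i z
      * ?d j z))" for i j
    by (intro Cinf_diff Cinf_mult Cinf_derivative fun_rep[OF U \<rho>] fun_rep[OF U f] open_chart_image[OF U]
        components_smooth[OF sym U])
  then have "Cinf (\<phi> ` U) (\<lambda>z. components M (pert f \<rho>) (U, \<phi>) (inv_into U \<phi> z) $ i $ j)" for i j
  proof (rule Cinf_cong[OF open_chart_image[OF U], rotated])
    fix z assume "z \<in> \<phi> ` U"
    then obtain y where y: "y \<in> U" "z = \<phi> y" by auto
    have yX: "y \<in> X" using y UX by auto
    show "components M g (U, \<phi>) (inv_into U \<phi> z) $ i $ j - (f \<circ> inv_into U \<phi>) z * (?d i z * ?d j z)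
      = components M (pert f \<rho>) (U, \<phi>) (inv_into U \<phi> z) $ i $ j"
      using chart_inv[OF U y(1)] y(2) \<rho> dvec_tangent[OF U y(1)]
      by (simp add: components_def coord_vec_dvec pert_eq[OF yX \<rho>] dvec_apply)
  qed
  then have "Cinf (\<phi> ` U) (\<lambda>z. \<chi> i. \<chi> j. components M (pert f \<rho>) (U, \<phi>) (inv_into U \<phi> z) $ i $ j)"
  proof -
    assume *: "\<And>i j. Cinf (\<phi> ` U) (\<lambda>z. components M (pert f \<rho>) (U, \<phi>) (inv_into U \<phi> z) $ i $ j)"
    have "Cinf (\<phi> ` U) (\<lambda>z. \<Sum>i\<in>UNIV. \<Sum>j\<in>UNIV. components M (pert f \<rho>) (U, \<phi>) (inv_into U \<phi> z) $ i $ j *\<^sub>R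
        axis i (axis j (1::real)))"
      by (intro Cinf_sum Cinf_scaleR Cinf_const * open_chart_image[OF U])
    moreover have "(\<Sum>i\<in>UNIV. \<Sum>j\<in>UNIV. A $ i $ j *\<^sub>R axis i (axis j (1::real))) = A" for A :: "real^'n^'n"
      by (simp add: vec_eq_iff axis_def if_distrib if_distribR sum.If_cases cong: if_cong)
    ultimately show ?thesis by (simp add: vec_lambda_eta)
  qed
  then have "Cinf (\<phi> ` U) (components M (pert f \<rho>) (U, \<phi>) \<circ> inv_into U \<phi>)"
    by (simp add: vec_lambda_eta o_def)
  then have "smooth_on (\<phi> ` U) (components M (pert f \<rho>) (U, \<phi>) \<circ> inv_into U \<phi>)"
    by (intro smooth_onI exI[of _ "\<phi> ` U"] exI[of _ "components M (pert f \<rho>) (U, \<phi>) \<circ> inv_into U \<phi>"]) (use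
        open_chart_image[OF U] in auto)
  then show "case c of (U, \<phi>) \<Rightarrow> smooth_on (\<phi> ` U) (components M (pert f \<rho>) (U, \<phi>) \<circ> inv_into U \<phi>)"
    by (simp add: cU)
qed

text \<open>In a chart the perturbation is a rank one matrix built from the components of d\<rho>,
  and the coordinate vector of the gradient solves the system that
  \<open>det_rank_one_update\<close> asks for.\<close>

lemma det_pert:
  assumes U: "(U, \<phi>) \<in> max_atlas M" "p \<in> U" and \<rho>: "smooth_fun M \<rho>"
  shows "det (components M (pert f \<rho>) (U, \<phi>) p) = det (components M g (U, \<phi>) p) * (1 - f p * grad \<rho> p \<rho>)"
proof -
  have p: "p \<in> X" using U chart_subset by blast
  obtain x where x: "\<forall>y\<in>U. grad \<rho> y = dvec M (U, \<phi>) y (x y)"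
    "\<forall>y\<in>U. components M g (U, \<phi>) y *v x y = (\<chi> i. dvec M (U, \<phi>) y (axis i 1) \<rho>)"
    by (rule grad_coordinates[OF U(1) \<rho>])
  let ?w = "\<chi> i. dvec M (U, \<phi>) p (axis i 1) \<rho>"
  have "components M (pert f \<rho>) (U, \<phi>) p = (\<chi> i j. components M g (U, \<phi>) p $ i $ j - f p * (?w $ i * ?w $ j))"
    using dvec_tangent[OF U] by (simp add: components_def coord_vec_dvec pert_eq[OF p \<rho>])
  then have "det (components M (pert f \<rho>) (U, \<phi>) p) = det (\<chi> i j. components M g (U, \<phi>) p $ i $ j - f p *
      (?w $ i * ?w $ j))"
    by (rule arg_cong)
  also have "\<dots> = det (components M g (U, \<phi>) p) * (1 - f p * (x p \<bullet> ?w))"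
    by (rule det_rank_one_update[OF bspec[OF x(2) U(2)]])
  also have "x p \<bullet> ?w = grad \<rho> p \<rho>"
    using components_bilinear[OF U, of "x p" "x p"] x U(2) grad[OF p \<rho>] by simp
  finally show ?thesis .
qed

end

subsection \<open>Submanifolds\<close>

lemma smooth_mapI:
  assumes M: "smooth_manifold M" and N: "smooth_manifold N"
    and F: "\<forall>p\<in>topspace (mtop M). map_near M (topspace (mtop M)) N F p"
  shows "smooth_map M N F"
  unfolding smooth_map_def
proof (intro conjI ballI)
  show "continuous_map (mtop M) (mtop N) F"
    unfolding continuous_map_def
  proof (intro conjI allI impI)
    show "F \<in> topspace (mtop M) \<rightarrow> topspace (mtop N)" using F by (auto simp: map_near_def)
    fix B assume B: "openin (mtop N) B"
    show "openin (mtop M) {x \<in> topspace (mtop M). F x \<in> B}"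
    proof (subst openin_subopen, safe)
      fix x assume x: "x \<in> topspace (mtop M)" "F x \<in> B"
      obtain A where A: "openin (mtop M) A" "x \<in> A" "\<forall>y\<in>A. y \<in> topspace (mtop M) \<longrightarrow> F y \<in> B"
        by (rule map_near_continuous[where F = F, OF M N bspec[OF F x(1)] x(1) x(1) B x(2)])
      then show "\<exists>T. openin (mtop M) T \<and> x \<in> T \<and> T \<subseteq> {x \<in> topspace (mtop M). F x \<in> B}"
        using openin_subset by (intro exI[of _ A]) auto
    qed
  qed
  show "case c of (U, \<phi>) \<Rightarrow> \<forall>(V, \<psi>)\<in>atlas N. smooth_on (\<phi> ` {p \<in> U. F p \<in> V}) (\<psi> \<circ> F \<circ> inv_into U \<phi>)"
    if c: "c \<in> atlas M" for c
  proof (clarsimp split: prod.split)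
    fix U \<phi> V \<psi> assume cU: "c = (U, \<phi>)" and d: "(V, \<psi>) \<in> atlas N"
    have U: "(U, \<phi>) \<in> max_atlas M" and V: "(V, \<psi>) \<in> max_atlas N"
      using atlas_subset_max_atlas M N c d cU by blast+
    show "smooth_on (\<phi> ` {p \<in> U. F p \<in> V}) (\<psi> \<circ> F \<circ> inv_into U \<phi>)"
    proof (rule smooth_onI)
      fix x assume "x \<in> \<phi> ` {p \<in> U. F p \<in> V}"
      then obtain p where p: "p \<in> U" "F p \<in> V" "x = \<phi> p" by auto
      have UX: "U \<subseteq> topspace (mtop M)" using is_chartD(5)[OF max_atlas_chart[OF U]] .
      then have near: "smooth_near M (topspace (mtop M)) (\<lambda>y. \<psi> (F y)) p"
        using F V p unfolding map_near_def by blast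
      obtain T G where T: "open T" "\<phi> p \<in> T" "Cinf T G"
        "\<forall>y\<in>U. y \<in> topspace (mtop M) \<longrightarrow> \<phi> y \<in> T \<longrightarrow> G (\<phi> y) = \<psi> (F y)"
        by (rule smooth_nearD[OF near U p(1)])
      show "\<exists>T G. open T \<and> x \<in> T \<and> Cinf T G \<and> (\<forall>z\<in>T \<inter> \<phi> ` {p \<in> U. F p \<in> V}. G z = (\<psi> \<circ> F \<circ> inv_into U \<phi>) z)"
        by (rule exI[of _ T], rule exI[of _ G])
          (use T p UX is_chartD(2)[OF max_atlas_chart[OF U]] in auto)
    qed
  qed
qed

context boundaryless
begin

lemma submanifold_topspace: "S \<subseteq> X \<Longrightarrow> topspace (mtop (submanifold M S Y)) = S"
  by (auto simp: submanifold_def)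

lemma submanifold_chart:
  "(U, \<phi>) \<in> max_atlas M \<Longrightarrow> \<phi> ` (U \<inter> S) = \<phi> ` U \<inter> Y \<Longrightarrow> (U \<inter> S, \<phi>) \<in> atlas (submanifold M S Y)"
  by (auto simp: submanifold_def)

text \<open>Compatibility of the restricted charts is inherited from ambient transition maps, so the
  one geometric input is that adapted charts cover \<open>S\<close>.\<close>

lemma submanifold_smooth:
  assumes S: "S \<subseteq> X" and cover: "\<forall>p\<in>S. \<exists>U \<phi>. (U, \<phi>) \<in> max_atlas M \<and> p \<in> U \<and> \<phi> ` (U \<inter> S) = \<phi> ` U \<inter> Y"
  shows "smooth_manifold (submanifold M S Y)"
proof -
  let ?N = "submanifold M S Y"
  have mt: "mtop ?N = subtopology (mtop M) S" "model ?N = Y" by (auto simp: submanifold_def)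
  have atl: "\<exists>U. c = (U \<inter> S, snd c) \<and> (U, snd c) \<in> max_atlas M \<and> snd c ` (U \<inter> S) = snd c ` U \<inter> Y"
    if "c \<in> atlas ?N" for c using that by (auto simp: submanifold_def)
  have ch: "is_chart ?N (U \<inter> S, \<phi>)" if U: "(U, \<phi>) \<in> max_atlas M" "\<phi> ` (U \<inter> S) = \<phi> ` U \<inter> Y" for U \<phi>
  proof -
    note c = max_atlas_chart[OF U(1)]
    have "openin (subtopology (mtop M) S) (U \<inter> S)"
      using is_chartD(1)[OF c] by (auto simp: openin_subtopology)
    moreover have "openin (top_of_set Y) (\<phi> ` (U \<inter> S))"
      unfolding U(2) using open_chart_image[OF U(1)] by (auto simp: openin_open)
    moreover have "homeomorphic_map (subtopology (mtop M) (U \<inter> S)) (top_of_set (\<phi> ` (U \<inter> S))) \<phi>"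
    proof -
      have "homeomorphic_map (subtopology (subtopology (mtop M) U) (U \<inter> S)) (subtopology (top_of_set (\<phi> `
          U)) (\<phi> ` (U \<inter> S))) \<phi>"
        by (rule homeomorphic_map_subtopologies[OF is_chartD(3)[OF c]]) (use is_chartD(5)[OF c] in auto)
      moreover have "U \<inter> (U \<inter> S) = U \<inter> S" "\<phi> ` U \<inter> \<phi> ` (U \<inter> S) = \<phi> ` (U \<inter> S)" by auto
      ultimately show ?thesis by (simp add: subtopology_subtopology)
    qed
    moreover have "S \<inter> (U \<inter> S) = U \<inter> S" by auto
    ultimately show ?thesis by (simp add: is_chart_def mt subtopology_subtopology)
  qed
  have com: "compatible (U \<inter> S, \<phi>) (V \<inter> S, \<psi>)" if U: "(U, \<phi>) \<in> max_atlas M" and V: "(V, \<psi>) \<in> max_atlas M"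
      for U \<phi> V \<psi>
  proof -
    have inj: "inj_on \<phi> (U \<inter> S)" "inj_on \<psi> (V \<inter> S)"
      using chart_inj[OF U] chart_inj[OF V] by (auto intro: inj_on_subset)
    have tr: "\<exists>T F. open T \<and> \<phi> p \<in> T \<and> Cinf T F \<and> (\<forall>y\<in>(U \<inter> S) \<inter> (V \<inter> S). \<phi> y \<in> T \<longrightarrow> F (\<phi> y) = \<psi> y)"
      if U: "(U, \<phi>) \<in> max_atlas M" and V: "(V, \<psi>) \<in> max_atlas M" and p: "p \<in> U" "p \<in> V" for U \<phi> V \<psi> p
    proof -
      obtain T F where "open T" "\<phi> p \<in> T" "Cinf T F" "\<forall>y\<in>U. \<phi> y \<in> T \<longrightarrow> y \<in> V \<and> F (\<phi> y) = \<psi> y"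
        by (rule max_atlas_transition[OF smooth U V p])
      then show ?thesis by (intro exI[of _ T] exI[of _ F]) auto
    qed
    have sw: "(U \<inter> S) \<inter> (V \<inter> S) = (V \<inter> S) \<inter> (U \<inter> S)" by blast
    show ?thesis
      unfolding compatible_iff[OF inj]
    proof (intro ballI conjI)
      fix p assume p: "p \<in> (U \<inter> S) \<inter> (V \<inter> S)"
      show "\<exists>T F. open T \<and> \<phi> p \<in> T \<and> Cinf T F \<and> (\<forall>y\<in>(U \<inter> S) \<inter> (V \<inter> S). \<phi> y \<in> T \<longrightarrow> F (\<phi> y) = \<psi> y)"
        by (rule tr[OF U V]) (use p in auto)
      show "\<exists>T F. open T \<and> \<psi> p \<in> T \<and> Cinf T F \<and> (\<forall>y\<in>(U \<inter> S) \<inter> (V \<inter> S). \<psi> y \<in> T \<longrightarrow> F (\<psi> y) = \<phi> y)"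
        unfolding sw by (rule tr[OF V U]) (use p in auto)
    qed
  qed
  show ?thesis
    unfolding smooth_manifold_def
  proof (intro conjI ballI)
    show "Hausdorff_space (mtop ?N)" "second_countable (mtop ?N)"
      using smooth by (auto simp: mt smooth_manifold_def Hausdorff_space_subtopology
          second_countable_subtopology)
    show "is_chart ?N c" if c: "c \<in> atlas ?N" for c
    proof -
      obtain U where U: "c = (U \<inter> S, snd c)" "(U, snd c) \<in> max_atlas M" "snd c ` (U \<inter> S) = snd c ` U \<inter> Y"
        using atl[OF c] by blast
      show ?thesis using ch[OF U(2,3)] U(1) by metis
    qed
    show "compatible c c'" if c: "c \<in> atlas ?N" "c' \<in> atlas ?N" for c c'
    proof -
      obtain U V where "c = (U \<inter> S, snd c)" "(U, snd c) \<in> max_atlas M" "c' = (V \<inter> S, snd c')" "(V, snd c')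
          \<in> max_atlas M"
        using atl[OF c(1)] atl[OF c(2)] by blast
      then show ?thesis using com by metis
    qed
    have "\<Union> (fst ` atlas ?N) = S"
    proof (intro equalityI subsetI)
      fix p assume "p \<in> \<Union> (fst ` atlas ?N)"
      then obtain c where c: "c \<in> atlas ?N" "p \<in> fst c" by blast
      obtain U where "c = (U \<inter> S, snd c)" using atl[OF c(1)] by blast
      then show "p \<in> S" using c(2) by (metis IntD2 fst_conv)
    next
      fix p assume p: "p \<in> S"
      then obtain U \<phi> where U: "(U, \<phi>) \<in> max_atlas M" "p \<in> U" "\<phi> ` (U \<inter> S) = \<phi> ` U \<inter> Y" using cover by blast
      show "p \<in> \<Union> (fst ` atlas ?N)"
        using submanifold_chart[OF U(1,3)] p U(2) by (force intro!: UnionI[of "U \<inter> S"] image_eqI[of _ _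
            "(U \<inter> S, \<phi>)"])
    qed
    then show "topspace (mtop ?N) = \<Union> (fst ` atlas ?N)" using submanifold_topspace[OF S] by simp
  qed
qed

text \<open>A chart of the submanifold is the same coordinate map on a smaller domain, so one
  extension witnesses both sides. Questions about the submanifold thereby become questions in
  \<open>M\<close>.\<close>

lemma smooth_near_submanifold:
  assumes S: "S \<subseteq> X" and N: "smooth_manifold (submanifold M S Y)" and p: "p \<in> S"
  shows "smooth_near (submanifold M S Y) S h p \<longleftrightarrow> smooth_near M S h p"
proof -
  let ?N = "submanifold M S Y"
  have "p \<in> topspace (mtop ?N)" using submanifold_topspace[OF S] p by simp
  then obtain U' \<phi> where U': "(U', \<phi>) \<in> atlas ?N" "p \<in> U'" using atlas_cover[OF N] by blast
  then obtain U where U: "U' = U \<inter> S" "(U, \<phi>) \<in> max_atlas M" by (auto simp: submanifold_def)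
  have mU': "(U \<inter> S, \<phi>) \<in> max_atlas ?N" using atlas_subset_max_atlas[OF N U'(1)] U(1) by simp
  have pU: "p \<in> U \<inter> S" "p \<in> U" using U' U by auto
  show ?thesis
  proof
    assume h: "smooth_near ?N S h p"
    obtain T F where T: "open T" "\<phi> p \<in> T" "Cinf T F" "\<forall>y\<in>U \<inter> S. y \<in> S \<longrightarrow> \<phi> y \<in> T \<longrightarrow> F (\<phi> y) = h y"
      by (rule smooth_nearD[OF h mU' pU(1)])
    show "smooth_near M S h p" by (rule smooth_nearI[OF smooth U(2) pU(2) T(1,2,3)]) (use T(4) in auto)
  next
    assume h: "smooth_near M S h p"
    obtain T F where T: "open T" "\<phi> p \<in> T" "Cinf T F" "\<forall>y\<in>U. y \<in> S \<longrightarrow> \<phi> y \<in> T \<longrightarrow> F (\<phi> y) = h y"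
      by (rule smooth_nearD[OF h U(2) pU(2)])
    show "smooth_near ?N S h p" by (rule smooth_nearI[OF N mU' pU(1) T(1,2,3)]) (use T(4) in auto)
  qed
qed

end

subsection \<open>The collar gluing\<close>

locale collared = riemannian M g for M :: "('a, 'n::finite) manifold" and g +
  fixes \<rho> :: "'a \<Rightarrow> real" and \<epsilon> :: real and \<Theta> :: "'a \<Rightarrow> real \<Rightarrow> 'a"
  assumes collar: "collar M \<rho> \<epsilon> \<Theta>" and \<rho>_pos: "\<forall>p\<in>topspace (mtop M). 0 < \<rho> p"
    and level: "\<forall>t. 0 < t \<and> t < \<epsilon> \<longrightarrow> (\<exists>p\<in>topspace (mtop M). \<rho> p = t)"
begin

text \<open>All that matters is that c lies strictly between 0 and \<epsilon>, so that the collar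
  reaches both sides of the level c.\<close>

definition c :: real where "c = \<epsilon> / 2"
definition H where "H = {p\<in>X. \<rho> p = c}"
definition Rpart where "Rpart = {p\<in>X. c < \<rho> p}"
definition Lpart where "Lpart = {p\<in>X. \<rho> p < c}"
text \<open>This will be the closure of \<open>Lpart\<close>, the half that is identified with the
  cylinder.\<close>

definition S where "S = {p\<in>X. \<rho> p \<le> c}"

lemma \<rho>: "smooth_fun M \<rho>" and \<epsilon>: "0 < \<epsilon>" and c: "0 < c" "c < \<epsilon>"
  using collar by (auto simp: collar_def c_def)

lemma \<Theta>:
  assumes "p \<in> X" "\<rho> p < \<epsilon>"
  shows "\<Theta> p (\<rho> p) = p" "0 < t \<Longrightarrow> t < \<epsilon> \<Longrightarrow> \<Theta> p t \<in> X" "0 < t \<Longrightarrow> t < \<epsilon> \<Longrightarrow> \<rho> (\<Theta> p t) = t"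
    "0 < t \<Longrightarrow> t < \<epsilon> \<Longrightarrow> 0 < s \<Longrightarrow> s < \<epsilon> \<Longrightarrow> \<Theta> (\<Theta> p t) s = \<Theta> p s"
  using assms collar \<rho>_pos by (auto simp: collar_def)

lemma \<Theta>_smooth:
  assumes "p \<in> X" "\<rho> p < \<epsilon>" "0 < t" "t < \<epsilon>"
  obtains V \<psi> T Q and R :: "'a \<Rightarrow> real^'n" and A where "(V, \<psi>) \<in> max_atlas M" "open T" "Cinf T Q"
      "smooth_near M X R p"
    "openin (mtop M) A" "p \<in> A" "R p + t *\<^sub>R bvec \<in> T"
    "\<forall>y\<in>A. \<forall>s. \<rho> y < \<epsilon> \<longrightarrow> 0 < s \<longrightarrow> s < \<epsilon> \<longrightarrow> R y + s *\<^sub>R bvec \<in> T \<longrightarrow>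
       \<Theta> y s \<in> V \<and> \<psi> (\<Theta> y s) = Q (R y + s *\<^sub>R bvec)"
proof -
  have "0 < \<rho> p" using \<rho>_pos assms(1) by blast
  then obtain V \<psi> T Q and R :: "'a \<Rightarrow> real^'n" and A where *: "(V, \<psi>) \<in> max_atlas M" "open T" "Cinf T Q"
      "smooth_near M X R p"
    "openin (mtop M) A" "p \<in> A" "R p + t *\<^sub>R bvec \<in> T"
    "\<forall>y\<in>A. \<forall>s. 0 < \<rho> y \<and> \<rho> y < \<epsilon> \<and> 0 < s \<and> s < \<epsilon> \<and> R y + s *\<^sub>R bvec \<in> T \<longrightarrow>
       \<Theta> y s \<in> V \<and> \<psi> (\<Theta> y s) = Q (R y + s *\<^sub>R bvec)"
    using collar assms unfolding collar_def by blast
  have "\<forall>y\<in>A. \<forall>s. \<rho> y < \<epsilon> \<longrightarrow> 0 < s \<longrightarrow> s < \<epsilon> \<longrightarrow> R y + s *\<^sub>R bvec \<in> T \<longrightarrow>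
       \<Theta> y s \<in> V \<and> \<psi> (\<Theta> y s) = Q (R y + s *\<^sub>R bvec)"
    using *(8) \<rho>_pos openin_subset[OF *(5)] by (meson subsetD)
  then show ?thesis by (rule that[OF *(1-7)])
qed

text \<open>Along the collar curve through p the function \<rho> is the parameter, so its velocity
  vector has derivative 1 on \<rho>. In coordinates this velocity is the derivative of
  \<open>Q\<close> in the direction \<open>bvec\<close>.\<close>

lemma d\<rho>_nonzero:
  assumes p: "p \<in> X" "\<rho> p < \<epsilon>"
  obtains w where "w \<in> tangent_space M p" "w \<rho> = 1"
proof -
  have pp: "0 < \<rho> p" using p \<rho>_pos by blast
  obtain V \<psi> T Q and R :: "'a \<Rightarrow> real^'n" and A where V: "(V, \<psi>) \<in> max_atlas M" and T: "open T" "Cinf T Q"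
    and A: "openin (mtop M) A" "p \<in> A" and RT: "R p + \<rho> p *\<^sub>R bvec \<in> T"
    and Q: "\<forall>y\<in>A. \<forall>s. \<rho> y < \<epsilon> \<longrightarrow> 0 < s \<longrightarrow> s < \<epsilon> \<longrightarrow> R y + s *\<^sub>R bvec \<in> T \<longrightarrow>
       \<Theta> y s \<in> V \<and> \<psi> (\<Theta> y s) = Q (R y + s *\<^sub>R bvec)"
    by (rule \<Theta>_smooth[OF p pp p(2)])
  have pV: "p \<in> V" "\<psi> p = Q (R p + \<rho> p *\<^sub>R bvec)"
    using Q A(2) p(2) pp RT \<Theta>(1)[OF p] by metis+
  let ?f = "\<lambda>s. (\<rho> \<circ> inv_into V \<psi>) (Q (R p + s *\<^sub>R bvec))"
  let ?v = "frechet_derivative Q (at (R p + \<rho> p *\<^sub>R bvec)) bvec"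
  have dQ: "(Q has_derivative frechet_derivative Q (at (R p + \<rho> p *\<^sub>R bvec))) (at (R p + \<rho> p *\<^sub>R bvec))"
    by (rule Cinf_has_derivative[OF T(2) RT])
  have dline: "((\<lambda>s. R p + s *\<^sub>R bvec) has_derivative (\<lambda>s. s *\<^sub>R bvec)) (at (\<rho> p))"
    by (auto intro!: derivative_eq_intros)
  have 1: "((\<lambda>s. Q (R p + s *\<^sub>R bvec)) has_derivative (\<lambda>s. frechet_derivative Q (at (R p + \<rho> p *\<^sub>R bvec))
      (s *\<^sub>R bvec))) (at (\<rho> p))"
    by (rule has_derivative_compose[OF dline dQ])
  have d\<rho>: "((\<rho> \<circ> inv_into V \<psi>) has_derivative frechet_derivative (\<rho> \<circ> inv_into V \<psi>) (at (\<psi> p))) (at (Q (R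
      p + \<rho> p *\<^sub>R bvec)))"
    using rep_derivative[OF V \<rho> pV(1)] pV(2) by simp
  have "(?f has_derivative (\<lambda>s. frechet_derivative (\<rho> \<circ> inv_into V \<psi>) (at (\<psi> p)) (frechet_derivative Q (at
      (R p + \<rho> p *\<^sub>R bvec)) (s *\<^sub>R bvec)))) (at (\<rho> p))"
    by (rule has_derivative_compose[OF 1 d\<rho>])
  then have der1: "(?f has_real_derivative frechet_derivative (\<rho> \<circ> inv_into V \<psi>) (at (\<psi> p)) ?v) (at (\<rho> p))"
    using linear_scale[OF has_derivative_linear[OF dQ]] linear_scale[OF has_derivative_linear[OF d\<rho>]]
    by (simp add: has_field_derivative_def mult_commute_abs)
  \<comment> \<open>The parameters for which the coordinate formula of the curve is available; they
    form an open set containing \<rho> p, as a comparison of derivatives requires.\<close>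
  let ?J = "{s. 0 < s \<and> s < \<epsilon> \<and> R p + s *\<^sub>R bvec \<in> T}"
  have "open ((\<lambda>s. R p + s *\<^sub>R bvec) -` T)"
    by (rule open_vimage[OF T(1)]) (intro continuous_intros)
  moreover have "?J = {0<..<\<epsilon>} \<inter> (\<lambda>s. R p + s *\<^sub>R bvec) -` T" by auto
  ultimately have oJ: "open ?J" by (metis open_Int open_greaterThanLessThan)
  have "((\<lambda>s. s) has_real_derivative 1) (at (\<rho> p))" by simp
  then have der2: "(?f has_real_derivative 1) (at (\<rho> p))"
  proof (rule has_field_derivative_transform_within_open[OF _ oJ])
    show "\<rho> p \<in> ?J" using pp p RT by simp
    fix s assume "s \<in> ?J"
    then have s: "0 < s" "s < \<epsilon>" "\<Theta> p s \<in> V" "\<psi> (\<Theta> p s) = Q (R p + s *\<^sub>R bvec)" using Q A(2) p(2) by auto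
    then show "s = ?f s" using \<Theta>(3)[OF p s(1,2)] chart_inv[OF V s(3)] by (metis comp_apply)
  qed
  have "frechet_derivative (\<rho> \<circ> inv_into V \<psi>) (at (\<psi> p)) ?v = 1" by (rule DERIV_unique[OF der1 der2])
  then have "dvec M (V, \<psi>) p ?v \<rho> = 1" using \<rho> by (simp add: dvec_apply)
  then show ?thesis using that dvec_tangent[OF V pV(1)] by blast
qed

lemma grad_positive: "p \<in> X \<Longrightarrow> \<rho> p < \<epsilon> \<Longrightarrow> 0 < grad \<rho> p \<rho>"
  by (rule d\<rho>_nonzero) (auto intro: grad_pos[OF _ \<rho>])

text \<open>Since d\<rho> is nonzero, \<rho> can replace one coordinate. The sign in c - \<rho> is
  chosen so that {\<rho> \<le> c} becomes the half space and \<open>H\<close> the hyperplane, which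
  makes one chart serve for both submanifolds.\<close>

lemma slice_chart:
  assumes q: "q \<in> X" "\<rho> q < \<epsilon>"
  obtains U \<phi> where "(U, \<phi>) \<in> max_atlas M" "q \<in> U" "\<forall>y\<in>U. \<phi> y $ bdry_coord = c - \<rho> y"
proof -
  obtain U \<phi> where U: "(U, \<phi>) \<in> max_atlas M" "q \<in> U" by (rule max_atlas_cover[OF smooth q(1)])
  define f where "f = \<rho> \<circ> inv_into U \<phi>"
  have Cf: "Cinf (\<phi> ` U) f" unfolding f_def by (rule fun_rep[OF U(1) \<rho>])
  have oU: "open (\<phi> ` U)" by (rule open_chart_image[OF U(1)])
  have x0: "\<phi> q \<in> \<phi> ` U" using U(2) by blast
  let ?D = "frechet_derivative f (at (\<phi> q))"
  have dD: "(f has_derivative ?D) (at (\<phi> q))" by (rule Cinf_has_derivative[OF Cf x0])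
  have lin: "linear ?D" using has_derivative_linear[OF dD] .
  obtain w where w: "w \<in> tangent_space M q" "w \<rho> = 1" by (rule d\<rho>_nonzero[OF q])
  obtain v where "w = dvec M (U, \<phi>) q v" by (rule tangent_eq_dvec[OF U w(1)])
  then have Dv: "?D v = 1" using w(2) \<rho> by (simp add: dvec_apply f_def)
  obtain k where k: "?D (axis k 1) \<noteq> 0"
  proof -
    have "?D v = ?D (\<Sum>i\<in>UNIV. v $ i *\<^sub>R axis i 1)" using basis_expansion[of v] by (simp add:
        scalar_mult_eq_scaleR)
    also have "\<dots> = (\<Sum>i\<in>UNIV. v $ i * ?D (axis i 1))" by (simp add: linear_sum[OF lin] linear_scale[OF lin])
    finally have "\<exists>i. ?D (axis i 1) \<noteq> 0" using Dv by (metis (no_types, lifting) mult_zero_right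
        sum.neutral zero_neq_one)
    then show ?thesis using that by blast
  qed
  \<comment> \<open>The coordinate k in which d\<rho> is nonzero is swapped with the boundary
    coordinate. The function c - \<rho> then replaces exactly that coordinate, and the derivative of
    \<open>P\<close> becomes injective.\<close>
  define \<tau> where "\<tau> i = (if i = bdry_coord then k else if i = k then bdry_coord else i)" for i
  define L where "L x = (\<chi> i. x $ \<tau> i)" for x :: "real^'n"
  have LL: "L (L x) = x" for x by (simp add: L_def \<tau>_def vec_eq_iff)
  have linL: "linear L" by (rule linearI) (auto simp: L_def vec_eq_iff)
  then have bL: "bounded_linear L" by (simp add: linear_conv_bounded_linear)
  have Lb: "L bvec = axis k 1" by (auto simp: L_def \<tau>_def axis_def vec_eq_iff)
  define P where "P x = hproj (L x) + (c - f x) *\<^sub>R bvec" for x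
  have CP: "Cinf (\<phi> ` U) P"
    unfolding P_def
    by (intro Cinf_add Cinf_scaleR Cinf_diff Cinf_const oU Cf Cinf_compose_linear[OF bounded_linear_hproj]
        Cinf_bounded_linear[OF bL])
  have "(P has_derivative (\<lambda>v. hproj (L v) + (0 - ?D v) *\<^sub>R bvec)) (at (\<phi> q))"
    unfolding P_def
    by (intro has_derivative_add bounded_linear.has_derivative[OF bounded_linear_hproj]
        bounded_linear_imp_has_derivative[OF bL]
        bounded_linear.has_derivative[OF bounded_linear_scaleR_left] has_derivative_diff
            has_derivative_const dD)
  then have DP: "frechet_derivative P (at (\<phi> q)) = (\<lambda>v. hproj (L v) + (0 - ?D v) *\<^sub>R bvec)"
    by (rule frechet_derivative_at[symmetric])
  have "v = 0" if "frechet_derivative P (at (\<phi> q)) v = 0" for v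
  proof -
    have eq: "hproj (L v) + (0 - ?D v) *\<^sub>R bvec = 0" using that by (simp add: DP)
    have Dv0: "?D v = 0" using arg_cong[OF eq, of "\<lambda>x. x $ bdry_coord"] by simp
    then have "hproj (L v) = 0" using eq by simp
    then have "L v = (L v $ bdry_coord) *\<^sub>R bvec" using hproj_decomp[of "L v"] by simp
    then have "v = (L v $ bdry_coord) *\<^sub>R axis k 1" using LL[of v] linear_scale[OF linL] Lb by metis
    moreover from this have "L v $ bdry_coord * ?D (axis k 1) = 0" using Dv0 linear_scale[OF lin] by
        (metis real_scaleR_def)
    ultimately show ?thesis using k by simp
  qed
  then obtain O1 V1 Q where O1: "open O1" "O1 \<subseteq> \<phi> ` U" "\<phi> q \<in> O1" "open V1" "homeomorphism O1 V1 P Q"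
      "Cinf V1 Q"
    using smooth_inverse_function[OF oU CP x0] by metis
  have "({y\<in>U. \<phi> y \<in> O1}, \<lambda>y. P (\<phi> y)) \<in> max_atlas M"
    by (rule chart_compose[OF U(1) O1(1,4,5) Cinf_subset[OF CP O1(2)] O1(6)])
  moreover have "\<forall>y\<in>{y\<in>U. \<phi> y \<in> O1}. P (\<phi> y) $ bdry_coord = c - \<rho> y"
    using chart_inv[OF U(1)] by (simp add: P_def f_def)
  ultimately show ?thesis using that U(2) O1(3) by blast
qed

lemma continuous_\<rho>: "continuous_map (mtop M) euclidean \<rho>"
  by (rule smooth_fun_continuous_map[OF smooth \<rho>])

lemma open_Rpart: "openin (mtop M) Rpart" and open_Lpart: "openin (mtop M) Lpart" and closed_H: "closedin
    (mtop M) H"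
  and closed_S: "closedin (mtop M) S" and closed_Rclosed: "closedin (mtop M) {p\<in>X. c \<le> \<rho> p}"
proof -
  show "openin (mtop M) Rpart" using openin_continuous_map_preimage[OF continuous_\<rho>, of "{c<..}"] by (simp
      add: Rpart_def)
  show "openin (mtop M) Lpart" using openin_continuous_map_preimage[OF continuous_\<rho>, of "{..<c}"] by (simp
      add: Lpart_def)
  show "closedin (mtop M) H" using closedin_continuous_map_preimage[OF continuous_\<rho>, of "{c}"] by (simp
      add: H_def)
  show "closedin (mtop M) S" using closedin_continuous_map_preimage[OF continuous_\<rho>, of "{..c}"] by (simp
      add: S_def)
  show "closedin (mtop M) {p\<in>X. c \<le> \<rho> p}" using closedin_continuous_map_preimage[OF continuous_\<rho>, of
      "{c..}"] by simp
qed

text \<open>In a slice chart, moving from q along positive or negative multiples of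
  \<open>bvec\<close> changes c - \<rho> by the same amount.\<close>

lemma both_sides:
  assumes q: "q \<in> H" and A: "openin (mtop M) A" "q \<in> A"
  shows "\<exists>y\<in>A. y \<in> Lpart" "\<exists>y\<in>A. y \<in> Rpart"
proof -
  have qX: "q \<in> X" "\<rho> q < \<epsilon>" "\<rho> q = c" using q c by (auto simp: H_def)
  obtain U \<phi> where U: "(U, \<phi>) \<in> max_atlas M" "q \<in> U" "\<forall>y\<in>U. \<phi> y $ bdry_coord = c - \<rho> y"
    by (rule slice_chart[OF qX(1,2)])
  obtain T where T: "open T" "\<phi> q \<in> T" "\<forall>y\<in>U. \<phi> y \<in> T \<longrightarrow> y \<in> A"
    by (rule chart_nbhd[OF max_atlas_chart[OF U(1)] A(1) U(2) A(2)])
  have "open (T \<inter> \<phi> ` U)" "\<phi> q \<in> T \<inter> \<phi> ` U" using T U(2) open_chart_image[OF U(1)] by auto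
  then obtain d where d: "0 < d" "ball (\<phi> q) d \<subseteq> T \<inter> \<phi> ` U" using open_contains_ball by blast
  have *: "\<exists>y\<in>A. y \<in> X \<and> \<rho> y = c - s" if "\<bar>s\<bar> < d" for s
  proof -
    have "\<phi> q + s *\<^sub>R bvec \<in> ball (\<phi> q) d" using that by (simp add: dist_norm)
    then have "\<phi> q + s *\<^sub>R bvec \<in> T" "\<phi> q + s *\<^sub>R bvec \<in> \<phi> ` U" using d(2) by blast+
    then obtain y where y: "y \<in> U" "\<phi> y = \<phi> q + s *\<^sub>R bvec" "\<phi> y \<in> T" by auto
    have "(\<phi> q + s *\<^sub>R bvec) $ bdry_coord = s" using U(2,3) qX(3) by simp
    then have "\<rho> y = c - s" using U(3) y by force
    then show ?thesis using T(3) y chart_subset[OF U(1)] by blast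
  qed
  show "\<exists>y\<in>A. y \<in> Lpart" using *[of "d / 2"] d(1) by (auto simp: Lpart_def)
  show "\<exists>y\<in>A. y \<in> Rpart" using *[of "- d / 2"] d(1) by (auto simp: Rpart_def)
qed

lemma closure_Lpart: "(mtop M) closure_of Lpart = S" and closure_Rpart: "(mtop M) closure_of Rpart = {p\<in>X.
    c \<le> \<rho> p}"
proof -
  have HX: "H \<subseteq> X" by (auto simp: H_def)
  have "Lpart \<subseteq> (mtop M) closure_of Lpart" "Rpart \<subseteq> (mtop M) closure_of Rpart"
    by (intro closure_of_subset; auto simp: Lpart_def Rpart_def)+
  moreover have "H \<subseteq> (mtop M) closure_of Lpart" "H \<subseteq> (mtop M) closure_of Rpart"
    using both_sides HX unfolding in_closure_of subset_iff by blast+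
  moreover have "S = Lpart \<union> H" "{p\<in>X. c \<le> \<rho> p} = Rpart \<union> H" by (auto simp: S_def Lpart_def Rpart_def H_def)
  moreover have "(mtop M) closure_of Lpart \<subseteq> S" by (rule closure_of_minimal[OF _ closed_S]) (auto simp:
      S_def Lpart_def)
  moreover have "(mtop M) closure_of Rpart \<subseteq> {p\<in>X. c \<le> \<rho> p}"
    by (rule closure_of_minimal[OF _ closed_Rclosed]) (auto simp: Rpart_def)
  ultimately show "(mtop M) closure_of Lpart = S" "(mtop M) closure_of Rpart = {p\<in>X. c \<le> \<rho> p}" by auto
qed

lemma slice_images:
  assumes "\<forall>y\<in>U. \<phi> y $ bdry_coord = c - \<rho> y" "U \<subseteq> X"
  shows "\<phi> ` (U \<inter> H) = \<phi> ` U \<inter> hyperplane" "\<phi> ` (U \<inter> S) = \<phi> ` U \<inter> half_space"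
  using assms by (auto simp: H_def S_def hyperplane_def half_space_def subset_iff)

lemma slice_cover:
  assumes "p \<in> S"
  obtains U \<phi> where "(U, \<phi>) \<in> max_atlas M" "p \<in> U" "\<forall>y\<in>U. \<phi> y $ bdry_coord = c - \<rho> y"
    "\<phi> ` (U \<inter> H) = \<phi> ` U \<inter> hyperplane" "\<phi> ` (U \<inter> S) = \<phi> ` U \<inter> half_space"
proof -
  have p: "p \<in> X" "\<rho> p < \<epsilon>" using assms c by (auto simp: S_def)
  obtain U \<phi> where U: "(U, \<phi>) \<in> max_atlas M" "p \<in> U" "\<forall>y\<in>U. \<phi> y $ bdry_coord = c - \<rho> y"
    by (rule slice_chart[OF p])
  show ?thesis by (rule that[OF U slice_images[OF U(3) chart_subset[OF U(1)]]])
qed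

lemma H_subset_S: "H \<subseteq> S" and S_subset: "S \<subseteq> X" and H_subset: "H \<subseteq> X"
  by (auto simp: H_def S_def)

lemma smooth_H: "smooth_manifold (submanifold M H hyperplane)"
proof (rule submanifold_smooth[OF H_subset], intro ballI)
  fix p assume "p \<in> H"
  then have "p \<in> S" using H_subset_S by blast
  obtain U \<phi> where "(U, \<phi>) \<in> max_atlas M" "p \<in> U" "\<phi> ` (U \<inter> H) = \<phi> ` U \<inter> hyperplane"
    by (rule slice_cover[OF \<open>p \<in> S\<close>])
  then show "\<exists>U \<phi>. (U, \<phi>) \<in> max_atlas M \<and> p \<in> U \<and> \<phi> ` (U \<inter> H) = \<phi> ` U \<inter> hyperplane" by blast
qed

lemma smooth_S: "smooth_manifold (submanifold M S half_space)"
proof (rule submanifold_smooth[OF S_subset], intro ballI)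
  fix p assume p: "p \<in> S"
  obtain U \<phi> where "(U, \<phi>) \<in> max_atlas M" "p \<in> U" "\<phi> ` (U \<inter> S) = \<phi> ` U \<inter> half_space"
    by (rule slice_cover[OF p])
  then show "\<exists>U \<phi>. (U, \<phi>) \<in> max_atlas M \<and> p \<in> U \<and> \<phi> ` (U \<inter> S) = \<phi> ` U \<inter> half_space" by blast
qed

lemma collar_gluing:
  assumes "connected_space (mtop M)"
  shows "collar_gluing M H Rpart Lpart"
  unfolding collar_gluing_def
proof (intro conjI)
  have lev: "\<exists>p\<in>X. \<rho> p = t" if "0 < t" "t < \<epsilon>" for t using level that by blast
  show "H \<noteq> {}" using lev[OF c] by (auto simp: H_def)
  show "Lpart \<noteq> {}" using lev[of "c / 2"] c by (auto simp: Lpart_def)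
  \<comment> \<open>Since c is \<epsilon> / 2, the level 3 \<epsilon> / 4 lies above c and still
    below \<epsilon>.\<close>
  show "Rpart \<noteq> {}" using lev[of "3 * \<epsilon> / 4"] \<epsilon> by (fastforce simp: Rpart_def c_def)
  show "embedded_hypersurface M H"
    unfolding embedded_hypersurface_def
  proof (intro conjI H_subset ballI)
    fix q assume "q \<in> H"
    then have "q \<in> S" using H_subset_S by blast
    obtain U \<phi> where "(U, \<phi>) \<in> max_atlas M" "q \<in> U" "\<phi> ` (U \<inter> H) = \<phi> ` U \<inter> hyperplane"
      by (rule slice_cover[OF \<open>q \<in> S\<close>])
    then show "\<exists>(U, \<phi>)\<in>max_atlas M. q \<in> U \<and> \<phi> ` (U \<inter> H) = \<phi> ` U \<inter> hyperplane" by blast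
  qed
  show "(mtop M) closure_of Rpart = Rpart \<union> H" "(mtop M) closure_of Lpart = Lpart \<union> H"
    unfolding closure_Rpart closure_Lpart by (auto simp: Rpart_def Lpart_def H_def S_def)
qed (use boundaryless assms closed_H open_Rpart open_Lpart in \<open>auto simp: Rpart_def Lpart_def H_def\<close>)

end

section \<open>The perturbed metric: tangent spaces of \<open>H\<close>, the coefficient
  \<open>f\<close>, the degeneracy along \<open>H\<close>\<close>

context collared
begin

abbreviation "N \<equiv> submanifold M H hyperplane"

lemma smooth_fun_H: "smooth_fun N h \<longleftrightarrow> (\<forall>p\<in>H. smooth_near M H h p)"
  unfolding smooth_fun_iff[OF smooth_H] submanifold_topspace[OF H_subset]
  by (intro ball_cong refl smooth_near_submanifold[OF H_subset smooth_H])

lemma smooth_fun_restrict: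
  assumes "smooth_fun M h"
  shows "smooth_fun N h"
  unfolding smooth_fun_H
proof
  fix p assume "p \<in> H"
  then have "smooth_near M X h p" using assms H_subset smooth_fun_near by auto
  then show "smooth_near M H h p" by (rule smooth_near_mono[OF _ H_subset])
qed

lemma smooth_fun_H_add: "smooth_fun N h \<Longrightarrow> smooth_fun N k \<Longrightarrow> smooth_fun N (h + k)"
  unfolding smooth_fun_H plus_fun_def by (intro ballI smooth_near_add) auto

lemma smooth_fun_H_mult: "smooth_fun N h \<Longrightarrow> smooth_fun N k \<Longrightarrow> smooth_fun N (h * k)"
  unfolding smooth_fun_H times_fun_def by (intro ballI smooth_near_mult) auto

lemma smooth_fun_H_cmult: "smooth_fun N h \<Longrightarrow> smooth_fun N (\<lambda>x. a * h x)"
  unfolding smooth_fun_H by (intro ballI smooth_near_mult smooth_near_const) auto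

lemma smooth_fun_H_vanishing: "\<forall>x\<in>H. h x = a \<Longrightarrow> smooth_fun N h"
  unfolding smooth_fun_H
proof
  fix p assume h: "\<forall>x\<in>H. h x = a" and p: "p \<in> H"
  show "smooth_near M H h p"
    by (rule smooth_near_cong[OF smooth_near_const[of M H a] openin_topspace]) (use h p H_subset in auto)
qed

text \<open>The functions on which tangent vectors of \<open>H\<close> act are defined on the whole type; a derivation
  at \<open>q \<in> H\<close> ignores their values off \<open>H\<close> because a function vanishing on \<open>H\<close> equals its own
  product with the indicator of the complement of \<open>H\<close>.\<close>

lemma hypersurface_tangent:
  assumes q: "q \<in> H"
  shows "hypersurface_tangent_space M H q = {v\<in>tangent_space M q. v \<rho> = 0}"
proof (intro equalityI subsetI)
  fix v assume "v \<in> hypersurface_tangent_space M H q"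
  then obtain w where w: "w \<in> tangent_space N q" and v: "v = pushforward M (\<lambda>x. x) w"
    by (auto simp: hypersurface_tangent_space_def)
  have wadd: "w (h + k) = w h + w k" if "smooth_fun N h" "smooth_fun N k" for h k
    using w that by (simp add: tangent_space_def)
  have wmul: "w (h * k) = h q * w k + k q * w h" if "smooth_fun N h" "smooth_fun N k" for h k
    using w that by (simp add: tangent_space_def)
  have wsc: "w (\<lambda>x. a * h x) = a * w h" if "smooth_fun N h" for h a
    using w that by (simp add: tangent_space_def)
  have vh: "v h = (if smooth_fun M h then w h else 0)" for h by (simp add: v pushforward_def o_def)
  have "v \<in> tangent_space M q"
    unfolding tangent_space_def
    using wadd wmul wsc smooth_fun_restrict smooth_fun_add smooth_fun_mult smooth_fun_cmult by (simp add: vh)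
  moreover have "v \<rho> = 0"
  proof -
    have s1: "smooth_fun N (\<lambda>x. 1)" and sd: "smooth_fun N (\<lambda>x. \<rho> x - c)"
      and s\<chi>: "smooth_fun N (\<lambda>x. if x \<in> H then 0 else 1)"
      by (rule smooth_fun_H_vanishing[of _ 1] smooth_fun_H_vanishing[of _ 0]; simp add: H_def)+
    have "w ((\<lambda>x. 1) * (\<lambda>x. 1)) = w (\<lambda>x. 1) + w (\<lambda>x. 1)" using wmul[OF s1 s1] by simp
    then have w1: "w (\<lambda>x. 1) = 0" by (simp add: times_fun_def)
    have "(\<lambda>x. \<rho> x - c) = (\<lambda>x. \<rho> x - c) * (\<lambda>x. if x \<in> H then 0 else 1)"
      by (auto simp: times_fun_def fun_eq_iff H_def)
    then have "w (\<lambda>x. \<rho> x - c) = (\<rho> q - c) * w (\<lambda>x. if x \<in> H then 0 else 1) + (if q \<in> H then 0 else 1) * w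
        (\<lambda>x. \<rho> x - c)"
      using wmul[OF sd s\<chi>] by metis
    then have wd: "w (\<lambda>x. \<rho> x - c) = 0" using q by (simp add: H_def)
    have "\<rho> = (\<lambda>x. c * 1) + (\<lambda>x. \<rho> x - c)" by (simp add: plus_fun_def)
    then have "w \<rho> = w (\<lambda>x. c * 1) + w (\<lambda>x. \<rho> x - c)" using wadd[OF smooth_fun_H_cmult[OF s1] sd] by metis
    then show ?thesis using wsc[OF s1, of c] w1 wd by (simp add: vh)
  qed
  ultimately show "v \<in> {v\<in>tangent_space M q. v \<rho> = 0}" by simp
next
  fix v assume "v \<in> {v\<in>tangent_space M q. v \<rho> = 0}"
  then have v: "v \<in> tangent_space M q" "v \<rho> = 0" by auto
  have qS: "q \<in> S" using q H_subset_S by blast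
  obtain U \<phi> where U: "(U, \<phi>) \<in> max_atlas M" "q \<in> U" "\<forall>y\<in>U. \<phi> y $ bdry_coord = c - \<rho> y"
    "\<phi> ` (U \<inter> H) = \<phi> ` U \<inter> hyperplane" by (rule slice_cover[OF qS])
  obtain x where x: "v = dvec M (U, \<phi>) q x" by (rule tangent_eq_dvec[OF U(1,2) v(1)])
  let ?x0 = "\<phi> q"
  have oU: "open (\<phi> ` U)" by (rule open_chart_image[OF U(1)])
  have x0U: "?x0 \<in> \<phi> ` U" using U(2) by blast
  have x0h: "?x0 \<in> hyperplane" using U(2,3) q by (simp add: hyperplane_def H_def)
  \<comment> \<open>In a slice chart d\<rho> is the negative of the boundary coordinate, so a vector
    on which it vanishes lies in the hyperplane.\<close>
  have xh: "x \<in> hyperplane"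
  proof -
    have "((\<lambda>z. c - z $ bdry_coord) has_derivative (\<lambda>z. 0 - z $ bdry_coord)) (at ?x0)"
      by (intro has_derivative_diff has_derivative_const bounded_linear_imp_has_derivative[OF
          bounded_linear_vec_nth])
    then have "((\<rho> \<circ> inv_into U \<phi>) has_derivative (\<lambda>z. 0 - z $ bdry_coord)) (at ?x0)"
      by (rule has_derivative_transform_within_open[OF _ oU x0U]) (use U(3) chart_inv[OF U(1)] in auto)
    then have "frechet_derivative (\<rho> \<circ> inv_into U \<phi>) (at ?x0) = (\<lambda>z. 0 - z $ bdry_coord)"
      by (rule frechet_derivative_at[symmetric])
    then show ?thesis using v(2) x \<rho> by (simp add: dvec_apply hyperplane_def)
  qed
  \<comment> \<open>A smooth function on \<open>H\<close> is controlled only along \<open>H\<close>.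
    Read through \<open>hproj\<close>, it becomes a function near \<phi> q that is constant in the
    direction \<open>bvec\<close> and differentiable. Its derivative in the tangential direction x
    is the derivation \<open>w\<close> on \<open>H\<close> whose pushforward is v.\<close>
  define E where "E h z = h (inv_into U \<phi> (hproj z))" for h :: "'a \<Rightarrow> real" and z
  have Eq: "E h ?x0 = h q" for h using chart_inv[OF U(1,2)] x0h by (simp add: E_def)
  have E_diff: "(E h has_derivative frechet_derivative (E h) (at ?x0)) (at ?x0)" if h: "smooth_fun N h" for h
  proof -
    have near: "smooth_near M H h q" using h q smooth_fun_H by blast
    obtain T F where T: "open T" "\<phi> q \<in> T" "Cinf T F" "\<forall>y\<in>U. y \<in> H \<longrightarrow> \<phi> y \<in> T \<longrightarrow> F (\<phi> y) = h y"
      by (rule smooth_nearD[OF near U(1,2)])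
    let ?O = "hproj -` (T \<inter> \<phi> ` U)"
    have oO: "open ?O"
      using T(1) oU by (intro open_vimage) (auto intro: linear_continuous_on bounded_linear_hproj)
    have x0O: "?x0 \<in> ?O" using x0h T(2) x0U by simp
    have "(F has_derivative frechet_derivative F (at ?x0)) (at (hproj ?x0))"
      using Cinf_has_derivative[OF T(3,2)] x0h by simp
    then have "((\<lambda>z. F (hproj z)) has_derivative (\<lambda>z. frechet_derivative F (at ?x0) (hproj z))) (at ?x0)"
      by (rule has_derivative_compose[OF bounded_linear_imp_has_derivative[OF bounded_linear_hproj]])
    then have "(E h has_derivative (\<lambda>z. frechet_derivative F (at ?x0) (hproj z))) (at ?x0)"
    proof (rule has_derivative_transform_within_open[OF _ oO x0O])
      fix z assume "z \<in> ?O"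
      then obtain y where y: "y \<in> U" "hproj z = \<phi> y" "\<phi> y \<in> T" by auto
      have "\<phi> y \<in> \<phi> ` (U \<inter> H)" using U(4) y(1) by (metis IntI hproj_in imageI y(2))
      then have "y \<in> H" using chart_inj[OF U(1)] y(1) by (auto dest: inj_onD)
      then show "F (hproj z) = E h z" using T(4) y chart_inv[OF U(1)] by (simp add: E_def)
    qed
    then show ?thesis using frechet_derivative_at by metis
  qed
  define w where "w h = (if smooth_fun N h then frechet_derivative (E h) (at ?x0) x else 0)" for h
  have "w \<in> tangent_space N q"
  proof -
    have add: "frechet_derivative (E (h + k)) (at ?x0) = (\<lambda>v. frechet_derivative (E h) (at ?x0) v +
        frechet_derivative (E k) (at ?x0) v)"
      if "smooth_fun N h" "smooth_fun N k" for h k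
      by (rule frechet_derivative_at[symmetric])
        (use has_derivative_add[OF E_diff[OF that(1)] E_diff[OF that(2)]] in \<open>simp add: E_def[abs_def]
            plus_fun_def\<close>)
    have scale: "frechet_derivative (E (\<lambda>x. a * h x)) (at ?x0) = (\<lambda>v. a * frechet_derivative (E h) (at ?x0) v)"
      if "smooth_fun N h" for a h
      by (rule frechet_derivative_at[symmetric])
        (use has_derivative_mult_right[OF E_diff[OF that], of a] in \<open>simp add: E_def[abs_def]\<close>)
    have mult: "frechet_derivative (E (h * k)) (at ?x0) = (\<lambda>v. h q * frechet_derivative (E k) (at ?x0) v +
        k q * frechet_derivative (E h) (at ?x0) v)"
      if "smooth_fun N h" "smooth_fun N k" for h k
    proof (rule frechet_derivative_at[symmetric])
      have "E (h * k) = (\<lambda>z. E h z * E k z)" by (simp add: E_def fun_eq_iff times_fun_def)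
      then show "(E (h * k) has_derivative (\<lambda>v. h q * frechet_derivative (E k) (at ?x0) v + k q *
          frechet_derivative (E h) (at ?x0) v)) (at ?x0)"
        using has_derivative_mult[OF E_diff[OF that(1)] E_diff[OF that(2)]] by (simp add: Eq mult.commute)
    qed
    show ?thesis
      unfolding tangent_space_def
      using add scale mult smooth_fun_H_add smooth_fun_H_mult smooth_fun_H_cmult by (simp add: w_def)
  qed
  moreover have "v = pushforward M (\<lambda>x. x) w"
  proof
    fix h
    show "v h = pushforward M (\<lambda>x. x) w h"
    proof (cases "smooth_fun M h")
      case True
      let ?D = "frechet_derivative (h \<circ> inv_into U \<phi>) (at ?x0)"
      have "((h \<circ> inv_into U \<phi>) has_derivative ?D) (at (hproj ?x0))"
        using rep_derivative[OF U(1) True U(2)] x0h by simp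
      then have "((\<lambda>z. (h \<circ> inv_into U \<phi>) (hproj z)) has_derivative (\<lambda>z. ?D (hproj z))) (at ?x0)"
        by (rule has_derivative_compose[OF bounded_linear_imp_has_derivative[OF bounded_linear_hproj]])
      then have "frechet_derivative (E h) (at ?x0) = (\<lambda>z. ?D (hproj z))"
        by (intro frechet_derivative_at[symmetric]) (simp add: E_def[abs_def])
      then have "frechet_derivative (E h) (at ?x0) x = ?D x" using xh by simp
      then show ?thesis
        using True smooth_fun_restrict[OF True] by (simp add: x dvec_apply pushforward_def w_def o_def)
    next
      case False
      then show ?thesis by (simp add: x dvec_def pushforward_def)
    qed
  qed
  ultimately show "v \<in> hypersurface_tangent_space M H q" by (auto simp: hypersurface_tangent_space_def)
qed

text \<open>The coefficient is chosen so that \<open>f |grad \<rho>|\<^sup>2 - 1\<close> has the sign of \<open>c - \<rho>\<close>; the flat summand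
  keeps the denominator positive where the gradient may vanish.\<close>

definition f :: "'a \<Rightarrow> real" where
  "f p = (1 + (c - \<rho> p)) / (grad \<rho> p \<rho> + flat 0 (\<rho> p - c))"

lemma denominator_pos:
  assumes "p \<in> X"
  shows "0 < grad \<rho> p \<rho> + flat 0 (\<rho> p - c)"
proof (cases "\<rho> p \<le> c")
  case True
  then show ?thesis using grad_positive[OF assms] c flat_nonneg[of 0 "\<rho> p - c"] by simp
next
  case False
  then show ?thesis using grad_nonneg[OF assms \<rho>] flat_pos[of "\<rho> p - c" 0] by simp
qed

lemma smooth_grad: "smooth_fun M (\<lambda>p. grad \<rho> p \<rho>)"
  using grad_vector_field[OF \<rho>] \<rho> by (simp add: vector_field_def)

lemma smooth_flat: "smooth_fun M (\<lambda>p. flat 0 (\<rho> p - c))"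
  unfolding smooth_fun_near
proof
  fix p assume p: "p \<in> X"
  have "smooth_near M X (\<lambda>p. \<rho> p - c) p"
    using \<rho> p by (intro smooth_near_diff smooth_near_const) (simp add: smooth_fun_near)
  then show "smooth_near M X (\<lambda>p. flat 0 (\<rho> p - c)) p"
    by (rule smooth_near_compose_UNIV[OF _ p Cinf_flat])
qed

lemma smooth_f: "smooth_fun M f"
  unfolding smooth_fun_near f_def
proof
  fix p assume p: "p \<in> X"
  show "smooth_near M X (\<lambda>p. (1 + (c - \<rho> p)) / (grad \<rho> p \<rho> + flat 0 (\<rho> p - c))) p"
    using \<rho> smooth_grad smooth_flat p denominator_pos[OF p]
    by (intro smooth_near_divide smooth_near_add smooth_near_diff smooth_near_const) (auto simp:
        smooth_fun_near)
qed

lemma defect: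
  assumes "p \<in> X"
  shows "1 - f p * grad \<rho> p \<rho> = (flat 0 (\<rho> p - c) - (c - \<rho> p) * grad \<rho> p \<rho>) / (grad \<rho> p \<rho> + flat 0 (\<rho> p - c))"
  using denominator_pos[OF assms] by (simp add: f_def field_simps)

text \<open>The denominator is positive. For \<rho> < c the flat term is zero and the gradient is
  nonzero, so the numerator is negative. For \<rho> > c both of its terms are nonnegative and the
  flat one is positive, even where the gradient vanishes.\<close>

lemma defect_sign:
  assumes "p \<in> X"
  shows "\<rho> p < c \<Longrightarrow> 1 < f p * grad \<rho> p \<rho>" "\<rho> p = c \<Longrightarrow> f p * grad \<rho> p \<rho> = 1" "c < \<rho> p \<Longrightarrow> f p * grad \<rho> p \<rho> < 1"
proof -
  note d = defect[OF assms] and pos = denominator_pos[OF assms]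
  show "1 < f p * grad \<rho> p \<rho>" if "\<rho> p < c"
  proof -
    have "0 < (c - \<rho> p) * grad \<rho> p \<rho>" using grad_positive[OF assms] that c by simp
    then have "1 - f p * grad \<rho> p \<rho> < 0" unfolding d using pos that by (intro divide_neg_pos) (auto simp:
        flat_zero)
    then show ?thesis by simp
  qed
  show "f p * grad \<rho> p \<rho> = 1" if "\<rho> p = c" using d that by (simp add: flat_zero)
  show "f p * grad \<rho> p \<rho> < 1" if "c < \<rho> p"
  proof -
    have "(c - \<rho> p) * grad \<rho> p \<rho> \<le> 0" using grad_nonneg[OF assms \<rho>] that by (simp add: mult_nonpos_nonneg)
    then have "0 < 1 - f p * grad \<rho> p \<rho>" unfolding d using pos that flat_pos[of "\<rho> p - c" 0] by (intro
        divide_pos_pos) auto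
    then show ?thesis by simp
  qed
qed

lemma degeneracy_locus_pert: "degeneracy_locus M (pert f \<rho>) = H"
proof (intro equalityI subsetI)
  fix q assume "q \<in> degeneracy_locus M (pert f \<rho>)"
  then obtain U \<phi> where U: "(U, \<phi>) \<in> max_atlas M" "q \<in> U" "det (components M (pert f \<rho>) (U, \<phi>) q) = 0"
    by (auto simp: degeneracy_locus_def)
  have qX: "q \<in> X" using U chart_subset by blast
  have "f q * grad \<rho> q \<rho> = 1" using det_pert[OF U(1,2) \<rho>, of f] U(3) det_components[OF U(1,2)] by simp
  then have "\<rho> q = c" using defect_sign[OF qX] by (metis less_irrefl linorder_neqE_linordered_idom)
  then show "q \<in> H" using qX by (simp add: H_def)
next
  fix q assume q: "q \<in> H"
  then have qX: "q \<in> X" using H_subset by blast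
  obtain U \<phi> where U: "(U, \<phi>) \<in> max_atlas M" "q \<in> U" by (rule max_atlas_cover[OF smooth qX])
  have "det (components M (pert f \<rho>) (U, \<phi>) q) = 0"
    using det_pert[OF U \<rho>, of f] defect_sign(2)[OF qX] q by (simp add: H_def)
  then show "q \<in> degeneracy_locus M (pert f \<rho>)" using U by (auto simp: degeneracy_locus_def)
qed

text \<open>In coordinates the determinant is Q K with K smooth and nonzero and Q vanishing at the
  point. The product rule leaves only dQ times K there, and dQ is d\<rho> times the squared length
  of the gradient: the flat term has zero derivative and the factor c - r vanishes.\<close>

lemma det_derivative_nonzero:
  assumes q: "q \<in> H" and U: "(U, \<phi>) \<in> max_atlas M" "q \<in> U"
  shows "frechet_derivative (\<lambda>x. det (components M (pert f \<rho>) (U, \<phi>) (inv_into U \<phi> x))) (at (\<phi> q)) \<noteq> (\<lambda>_. 0)"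
proof -
  have qX: "q \<in> X" and qc: "\<rho> q = c" using q by (auto simp: H_def)
  let ?i = "inv_into U \<phi>" and ?x0 = "\<phi> q"
  have oU: "open (\<phi> ` U)" by (rule open_chart_image[OF U(1)])
  have x0: "?x0 \<in> \<phi> ` U" using U(2) by blast
  have iq: "?i ?x0 = q" by (rule chart_inv[OF U])
  define a where "a x = grad \<rho> (?i x) \<rho>" for x
  define r where "r x = \<rho> (?i x)" for x
  define s where "s x = flat 0 (r x - c)" for x
  define Q where "Q x = s x - (c - r x) * a x" for x
  define K where "K x = det (components M g (U, \<phi>) (?i x)) * (1 / (a x + s x))" for x
  have Ca: "Cinf (\<phi> ` U) a" using fun_rep[OF U(1) smooth_grad] by (simp add: a_def[abs_def] o_def)
  have Cr: "Cinf (\<phi> ` U) r" using fun_rep[OF U(1) \<rho>] by (simp add: r_def[abs_def] o_def)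
  have Cs: "Cinf (\<phi> ` U) s" using fun_rep[OF U(1) smooth_flat] by (simp add: s_def[abs_def] r_def o_def)
  have den: "a x + s x \<noteq> 0" if "x \<in> \<phi> ` U" for x
    using that denominator_pos[of "?i x"] chart_inv[OF U(1)] chart_subset[OF U(1)] by (force simp: a_def
        s_def r_def)
  have CK: "Cinf (\<phi> ` U) K"
    unfolding K_def
    by (intro Cinf_mult Cinf_divide Cinf_add Cinf_const Cinf_det components_smooth[OF sym U(1)] oU Ca Cs den)
  have eq: "det (components M (pert f \<rho>) (U, \<phi>) (?i x)) = Q x * K x" if "x \<in> \<phi> ` U" for x
  proof -
    have ix: "?i x \<in> U" using that by (rule inv_into_into)
    then have "?i x \<in> X" using chart_subset[OF U(1)] by blast
    then show ?thesis
      using det_pert[OF U(1) ix \<rho>, of f] defect[of "?i x"] by (simp add: Q_def K_def a_def s_def r_def)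
  qed
  have K0: "K ?x0 \<noteq> 0" using det_components[OF U] den[OF x0] by (simp add: K_def iq)
  have a0: "0 < a ?x0" using grad_positive[OF qX] qc c by (simp add: a_def iq)
  have r0: "r ?x0 = c" by (simp add: r_def iq qc)
  have Q0: "Q ?x0 = 0" by (simp add: Q_def s_def r0 flat_zero)
  let ?Da = "frechet_derivative a (at ?x0)" and ?Dr = "frechet_derivative r (at ?x0)" and ?DK =
      "frechet_derivative K (at ?x0)"
  note da = Cinf_has_derivative[OF Ca x0] and dr = Cinf_has_derivative[OF Cr x0] and dK =
      Cinf_has_derivative[OF CK x0]
  \<comment> \<open>Vanishing of the flat function to first order at 0 is what keeps the correction
    of the denominator from affecting the derivative along \<open>H\<close>.\<close>
  have "(flat 0 has_derivative (*) 0) (at (r ?x0 - c))"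
    using flat_DERIV[of 0 0] by (simp add: r0 has_field_derivative_def flat_zero)
  moreover have "((\<lambda>x. r x - c) has_derivative (\<lambda>v. ?Dr v - 0)) (at ?x0)"
    by (intro has_derivative_diff dr has_derivative_const)
  ultimately have "((\<lambda>x. flat 0 (r x - c)) has_derivative (\<lambda>v. 0 * (?Dr v - 0))) (at ?x0)"
    using has_derivative_compose by blast
  then have ds: "(s has_derivative (\<lambda>v. 0)) (at ?x0)" by (simp add: s_def[abs_def])
  have "(Q has_derivative (\<lambda>v. 0 - ((c - r ?x0) * ?Da v + (0 - ?Dr v) * a ?x0))) (at ?x0)"
    unfolding Q_def[abs_def]
    by (intro has_derivative_diff has_derivative_mult has_derivative_const ds dr da)
  then have dQ: "(Q has_derivative (\<lambda>v. ?Dr v * a ?x0)) (at ?x0)" by (simp add: r0)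
  have "((\<lambda>x. Q x * K x) has_derivative (\<lambda>v. Q ?x0 * ?DK v + ?Dr v * a ?x0 * K ?x0)) (at ?x0)"
    by (rule has_derivative_mult[OF dQ dK])
  then have "((\<lambda>x. det (components M (pert f \<rho>) (U, \<phi>) (?i x))) has_derivative (\<lambda>v. Q ?x0 * ?DK v + ?Dr v
      * a ?x0 * K ?x0)) (at ?x0)"
    by (rule has_derivative_transform_within_open[OF _ oU x0]) (simp add: eq)
  then have D: "frechet_derivative (\<lambda>x. det (components M (pert f \<rho>) (U, \<phi>) (?i x))) (at ?x0) = (\<lambda>v. Q ?x0
      * ?DK v + ?Dr v * a ?x0 * K ?x0)"
    by (rule frechet_derivative_at[symmetric])
  have \<rho>q: "\<rho> q < \<epsilon>" using qc c by simp
  obtain w where w: "w \<in> tangent_space M q" "w \<rho> = 1" by (rule d\<rho>_nonzero[OF qX \<rho>q])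
  obtain v where "w = dvec M (U, \<phi>) q v" by (rule tangent_eq_dvec[OF U w(1)])
  then have "?Dr v = 1" using w(2) \<rho> by (simp add: dvec_apply r_def[abs_def] o_def)
  then have "(\<lambda>v. Q ?x0 * ?DK v + ?Dr v * a ?x0 * K ?x0) v \<noteq> 0" using Q0 a0 K0 by simp
  then show ?thesis unfolding D by metis
qed

text \<open>The radical is the line of the gradient and the tangent space of \<open>H\<close> is the
  kernel of d\<rho>. As d\<rho> is positive on the gradient, each tangent vector t splits uniquely;
  the coefficient ?k is chosen so that the remainder is annihilated by d\<rho>.\<close>

lemma radical_transverse_pert: "radical_transverse M (pert f \<rho>) H"
  unfolding radical_transverse_def
proof
  fix q assume q: "q \<in> H"
  then have qX: "q \<in> X" and qc: "\<rho> q = c" by (auto simp: H_def)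
  note rad = radical_pert_span[where f = f, OF qX \<rho> defect_sign(2)[OF qX qc]]
  note G = grad(1)[OF qX \<rho>]
  have a: "0 < grad \<rho> q \<rho>" using grad_positive[OF qX] qc c by simp
  have "radical M (pert f \<rho>) q \<inter> hypersurface_tangent_space M H q = {0}"
  proof (intro equalityI subsetI)
    fix v assume v: "v \<in> radical M (pert f \<rho>) q \<inter> hypersurface_tangent_space M H q"
    then obtain k where k: "v = tscale k (grad \<rho> q)" using rad by auto
    have "v \<rho> = 0" using v hypersurface_tangent[OF q] by simp
    then have "k = 0" using a by (simp add: k tscale_def)
    then show "v \<in> {0}" by (simp add: k)
  next
    fix v :: "'a tvec" assume v: "v \<in> {0}"
    then have "v = tscale 0 (grad \<rho> q)" by simp
    then have "v \<in> radical M (pert f \<rho>) q" unfolding rad by blast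
    then show "v \<in> radical M (pert f \<rho>) q \<inter> hypersurface_tangent_space M H q"
      using v zero_tangent hypersurface_tangent[OF q] by simp
  qed
  moreover have "{u + v | u v. u \<in> radical M (pert f \<rho>) q \<and> v \<in> hypersurface_tangent_space M H q} =
      tangent_space M q"
  proof (intro equalityI subsetI)
    fix t assume "t \<in> {u + v | u v. u \<in> radical M (pert f \<rho>) q \<and> v \<in> hypersurface_tangent_space M H q}"
    then obtain u v where "t = u + v" "u \<in> tangent_space M q" "v \<in> tangent_space M q"
      using hypersurface_tangent[OF q] by (auto simp: radical_def)
    then show "t \<in> tangent_space M q" using tangent_subspace tangent.subspace_add by blast
  next
    fix t assume t: "t \<in> tangent_space M q"
    let ?k = "t \<rho> / grad \<rho> q \<rho>"
    let ?u = "tscale ?k (grad \<rho> q)" and ?v = "tscale 1 t + tscale (- ?k) (grad \<rho> q)"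
    have "?u \<in> radical M (pert f \<rho>) q" unfolding rad by blast
    moreover have "?v \<in> tangent_space M q" by (rule tangent_closed[OF t G])
    moreover have "?v \<rho> = 0" using a by (simp add: tscale_def)
    moreover have "t = ?u + ?v" by (simp add: fun_eq_iff tscale_def)
    ultimately show "t \<in> {u + v | u v. u \<in> radical M (pert f \<rho>) q \<and> v \<in> hypersurface_tangent_space M H q}"
      using hypersurface_tangent[OF q] by blast
  qed
  ultimately show "radical M (pert f \<rho>) q \<inter> hypersurface_tangent_space M H q = {0} \<and>
     {u + v | u v. u \<in> radical M (pert f \<rho>) q \<and> v \<in> hypersurface_tangent_space M H q} = tangent_space M q" ..
qed

lemma admissible:
  assumes "connected_space (mtop M)" "CARD('n) \<ge> 2"
  shows "admissible_collar_gluing M g H Rpart Lpart"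
proof -
  have pert: "(\<lambda>p v w. g p v w - f p * (g p (grad \<rho> p) v * g p (grad \<rho> p) w)) = pert f \<rho>"
    by (simp add: fun_eq_iff pert_def)
  have rad: "radical M (pert f \<rho>) p \<noteq> {0} \<longleftrightarrow> \<rho> p = c" if p: "p \<in> X" for p
  proof
    assume "radical M (pert f \<rho>) p \<noteq> {0}"
    then have "f p * grad \<rho> p \<rho> = 1" using radical_pert_trivial[where f = f, OF p \<rho>] by blast
    then show "\<rho> p = c" using defect_sign[OF p] by (metis less_irrefl linorder_neqE_linordered_idom)
  next
    assume pc: "\<rho> p = c"
    have "0 < grad \<rho> p \<rho>" using grad_positive[OF p] pc c by simp
    then have "grad \<rho> p \<noteq> 0" by auto
    moreover have "tscale 1 (grad \<rho> p) \<in> radical M (pert f \<rho>) p"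
      unfolding radical_pert_span[where f = f, OF p \<rho> defect_sign(2)[OF p pc]] by blast
    ultimately show "radical M (pert f \<rho>) p \<noteq> {0}" by auto
  qed
  have dim: "tangent.dim (radical M (pert f \<rho>) q) = 1" if q: "q \<in> H" for q
  proof -
    have qX: "q \<in> X" and qc: "\<rho> q = c" using q by (auto simp: H_def)
    have "0 < grad \<rho> q \<rho>" using grad_positive[OF qX] qc c by simp
    then have "tangent.independent {grad \<rho> q}" by (auto simp: tangent.dependent_single)
    moreover have "radical M (pert f \<rho>) q = tangent.span {grad \<rho> q}"
      unfolding radical_pert_span[where f = f, OF qX \<rho> defect_sign(2)[OF qX qc]] by (simp add:
          tangent.span_singleton)
    ultimately show ?thesis using tangent.dim_eq_card_independent[of "{grad \<rho> q}"] by simp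
  qed
  have ne: "H \<noteq> {}" using collar_gluing[OF assms(1)] by (simp add: collar_gluing_def)
  have "riemannian_on M Rpart (pert f \<rho>)"
    unfolding riemannian_on_def
  proof (intro ballI impI)
    fix p v assume "p \<in> Rpart" and v: "v \<in> tangent_space M p" "v \<noteq> 0"
    then have p: "p \<in> X" "c < \<rho> p" by (auto simp: Rpart_def)
    show "0 < pert f \<rho> p v v"
      by (rule pert_pos[where f = f, OF p(1) \<rho> defect_sign(3)[OF p] v])
  qed
  moreover have "lorentzian_on M Lpart (pert f \<rho>)"
    unfolding lorentzian_on_def
  proof
    fix p assume "p \<in> Lpart"
    then have p: "p \<in> X" "\<rho> p < c" by (auto simp: Lpart_def)
    show "radical M (pert f \<rho>) p = {0} \<and> index M (pert f \<rho>) p = 1"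
      using rad[OF p(1)] p(2) index_pert[where f = f, OF p(1) \<rho> defect_sign(1)[OF p]] by auto
  qed
  moreover have "{p \<in> X. radical M (pert f \<rho>) p \<noteq> {0}} = H"
    using rad by (auto simp: H_def)
  moreover have "transverse_type_changing M (pert f \<rho>)"
    unfolding transverse_type_changing_def degeneracy_locus_pert
    using boundaryless assms(2) pert_symmetric[OF \<rho> smooth_f] ne det_derivative_nonzero by auto
  ultimately have "riemannian_on M Rpart (pert f \<rho>) \<and> lorentzian_on M Lpart (pert f \<rho>) \<and>
          {p \<in> X. radical M (pert f \<rho>) p \<noteq> {0}} = H \<and>
          (\<forall>q\<in>H. tangent.dim (radical M (pert f \<rho>) q) = 1) \<and>
          transverse_type_changing M (pert f \<rho>) \<and> radical_transverse M (pert f \<rho>) H"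
    using dim radical_transverse_pert by simp
  then show ?thesis
    unfolding admissible_collar_gluing_def
    using collar_gluing[OF assms(1)] smooth_f grad_vector_field[OF \<rho>]
    by (intro conjI exI[of _ f] exI[of _ "grad \<rho>"]) (simp_all add: Let_def pert)
qed

end

subsection \<open>Half cylinders\<close>

lemma second_countable_euclidean: "second_countable (euclidean :: 'a::second_countable_topology topology)"
proof -
  obtain \<B> :: "'a set set" where \<B>: "countable \<B>" "\<And>C. C \<in> \<B> \<Longrightarrow> open C" "\<And>S. open S \<Longrightarrow> \<exists>U. U \<subseteq> \<B> \<and> S = \<Union>U"
    by (rule univ_second_countable) blast
  show ?thesis
    unfolding second_countable_def
  proof (intro exI conjI ballI allI impI)
    show "countable \<B>" "\<And>V. V \<in> \<B> \<Longrightarrow> openin euclidean V" using \<B> by auto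
    fix U and x :: 'a assume "openin euclidean U \<and> x \<in> U"
    then obtain \<U> where "\<U> \<subseteq> \<B>" "U = \<Union>\<U>" "x \<in> U" using \<B>(3)[of U] by auto
    then show "\<exists>V\<in>\<B>. x \<in> V \<and> V \<subseteq> U" by blast
  qed
qed

lemma second_countable_prod_topology:
  assumes "second_countable A" "second_countable B"
  shows "second_countable (prod_topology A B)"
proof -
  obtain \<A> where \<A>: "countable \<A>" "\<forall>V\<in>\<A>. openin A V" "\<forall>U x. openin A U \<and> x \<in> U \<longrightarrow> (\<exists>V\<in>\<A>. x \<in> V \<and> V \<subseteq> U)"
    using assms(1) by (auto simp: second_countable_def)
  obtain \<B> where \<B>: "countable \<B>" "\<forall>V\<in>\<B>. openin B V" "\<forall>U x. openin B U \<and> x \<in> U \<longrightarrow> (\<exists>V\<in>\<B>. x \<in> V \<and> V \<subseteq> U)"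
    using assms(2) by (auto simp: second_countable_def)
  let ?C = "(\<lambda>(V, W). V \<times> W) ` (\<A> \<times> \<B>)"
  show ?thesis
    unfolding second_countable_def
  proof (intro exI[of _ ?C] conjI ballI allI impI)
    show "countable ?C" using \<A>(1) \<B>(1) by auto
    show "openin (prod_topology A B) V" if "V \<in> ?C" for V
      using that \<A>(2) \<B>(2) by (auto simp: openin_prod_Times_iff)
    fix U x assume "openin (prod_topology A B) U \<and> x \<in> U"
    then obtain E F where EF: "openin A E" "openin B F" "fst x \<in> E" "snd x \<in> F" "E \<times> F \<subseteq> U"
      unfolding openin_prod_topology_alt by (metis prod.collapse)
    then obtain V W where VW: "V \<in> \<A>" "fst x \<in> V" "V \<subseteq> E" "W \<in> \<B>" "snd x \<in> W" "W \<subseteq> F" using \<A>(3) \<B>(3) by meson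
    then have "V \<times> W \<in> ?C" by blast
    moreover have "x \<in> V \<times> W" "V \<times> W \<subseteq> U" using VW EF(5) by (auto simp: mem_Times_iff)
    ultimately show "\<exists>V\<in>?C. x \<in> V \<and> V \<subseteq> U" by blast
  qed
qed

definition cyl :: "('a \<Rightarrow> real^'n::finite) \<Rightarrow> 'a \<times> real \<Rightarrow> real^'n" where
  "cyl \<phi> = (\<lambda>(q, t). \<phi> q + t *\<^sub>R bvec)"

lemma half_cylinder_atlas: "atlas (half_cylinder N) = {(U \<times> {0..}, cyl \<phi>) | U \<phi>. (U, \<phi>) \<in> atlas N}"
  by (simp add: half_cylinder_def cyl_def)

lemma cyl_coords:
  assumes "\<phi> q \<in> hyperplane"
  shows "hproj (cyl \<phi> (q, t)) = \<phi> q" "cyl \<phi> (q, t) $ bdry_coord = t"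
  using assms by (auto simp: cyl_def hyperplane_def)

text \<open>Charts of \<open>N\<close> take values in the hyperplane, so the two factors of the
  cylinder can be recovered from \<open>cyl \<phi>\<close> as its projection by \<open>hproj\<close>
  and its boundary coordinate. The inverse charts and transition maps are therefore those of
  \<open>N\<close> after \<open>hproj\<close>, with the boundary coordinate left unchanged.\<close>

lemma half_cylinder_smooth:
  fixes N :: "('a, 'n::finite) manifold"
  assumes N: "smooth_manifold N" and m: "model N = hyperplane"
  shows "smooth_manifold (half_cylinder N)"
proof -
  let ?C = "half_cylinder N" and ?R = "top_of_set {0::real..}"
  have mt: "mtop ?C = prod_topology (mtop N) ?R" "model ?C = half_space" by (auto simp: half_cylinder_def)
  have hyp: "\<phi> q \<in> hyperplane" if "(U, \<phi>) \<in> atlas N" "q \<in> U" for U \<phi> q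
    using is_chartD(4)[OF max_atlas_chart[OF atlas_subset_max_atlas[OF N that(1)]]] that(2) m by blast
  have inj: "inj_on (cyl \<phi>) (U \<times> {0..})" if U: "(U, \<phi>) \<in> atlas N" for U \<phi>
  proof (rule inj_onI)
    fix x y assume x: "x \<in> U \<times> {0..}" and y: "y \<in> U \<times> {0..}" and eq: "cyl \<phi> x = cyl \<phi> y"
    obtain q s r t where xy: "x = (q, s)" "y = (r, t)" by (cases x, cases y)
    have qr: "q \<in> U" "r \<in> U" using x y xy by auto
    have "\<phi> q = \<phi> r" "s = t"
      using eq cyl_coords[where \<phi> = \<phi>, OF hyp[OF U qr(1)], of s] cyl_coords[where \<phi> = \<phi>, OF hyp[OF U
          qr(2)], of t] xy by auto
    then show "x = y"
      using inj_onD[OF is_chartD(2)[OF max_atlas_chart[OF atlas_subset_max_atlas[OF N U]]]] qr xy by auto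
  qed
  have ch: "is_chart ?C (U \<times> {0..}, cyl \<phi>)" if U: "(U, \<phi>) \<in> atlas N" for U \<phi>
  proof -
    note c = max_atlas_chart[OF atlas_subset_max_atlas[OF N U]]
    obtain T where T: "open T" "\<phi> ` U = T \<inter> hyperplane" using is_chartD(4)[OF c] m by auto
    have im: "cyl \<phi> ` (U \<times> {0..}) = half_space \<inter> hproj -` T"
    proof (intro equalityI subsetI)
      fix z assume "z \<in> cyl \<phi> ` (U \<times> {0..})"
      then obtain q t where z: "z = cyl \<phi> (q, t)" "q \<in> U" "0 \<le> t" by auto
      then show "z \<in> half_space \<inter> hproj -` T"
        using cyl_coords[where \<phi> = \<phi>, OF hyp[OF U z(2)], of t] T(2) by (auto simp: half_space_def)
    next
      fix z assume z: "z \<in> half_space \<inter> hproj -` T"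
      then have "hproj z \<in> \<phi> ` U" using T(2) by auto
      then obtain q where q: "q \<in> U" "hproj z = \<phi> q" by auto
      have "z = cyl \<phi> (q, z $ bdry_coord)" using hproj_decomp[of z] q(2) by (simp add: cyl_def)
      then show "z \<in> cyl \<phi> ` (U \<times> {0..})" using q(1) z by (auto simp: half_space_def)
    qed
    obtain h where h: "homeomorphic_maps (subtopology (mtop N) U) (top_of_set (\<phi> ` U)) \<phi> h"
      using is_chartD(3)[OF c] homeomorphic_map_maps by blast
    have UT: "topspace (subtopology (mtop N) U) = U" using is_chartD(5)[OF c] by auto
    have h\<phi>: "h (\<phi> q) = q" if "q \<in> U" for q using h UT that by (auto simp: homeomorphic_maps_def)
    have ch: "continuous_map (top_of_set (\<phi> ` U)) (subtopology (mtop N) U) h" and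
      c\<phi>: "continuous_map (subtopology (mtop N) U) euclidean \<phi>"
      using h by (auto simp: homeomorphic_maps_def continuous_map_in_subtopology)
    let ?P = "prod_topology (subtopology (mtop N) U) ?R"
    have sub: "subtopology (mtop ?C) (U \<times> {0..}) = ?P" by (simp add: mt subtopology_Times
        subtopology_subtopology)
    let ?h = "\<lambda>z. (h (hproj z), z $ bdry_coord)"
    have "homeomorphic_maps ?P (top_of_set (cyl \<phi> ` (U \<times> {0..}))) (cyl \<phi>) ?h"
      unfolding homeomorphic_maps_def
    proof (intro conjI ballI)
      have 1: "continuous_map ?P euclidean (\<lambda>x. \<phi> (fst x))"
        using continuous_map_compose[OF continuous_map_fst c\<phi>] by (simp add: o_def)
      have "continuous_map ?P euclidean (\<lambda>x. snd x)"
        using continuous_map_snd[of "subtopology (mtop N) U" ?R] by (simp add: continuous_map_in_subtopology)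
      then have "continuous_map ?P euclidean ((\<lambda>t. t *\<^sub>R bvec) \<circ> (\<lambda>x. snd x))"
        by (rule continuous_map_compose) (auto intro!: continuous_intros)
      then have "continuous_map ?P euclidean (\<lambda>x. \<phi> (fst x) + snd x *\<^sub>R bvec)"
        using continuous_map_add[OF 1] by (simp add: o_def)
      then have "continuous_map ?P euclidean (cyl \<phi>)" by (simp add: cyl_def case_prod_unfold)
      then show "continuous_map ?P (top_of_set (cyl \<phi> ` (U \<times> {0..}))) (cyl \<phi>)"
        using UT by (auto simp: continuous_map_in_subtopology)
      have "continuous_map (top_of_set (cyl \<phi> ` (U \<times> {0..}))) (top_of_set (\<phi> ` U)) hproj"
        using im T by (auto simp: intro!: linear_continuous_on bounded_linear_hproj)
      then have "continuous_map (top_of_set (cyl \<phi> ` (U \<times> {0..}))) (subtopology (mtop N) U) (h \<circ> hproj)"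
        by (rule continuous_map_compose[OF _ ch])
      moreover have "continuous_map (top_of_set (cyl \<phi> ` (U \<times> {0..}))) ?R (\<lambda>z. z $ bdry_coord)"
        using im by (auto simp: half_space_def intro!: continuous_intros)
      ultimately show "continuous_map (top_of_set (cyl \<phi> ` (U \<times> {0..}))) ?P ?h"
        by (intro continuous_map_pairedI) (simp_all add: o_def)
      show "?h (cyl \<phi> x) = x" if xP: "x \<in> topspace ?P" for x
      proof -
        have "x \<in> U \<times> {0..}" using xP unfolding topspace_prod_topology UT by simp
        then obtain q t where x: "x = (q, t)" "q \<in> U" "0 \<le> t" by auto
        show ?thesis using cyl_coords[where \<phi> = \<phi>, OF hyp[OF U x(2)], of t] h\<phi>[OF x(2)] x(1) by simp
      qed
      show "cyl \<phi> (?h z) = z" if zC: "z \<in> topspace (top_of_set (cyl \<phi> ` (U \<times> {0..})))" for z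
      proof -
        have "z \<in> cyl \<phi> ` (U \<times> {0..})" using zC by simp
        then obtain q t where z: "z = cyl \<phi> (q, t)" "q \<in> U" by auto
        show ?thesis using cyl_coords[where \<phi> = \<phi>, OF hyp[OF U z(2)], of t] h\<phi>[OF z(2)] z(1) by simp
      qed
    qed
    then have "homeomorphic_map (subtopology (mtop ?C) (U \<times> {0..})) (top_of_set (cyl \<phi> ` (U \<times> {0..}))) (cyl \<phi>)"
      unfolding sub using homeomorphic_map_maps by blast
    moreover have "openin (mtop ?C) (U \<times> {0..})"
      using is_chartD(1)[OF c] by (simp add: mt openin_prod_Times_iff openin_topspace[of ?R, simplified])
    moreover have "open (hproj -` T :: (real^'n) set)"
      using T(1) by (intro open_vimage) (auto intro: linear_continuous_on bounded_linear_hproj)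
    then have "openin (top_of_set half_space) (cyl \<phi> ` (U \<times> {0..}))"
      unfolding im by (auto simp: openin_open)
    ultimately show ?thesis by (simp add: is_chart_def mt)
  qed
  have tr: "\<exists>T F. open T \<and> cyl \<phi> x \<in> T \<and> Cinf T F \<and> (\<forall>y\<in>(U \<times> {0..}) \<inter> (V \<times> {0..}). cyl \<phi> y \<in> T \<longrightarrow> F (cyl \<phi>
      y) = cyl \<psi> y)"
    if U: "(U, \<phi>) \<in> atlas N" and V: "(V, \<psi>) \<in> atlas N" and x: "x \<in> (U \<times> {0..}) \<inter> (V \<times> {0..})" for U \<phi> V \<psi> x
  proof -
    obtain q t where qt: "x = (q, t)" "q \<in> U" "q \<in> V" using x by (cases x) auto
    obtain T F where T: "open T" "\<phi> q \<in> T" "Cinf T F" "\<forall>y\<in>U. \<phi> y \<in> T \<longrightarrow> y \<in> V \<and> F (\<phi> y) = \<psi> y"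
      by (rule max_atlas_transition[OF N atlas_subset_max_atlas[OF N U] atlas_subset_max_atlas[OF N V] qt(2,3)])
    let ?T = "UNIV \<inter> hproj -` T"
    have hp: "Cinf UNIV (hproj :: real^'n \<Rightarrow> real^'n)" by (rule Cinf_bounded_linear[OF bounded_linear_hproj
        open_UNIV])
    note comp = Cinf_compose_Int[OF open_UNIV T(1) hp T(3)]
    have "Cinf ?T (\<lambda>z. F (hproj z) + (z $ bdry_coord) *\<^sub>R bvec)"
      by (intro Cinf_add Cinf_scaleR Cinf_const Cinf_vec_nth Cinf_ident comp)
    moreover have "F (hproj (cyl \<phi> y)) + (cyl \<phi> y $ bdry_coord) *\<^sub>R bvec = cyl \<psi> y"
      if yy: "y \<in> (U \<times> {0..}) \<inter> (V \<times> {0..})" "cyl \<phi> y \<in> ?T" for y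
    proof -
      obtain r s where y: "y = (r, s)" "r \<in> U" using yy(1) by (cases y) auto
      show ?thesis using cyl_coords[where \<phi> = \<phi>, OF hyp[OF U y(2)], of s] yy(2) T(4) y by (simp add: cyl_def)
    qed
    moreover have "cyl \<phi> x \<in> ?T" using cyl_coords[where \<phi> = \<phi>, OF hyp[OF U qt(2)], of t] T(2) qt(1) by simp
    ultimately show ?thesis using comp(1) by blast
  qed
  have com: "compatible (U \<times> {0..}, cyl \<phi>) (V \<times> {0..}, cyl \<psi>)" if U: "(U, \<phi>) \<in> atlas N" and V: "(V, \<psi>) \<in>
      atlas N" for U \<phi> V \<psi>
  proof -
    have sw: "(U \<times> {0::real..}) \<inter> (V \<times> {0..}) = (V \<times> {0..}) \<inter> (U \<times> {0..})" by blast
    show ?thesis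
      unfolding compatible_iff[OF inj[OF U] inj[OF V]]
    proof (intro ballI conjI)
      fix x :: "'a \<times> real" assume x: "x \<in> (U \<times> {0..}) \<inter> (V \<times> {0..})"
      show "\<exists>T F. open T \<and> cyl \<phi> x \<in> T \<and> Cinf T F \<and> (\<forall>y\<in>(U \<times> {0..}) \<inter> (V \<times> {0..}). cyl \<phi> y \<in> T \<longrightarrow> F (cyl \<phi>
          y) = cyl \<psi> y)"
        by (rule tr[OF U V x])
      show "\<exists>T F. open T \<and> cyl \<psi> x \<in> T \<and> Cinf T F \<and> (\<forall>y\<in>(U \<times> {0..}) \<inter> (V \<times> {0..}). cyl \<psi> y \<in> T \<longrightarrow> F (cyl \<psi>
          y) = cyl \<phi> y)"
        unfolding sw by (rule tr[OF V U]) (use x in blast)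
    qed
  qed
  show ?thesis
    unfolding smooth_manifold_def
  proof (intro conjI ballI)
    show "Hausdorff_space (mtop ?C)"
      using N by (simp add: mt smooth_manifold_def Hausdorff_space_prod_topology Hausdorff_space_subtopology)
    show "second_countable (mtop ?C)"
      using N by (simp add: mt smooth_manifold_def second_countable_prod_topology
          second_countable_subtopology second_countable_euclidean)
    show "is_chart ?C c" if "c \<in> atlas ?C" for c using that ch by (auto simp: half_cylinder_atlas)
    show "compatible c c'" if "c \<in> atlas ?C" "c' \<in> atlas ?C" for c c' using that com by (auto simp:
        half_cylinder_atlas)
    have "topspace (mtop N) = \<Union> (fst ` atlas N)" using N by (simp add: smooth_manifold_def)
    then show "topspace (mtop ?C) = \<Union> (fst ` atlas ?C)"
      by (auto simp: mt half_cylinder_atlas image_iff) (metis fst_conv mem_Sigma_iff atLeast_iff)+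
  qed
qed

section \<open>The diffeomorphism of the non-compact half with the half cylinder\<close>

context collared
begin

lemma \<Theta>_map_near:
  assumes p: "p \<in> X" "\<rho> p < \<epsilon>" and t: "0 < t" "t < \<epsilon>"
  shows "map_near M X M (\<lambda>y. \<Theta> y t) p"
proof -
  obtain V \<psi> T Q and R :: "'a \<Rightarrow> real^'n" and A where V: "(V, \<psi>) \<in> max_atlas M" and T: "open T" "Cinf T Q"
    and R: "smooth_near M X R p" and A: "openin (mtop M) A" "p \<in> A" and RT: "R p + t *\<^sub>R bvec \<in> T"
    and Q: "\<forall>y\<in>A. \<forall>s. \<rho> y < \<epsilon> \<longrightarrow> 0 < s \<longrightarrow> s < \<epsilon> \<longrightarrow> R y + s *\<^sub>R bvec \<in> T \<longrightarrow>
       \<Theta> y s \<in> V \<and> \<psi> (\<Theta> y s) = Q (R y + s *\<^sub>R bvec)"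
    by (rule \<Theta>_smooth[OF p t])
  have Rt: "smooth_near M X (\<lambda>y. R y + t *\<^sub>R bvec) p" by (intro smooth_near_add R smooth_near_const)
  obtain A1 where A1: "openin (mtop M) A1" "p \<in> A1" "\<forall>y\<in>A1. y \<in> X \<longrightarrow> R y + t *\<^sub>R bvec \<in> T"
    by (rule smooth_near_continuous[OF smooth Rt p(1) p(1) T(1) RT])
  have oY: "openin (mtop M) {y\<in>X. \<rho> y < \<epsilon>}"
    using openin_continuous_map_preimage[OF continuous_\<rho>, of "{..<\<epsilon>}"] by simp
  let ?A = "A \<inter> A1 \<inter> {y\<in>X. \<rho> y < \<epsilon>}"
  have oA: "openin (mtop M) ?A" using A(1) A1(1) oY by blast
  have pA: "p \<in> ?A" using A A1 p by simp
  have on: "\<Theta> y t \<in> V" "\<psi> (\<Theta> y t) = Q (R y + t *\<^sub>R bvec)" if "y \<in> ?A" for y using Q A1(3) that t by auto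
  have "smooth_near M X (\<lambda>y. \<psi> (\<Theta> y t)) p"
    by (rule smooth_near_cong[OF smooth_near_compose[OF Rt p(1) T(1) RT T(2)] oA pA]) (use on in auto)
  then show ?thesis
    by (intro map_nearI[where F = "\<lambda>y. \<Theta> y t", OF smooth p(1) V _ oA pA _ smooth]) (use on pA in auto)
qed

abbreviation "Cman \<equiv> half_cylinder N"
abbreviation "Sman \<equiv> submanifold M S half_space"

lemma smooth_C: "smooth_manifold Cman"
  by (rule half_cylinder_smooth[OF smooth_H]) (simp add: submanifold_def)

lemma topspace_C: "topspace (mtop Cman) = H \<times> {0..}"
  using submanifold_topspace[OF H_subset] by (simp add: half_cylinder_def)

lemma topspace_S: "topspace (mtop Sman) = S"
  by (rule submanifold_topspace[OF S_subset])

lemma C_chart: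
  assumes "(U, \<phi>) \<in> max_atlas M" "\<phi> ` (U \<inter> H) = \<phi> ` U \<inter> hyperplane"
  shows "((U \<inter> H) \<times> {0..}, cyl \<phi>) \<in> max_atlas Cman"
  using atlas_subset_max_atlas[OF smooth_C] submanifold_chart[OF assms] by (auto simp: half_cylinder_atlas)

definition to_cyl :: "'a \<Rightarrow> 'a \<times> real" where
  "to_cyl p = (\<Theta> p c, c / \<rho> p - 1)"

text \<open>Solving c / \<rho> - 1 = s for \<rho> gives the height c / (1 + s), which runs from c
  down towards 0 as s increases.\<close>

definition from_cyl :: "'a \<times> real \<Rightarrow> 'a" where
  "from_cyl = (\<lambda>(h, s). \<Theta> h (c / (1 + s)))"

lemma S_facts:
  assumes "p \<in> S"
  shows "p \<in> X" "0 < \<rho> p" "\<rho> p \<le> c" "\<rho> p < \<epsilon>"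
  using assms c \<rho>_pos by (auto simp: S_def)

lemma scaled:
  assumes "0 \<le> s"
  shows "0 < c / (1 + s)" "c / (1 + s) \<le> c" "c / (1 + s) < \<epsilon>"
proof -
  show 1: "0 < c / (1 + s)" using assms c by simp
  show "c / (1 + s) \<le> c" using assms c by (simp add: field_simps)
  then show "c / (1 + s) < \<epsilon>" using c by linarith
qed

lemma to_cyl_in:
  assumes "p \<in> S"
  shows "to_cyl p \<in> H \<times> {0..}"
proof -
  note f = S_facts[OF assms]
  have "\<Theta> p c \<in> H" using \<Theta>(2)[OF f(1,4) c] \<Theta>(3)[OF f(1,4) c] by (simp add: H_def)
  moreover have "1 \<le> c / \<rho> p" using f by (simp add: le_divide_eq)
  ultimately show ?thesis by (simp add: to_cyl_def)
qed

lemma from_cyl_in: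
  assumes "x \<in> H \<times> {0..}"
  shows "from_cyl x \<in> S"
proof -
  obtain h s where x: "x = (h, s)" by (cases x)
  then have h: "h \<in> X" "\<rho> h < \<epsilon>" and s: "0 \<le> s" using assms c by (auto simp: H_def)
  note t = scaled[OF s]
  show ?thesis using \<Theta>(2)[OF h t(1,3)] \<Theta>(3)[OF h t(1,3)] t(2) by (simp add: x from_cyl_def S_def)
qed

lemma from_to_cyl:
  assumes "p \<in> S"
  shows "from_cyl (to_cyl p) = p"
proof -
  note f = S_facts[OF assms]
  have "c / (1 + (c / \<rho> p - 1)) = \<rho> p" using f c by simp
  then show ?thesis using \<Theta>(1)[OF f(1,4)] \<Theta>(4)[OF f(1,4) c f(2,4)] by (simp add: from_cyl_def to_cyl_def)
qed

lemma to_from_cyl: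
  assumes "x \<in> H \<times> {0..}"
  shows "to_cyl (from_cyl x) = x"
proof -
  obtain h s where x: "x = (h, s)" by (cases x)
  then have h: "h \<in> X" "\<rho> h = c" "\<rho> h < \<epsilon>" and s: "0 \<le> s" using assms c by (auto simp: H_def)
  note t = scaled[OF s]
  have "\<rho> (\<Theta> h (c / (1 + s))) = c / (1 + s)" by (rule \<Theta>(3)[OF h(1,3) t(1,3)])
  moreover have "\<Theta> (\<Theta> h (c / (1 + s))) c = h"
    using \<Theta>(4)[OF h(1,3) t(1,3) c] \<Theta>(1)[OF h(1,3)] h(2) by simp
  ultimately show ?thesis using c s by (simp add: x to_cyl_def from_cyl_def)
qed

text \<open>In a slice chart around the foot point \<Theta> p c, the map is the coordinate
  expression of \<Theta> y c plus a smooth multiple of \<open>bvec\<close>. It is smooth in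
  \<open>M\<close> near p, so restricting it to \<open>S\<close> gives smoothness up to the
  boundary.\<close>

lemma smooth_to_cyl:
  assumes p: "p \<in> S"
  shows "map_near Sman S Cman to_cyl p"
proof -
  note f = S_facts[OF p]
  have th: "map_near M X M (\<lambda>y. \<Theta> y c) p" by (rule \<Theta>_map_near[OF f(1,4) c])
  have thH: "\<Theta> p c \<in> H" using to_cyl_in[OF p] by (simp add: to_cyl_def)
  then have thS: "\<Theta> p c \<in> S" using H_subset_S by blast
  obtain U \<phi> where U: "(U, \<phi>) \<in> max_atlas M" "\<Theta> p c \<in> U" "\<phi> ` (U \<inter> H) = \<phi> ` U \<inter> hyperplane"
    by (rule slice_cover[OF thS])
  obtain A where A: "openin (mtop M) A" "p \<in> A" "\<forall>y\<in>A \<inter> X. \<Theta> y c \<in> U" and s: "smooth_near M X (\<lambda>y. \<phi> (\<Theta> y c)) p"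
    using th U(1,2) unfolding map_near_def by auto
  have sr: "smooth_near M X \<rho> p" using \<rho> f(1) by (simp add: smooth_fun_near)
  have "smooth_near M X (\<lambda>y. \<phi> (\<Theta> y c) + (c / \<rho> y - 1) *\<^sub>R bvec) p"
    by (intro smooth_near_add smooth_near_scaleR smooth_near_diff smooth_near_divide smooth_near_const s
        sr f(1))
      (use f(2) in simp)
  then have "smooth_near M S (\<lambda>y. \<phi> (\<Theta> y c) + (c / \<rho> y - 1) *\<^sub>R bvec) p" by (rule smooth_near_mono[OF _
      S_subset])
  then have "smooth_near Sman S (\<lambda>y. \<phi> (\<Theta> y c) + (c / \<rho> y - 1) *\<^sub>R bvec) p"
    by (simp add: smooth_near_submanifold[OF S_subset smooth_S p])
  then have sm: "smooth_near Sman S (\<lambda>y. cyl \<phi> (to_cyl y)) p" by (simp add: cyl_def to_cyl_def)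
  have oA: "openin (mtop Sman) (A \<inter> S)" using A(1) by (auto simp: submanifold_def openin_subtopology)
  show ?thesis
  proof (rule map_nearI[where F = to_cyl, OF smooth_C p C_chart[OF U(1,3)] _ oA _ _ smooth_S sm])
    show "to_cyl p \<in> (U \<inter> H) \<times> {0..}" using to_cyl_in[OF p] U(2) by (auto simp: to_cyl_def)
    show "p \<in> A \<inter> S" using A p by simp
    show "to_cyl y \<in> (U \<inter> H) \<times> {0..}" if "y \<in> A \<inter> S" for y
      using to_cyl_in[of y] A(3) that S_subset by (auto simp: to_cyl_def)
  qed
qed

text \<open>Both the foot point and the height vary here, so smoothness of \<Theta> for fixed height
  is not enough. The factorisation of \<Theta> y s through R y + s bvec supplies joint smoothness,
  and the extension demanded at boundary points is a composition of smooth maps on open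
  sets.\<close>

lemma smooth_from_cyl:
  assumes x: "x \<in> H \<times> {0..}"
  shows "map_near Cman (H \<times> {0..}) Sman from_cyl x"
proof -
  obtain h s0 where hs: "x = (h, s0)" by (cases x)
  have h: "h \<in> X" "\<rho> h = c" "\<rho> h < \<epsilon>" "h \<in> H" and s0: "0 \<le> s0" using x c by (auto simp: H_def hs)
  define t0 where "t0 = c / (1 + s0)"
  have t0: "0 < t0" "t0 < \<epsilon>" using scaled[OF s0] by (auto simp: t0_def)
  define p where "p = \<Theta> h t0"
  have px: "from_cyl x = p" by (simp add: p_def hs from_cyl_def t0_def)
  have pS: "p \<in> S" using from_cyl_in[OF x] px by simp
  obtain U' \<psi>' where U': "(U', \<psi>') \<in> max_atlas M" "p \<in> U'" "\<psi>' ` (U' \<inter> S) = \<psi>' ` U' \<inter> half_space"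
    by (rule slice_cover[OF pS])
  have mU': "(U' \<inter> S, \<psi>') \<in> max_atlas Sman" using atlas_subset_max_atlas[OF smooth_S submanifold_chart[OF
      U'(1,3)]] .
  have hS: "h \<in> S" using h(4) H_subset_S by blast
  obtain U \<phi> where U: "(U, \<phi>) \<in> max_atlas M" "h \<in> U" "\<phi> ` (U \<inter> H) = \<phi> ` U \<inter> hyperplane"
    by (rule slice_cover[OF hS])
  note mC = C_chart[OF U(1,3)]
  have hyp: "\<phi> q \<in> hyperplane" if "q \<in> U" "q \<in> H" for q using U(3) that by blast
  obtain V \<psi> T Q and R :: "'a \<Rightarrow> real^'n" and A where V: "(V, \<psi>) \<in> max_atlas M" and T: "open T" "Cinf T Q"
    and R: "smooth_near M X R h" and A: "openin (mtop M) A" "h \<in> A" and RT: "R h + t0 *\<^sub>R bvec \<in> T"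
    and Q: "\<forall>y\<in>A. \<forall>s. \<rho> y < \<epsilon> \<longrightarrow> 0 < s \<longrightarrow> s < \<epsilon> \<longrightarrow> R y + s *\<^sub>R bvec \<in> T \<longrightarrow>
       \<Theta> y s \<in> V \<and> \<psi> (\<Theta> y s) = Q (R y + s *\<^sub>R bvec)"
    by (rule \<Theta>_smooth[OF h(1,3) t0])
  have pV: "p \<in> V" "\<psi> p = Q (R h + t0 *\<^sub>R bvec)" using Q A(2) h(3) t0 RT by (auto simp: p_def)
  obtain T' F where T': "open T'" "\<psi> p \<in> T'" "Cinf T' F" "\<forall>y\<in>V. \<psi> y \<in> T' \<longrightarrow> y \<in> U' \<and> F (\<psi> y) = \<psi>' y"
    by (rule max_atlas_transition[OF smooth V U'(1) pV(1) U'(2)])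
  obtain T1 R1 where T1: "open T1" "\<phi> h \<in> T1" "Cinf T1 R1" "\<forall>y\<in>U. y \<in> X \<longrightarrow> \<phi> y \<in> T1 \<longrightarrow> R1 (\<phi> y) = R y"
    by (rule smooth_nearD[OF R U(1,2)])
  obtain T2 where T2: "open T2" "\<phi> h \<in> T2" "\<forall>y\<in>U. \<phi> y \<in> T2 \<longrightarrow> y \<in> A"
    by (rule chart_nbhd[OF max_atlas_chart[OF U(1)] A(1) U(2) A(2)])
  \<comment> \<open>Beyond the half space s may become negative; on this open set 1 + s stays
    positive, so c / (1 + s) extends smoothly across s = 0.\<close>
  let ?P = "{z :: real^'n. - 1 < z $ bdry_coord}"
  have oP: "open ?P" by (intro open_Collect_less continuous_intros)
  have hp: "Cinf ?P (hproj :: real^'n \<Rightarrow> real^'n)" by (rule Cinf_bounded_linear[OF bounded_linear_hproj oP])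
  let ?O1 = "?P \<inter> hproj -` (T1 \<inter> T2)"
  note comp1 = Cinf_compose_Int[OF oP open_Int[OF T1(1) T2(1)] hp Cinf_subset[OF T1(3) Int_lower1]]
  \<comment> \<open>In cylinder coordinates, \<open>hproj\<close> returns the coordinates of the
    foot point and the boundary coordinate returns s. Thus ?K computes the argument of
    \<open>Q\<close> for the point with foot q at height c / (1 + s).\<close>
  let ?K = "\<lambda>z. R1 (hproj z) + (c / (1 + z $ bdry_coord)) *\<^sub>R bvec"
  have K: "Cinf ?O1 ?K"
    by (intro Cinf_add Cinf_scaleR Cinf_divide Cinf_const Cinf_vec_nth Cinf_ident comp1) auto
  let ?T = "T \<inter> Q -` T'"
  note comp2 = Cinf_compose_Int[OF T(1) T'(1) T(2) T'(3)]
  note comp3 = Cinf_compose_Int[OF comp1(1) comp2(1) K comp2(2)]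
  let ?O = "?O1 \<inter> ?K -` ?T"
  have key: "from_cyl y \<in> U' \<inter> S \<and> F (Q (?K (cyl \<phi> y))) = \<psi>' (from_cyl y)"
    if y: "y \<in> (U \<inter> H) \<times> {0..}" "cyl \<phi> y \<in> ?O" for y
  proof -
    obtain q s where qs: "y = (q, s)" "q \<in> U" "q \<in> H" "0 \<le> s" using y(1) by (cases y) auto
    have q: "q \<in> X" "\<rho> q < \<epsilon>" using qs(3) c by (auto simp: H_def)
    note cc = cyl_coords[where \<phi> = \<phi>, OF hyp[OF qs(2,3)], of s] and t = scaled[OF qs(4)]
    have inT: "\<phi> q \<in> T1" "\<phi> q \<in> T2" using y(2) cc qs(1) by auto
    have KR: "?K (cyl \<phi> y) = R q + (c / (1 + s)) *\<^sub>R bvec" using cc qs T1(4) q(1) inT(1) by simp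
    then have "R q + (c / (1 + s)) *\<^sub>R bvec \<in> ?T" using y(2) by auto
    moreover have "q \<in> A" using T2(3) qs(2) inT(2) by blast
    ultimately have "\<Theta> q (c / (1 + s)) \<in> V" "\<psi> (\<Theta> q (c / (1 + s))) = Q (R q + (c / (1 + s)) *\<^sub>R bvec)" "\<psi>
        (\<Theta> q (c / (1 + s))) \<in> T'"
      using Q q(2) t(1,3) by auto
    then have "from_cyl y \<in> U'" "F (Q (?K (cyl \<phi> y))) = \<psi>' (from_cyl y)"
      unfolding KR using T'(4) by (auto simp: from_cyl_def qs(1))
    moreover have "from_cyl y \<in> S" by (rule from_cyl_in) (use qs in auto)
    ultimately show ?thesis by simp
  qed
  have xU: "x \<in> (U \<inter> H) \<times> {0..}" using U(2) h(4) s0 by (simp add: hs)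
  have xO: "cyl \<phi> x \<in> ?O"
  proof -
    note cc = cyl_coords[where \<phi> = \<phi>, OF hyp[OF U(2) h(4)], of s0]
    have "?K (cyl \<phi> x) = R h + t0 *\<^sub>R bvec" using cc T1(2,4) U(2) h(1) by (simp add: hs t0_def)
    then show ?thesis using cc T1(2) T2(2) RT pV(2) T'(2) s0 by (auto simp: hs)
  qed
  have sm: "smooth_near Cman (H \<times> {0..}) (\<lambda>y. \<psi>' (from_cyl y)) x"
    by (rule smooth_nearI[OF smooth_C mC xU comp3(1) xO comp3(2)]) (use key in auto)
  show ?thesis
    by (rule map_nearI[where F = from_cyl, OF smooth_S x mU' _ chart_open[OF max_atlas_chart[OF mC]
        comp3(1)] _ _ smooth_C sm])
      (use key xU xO in auto)
qed

lemma diffeomorphic_cylinder: "diffeomorphic Sman Cman"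
  unfolding diffeomorphic_def
proof (intro conjI exI ballI smooth_S smooth_C)
  show "smooth_map Sman Cman to_cyl"
    by (rule smooth_mapI[OF smooth_S smooth_C]) (simp add: topspace_S smooth_to_cyl)
  show "smooth_map Cman Sman from_cyl"
    by (rule smooth_mapI[OF smooth_C smooth_S]) (use smooth_from_cyl in \<open>simp add: topspace_C\<close>)
qed (auto simp: topspace_S topspace_C from_to_cyl to_from_cyl)

end

theorem corollary4p1:
  fixes M :: "('a, 'n::finite) manifold"
    and g :: "'a tensor02"
    and W :: "('w, 'n) manifold"
  assumes "manifold_without_boundary M"
    and "connected_space (mtop M)"
    and "CARD('n) \<ge> 2"
    and "riemannian_metric M g"
    and "manifold_with_boundary W"
    and "compact_space (mtop W)"
    and "boundary_pts W \<noteq> {}"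
    and "diffeomorphic M (interior_manifold W)"
  shows "\<exists>H M\<^sub>R M\<^sub>L. admissible_collar_gluing M g H M\<^sub>R M\<^sub>L \<and>
    compactin (mtop M) ((mtop M) closure_of M\<^sub>R) \<and>
    diffeomorphic (submanifold M ((mtop M) closure_of M\<^sub>L) half_space)
      (half_cylinder (submanifold M H hyperplane))"
proof -
  interpret W: compact_bounded_manifold W
    by unfold_locales (rule assms)+
  obtain \<rho> \<epsilon> \<Theta> where end_collar: "collar M \<rho> \<epsilon> \<Theta>" "\<forall>p\<in>topspace (mtop M). 0 < \<rho> p"
    "\<forall>c>0. compactin (mtop M) {p\<in>topspace (mtop M). c \<le> \<rho> p}"
    "\<forall>t. 0 < t \<and> t < \<epsilon> \<longrightarrow> (\<exists>p\<in>topspace (mtop M). \<rho> p = t)"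
    by (rule W.end_collar[OF assms(8,7)])
  interpret collared M g \<rho> \<epsilon> \<Theta>
    by unfold_locales (rule assms end_collar)+
  have "compactin (mtop M) ((mtop M) closure_of Rpart)"
    using end_collar(3) c(1) by (simp add: closure_Rpart)
  then show ?thesis
    using admissible[OF assms(2,3)] diffeomorphic_cylinder
    by (intro exI[of _ H] exI[of _ Rpart] exI[of _ Lpart]) (simp add: closure_Lpart)
qed

end
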